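(* Let $K$ be a field and let $\Gamma$ be a $K$-algebra such that $\Gamma^e=\Gamma\otimes\Gamma^o$ is a Noetherian domain. Let $A=\Gamma[x_1;\sigma_1,\delta_1]\cdots[x_n;\sigma_n,\delta_n]$ be an iterated Ore extension. Then $\Gamma$ and $A$ are Noetherian domains, and, with $D=\mathrm{Frac}(A)$, $D^e=D\otimes D^o$ is a Noetherian domain. Consequently the following hold for every $\Delta=\{d_1,\ldots,d_t\}$ which is either a finite set of commuting $K$-derivations or a finite set of commuting $K$-automorphisms of $D$: 1. $D$ satisfies the ascending chain condition on division $K$-subalgebras, or equivalently, every division $K$-subalgebra of $D$ is a finitely generated division $K$-algebra. 2. The group of eigenvalues $\mathrm{Ev}(\Delta)$ is a finitely generated abelian group, and so $\mathrm{Ev}(\Delta)=\mathcal{T}\oplus\mathbb{Z}^r$, where $r$ is the rank of $\mathrm{Ev}(\Delta)$ and $\mathcal{T}$ is a finite abelian group. 3. The eigen-algebra $D(\Delta)$ is a Noetherian domain isomorphic to an iterated skew Laurent extension: $D_{\mathcal{T}}:=\bigoplus_{\lambda\in\mathcal{T}}D_\lambda$ is a division algebra of right and left dimension $|\mathcal{T}|$ over the division algebra $D_0$, and $D(\Delta)$ is isomorphic to an iterated skew Laurent extension $D_{\mathcal{T}}[y_1,y_1^{-1};\tau_1]\cdots[y_r,y_r^{-1};\tau_r]$. 4. For each subgroup $F$ of $\mathrm{Ev}(\Delta)$, $\mathcal{F}(F):=\bigoplus_{\lambda\in F}D_\lambda$ is a Noetherian domain whose quotient division algebra $\mathrm{Frac}(\mathcal{F}(F))$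 is $\Delta$-invariant and satisfies $\mathrm{Ev}(\mathrm{Frac}(\mathcal{F}(F)))=F$; any $\Delta$-eigenvector $v\in\mathrm{Frac}(\mathcal{F}(F))_\lambda$ has the form $u^{-1}w$ for some $0\neq u\in D_\mu$, $w\in D_{\lambda+\mu}$, with $\lambda,\mu\in F$.
   Context: Notation: $\otimes=\otimes_K$; "Noetherian" for rings means left and right Noetherian. $A^o$ is the opposite algebra of $A$ (multiplication $a*b=ba$). For a Noetherian domain $A$, $\mathrm{Frac}(A)$ is its quotient division algebra. Ore extensions. Let $R$ be a $K$-algebra, $\sigma$ a $K$-automorphism of $R$, and $\delta$ a $K$-linear $\sigma$-derivation of $R$: $\delta(ab)=\delta(a)b+\sigma(a)\delta(b)$. The Ore extension $R[x;\sigma,\delta]$ is the $K$-algebra generated freely by $R$ and $x$ subject to $xa=\sigma(a)x+\delta(a)$, $a\in R$. Iterated Ore extensions are defined inductively, with $\sigma_n$ a $K$-automorphism and $\delta_n$ a $\sigma_n$-derivation of $\Gamma[x_1;\sigma_1,\delta_1]\cdots[x_{n-1};\sigma_{n-1},\delta_{n-1}]$. A division $K$-algebra $E$ is a finitely generated division algebra if there are finitely many elements $z_1,\ldots,z_m\in E$ such that $E$ is the only division $K$-subalgebra of $E$ containing $z_1,\ldots,z_m$. Eigenvalues. In the derivation case $\mathrm{Ev}(\Delta):=\{\lambda\in K^t \mid d_i(u)=\lambda_iu,\ i=1,\ldots,t,\ \text{for some } 0\ne u\in D\}$, an additive subgroup of $K^t$. In the automorphism case $\mathrm{Ev}(\Delta):=\{\lambda\in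 (K^* )^t\mid d_i(u)=\lambda_iu,\ i=1,\ldots,t,\ \text{for some } 0\neq u\in D\}$, a multiplicative subgroup of $(K^* )^t$, $K^*=K\setminus\{0\}$; its operation is also written additively, so $\lambda+\mu$ means the componentwise product and $0$ means $(1,\ldots,1)$. For $\lambda\in\mathrm{Ev}(\Delta)$, $D_\lambda:=\{u\in D\mid d_i(u)=\lambda_iu,\ i=1,\ldots,t\}$; in particular $D_0$ is the division subalgebra of $\Delta$-constants. The eigen-algebra is $D(\Delta):=\bigoplus_{\lambda\in\mathrm{Ev}(\Delta)}D_\lambda\subseteq D$. For a $\Delta$-invariant division subalgebra $E\subseteq D$, $\mathrm{Ev}(E)$ and $E_\lambda$ are defined in the same way with $E$ in place of $D$; $\mathrm{Frac}(\mathcal{F}(F))$ is viewed inside $D$. The rank of an abelian group $G$ is $\dim_{\mathbb{Q}}(\mathbb{Q}\otimes_{\mathbb{Z}}G)$; $\mathcal{T}$ is the torsion subgroup of $\mathrm{Ev}(\Delta)$. For a ring $R$ and an automorphism $\tau$ of $R$, the skew Laurent extension $R[y,y^{-1};\tau]$ is generated by $R$ and $y^{\pm1}$ subject to $y^{\pm1}a=\tau^{\pm1}(a)y^{\pm1}$ for $a\in R$ (free as a left $R$-module on the powers of $y$). Iterated skew Laurent extensions are defined inductively by $A_n=A_{n-1}[y_n,y_n^{-1};\tau_n]$ with $\tau_n$ an automorphism of $A_{n-1}$, $A_0=R$. *)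

theory Defs
  imports "HOL-Algebra.Algebra"
begin

section \<open>Algebras over a field and Noetherian domains\<close>

text \<open>The library locale \<open>algebra\<close> requires a commutative multiplication, and the library locales
  \<open>domain\<close>, \<open>noetherian_ring\<close> and \<open>noetherian_domain\<close> are about commutative domains and two-sided
  ideals.  Everything below is for associative unital rings that need not be commutative.
  Subobjects are subsets \<open>B\<close> of a carrier, regarded as algebras \<open>A\<lparr>carrier := B\<rparr>\<close>.\<close>

locale K_algebra = module K A + ring A for K (structure) and A (structure) +
  assumes K_field: "field K"
    and smult_mult_left:
      "\<lbrakk> k \<in> carrier K; a \<in> carrier A; b \<in> carrier A \<rbrakk>
        \<Longrightarrow> (k \<odot>\<^bsub>A\<^esub> a) \<otimes>\<^bsub>A\<^esub> b = k \<odot>\<^bsub>A\<^esub> (a \<otimes>\<^bsub>A\<^esub> b)"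
    and smult_mult_right:
      "\<lbrakk> k \<in> carrier K; a \<in> carrier A; b \<in> carrier A \<rbrakk>
        \<Longrightarrow> a \<otimes>\<^bsub>A\<^esub> (k \<odot>\<^bsub>A\<^esub> b) = k \<odot>\<^bsub>A\<^esub> (a \<otimes>\<^bsub>A\<^esub> b)"

definition K_subalgebra :: "'k ring \<Rightarrow> ('k, 'a) module \<Rightarrow> 'a set \<Rightarrow> bool" where
  "K_subalgebra K A B \<longleftrightarrow>
     subring B A \<and> (\<forall>k\<in>carrier K. \<forall>b\<in>B. k \<odot>\<^bsub>A\<^esub> b \<in> B)"

definition algebra_hom :: "'k ring \<Rightarrow> ('k, 'a) module \<Rightarrow> ('k, 'b) module \<Rightarrow> ('a \<Rightarrow> 'b) set" where
  "algebra_hom K A B =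
     {h \<in> ring_hom A B. \<forall>k\<in>carrier K. \<forall>a\<in>carrier A. h (k \<odot>\<^bsub>A\<^esub> a) = k \<odot>\<^bsub>B\<^esub> h a}"

definition algebra_iso :: "'k ring \<Rightarrow> ('k, 'a) module \<Rightarrow> ('k, 'b) module \<Rightarrow> ('a \<Rightarrow> 'b) set" where
  "algebra_iso K A B = {h \<in> algebra_hom K A B. bij_betw h (carrier A) (carrier B)}"

definition opposite :: "('k, 'a) module \<Rightarrow> ('k, 'a) module" where
  "opposite A = A\<lparr>monoid.mult := (\<lambda>a b. b \<otimes>\<^bsub>A\<^esub> a)\<rparr>"

definition nc_domain :: "('k, 'a) module \<Rightarrow> bool" where
  "nc_domain R \<longleftrightarrow> ring R \<and> \<one>\<^bsub>R\<^esub> \<noteq> \<zero>\<^bsub>R\<^esub> \<and>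
     (\<forall>a\<in>carrier R. \<forall>b\<in>carrier R. a \<otimes>\<^bsub>R\<^esub> b = \<zero>\<^bsub>R\<^esub> \<longrightarrow> a = \<zero>\<^bsub>R\<^esub> \<or> b = \<zero>\<^bsub>R\<^esub>)"

definition left_ideal :: "'a set \<Rightarrow> ('k, 'a) module \<Rightarrow> bool" where
  "left_ideal I R \<longleftrightarrow> subgroup I (add_monoid R) \<and> (\<forall>r\<in>carrier R. \<forall>a\<in>I. r \<otimes>\<^bsub>R\<^esub> a \<in> I)"

definition left_noetherian :: "('k, 'a) module \<Rightarrow> bool" where
  "left_noetherian R \<longleftrightarrow>
     (\<forall>I :: nat \<Rightarrow> 'a set. (\<forall>i. left_ideal (I i) R \<and> I i \<subseteq> I (Suc i)) \<longrightarrow>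
        (\<exists>N. \<forall>i\<ge>N. I i = I N))"

definition nc_noetherian_domain :: "('k, 'a) module \<Rightarrow> bool" where
  "nc_noetherian_domain R \<longleftrightarrow>
     nc_domain R \<and> left_noetherian R \<and> left_noetherian (opposite R)"


section \<open>Tensor products\<close>

text \<open>\<open>M \<otimes>\<^sub>R N\<close> is the free abelian group on \<open>M \<times> N\<close> modulo the subgroup generated by the
  bilinearity relations.  Only the additive structure and the scalar action of \<open>M\<close> and \<open>N\<close> matter
  here.  Elements of the quotient are cosets.\<close>

definition tensor_relations ::
    "'r ring \<Rightarrow> ('r, 'm) module \<Rightarrow> ('r, 'n) module \<Rightarrow> ('m \<times> 'n \<Rightarrow>\<^sub>0 int) set" where
  "tensor_relations R M N =
     {frag_of (m \<oplus>\<^bsub>M\<^esub> m', n) - frag_of (m, n) - frag_of (m', n) | m m' n.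
        m \<in> carrier M \<and> m' \<in> carrier M \<and> n \<in> carrier N} \<union>
     {frag_of (m, n \<oplus>\<^bsub>N\<^esub> n') - frag_of (m, n) - frag_of (m, n') | m n n'.
        m \<in> carrier M \<and> n \<in> carrier N \<and> n' \<in> carrier N} \<union>
     {frag_of (r \<odot>\<^bsub>M\<^esub> m, n) - frag_of (m, r \<odot>\<^bsub>N\<^esub> n) | r m n.
        r \<in> carrier R \<and> m \<in> carrier M \<and> n \<in> carrier N}"

definition tensor_kernel ::
    "'r ring \<Rightarrow> ('r, 'm) module \<Rightarrow> ('r, 'n) module \<Rightarrow> ('m \<times> 'n \<Rightarrow>\<^sub>0 int) set" where
  "tensor_kernel R M N =
     generate (free_Abelian_group (carrier M \<times> carrier N)) (tensor_relations R M N)"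

definition tensor_group ::
    "'r ring \<Rightarrow> ('r, 'm) module \<Rightarrow> ('r, 'n) module \<Rightarrow> ('m \<times> 'n \<Rightarrow>\<^sub>0 int) set monoid" where
  "tensor_group R M N = free_Abelian_group (carrier M \<times> carrier N) Mod tensor_kernel R M N"

definition tensor_coset ::
    "'r ring \<Rightarrow> ('r, 'm) module \<Rightarrow> ('r, 'n) module \<Rightarrow>
      ('m \<times> 'n \<Rightarrow>\<^sub>0 int) \<Rightarrow> ('m \<times> 'n \<Rightarrow>\<^sub>0 int) set" where
  "tensor_coset R M N z =
     tensor_kernel R M N #>\<^bsub>free_Abelian_group (carrier M \<times> carrier N)\<^esub> z"

text \<open>The map \<open>f \<otimes> id\<close>, for an \<open>R\<close>-linear \<open>f : M \<rightarrow> M\<close>.\<close>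

definition tensor_map_left ::
    "'r ring \<Rightarrow> ('r, 'm) module \<Rightarrow> ('r, 'n) module \<Rightarrow> ('m \<Rightarrow> 'm) \<Rightarrow>
      ('m \<times> 'n \<Rightarrow>\<^sub>0 int) set \<Rightarrow> ('m \<times> 'n \<Rightarrow>\<^sub>0 int) set" where
  "tensor_map_left R M N f P =
     (\<Union>z\<in>P. tensor_coset R M N (frag_extend (\<lambda>(m, n). frag_of (f m, n)) z))"

text \<open>\<open>A \<otimes>\<^sub>K B\<close> as a \<open>K\<close>-algebra, with \<open>(a \<otimes> b)(a' \<otimes> b') = aa' \<otimes> bb'\<close> extended biadditively.\<close>

definition tensor_algebra ::
    "'k ring \<Rightarrow> ('k, 'a) module \<Rightarrow> ('k, 'b) module \<Rightarrow> ('k, ('a \<times> 'b \<Rightarrow>\<^sub>0 int) set) module" where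
  "tensor_algebra K A B =
     \<lparr>carrier = carrier (tensor_group K A B),
      monoid.mult = (\<lambda>P Q. \<Union>x\<in>P. \<Union>y\<in>Q. tensor_coset K A B
        (frag_extend (\<lambda>(a, b). frag_extend (\<lambda>(a', b').
            frag_of (a \<otimes>\<^bsub>A\<^esub> a', b \<otimes>\<^bsub>B\<^esub> b')) y) x)),
      one = tensor_coset K A B (frag_of (\<one>\<^bsub>A\<^esub>, \<one>\<^bsub>B\<^esub>)),
      ring.zero = \<one>\<^bsub>tensor_group K A B\<^esub>,
      add = monoid.mult (tensor_group K A B),
      smult = (\<lambda>k. tensor_map_left K A B (\<lambda>a. k \<odot>\<^bsub>A\<^esub> a))\<rparr>"

definition enveloping_algebra ::
    "'k ring \<Rightarrow> ('k, 'a) module \<Rightarrow> ('k, ('a \<times> 'a \<Rightarrow>\<^sub>0 int) set) module" where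
  "enveloping_algebra K A = tensor_algebra K A (opposite A)"


section \<open>Iterated Ore extensions and iterated skew Laurent extensions\<close>

text \<open>With \<open>\<sigma> = id\<close> these are the \<open>K\<close>-derivations.\<close>

definition skew_derivation :: "'k ring \<Rightarrow> ('k, 'a) module \<Rightarrow> ('a \<Rightarrow> 'a) \<Rightarrow> ('a \<Rightarrow> 'a) \<Rightarrow> bool" where
  "skew_derivation K R \<sigma> \<delta> \<longleftrightarrow>
     \<delta> \<in> carrier R \<rightarrow> carrier R \<and>
     (\<forall>a\<in>carrier R. \<forall>b\<in>carrier R. \<delta> (a \<oplus>\<^bsub>R\<^esub> b) = \<delta> a \<oplus>\<^bsub>R\<^esub> \<delta> b) \<and>
     (\<forall>k\<in>carrier K. \<forall>a\<in>carrier R. \<delta> (k \<odot>\<^bsub>R\<^esub> a) = k \<odot>\<^bsub>R\<^esub> \<delta> a) \<and>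
     (\<forall>a\<in>carrier R. \<forall>b\<in>carrier R.
        \<delta> (a \<otimes>\<^bsub>R\<^esub> b) = \<delta> a \<otimes>\<^bsub>R\<^esub> b \<oplus>\<^bsub>R\<^esub> \<sigma> a \<otimes>\<^bsub>R\<^esub> \<delta> b)"

text \<open>\<open>ore_extension K S R x \<sigma> \<delta>\<close> says \<open>S = R[x;\<sigma>,\<delta>]\<close> for a subalgebra \<open>R\<close> of \<open>S\<close>: \<open>S\<close> is generated
  by \<open>R\<close> and \<open>x\<close> subject to the commutation rule, and freely so, i.e. the powers of \<open>x\<close> are left
  linearly independent over \<open>R\<close>.  (By the commutation rule they also span \<open>S\<close> as a left
  \<open>R\<close>-module.)\<close>

definition ore_extension ::
    "'k ring \<Rightarrow> ('k, 'a) module \<Rightarrow> 'a set \<Rightarrow> 'a \<Rightarrow> ('a \<Rightarrow> 'a) \<Rightarrow> ('a \<Rightarrow> 'a) \<Rightarrow> bool" where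
  "ore_extension K S R x \<sigma> \<delta> \<longleftrightarrow>
     K_algebra K S \<and> K_subalgebra K S R \<and> x \<in> carrier S \<and>
     \<sigma> \<in> algebra_iso K (S\<lparr>carrier := R\<rparr>) (S\<lparr>carrier := R\<rparr>) \<and>
     skew_derivation K (S\<lparr>carrier := R\<rparr>) \<sigma> \<delta> \<and>
     (\<forall>a\<in>R. x \<otimes>\<^bsub>S\<^esub> a = \<sigma> a \<otimes>\<^bsub>S\<^esub> x \<oplus>\<^bsub>S\<^esub> \<delta> a) \<and>
     (\<forall>C. K_subalgebra K S C \<and> insert x R \<subseteq> C \<longrightarrow> C = carrier S) \<and>
     (\<forall>(m :: nat) c. (\<forall>i\<le>m. c i \<in> R) \<and>
        (\<Oplus>\<^bsub>S\<^esub>i\<in>{..m}. c i \<otimes>\<^bsub>S\<^esub> (x [^]\<^bsub>S\<^esub> i)) = \<zero>\<^bsub>S\<^esub> \<longrightarrow> (\<forall>i\<le>m. c i = \<zero>\<^bsub>S\<^esub>))"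

text \<open>\<open>A = \<Gamma>[x\<^sub>0;\<sigma>\<^sub>0,\<delta>\<^sub>0]\<dots>[x\<^sub>n\<^sub>-\<^sub>1;\<sigma>\<^sub>n\<^sub>-\<^sub>1,\<delta>\<^sub>n\<^sub>-\<^sub>1]\<close>, where \<open>\<Gamma>\<close> sits in \<open>A\<close> via the embedding \<open>\<iota>\<close> and
  \<open>C i\<close> is the subalgebra obtained after \<open>i\<close> steps.\<close>

definition iterated_ore_extension ::
    "'k ring \<Rightarrow> ('k, 'g) module \<Rightarrow> nat \<Rightarrow> ('g \<Rightarrow> 'a) \<Rightarrow> (nat \<Rightarrow> 'a) \<Rightarrow>
      (nat \<Rightarrow> 'a \<Rightarrow> 'a) \<Rightarrow> (nat \<Rightarrow> 'a \<Rightarrow> 'a) \<Rightarrow> ('k, 'a) module \<Rightarrow> bool" where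
  "iterated_ore_extension K \<Gamma> n \<iota> x \<sigma> \<delta> A \<longleftrightarrow>
     K_algebra K \<Gamma> \<and> K_algebra K A \<and> \<iota> \<in> algebra_hom K \<Gamma> A \<and> inj_on \<iota> (carrier \<Gamma>) \<and>
     (\<exists>C. C 0 = \<iota> ` carrier \<Gamma> \<and> C n = carrier A \<and>
        (\<forall>i\<le>n. K_subalgebra K A (C i)) \<and>
        (\<forall>i<n. ore_extension K (A\<lparr>carrier := C (Suc i)\<rparr>) (C i) (x i) (\<sigma> i) (\<delta> i)))"

text \<open>\<open>skew_laurent_extension K S R y \<tau>\<close> says \<open>S = R[y,y\<^sup>-\<^sup>1;\<tau>]\<close> for a subalgebra \<open>R\<close> of \<open>S\<close>.\<close>

definition skew_laurent_extension ::
    "'k ring \<Rightarrow> ('k, 'a) module \<Rightarrow> 'a set \<Rightarrow> 'a \<Rightarrow> ('a \<Rightarrow> 'a) \<Rightarrow> bool" where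
  "skew_laurent_extension K S R y \<tau> \<longleftrightarrow>
     K_algebra K S \<and> K_subalgebra K S R \<and> y \<in> Units S \<and>
     \<tau> \<in> ring_iso (S\<lparr>carrier := R\<rparr>) (S\<lparr>carrier := R\<rparr>) \<and>
     (\<forall>a\<in>R. y \<otimes>\<^bsub>S\<^esub> a = \<tau> a \<otimes>\<^bsub>S\<^esub> y) \<and>
     (\<forall>a\<in>R. inv\<^bsub>S\<^esub> y \<otimes>\<^bsub>S\<^esub> a = inv_into R \<tau> a \<otimes>\<^bsub>S\<^esub> inv\<^bsub>S\<^esub> y) \<and>
     (\<forall>C. subring C S \<and> insert y (insert (inv\<^bsub>S\<^esub> y) R) \<subseteq> C \<longrightarrow> C = carrier S) \<and>
     (\<forall>(I :: int set) c. finite I \<and> (\<forall>i\<in>I. c i \<in> R) \<and>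
        (\<Oplus>\<^bsub>S\<^esub>i\<in>I. c i \<otimes>\<^bsub>S\<^esub> (y [^]\<^bsub>S\<^esub> i)) = \<zero>\<^bsub>S\<^esub> \<longrightarrow> (\<forall>i\<in>I. c i = \<zero>\<^bsub>S\<^esub>))"

definition iterated_skew_laurent_extension ::
    "'k ring \<Rightarrow> ('k, 'b) module \<Rightarrow> nat \<Rightarrow> ('b \<Rightarrow> 'a) \<Rightarrow> (nat \<Rightarrow> 'a) \<Rightarrow>
      (nat \<Rightarrow> 'a \<Rightarrow> 'a) \<Rightarrow> ('k, 'a) module \<Rightarrow> bool" where
  "iterated_skew_laurent_extension K R r \<iota> y \<tau> L \<longleftrightarrow>
     K_algebra K R \<and> K_algebra K L \<and> \<iota> \<in> algebra_hom K R L \<and> inj_on \<iota> (carrier R) \<and>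
     (\<exists>C. C 0 = \<iota> ` carrier R \<and> C r = carrier L \<and>
        (\<forall>i\<le>r. K_subalgebra K L (C i)) \<and>
        (\<forall>i<r. skew_laurent_extension K (L\<lparr>carrier := C (Suc i)\<rparr>) (C i) (y i) (\<tau> i)))"


section \<open>Division algebras and quotient division algebras\<close>

definition division_algebra :: "'k ring \<Rightarrow> ('k, 'a) module \<Rightarrow> bool" where
  "division_algebra K D \<longleftrightarrow> K_algebra K D \<and> Units D = carrier D - {\<zero>\<^bsub>D\<^esub>}"

definition division_subalgebra :: "'k ring \<Rightarrow> ('k, 'a) module \<Rightarrow> 'a set \<Rightarrow> bool" where
  "division_subalgebra K D E \<longleftrightarrow>
     K_subalgebra K D E \<and> division_algebra K (D\<lparr>carrier := E\<rparr>)"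

definition finitely_generated_division_algebra :: "'k ring \<Rightarrow> ('k, 'a) module \<Rightarrow> bool" where
  "finitely_generated_division_algebra K E \<longleftrightarrow> division_algebra K E \<and>
     (\<exists>Z. finite Z \<and> Z \<subseteq> carrier E \<and>
        (\<forall>E'. division_subalgebra K E E' \<and> Z \<subseteq> E' \<longrightarrow> E' = carrier E))"

text \<open>\<open>Q = Frac(A)\<close> with \<open>A\<close> embedded by \<open>j\<close>: every element is both a left fraction \<open>s\<^sup>-\<^sup>1a\<close> and a
  right fraction \<open>as\<^sup>-\<^sup>1\<close>.  For a Noetherian domain \<open>A\<close> such \<open>Q\<close> exists and is unique up to a unique
  isomorphism over \<open>A\<close>.\<close>

definition quotient_division_algebra ::
    "'k ring \<Rightarrow> ('k, 'a) module \<Rightarrow> ('a \<Rightarrow> 'q) \<Rightarrow> ('k, 'q) module \<Rightarrow> bool" where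
  "quotient_division_algebra K A j Q \<longleftrightarrow>
     division_algebra K Q \<and> j \<in> algebra_hom K A Q \<and> inj_on j (carrier A) \<and>
     (\<forall>q\<in>carrier Q.
        (\<exists>s\<in>carrier A - {\<zero>\<^bsub>A\<^esub>}. \<exists>a\<in>carrier A. q = inv\<^bsub>Q\<^esub> (j s) \<otimes>\<^bsub>Q\<^esub> j a) \<and>
        (\<exists>s\<in>carrier A - {\<zero>\<^bsub>A\<^esub>}. \<exists>a\<in>carrier A. q = j a \<otimes>\<^bsub>Q\<^esub> inv\<^bsub>Q\<^esub> (j s)))"

text \<open>The quotient division algebra of a Noetherian subdomain \<open>B\<close>, viewed inside the division
  algebra \<open>D\<close>.\<close>

definition frac_in :: "('k, 'a) module \<Rightarrow> 'a set \<Rightarrow> 'a set" where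
  "frac_in D B = {inv\<^bsub>D\<^esub> s \<otimes>\<^bsub>D\<^esub> b | s b. s \<in> B - {\<zero>\<^bsub>D\<^esub>} \<and> b \<in> B}"


section \<open>Abelian groups\<close>

definition finitely_generated_group :: "('g, 'm) monoid_scheme \<Rightarrow> bool" where
  "finitely_generated_group G \<longleftrightarrow>
     group G \<and> (\<exists>S. finite S \<and> S \<subseteq> carrier G \<and> generate G S = carrier G)"

definition torsion_subgroup :: "('g, 'm) monoid_scheme \<Rightarrow> 'g set" where
  "torsion_subgroup G = {g \<in> carrier G. \<exists>n::nat. n > 0 \<and> g [^]\<^bsub>G\<^esub> n = \<one>\<^bsub>G\<^esub>}"

definition rat_field :: "rat ring" where
  "rat_field = \<lparr>carrier = UNIV, monoid.mult = (*), one = 1, ring.zero = 0, add = (+)\<rparr>"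

definition rat_int_module :: "(int, rat) module" where
  "rat_int_module = \<lparr>carrier = UNIV, monoid.mult = (*), one = 1, ring.zero = 0, add = (+),
     smult = (\<lambda>z q. of_int z * q)\<rparr>"

text \<open>A multiplicatively written abelian group as a module over the integers.  The fields \<open>mult\<close> and
  \<open>one\<close> of the module record are fillers without meaning.\<close>

definition group_int_module :: "('g, 'm) monoid_scheme \<Rightarrow> (int, 'g) module" where
  "group_int_module G = \<lparr>carrier = carrier G, monoid.mult = monoid.mult G, one = \<one>\<^bsub>G\<^esub>,
     ring.zero = \<one>\<^bsub>G\<^esub>, add = monoid.mult G, smult = (\<lambda>z g. g [^]\<^bsub>G\<^esub> z)\<rparr>"

text \<open>\<open>\<rat> \<otimes>\<^sub>\<int> G\<close> as a vector space over \<open>\<rat>\<close>, with \<open>q(q' \<otimes> g) = qq' \<otimes> g\<close>; again \<open>mult\<close> and \<open>one\<close> are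
  fillers.\<close>

definition rationalization ::
    "('g, 'm) monoid_scheme \<Rightarrow> (rat, (rat \<times> 'g \<Rightarrow>\<^sub>0 int) set) module" where
  "rationalization G =
     (let T = tensor_group int_ring rat_int_module (group_int_module G)
      in \<lparr>carrier = carrier T, monoid.mult = monoid.mult T, one = \<one>\<^bsub>T\<^esub>, ring.zero = \<one>\<^bsub>T\<^esub>, add = monoid.mult T,
          smult = (\<lambda>q. tensor_map_left int_ring rat_int_module (group_int_module G) (\<lambda>q'. q * q'))\<rparr>)"

definition has_dimension :: "'k ring \<Rightarrow> ('k, 'v) module \<Rightarrow> nat \<Rightarrow> bool" where
  "has_dimension K V n \<longleftrightarrow>
     (\<exists>B. finite B \<and> B \<subseteq> carrier V \<and> card B = n \<and>
        (\<forall>v\<in>carrier V. \<exists>!c. c \<in> B \<rightarrow>\<^sub>E carrier K \<and> v = (\<Oplus>\<^bsub>V\<^esub>b\<in>B. c b \<odot>\<^bsub>V\<^esub> b)))"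

definition has_rank :: "('g, 'm) monoid_scheme \<Rightarrow> nat \<Rightarrow> bool" where
  "has_rank G r \<longleftrightarrow> has_dimension rat_field (rationalization G) r"


section \<open>Eigenvalues and eigen-algebras\<close>

text \<open>\<open>\<Delta> = {d 0, \<dots>, d (t - 1)}\<close>.  The eigenvalue tuples live in an ambient group \<open>G\<close>, which is \<open>K\<^sup>t\<close>
  with componentwise addition for derivations and \<open>(K\<^sup>*)\<^sup>t\<close> with componentwise multiplication for
  automorphisms.  Tuples are functions on \<open>{..<t}\<close>, extended by \<open>undefined\<close>.\<close>

definition commuting_on :: "'a set \<Rightarrow> nat \<Rightarrow> (nat \<Rightarrow> 'a \<Rightarrow> 'a) \<Rightarrow> bool" where
  "commuting_on D t d \<longleftrightarrow> (\<forall>i<t. \<forall>j<t. \<forall>u\<in>D. d i (d j u) = d j (d i u))"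

definition commuting_derivations ::
    "'k ring \<Rightarrow> ('k, 'a) module \<Rightarrow> nat \<Rightarrow> (nat \<Rightarrow> 'a \<Rightarrow> 'a) \<Rightarrow> bool" where
  "commuting_derivations K D t d \<longleftrightarrow>
     (\<forall>i<t. skew_derivation K D (\<lambda>u. u) (d i)) \<and> commuting_on (carrier D) t d"

definition commuting_automorphisms ::
    "'k ring \<Rightarrow> ('k, 'a) module \<Rightarrow> nat \<Rightarrow> (nat \<Rightarrow> 'a \<Rightarrow> 'a) \<Rightarrow> bool" where
  "commuting_automorphisms K D t d \<longleftrightarrow>
     (\<forall>i<t. d i \<in> algebra_iso K D D) \<and> commuting_on (carrier D) t d"

definition additive_tuples :: "'k ring \<Rightarrow> nat \<Rightarrow> (nat \<Rightarrow> 'k) monoid" where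
  "additive_tuples K t = product_group {..<t} (\<lambda>_. add_monoid K)"

definition multiplicative_tuples :: "'k ring \<Rightarrow> nat \<Rightarrow> (nat \<Rightarrow> 'k) monoid" where
  "multiplicative_tuples K t = product_group {..<t} (\<lambda>_. units_of K)"

definition eigenspace ::
    "('k, 'a) module \<Rightarrow> nat \<Rightarrow> (nat \<Rightarrow> 'a \<Rightarrow> 'a) \<Rightarrow> 'a set \<Rightarrow> (nat \<Rightarrow> 'k) \<Rightarrow> 'a set" where
  "eigenspace D t d E l = {u \<in> E. \<forall>i<t. d i u = l i \<odot>\<^bsub>D\<^esub> u}"

definition eigenvalues ::
    "(nat \<Rightarrow> 'k) monoid \<Rightarrow> ('k, 'a) module \<Rightarrow> nat \<Rightarrow> (nat \<Rightarrow> 'a \<Rightarrow> 'a) \<Rightarrow> 'a set \<Rightarrow> (nat \<Rightarrow> 'k) set" where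
  "eigenvalues G D t d E = {l \<in> carrier G. \<exists>u\<in>eigenspace D t d E l. u \<noteq> \<zero>\<^bsub>D\<^esub>}"

text \<open>The sum of the \<open>D\<^sub>\<lambda>\<close>, \<open>\<lambda> \<in> F\<close>, inside \<open>D\<close>; that it is direct is \<open>eigenspaces_independent\<close>.\<close>

definition eigen_sum ::
    "('k, 'a) module \<Rightarrow> nat \<Rightarrow> (nat \<Rightarrow> 'a \<Rightarrow> 'a) \<Rightarrow> (nat \<Rightarrow> 'k) set \<Rightarrow> 'a set" where
  "eigen_sum D t d F =
     {(\<Oplus>\<^bsub>D\<^esub>l\<in>S. u l) | S u. finite S \<and> S \<subseteq> F \<and> (\<forall>l\<in>S. u l \<in> eigenspace D t d (carrier D) l)}"

definition eigenspaces_independent ::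
    "('k, 'a) module \<Rightarrow> nat \<Rightarrow> (nat \<Rightarrow> 'a \<Rightarrow> 'a) \<Rightarrow> (nat \<Rightarrow> 'k) set \<Rightarrow> bool" where
  "eigenspaces_independent D t d F \<longleftrightarrow>
     (\<forall>S u. finite S \<and> S \<subseteq> F \<and> (\<forall>l\<in>S. u l \<in> eigenspace D t d (carrier D) l) \<and>
        (\<Oplus>\<^bsub>D\<^esub>l\<in>S. u l) = \<zero>\<^bsub>D\<^esub> \<longrightarrow> (\<forall>l\<in>S. u l = \<zero>\<^bsub>D\<^esub>))"

end

theory Submission imports Defs
begin

section \<open>Left-right symmetry, left ideals of subrings, and images under homomorphisms\<close>

section \<open>Opposite rings, subrings and left ideals\<close>

text \<open>All finiteness statements about D are drawn from one fact: D^e = D \<otimes> D^o is left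
  Noetherian. To prove it, the tower \<iota>(\<Gamma>) = C_0 \<subseteq> ... \<subseteq> C_n = A is
  placed inside D^e in the form of the subrings C_i \<otimes> C_k (\<open>sub_tensor\<close>). The
  bottom C_0 \<otimes> C_0 is a copy of \<Gamma>^e (\<open>sub_tensor_image\<close>). Raising one of
  the two indices adjoins a single element, x_i \<otimes> 1 or 1 \<otimes> x_i, which still obeys an
  Ore commutation rule and is still free over the smaller ring (\<open>tens_ore_free\<close>).
  Hilbert's basis theorem and a comparison of leading terms then carry the property of being a
  Noetherian domain up to A \<otimes> A^o (\<open>nc_noetherian_domain_ore_free\<close>). Finally
  D^e arises from A \<otimes> A^o by inverting the elements s \<otimes> t, and the property survives
  this localization (\<open>nc_noetherian_domain_localization\<close>). Freeness and injectivity in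
  tensor products are always tested by slice maps id \<otimes> f with f a linear functional; these
  separate points (\<open>slices_separate\<close>). The same maps recover a left ideal I of \<Gamma>
  from I \<otimes> \<Gamma>^o, so \<Gamma> is Noetherian, and so is A by Hilbert's theorem.

  For a division subalgebra E let J(E) be the kernel of D \<otimes> D^o \<rightarrow> D \<otimes>_E
  D (\<open>kernel_ideal\<close>). It is a left ideal of D^e, grows with E, and determines E: an
  element e lies in E exactly when e \<otimes> 1 - 1 \<otimes> e lies in J(E)
  (\<open>dlt_kernel_ideal\<close>, \<open>kernel_ideal_separates\<close>). Hence ascending chains
  of division subalgebras stop (\<open>acc_division_subalgebras\<close>). The same construction for
  finite subsets of E gives finite generation.

  The eigenspaces D_\<lambda> form a grading by the abelian group Ev in which every nonzero
  homogeneous element has a homogeneous inverse (\<open>graded_division\<close>). For a finitely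
  generated subgroup H the sum of the D_\<lambda> with \<lambda> in H is Noetherian, by Hilbert's
  theorem and localization at powers of one homogeneous element per generator
  (\<open>left_noetherian_ES_step\<close>). Its quotient division algebra lies in D and contains no
  nonzero homogeneous elements of degree outside H (\<open>homogeneous_fraction\<close>), because
  different cosets of H give independent pieces. So H can be read off from a division subalgebra,
  and the chain condition shows that all subgroups of Ev are finitely generated
  (\<open>subgroup_finitely_generated\<close>). Consequently the torsion subgroup T is finite and Ev
  has a basis modulo T. The algebra D_T is a finite-dimensional left D_0-space without zero
  divisors, hence a division algebra (\<open>ES_finite_inverse\<close>). Nonzero eigenvectors y_i
  for the basis elements are the Laurent variables: no nonzero multiple of a basis element lies in
  the subgroup generated by T and the preceding ones
  (\<open>iterated_skew_laurent_extension_ES\<close>).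

  Derivations and automorphisms differ only in the verification of the axioms of
  \<open>joint_eigenvectors\<close>.\<close>

lemma opposite_simps [simp]: "carrier (opposite R) = carrier R" "a \<otimes>\<^bsub>opposite R\<^esub> b = b \<otimes>\<^bsub>R\<^esub> a"
 "\<one>\<^bsub>opposite R\<^esub> = \<one>\<^bsub>R\<^esub>" "\<zero>\<^bsub>opposite R\<^esub> = \<zero>\<^bsub>R\<^esub>"
 "add (opposite R) = add R" "smult (opposite R) = smult R"
 "add_monoid (opposite R) = add_monoid R"
 "opposite (opposite R) = R"
 "opposite (R\<lparr>carrier := S\<rparr>) = (opposite R)\<lparr>carrier := S\<rparr>"
 by (simp_all add: opposite_def)

lemma opposite_a_inv [simp]: "\<ominus>\<^bsub>opposite R\<^esub> a = \<ominus>\<^bsub>R\<^esub> a" by (simp add: a_inv_def)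

lemma opposite_finsum [simp]: "finsum (opposite R) f I = finsum R f I" by (simp add: finsum_def)

lemma opposite_Units [simp]: "Units (opposite R) = Units R" by (auto simp: Units_def)

lemma opposite_m_inv [simp]: "inv\<^bsub>opposite R\<^esub> a = inv\<^bsub>R\<^esub> a"
 unfolding m_inv_def by (rule arg_cong[where f = The]) auto

lemma ring_opposite: assumes "ring R" shows "ring (opposite R)"
proof - interpret ring R by fact show ?thesis proof (rule ringI) show "abelian_group (opposite R)"
   using abelian_group_axioms
   by (simp add: abelian_group_def abelian_group_axioms_def abelian_monoid_def)
  show "monoid (opposite R)" by (rule monoidI) (auto simp: m_assoc)
 qed (auto simp: l_distr r_distr)
qed

text \<open>The negative of a is (-1)a, and -1 lies in the subring of multipliers.\<close>

lemma (in ring) minus_mult_closed_subset: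
 assumes "\<And>r a. r \<in> S ==> a \<in> I ==> r \<otimes> a \<in> I" "subring S R" "I \<subseteq> carrier R" "a \<in> I"
 shows "\<ominus> a \<in> I"
proof - have "\<ominus> \<one> \<in> S" using subringE[OF assms(2)] by blast then have "\<ominus> \<one> \<otimes> a \<in> I" using assms by blast
 then show ?thesis using assms by (auto simp: l_minus)
qed

lemma subring_opposite: assumes "ring R" "subring S R" shows "subring S (opposite R)"
proof - interpret ring R by fact interpret op: ring "opposite R" using assms ring_opposite by blast
 show ?thesis by (rule op.subringI) (use subringE[OF assms(2)] in auto)
qed

text \<open>Expresses left ideals of a subring by operations of the ambient ring, so that chains of
  ideals in different subrings can be compared inside one ring. Negatives come from multiplication
  by -1.\<close>

lemma left_ideal_subring_iff: assumes "ring R" "subring S R"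
 shows "left_ideal I (R\<lparr>carrier := S\<rparr>) \<longleftrightarrow> I \<subseteq> S \<and> \<zero>\<^bsub>R\<^esub> \<in> I \<and>
  (\<forall>a\<in>I. \<forall>b\<in>I. a \<oplus>\<^bsub>R\<^esub> b \<in> I) \<and> (\<forall>r\<in>S. \<forall>a\<in>I. r \<otimes>\<^bsub>R\<^esub> a \<in> I)"
  (is "?l \<longleftrightarrow> ?r")
proof - interpret ring R by fact interpret S: ring "R\<lparr>carrier := S\<rparr>" using subring_is_ring assms by blast
 note Ssub = subringE[OF assms(2)]
 show ?thesis
 proof assume ?l then have *: "subgroup I (add_monoid (R\<lparr>carrier := S\<rparr>))" "\<forall>r\<in>S. \<forall>a\<in>I. r \<otimes>\<^bsub>R\<^esub> a \<in> I"
   by (auto simp: left_ideal_def)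
  then show ?r
   using subgroup.subset[OF *(1)] subgroup.one_closed[OF *(1)] subgroup.m_closed[OF *(1)] by auto
 next assume r: ?r have neg: "\<ominus>\<^bsub>R\<^esub> a \<in> I" if "a \<in> I" for a
   by (rule minus_mult_closed_subset[of S]) (use r assms(2) that Ssub in auto)
  have inv: "\<ominus>\<^bsub>R\<lparr>carrier := S\<rparr>\<^esub> a = \<ominus>\<^bsub>R\<^esub> a" if "a \<in> S" for a
   by (rule S.minus_equality) (use that Ssub in \<open>auto intro: l_neg\<close>)
  have "subgroup I (add_monoid (R\<lparr>carrier := S\<rparr>))" by (rule S.add.subgroupI) (use r neg inv in auto)
  then show ?l using r by (simp add: left_ideal_def)
 qed
qed

lemma left_ideal_iff: assumes "ring R" shows "left_ideal I R \<longleftrightarrow> I \<subseteq> carrier R \<and> \<zero>\<^bsub>R\<^esub> \<in> I \<and>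
  (\<forall>a\<in>I. \<forall>b\<in>I. a \<oplus>\<^bsub>R\<^esub> b \<in> I) \<and> (\<forall>r\<in>carrier R. \<forall>a\<in>I. r \<otimes>\<^bsub>R\<^esub> a \<in> I)"
 using left_ideal_subring_iff[OF assms ring.carrier_is_subring[OF assms]] by simp

lemma nc_domain_opposite: assumes "nc_domain R" shows "nc_domain (opposite R)"
 using assms ring_opposite unfolding nc_domain_def by auto

lemma nc_noetherian_domain_opposite:
 assumes "nc_noetherian_domain R" shows "nc_noetherian_domain (opposite R)"
 using assms nc_domain_opposite unfolding nc_noetherian_domain_def by auto

text \<open>Left ideals of the image pull back to left ideals of R, and each is the image of its
  pull-back, so a chain stops as soon as the pulled-back chain does.\<close>

lemma left_noetherian_image:
 assumes R: "ring R" and R': "ring R'" and h: "h \<in> ring_hom R R'" and N: "left_noetherian R"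
 shows "left_noetherian (R'\<lparr>carrier := h ` carrier R\<rparr>)"
proof - interpret R: ring R by fact interpret R': ring R' by fact
 interpret h: ring_hom_ring R R' h using ring_hom_ringI2[OF R R' h] .
 have im: "subring (h ` carrier R) R'" by (rule h.img_is_subring[OF R.carrier_is_subring])
 show ?thesis unfolding left_noetherian_def
 proof (intro allI impI)
  fix I assume I: "\<forall>i::nat. left_ideal (I i) (R'\<lparr>carrier := h ` carrier R\<rparr>) \<and> I i \<subseteq> I (Suc i)"
  define J where "J i = {a \<in> carrier R. h a \<in> I i}" for i
  have Ii: "I i \<subseteq> h ` carrier R" "\<zero>\<^bsub>R'\<^esub> \<in> I i" "\<And>a b. a \<in> I i ==> b \<in> I i ==> a \<oplus>\<^bsub>R'\<^esub> b \<in> I i"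
   "\<And>r a. r \<in> carrier R ==> a \<in> I i ==> h r \<otimes>\<^bsub>R'\<^esub> a \<in> I i" for i
   using I left_ideal_subring_iff[OF R' im] by auto
  have "left_ideal (J i) R" for i unfolding left_ideal_iff[OF R] J_def using Ii by (auto simp: subset_iff)
  moreover have "J i \<subseteq> J (Suc i)" for i using I by (auto simp: J_def)
  ultimately have "\<forall>i. left_ideal (J i) R \<and> J i \<subseteq> J (Suc i)" by blast
  then obtain N where N: "\<forall>i\<ge>N. J i = J N" using N unfolding left_noetherian_def by blast
  have "I i = h ` J i" for i using Ii(1)[of i] by (auto simp: J_def)
  then show "\<exists>N. \<forall>i\<ge>N. I i = I N" using N by metis
 qed
qed

lemma ring_hom_opposite: "h \<in> ring_hom R R' ==> h \<in> ring_hom (opposite R) (opposite R')"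
 by (auto simp: ring_hom_def)

lemma nc_domain_subring: assumes "nc_domain R" "subring S R" shows "nc_domain (R\<lparr>carrier := S\<rparr>)"
 using assms ring.subring_is_ring[OF _ assms(2)] subringE(1)[OF assms(2)]
 unfolding nc_domain_def by (auto simp: subset_iff)

text \<open>Injectivity transports the absence of zero divisors; the right Noetherian half is the
  left one for the opposite rings.\<close>

lemma nc_noetherian_domain_image:
 assumes R': "ring R'" and h: "h \<in> ring_hom R R'" and inj: "inj_on h (carrier R)"
  and N: "nc_noetherian_domain R"
 shows "nc_noetherian_domain (R'\<lparr>carrier := h ` carrier R\<rparr>)"
proof - have R: "ring R" using N by (simp add: nc_noetherian_domain_def nc_domain_def)
 interpret R: ring R by fact
 interpret R': ring R' by fact
 interpret h: ring_hom_ring R R' h using ring_hom_ringI2[OF R R' h] .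
 have im: "subring (h ` carrier R) R'" by (rule h.img_is_subring[OF R.carrier_is_subring])
 have h0: "h a = \<zero>\<^bsub>R'\<^esub> \<longleftrightarrow> a = \<zero>\<^bsub>R\<^esub>" if "a \<in> carrier R" for a
  using inj that by (metis R.zero_closed h.hom_zero inj_onD)
 have dom: "nc_domain R" using N by (simp add: nc_noetherian_domain_def)
 have dd: "h x = \<zero>\<^bsub>R'\<^esub> \<or> h y = \<zero>\<^bsub>R'\<^esub>" if "h x \<otimes>\<^bsub>R'\<^esub> h y = \<zero>\<^bsub>R'\<^esub>" "x \<in> carrier R" "y \<in> carrier R" for x y
 proof - have "h (x \<otimes>\<^bsub>R\<^esub> y) = \<zero>\<^bsub>R'\<^esub>" using that by simp
  then have "x \<otimes>\<^bsub>R\<^esub> y = \<zero>\<^bsub>R\<^esub>" using h0[of "x \<otimes>\<^bsub>R\<^esub> y"] that by blast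
  then show ?thesis using dom that h0 unfolding nc_domain_def by blast
 qed
 have one: "\<one>\<^bsub>R'\<^esub> \<noteq> \<zero>\<^bsub>R'\<^esub>" using dom h0[of "\<one>\<^bsub>R\<^esub>"] by (auto simp: nc_domain_def)
 have "nc_domain (R'\<lparr>carrier := h ` carrier R\<rparr>)"
  unfolding nc_domain_def using R'.subring_is_ring[OF im] one dd h.hom_zero by auto
 moreover have "left_noetherian (R'\<lparr>carrier := h ` carrier R\<rparr>)"
  using N left_noetherian_image[OF R R' h] by (simp add: nc_noetherian_domain_def)
 moreover have "left_noetherian (opposite (R'\<lparr>carrier := h ` carrier R\<rparr>))"
  using left_noetherian_image[OF ring_opposite[OF R] ring_opposite[OF R'] ring_hom_opposite[OF h]] N
  by (simp add: nc_noetherian_domain_def)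
 ultimately show ?thesis by (simp add: nc_noetherian_domain_def)
qed

section \<open>Hilbert's basis theorem and zero divisors for Ore extensions\<close>

section \<open>Hilbert's basis theorem for Ore extensions\<close>

text \<open>\<open>S'\<close> is generated by \<open>S\<close> and \<open>x\<close>, and \<open>S + S x = S + x S\<close>.  All axioms are invariant under
 passing to the opposite ring, so only one side of each statement has to be proved.\<close>

locale ore_generated = ring R for R :: "('k, 'a) module" (structure) + fixes S S' :: "'a set" and x :: 'a
 assumes S: "subring S R" and S': "subring S' R" and SS': "S \<subseteq> S'" and xS': "x \<in> S'"
  and comm_l: "s \<in> S ==> \<exists>s'\<in>S. \<exists>s''\<in>S. x \<otimes> s = s' \<otimes> x \<oplus> s''"
  and comm_r: "s \<in> S ==> \<exists>s'\<in>S. \<exists>s''\<in>S. s \<otimes> x = x \<otimes> s' \<oplus> s''"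
  and gen: "subring C R ==> S \<subseteq> C ==> x \<in> C ==> S' \<subseteq> C"

text \<open>Polynomials in \<open>x\<close> of degree less than \<open>n\<close>, in Horner form.\<close>

primrec ore_filtration :: "('k, 'a) module \<Rightarrow> 'a set \<Rightarrow> 'a \<Rightarrow> nat \<Rightarrow> 'a set" where
 "ore_filtration R S x 0 = {\<zero>\<^bsub>R\<^esub>}"
| "ore_filtration R S x (Suc n) = {x \<otimes>\<^bsub>R\<^esub> g \<oplus>\<^bsub>R\<^esub> s | g s. g \<in> ore_filtration R S x n \<and> s \<in> S}"

declare ore_filtration.simps(2) [simp del]

context ore_generated
begin

abbreviation "F \<equiv> ore_filtration R S x"

lemma opposite_ore_generated: "ore_generated (opposite R) S S' x"
proof - have ops: "subring C (opposite R) \<longleftrightarrow> subring C R" for C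
  using subring_opposite[of R C] subring_opposite[of "opposite R" C] ring_axioms ring_opposite
  by auto
 show ?thesis unfolding ore_generated_def ore_generated_axioms_def ops
  using ring_opposite[OF ring_axioms] S S' SS' xS' comm_l comm_r gen by auto
qed

lemma sets [simp]: shows S_carr: "s \<in> S ==> s \<in> carrier R" and S'_carr: "s \<in> S' ==> s \<in> carrier R"
  and x_carr: "x \<in> carrier R"
 using subringE(1)[OF S] subringE(1)[OF S'] xS' by auto

lemma S_closed [simp]: "\<zero> \<in> S" "\<one> \<in> S" "a \<in> S ==> \<ominus> a \<in> S" "a \<in> S ==> b \<in> S ==> a \<oplus> b \<in> S"
 "a \<in> S ==> b \<in> S ==> a \<otimes> b \<in> S"
 using subringE[OF S] by auto

lemma S'_closed [simp]: "\<zero> \<in> S'" "\<one> \<in> S'" "a \<in> S' ==> \<ominus> a \<in> S'" "a \<in> S' ==> b \<in> S' ==> a \<oplus> b \<in> S'"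
 "a \<in> S' ==> b \<in> S' ==> a \<otimes> b \<in> S'"
 using subringE[OF S'] by auto

lemma F_S': "a \<in> F n ==> a \<in> S'"
 using SS' xS' by (induction n arbitrary: a) (auto simp: ore_filtration.simps(2))

lemma F_carr [simp]: "a \<in> F n ==> a \<in> carrier R" using F_S' by auto

lemma F_SucI: "g \<in> F n ==> s \<in> S ==> x \<otimes> g \<oplus> s \<in> F (Suc n)" by (auto simp: ore_filtration.simps(2))

lemma F_zero [simp]: "\<zero> \<in> F n"
proof (induction n) case (Suc n) then show ?case using F_SucI[OF Suc S_closed(1)] by simp
qed simp

lemma F_x: "g \<in> F n ==> x \<otimes> g \<in> F (Suc n)" using F_SucI[of g n \<zero>] by simp

lemma S_F: "s \<in> S ==> s \<in> F (Suc n)" using F_SucI[of \<zero> n s] by simp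

lemma F_Suc_cases: assumes "a \<in> F (Suc n)" obtains g s where "g \<in> F n" "s \<in> S" "a = x \<otimes> g \<oplus> s"
 using assms by (auto simp: ore_filtration.simps(2))

lemma F_one: "F (Suc 0) = S" using S_F[of _ 0] by (auto elim!: F_Suc_cases)

lemma F_add: "a \<in> F n ==> b \<in> F n ==> a \<oplus> b \<in> F n"
proof (induction n arbitrary: a b) case (Suc n)
 obtain g s h t where *: "g \<in> F n" "s \<in> S" "a = x \<otimes> g \<oplus> s" "h \<in> F n" "t \<in> S" "b = x \<otimes> h \<oplus> t"
  using Suc.prems by (metis F_Suc_cases)
 have "a \<oplus> b = x \<otimes> (g \<oplus> h) \<oplus> (s \<oplus> t)" using * by (simp add: r_distr a_ac)
 moreover have "x \<otimes> (g \<oplus> h) \<oplus> (s \<oplus> t) \<in> F (Suc n)" by (rule F_SucI) (use Suc.IH * in auto)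
 ultimately show ?case by (simp only:)
qed simp

lemma F_neg: "a \<in> F n ==> \<ominus> a \<in> F n"
proof (induction n arbitrary: a) case (Suc n) obtain g s where *: "g \<in> F n" "s \<in> S" "a = x \<otimes> g \<oplus> s"
  using Suc.prems by (metis F_Suc_cases)
 have "\<ominus> a = x \<otimes> (\<ominus> g) \<oplus> (\<ominus> s)" using * by (simp add: r_minus minus_add a_comm)
 moreover have "x \<otimes> (\<ominus> g) \<oplus> (\<ominus> s) \<in> F (Suc n)" by (rule F_SucI) (use Suc.IH * in auto)
 ultimately show ?case by (simp only:)
qed simp

lemma F_Suc: "a \<in> F n ==> a \<in> F (Suc n)"
proof (induction n arbitrary: a) case (Suc n) then show ?case by (metis F_SucI F_Suc_cases)
qed auto

lemma F_mono: "m \<le> n ==> a \<in> F m ==> a \<in> F n" by (induction rule: dec_induct) (auto intro: F_Suc)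

lemma F_S_right: "a \<in> F n ==> t \<in> S ==> a \<otimes> t \<in> F n"
proof (induction n arbitrary: a) case (Suc n) obtain g s where *: "g \<in> F n" "s \<in> S" "a = x \<otimes> g \<oplus> s"
  using Suc.prems by (metis F_Suc_cases)
 have "a \<otimes> t = x \<otimes> (g \<otimes> t) \<oplus> (s \<otimes> t)" using * Suc.prems by (simp add: l_distr m_assoc)
 moreover have "x \<otimes> (g \<otimes> t) \<oplus> (s \<otimes> t) \<in> F (Suc n)" by (rule F_SucI) (use Suc.IH Suc.prems * in auto)
 ultimately show ?case by (simp only:)
qed simp

lemma F_S_left: "a \<in> F n ==> t \<in> S ==> t \<otimes> a \<in> F n"
proof (induction n arbitrary: a t) case (Suc n) obtain g s where *: "g \<in> F n" "s \<in> S" "a = x \<otimes> g \<oplus> s"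
  using Suc.prems by (metis F_Suc_cases)
 obtain t1 t2 where t: "t1 \<in> S" "t2 \<in> S" "t \<otimes> x = x \<otimes> t1 \<oplus> t2" using comm_r Suc.prems by blast
 have "t \<otimes> a = (t \<otimes> x) \<otimes> g \<oplus> t \<otimes> s" using * Suc.prems by (simp add: r_distr m_assoc)
 also have "\<dots> = (x \<otimes> (t1 \<otimes> g) \<oplus> t \<otimes> s) \<oplus> t2 \<otimes> g"
  unfolding t(3) using t * Suc.prems by (simp add: l_distr m_assoc a_ac)
 finally show ?case
  using Suc.IH[of g t1] Suc.IH[of g t2] * t Suc.prems by (metis F_SucI F_Suc F_add S_closed(5))
qed simp

text \<open>Moving a coefficient across \<open>x\<close> by \<open>comm_l\<close> or
  \<open>comm_r\<close> only produces additional terms of lower degree, so the Horner form can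
  equally be built from the right. This is what makes the filtration the same for the opposite ring
  (\<open>opposite_F\<close>).\<close>

lemma F_Suc_right: "F (Suc n) = {g \<otimes> x \<oplus> s | g s. g \<in> F n \<and> s \<in> S}"
proof (induction n) case 0 then show ?case by (auto simp: ore_filtration.simps(2))
next case (Suc n) show ?case proof (intro equalityI subsetI) fix a assume "a \<in> F (Suc (Suc n))"
  then obtain g s where g: "g \<in> F (Suc n)" "s \<in> S" "a = x \<otimes> g \<oplus> s" by (rule F_Suc_cases)
  then obtain h t where h: "h \<in> F n" "t \<in> S" "g = h \<otimes> x \<oplus> t" using Suc by auto
  obtain t1 t2 where t: "t1 \<in> S" "t2 \<in> S" "x \<otimes> t = t1 \<otimes> x \<oplus> t2" using comm_l h by blast
  have "a = x \<otimes> h \<otimes> x \<oplus> x \<otimes> t \<oplus> s" using g h by (simp add: r_distr m_assoc)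
  also have "\<dots> = (x \<otimes> h \<oplus> t1) \<otimes> x \<oplus> (t2 \<oplus> s)" unfolding t(3) using t g(2) h by (simp add: l_distr a_ac)
  finally show "a \<in> {g \<otimes> x \<oplus> s | g s. g \<in> F (Suc n) \<and> s \<in> S}"
   using F_SucI[OF h(1) t(1)] S_closed(4)[OF t(2) g(2)] by blast
 next fix a assume "a \<in> {g \<otimes> x \<oplus> s | g s. g \<in> F (Suc n) \<and> s \<in> S}"
  then obtain g s where g: "g \<in> F (Suc n)" "s \<in> S" "a = g \<otimes> x \<oplus> s" by blast
  then obtain h t where h: "h \<in> F n" "t \<in> S" "g = x \<otimes> h \<oplus> t" by (metis F_Suc_cases)
  obtain t1 t2 where t: "t1 \<in> S" "t2 \<in> S" "t \<otimes> x = x \<otimes> t1 \<oplus> t2" using comm_r h by blast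
  have "a = x \<otimes> (h \<otimes> x) \<oplus> t \<otimes> x \<oplus> s" using g h by (simp add: l_distr m_assoc)
  also have "\<dots> = x \<otimes> (h \<otimes> x \<oplus> t1) \<oplus> (t2 \<oplus> s)" unfolding t(3) using t g(2) h by (simp add: r_distr a_ac)
  finally have a: "a = x \<otimes> (h \<otimes> x \<oplus> t1) \<oplus> (t2 \<oplus> s)" .
  have "h \<otimes> x \<oplus> t1 \<in> F (Suc n)" unfolding Suc using h(1) t(1) by blast
  then show "a \<in> F (Suc (Suc n))" unfolding a using F_SucI S_closed(4)[OF t(2) g(2)] by blast
 qed
qed

lemma opposite_F: "ore_filtration (opposite R) S x n = F n"
proof (induction n) case (Suc n)
 have "ore_filtration (opposite R) S x (Suc n) = {g \<otimes> x \<oplus> s | g s. g \<in> F n \<and> s \<in> S}"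
  by (simp add: Suc ore_filtration.simps(2))
 then show ?case using F_Suc_right by metis
qed simp

text \<open>Degree less than n times degree at most m gives degree less than n + m; this accounts
  for the single \<open>Suc\<close>.\<close>

lemma F_mult: "a \<in> F n ==> b \<in> F (Suc m) ==> a \<otimes> b \<in> F (n + m)"
proof (induction n arbitrary: a) case 0 then show ?case using F_zero F_carr[OF 0(2)] by auto
next case (Suc n) obtain g s where *: "g \<in> F n" "s \<in> S" "a = x \<otimes> g \<oplus> s" using Suc.prems by (metis F_Suc_cases)
 note b = F_carr[OF Suc.prems(2)]
 have "a \<otimes> b = x \<otimes> (g \<otimes> b) \<oplus> (s \<otimes> b)" using * b by (simp add: l_distr m_assoc)
 moreover have "x \<otimes> (g \<otimes> b) \<in> F (Suc n + m)" using F_x Suc.IH[OF *(1)] Suc.prems by force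
 moreover have "s \<otimes> b \<in> F (Suc n + m)"
  using F_mono[of "Suc m" "Suc n + m"] F_S_left Suc.prems(2) *(2) by force
 ultimately show ?case using F_add by metis
qed

text \<open>The union of the filtration is a subring containing \<open>S\<close> and
  \<open>x\<close>, so \<open>gen\<close> makes it exhaust \<open>S'\<close>.\<close>

lemma S'_F: assumes "a \<in> S'" obtains n where "a \<in> F n"
proof - have "subring (\<Union>n. F n) R" proof (rule subringI) show "(\<Union>n. F n) \<subseteq> carrier R" using F_carr by blast
  show "\<one> \<in> (\<Union>n. F n)" using S_F[OF S_closed(2), of 0] by blast
  show "\<ominus> a \<in> (\<Union>n. F n)" if "a \<in> (\<Union>n. F n)" for a using F_neg that by blast
  fix a b assume "a \<in> (\<Union>n. F n)" "b \<in> (\<Union>n. F n)"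
  then obtain n m where "a \<in> F n" "b \<in> F m" by blast
  then have nm: "a \<in> F (Suc (max n m))" "b \<in> F (Suc (max n m))"
   using F_mono[of n "Suc (max n m)" a] F_mono[of m "Suc (max n m)" b] by simp_all
  show "a \<oplus> b \<in> (\<Union>n. F n)" using F_add[OF nm] by blast
  show "a \<otimes> b \<in> (\<Union>n. F n)" using F_mult[OF nm] by blast
 qed
 moreover have "S \<subseteq> (\<Union>n. F n)" using S_F by blast
 moreover have "x \<in> (\<Union>n. F n)" using F_x[OF S_F[OF S_closed(2)], of 0] r_one[OF x_carr] by (metis UN_I UNIV_I)
 ultimately have "S' \<subseteq> (\<Union>n. F n)" by (rule gen)
 then show ?thesis using that assms by blast
qed

lemma pow_S' [simp]: "x [^] (n::nat) \<in> S'" by (induction n) (auto simp: xS')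

lemma x_pow: "x \<otimes> x [^] (n::nat) = x [^] (Suc n)" using nat_pow_Suc2 by simp

lemma F_pow: "g \<in> F m ==> x [^] (n::nat) \<otimes> g \<in> F (n + m)"
proof (induction n) case (Suc n) have "x [^] Suc n \<otimes> g = x \<otimes> (x [^] n \<otimes> g)"
  using F_carr[OF Suc.prems] unfolding x_pow[symmetric] by (simp add: m_assoc del: nat_pow_Suc)
 then show ?case using F_x[OF Suc.IH[OF Suc.prems]] by (simp del: nat_pow_Suc)
qed simp

lemma F_top: assumes "a \<in> F (Suc n)" obtains r f where "r \<in> S" "f \<in> F n" "a = x [^] n \<otimes> r \<oplus> f" using assms
proof (induction n arbitrary: a thesis) case 0 then show ?case using F_one by (auto intro: 0(1)[of _ \<zero>])
next case (Suc n)
 obtain g s where g: "g \<in> F (Suc n)" "s \<in> S" "a = x \<otimes> g \<oplus> s" using Suc.prems(2) by (rule F_Suc_cases)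
 obtain r f where r: "r \<in> S" "f \<in> F n" "g = x [^] n \<otimes> r \<oplus> f" using Suc.IH[OF _ g(1)] by blast
 have "a = x \<otimes> (x [^] n \<otimes> r) \<oplus> (x \<otimes> f \<oplus> s)" unfolding g(3) r(3) using r g(2) by (simp add: r_distr a_assoc)
 then have "a = x [^] Suc n \<otimes> r \<oplus> (x \<otimes> f \<oplus> s)" unfolding x_pow[symmetric] using r by (simp add: m_assoc)
 then show ?case using Suc.prems(1) r(1) F_SucI[OF r(2) g(2)] by blast
qed

text \<open>Top coefficients are written to the right of the power of \<open>x\<close>. To multiply
  such a coefficient by s from the left, one multiplies the whole polynomial by the s' found
  here.\<close>

lemma pow_comm: "s \<in> S ==> \<exists>s'\<in>S. \<exists>f\<in>F n. s' \<otimes> x [^] n = x [^] n \<otimes> s \<oplus> f"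
proof (induction n arbitrary: s) case 0 then have "s \<otimes> x [^] (0::nat) = x [^] (0::nat) \<otimes> s \<oplus> \<zero>" by simp
 then show ?case using 0 F_zero by blast
next case (Suc n) obtain s1 f1 where 1: "s1 \<in> S" "f1 \<in> F n" "s1 \<otimes> x [^] n = x [^] n \<otimes> s \<oplus> f1"
  using Suc by blast
 obtain s2 s3 where 2: "s2 \<in> S" "s3 \<in> S" "x \<otimes> s1 = s2 \<otimes> x \<oplus> s3" using comm_l 1 by blast
 have p: "x [^] n \<in> carrier R" by simp
 have "s2 \<otimes> x = x \<otimes> s1 \<ominus> s3" unfolding 2(3) using 2 by (simp add: minus_eq a_assoc r_neg)
 then have "s2 \<otimes> x \<otimes> x [^] n = (x \<otimes> s1 \<oplus> \<ominus> s3) \<otimes> x [^] n" by (simp only: minus_eq)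
 also have "\<dots> = x \<otimes> (s1 \<otimes> x [^] n) \<oplus> \<ominus> (s3 \<otimes> x [^] n)"
  using 1(1) 2(1,2) p by (simp add: l_distr l_minus m_assoc)
 also have "\<dots> = x \<otimes> (x [^] n \<otimes> s) \<oplus> (x \<otimes> f1 \<oplus> \<ominus> (s3 \<otimes> x [^] n))"
  unfolding 1(3) using p Suc.prems 1 2 by (simp add: r_distr a_assoc)
 finally have "s2 \<otimes> x [^] Suc n = x [^] Suc n \<otimes> s \<oplus> (x \<otimes> f1 \<oplus> \<ominus> (s3 \<otimes> x [^] n))"
  unfolding x_pow[symmetric] using p Suc.prems 1 2 by (simp add: m_assoc)
 moreover have "x [^] n \<otimes> \<one> \<in> F (n + Suc 0)" by (rule F_pow[OF S_F]) simp
 then have "x [^] n \<in> F (Suc n)" by simp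
 then have "x \<otimes> f1 \<oplus> \<ominus> (s3 \<otimes> x [^] n) \<in> F (Suc n)"
  using F_add[OF F_x[OF 1(2)] F_neg[OF F_S_left[OF _ 2(2)]]] by blast
 ultimately show ?case using 2(1) by blast
qed

text \<open>Coefficients of degree n of the elements of \<open>I\<close> of degree at most n; zero
  is included when the degree is smaller, so that the set is a left ideal.\<close>

definition leading :: "'a set \<Rightarrow> nat \<Rightarrow> 'a set" where "leading I n = {r \<in> S. \<exists>f\<in>F n. x [^] n \<otimes> r \<oplus> f \<in> I}"

lemma leading_ideal:
 assumes I: "left_ideal I (R\<lparr>carrier := S'\<rparr>)" shows "left_ideal (leading I n) (R\<lparr>carrier := S\<rparr>)"
proof - have Ii: "I \<subseteq> S'" "\<zero> \<in> I" "\<And>a b. a \<in> I ==> b \<in> I ==> a \<oplus> b \<in> I" "\<And>r a. r \<in> S' ==> a \<in> I ==> r \<otimes> a \<in> I"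
  using I left_ideal_subring_iff[OF ring_axioms S'] by auto
 have p: "x [^] n \<in> carrier R" by simp
 show ?thesis unfolding left_ideal_subring_iff[OF ring_axioms S]
 proof (intro conjI ballI) show "leading I n \<subseteq> S" by (auto simp: leading_def)
  show "\<zero> \<in> leading I n" using Ii by (auto simp: leading_def intro!: bexI[of _ \<zero>])
  fix a assume "a \<in> leading I n"
  then obtain f where a: "a \<in> S" "f \<in> F n" "x [^] n \<otimes> a \<oplus> f \<in> I" by (auto simp: leading_def)
  { fix b assume "b \<in> leading I n"
   then obtain g where b: "b \<in> S" "g \<in> F n" "x [^] n \<otimes> b \<oplus> g \<in> I" by (auto simp: leading_def)
   have "x [^] n \<otimes> (a \<oplus> b) \<oplus> (f \<oplus> g) = (x [^] n \<otimes> a \<oplus> f) \<oplus> (x [^] n \<otimes> b \<oplus> g)"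
    using a b by (simp add: r_distr a_ac)
   then show "a \<oplus> b \<in> leading I n" using Ii(3) a b F_add by (force simp: leading_def)
  next fix s assume s: "s \<in> S"
   then obtain s' g where s': "s' \<in> S" "g \<in> F n" "s' \<otimes> x [^] n = x [^] n \<otimes> s \<oplus> g" using pow_comm by blast
   have "s' \<otimes> (x [^] n \<otimes> a \<oplus> f) = (s' \<otimes> x [^] n) \<otimes> a \<oplus> s' \<otimes> f"
    using s'(1,2) a by (simp add: r_distr m_assoc)
   also have "\<dots> = x [^] n \<otimes> (s \<otimes> a) \<oplus> (g \<otimes> a \<oplus> s' \<otimes> f)"
    unfolding s'(3) using s s'(1,2) a by (simp add: l_distr m_assoc a_assoc)
   finally have "x [^] n \<otimes> (s \<otimes> a) \<oplus> (g \<otimes> a \<oplus> s' \<otimes> f) \<in> I" using Ii(4) a s' SS' by (metis subsetD)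
   moreover have "g \<otimes> a \<oplus> s' \<otimes> f \<in> F n" using F_add F_S_right F_S_left a s' by blast
   ultimately show "s \<otimes> a \<in> leading I n" using s a by (auto simp: leading_def)
  }
 qed
qed

text \<open>Multiplication by \<open>x\<close> from the left raises the degree by one and leaves the
  right-hand coefficient alone.\<close>

lemma leading_Suc: assumes I: "left_ideal I (R\<lparr>carrier := S'\<rparr>)" shows "leading I n \<subseteq> leading I (Suc n)"
proof fix a assume "a \<in> leading I n"
 then obtain f where a: "a \<in> S" "f \<in> F n" "x [^] n \<otimes> a \<oplus> f \<in> I" by (auto simp: leading_def)
 have "x \<otimes> (x [^] n \<otimes> a \<oplus> f) \<in> I" using I a xS' left_ideal_subring_iff[OF ring_axioms S'] by auto
 moreover have "x \<otimes> (x [^] n \<otimes> a \<oplus> f) = x [^] Suc n \<otimes> a \<oplus> x \<otimes> f"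
  unfolding x_pow[symmetric] using a by (simp add: r_distr m_assoc)
 ultimately show "a \<in> leading I (Suc n)" using a F_x by (force simp: leading_def)
qed

lemma leading_mono: "I \<subseteq> J ==> leading I n \<subseteq> leading J n" by (auto simp: leading_def)

text \<open>Induction on the degree: an element of \<open>J\<close> shares its top coefficient with
  an element of \<open>I\<close>, and their difference lies in \<open>J\<close> and has smaller
  degree.\<close>

lemma leading_eq_imp_subset:
 assumes I: "left_ideal I (R\<lparr>carrier := S'\<rparr>)" and J: "left_ideal J (R\<lparr>carrier := S'\<rparr>)"
  and IJ: "I \<subseteq> J" and eq: "\<And>n. leading J n \<subseteq> leading I n"
 shows "J \<subseteq> I"
proof have Ii: "I \<subseteq> S'" "\<zero> \<in> I" "\<And>a b. a \<in> I ==> b \<in> I ==> a \<oplus> b \<in> I" "\<And>r a. r \<in> S' ==> a \<in> I ==> r \<otimes> a \<in> I"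
  using I left_ideal_subring_iff[OF ring_axioms S'] by auto
 have Ji: "J \<subseteq> S'" "\<And>a b. a \<in> J ==> b \<in> J ==> a \<oplus> b \<in> J" "\<And>r a. r \<in> S' ==> a \<in> J ==> r \<otimes> a \<in> J"
  using J left_ideal_subring_iff[OF ring_axioms S'] by auto
 have Jn: "\<ominus> a \<in> J" if "a \<in> J" for a by (rule minus_mult_closed_subset[of S']) (use Ji S' that in auto)
 have "z \<in> J ==> z \<in> F n ==> z \<in> I" for z n
 proof (induction n arbitrary: z) case 0 then show ?case using Ii by simp
 next case (Suc n)
  obtain r f where r: "r \<in> S" "f \<in> F n" "z = x [^] n \<otimes> r \<oplus> f" using Suc.prems(2) by (rule F_top)
  then have "r \<in> leading J n" using Suc.prems by (auto simp: leading_def)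
  then obtain g where g: "g \<in> F n" "x [^] n \<otimes> r \<oplus> g \<in> I" using eq by (force simp: leading_def)
  let ?y = "x [^] n \<otimes> r \<oplus> g"
  have "z \<oplus> \<ominus> ?y = (x [^] n \<otimes> r \<oplus> \<ominus> (x [^] n \<otimes> r)) \<oplus> (f \<oplus> \<ominus> g)"
   unfolding r(3) using r(1,2) g by (simp add: minus_add a_ac del: r_neg)
  also have "\<dots> = f \<oplus> \<ominus> g" using r g by (simp add: r_neg)
  finally have *: "z \<oplus> \<ominus> ?y = f \<oplus> \<ominus> g" .
  then have "z \<oplus> \<ominus> ?y \<in> I" using Suc.IH[of "z \<oplus> \<ominus> ?y"] F_add[OF r(2) F_neg[OF g(1)]] Ji(2) Jn Suc.prems(1) g(2) IJ
   by (metis subsetD)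
  then have "(z \<oplus> \<ominus> ?y) \<oplus> ?y \<in> I" using Ii(3) g by blast
  moreover have "(z \<oplus> \<ominus> ?y) \<oplus> ?y = z" using Suc.prems(1) Ji(1) r(1) g(1)
   by (simp add: a_assoc l_neg subset_iff)
  ultimately show ?case by simp
 qed
 then show "z \<in> I" if "z \<in> J" for z using that Ji(1) S'_F[of z] by blast
qed

text \<open>Hilbert's argument on the double family \<open>leading (I i) n\<close>, which increases
  in both indices. The diagonal becomes constant from N on; this controls all degrees above N, and
  each of the finitely many remaining degrees has its own point of stabilization. Equal leading
  ideals in all degrees force equal ideals.\<close>

theorem left_noetherian_ore_generated: assumes N: "left_noetherian (R\<lparr>carrier := S\<rparr>)"
 shows "left_noetherian (R\<lparr>carrier := S'\<rparr>)"
 unfolding left_noetherian_def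
proof (intro allI impI) fix I assume I: "\<forall>i::nat. left_ideal (I i) (R\<lparr>carrier := S'\<rparr>) \<and> I i \<subseteq> I (Suc i)"
 have I': "left_ideal (I i) (R\<lparr>carrier := S'\<rparr>)" for i using I by blast
 have Imono: "i \<le> j ==> I i \<subseteq> I j" for i j using I lift_Suc_mono_le[of I] by blast
 have Lmono: "leading (I i) n \<subseteq> leading (I j) m" if "i \<le> j" "n \<le> m" for i j n m
  using leading_mono[OF Imono[OF that(1)], of n]
   lift_Suc_mono_le[of "leading (I j)", OF leading_Suc[OF I'] that(2)] by blast
 have Lid: "left_ideal (leading (I i) n) (R\<lparr>carrier := S\<rparr>)" for i n using leading_ideal I' by blast
 have st: "\<exists>N. \<forall>i\<ge>N. leading (I i) (f i) = leading (I N) (f N)" if "mono f" for f :: "nat \<Rightarrow> nat"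
 proof - have "\<forall>i. left_ideal (leading (I i) (f i)) (R\<lparr>carrier := S\<rparr>) \<and>
    leading (I i) (f i) \<subseteq> leading (I (Suc i)) (f (Suc i))"
   using Lid Lmono monoD[OF that] by simp
  then show ?thesis using N[unfolded left_noetherian_def, rule_format, of "\<lambda>i. leading (I i) (f i)"] by blast
 qed
 obtain N where N: "\<And>i. i \<ge> N ==> leading (I i) i = leading (I N) N"
  using st[of "\<lambda>i. i"] monoI[of "\<lambda>i::nat. i"] by blast
 have "\<forall>n. \<exists>N. \<forall>i\<ge>N. leading (I i) n = leading (I N) n"
  using st[of "\<lambda>_. n" for n] monoI[of "\<lambda>_::nat. n::nat" for n] by blast
 then obtain M where M: "\<And>n i. i \<ge> M n ==> leading (I i) n = leading (I (M n)) n" by metis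
 \<comment> \<open>From \<open>B\<close> on the diagonal and every row of degree at most N are
   constant.\<close>
 define B where "B = Max (insert N (M ` {..N}))"
 have "finite (insert N (M ` {..N}))" by simp
 then have B: "N \<le> B" "\<And>n. n \<le> N ==> M n \<le> B" unfolding B_def by (meson Max_ge insertCI imageI atMost_iff)+
 have "leading (I i) n \<subseteq> leading (I B) n" if "i \<ge> B" for i n
 proof (cases "n \<le> N") case True then have "M n \<le> B" by (rule B(2))
  then have "leading (I i) n = leading (I B) n" using M[of n i] M[of n B] that by (metis order.trans)
  then show ?thesis by simp
 \<comment> \<open>A degree n above N: the ideal is squeezed between \<open>leading (I B) n\<close>
   and a diagonal entry, and both agree with the diagonal value at N.\<close>
 next case False have "leading (I i) n \<subseteq> leading (I (max i n)) (max i n)" by (rule Lmono) auto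
  also have "\<dots> = leading (I N) N" by (rule N) (use False in simp)
  also have "\<dots> \<subseteq> leading (I B) n" by (rule Lmono) (use B False in simp_all)
  finally show ?thesis .
 qed
 then have "I i = I B" if "i \<ge> B" for i
  using leading_eq_imp_subset[OF I' I' Imono[OF that]] Imono[OF that] that by (intro subset_antisym) auto
 then show "\<exists>N. \<forall>i\<ge>N. I i = I N" by blast
qed

end

lemma (in ore_generated) right_noetherian_ore_generated:
 assumes "left_noetherian (opposite (R\<lparr>carrier := S\<rparr>))"
 shows "left_noetherian (opposite (R\<lparr>carrier := S'\<rparr>))"
 using ore_generated.left_noetherian_ore_generated[OF opposite_ore_generated] assms by simp

text \<open>The powers of \<open>x\<close> are left and right linearly independent over \<open>S\<close>.\<close>

locale ore_free = ore_generated + assumes free_l: "g \<in> S' ==> x \<otimes> g \<in> S ==> g = \<zero>"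
  and free_r: "g \<in> S' ==> g \<otimes> x \<in> S ==> g = \<zero>"
begin

lemma opposite_ore_free: "ore_free (opposite R) S S' x" unfolding ore_free_def ore_free_axioms_def
 using opposite_ore_generated free_l free_r by auto

text \<open>If xu = xg + s with g in \<open>F n\<close>, then x(u - g) lies in \<open>S\<close>, and
  \<open>free_l\<close> gives u = g.\<close>

lemma F_cancel: assumes u: "u \<in> S'" and "x \<otimes> u \<in> F (Suc n)" shows "u \<in> F n"
proof - obtain g s where *: "g \<in> F n" "s \<in> S" "x \<otimes> u = x \<otimes> g \<oplus> s" using assms(2) by (rule F_Suc_cases)
 have "x \<otimes> (u \<oplus> \<ominus> g) = (x \<otimes> g \<oplus> s) \<oplus> \<ominus> (x \<otimes> g)" using u * by (simp add: r_distr r_minus)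
 also have "\<dots> = (x \<otimes> g \<oplus> \<ominus> (x \<otimes> g)) \<oplus> s" using * by (simp add: a_ac del: r_neg)
 also have "\<dots> = s" using * by (simp add: r_neg)
 finally have "u \<oplus> \<ominus> g = \<zero>" using free_l[of "u \<oplus> \<ominus> g"] u F_S'[OF *(1)] *(2) by simp
 then have "u = g" using u * by (metis F_carr S'_carr minus_equality minus_minus a_inv_closed r_neg add.r_cancel)
 then show ?thesis using * by simp
qed

lemma F_cancel_pow: "u \<in> S' ==> x [^] k \<otimes> u \<in> F (k + n) ==> u \<in> F n"
proof (induction k) case (Suc k) have "x [^] Suc k \<otimes> u = x \<otimes> (x [^] k \<otimes> u)"
  unfolding x_pow[symmetric] using Suc.prems by (simp add: m_assoc)
 then have "x \<otimes> (x [^] k \<otimes> u) \<in> F (Suc (k + n))" using Suc.prems by simp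
 then have "x [^] k \<otimes> u \<in> F (k + n)" using F_cancel Suc.prems by simp
 then show ?case using Suc by blast
qed simp

text \<open>Leading terms multiply to a leading term. The top coefficient r of f is written to the
  right of its power and the top coefficient s of h to the left of its power; then the product of
  the top terms is x^n (rs) x^m, with r and s adjacent and no twist between them.\<close>

lemma nc_domain_ore_free: assumes "nc_domain (R\<lparr>carrier := S\<rparr>)" shows "nc_domain (R\<lparr>carrier := S'\<rparr>)"
proof - interpret op: ore_free "opposite R" S S' x by (rule opposite_ore_free)
 have S: "\<one> \<noteq> \<zero>" "\<And>a b. a \<in> S ==> b \<in> S ==> a \<otimes> b = \<zero> ==> a = \<zero> \<or> b = \<zero>" using assms by (auto simp: nc_domain_def)
 have least: "\<exists>n. a \<in> F (Suc n) \<and> a \<notin> F n" if a: "a \<in> S'" "a \<noteq> \<zero>" for a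
 proof - obtain N where N: "a \<in> F N" using S'_F[OF a(1)] by blast define m where "m = (LEAST m. a \<in> F m)"
  have "a \<in> F m" unfolding m_def using N by (rule LeastI)
  moreover have "a \<notin> F k" if "k < m" for k using not_less_Least that unfolding m_def by blast
  moreover have "m \<noteq> 0" using a(2) calculation(1) by (metis ore_filtration.simps(1) singletonD)
  ultimately show ?thesis by (metis lessI not0_implies_Suc)
 qed
 have pow_op: "x [^]\<^bsub>opposite R\<^esub> (m::nat) = x [^] m" for m
 proof (induction m) case (Suc m) then show ?case using x_pow[of m] by simp
 qed simp
 have "f = \<zero> \<or> h = \<zero>" if f: "f \<in> S'" and h: "h \<in> S'" and fh: "f \<otimes> h = \<zero>" for f h
 proof (rule ccontr) assume "\<not> (f = \<zero> \<or> h = \<zero>)"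
  then obtain n m where n: "f \<in> F (Suc n)" "f \<notin> F n" and m: "h \<in> F (Suc m)" "h \<notin> F m"
   using least f h by metis
  obtain r f' where r: "r \<in> S" "f' \<in> F n" "f = x [^] n \<otimes> r \<oplus> f'" using n(1) by (rule F_top)
  obtain s h' where s: "s \<in> S" "h' \<in> F m" "h = s \<otimes> x [^] m \<oplus> h'"
   using op.F_top[of h m] m(1) unfolding opposite_F by (auto simp: pow_op)
  have p: "x [^] n \<in> carrier R" "x [^] m \<in> carrier R" by simp_all
  have "\<zero> = x [^] n \<otimes> r \<otimes> h \<oplus> f' \<otimes> h" using fh r(1,2) h unfolding r(3) by (simp add: l_distr)
  also have "x [^] n \<otimes> r \<otimes> h = x [^] n \<otimes> (r \<otimes> s \<otimes> x [^] m) \<oplus> x [^] n \<otimes> (r \<otimes> h')"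
   unfolding s(3) using s(1,2) r(1,2) by (simp add: r_distr m_assoc)
  finally have "x [^] n \<otimes> (r \<otimes> s \<otimes> x [^] m) \<oplus> (x [^] n \<otimes> (r \<otimes> h') \<oplus> f' \<otimes> h) = \<zero>"
   using r(1,2) s(1,2) h by (simp add: a_assoc)
  then have "x [^] n \<otimes> (r \<otimes> s \<otimes> x [^] m) = \<ominus> (x [^] n \<otimes> (r \<otimes> h') \<oplus> f' \<otimes> h)"
   using r(1,2) s(1,2) h by (intro minus_equality[symmetric]) simp_all
  moreover have "\<ominus> (x [^] n \<otimes> (r \<otimes> h') \<oplus> f' \<otimes> h) \<in> F (n + m)"
   using F_pow[of "r \<otimes> h'" m n] F_S_left F_mult[OF r(2) m(1)] r s by (intro F_neg F_add) auto
  ultimately have "x [^] n \<otimes> (r \<otimes> s \<otimes> x [^] m) \<in> F (n + m)" by simp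
  \<comment> \<open>Everything else in fh = 0 has degree less than n + m. Cancelling x^n on the left
    and then x^m on the right leaves rs in \<open>F 0\<close>, which is zero.\<close>
  then have "r \<otimes> s \<otimes> x [^] m \<in> F m" using F_cancel_pow r(1) s(1) SS' by (auto simp: subset_iff)
  then have "r \<otimes> s \<in> F 0" using op.F_cancel_pow[of "r \<otimes> s" m 0] r(1) s(1) SS' unfolding opposite_F
   by (auto simp: pow_op subset_iff)
  then have "r = \<zero> \<or> s = \<zero>" using S(2) r s by simp
  then show False using n(2) m(2) r s by auto
 qed
 then show ?thesis using S(1) subring_is_ring[OF S'] by (auto simp: nc_domain_def)
qed

theorem nc_noetherian_domain_ore_free:
 assumes "nc_noetherian_domain (R\<lparr>carrier := S\<rparr>)" shows "nc_noetherian_domain (R\<lparr>carrier := S'\<rparr>)"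
 using assms nc_domain_ore_free left_noetherian_ore_generated right_noetherian_ore_generated
 unfolding nc_noetherian_domain_def by blast

end

section \<open>Noetherian localizations, and the Ore condition in Noetherian domains\<close>

section \<open>Localization and the Ore condition\<close>

lemma left_noetherianE: assumes "left_noetherian R" "\<And>i::nat. left_ideal (I i) R" "\<And>i. I i \<subseteq> I (Suc i)"
 obtains N where "\<And>i. i \<ge> N ==> I i = I N"
proof - have "(\<forall>i. left_ideal (I i) R \<and> I i \<subseteq> I (Suc i)) \<longrightarrow> (\<exists>N. \<forall>i\<ge>N. I i = I N)"
  using assms(1) unfolding left_noetherian_def by (rule spec)
 then show ?thesis using assms(2,3) that by blast
qed

text \<open>A left ideal of \<open>T\<close> is determined by its intersection with
  \<open>S\<close>: every z in it equals v(uz) with uz in the intersection.\<close>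

lemma left_noetherian_localization: fixes R (structure)
 assumes R: "ring R" and S: "subring S R" and T: "subring T R" and ST: "S \<subseteq> T"
  and loc: "\<And>z. z \<in> T ==> \<exists>u\<in>S. \<exists>v\<in>T. u \<otimes> z \<in> S \<and> v \<otimes> u = \<one>"
  and N: "left_noetherian (R\<lparr>carrier := S\<rparr>)"
 shows "left_noetherian (R\<lparr>carrier := T\<rparr>)"
 unfolding left_noetherian_def
proof (intro allI impI) interpret ring R by fact
 fix I assume I: "\<forall>i::nat. left_ideal (I i) (R\<lparr>carrier := T\<rparr>) \<and> I i \<subseteq> I (Suc i)"
 have Ii: "I i \<subseteq> T" "\<zero> \<in> I i" "\<And>a b. a \<in> I i ==> b \<in> I i ==> a \<oplus> b \<in> I i"
  "\<And>r a. r \<in> T ==> a \<in> I i ==> r \<otimes> a \<in> I i" for i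
  using I left_ideal_subring_iff[OF R T] by auto
 have Imono: "i \<le> j ==> I i \<subseteq> I j" for i j using I lift_Suc_mono_le[of I] by blast
 have "\<forall>i. left_ideal (I i \<inter> S) (R\<lparr>carrier := S\<rparr>) \<and> I i \<inter> S \<subseteq> I (Suc i) \<inter> S"
  unfolding left_ideal_subring_iff[OF R S]
  using I Ii ST subringE(2,6,7)[OF S] by (auto simp: subset_iff)
 then obtain N where N: "\<forall>i\<ge>N. I i \<inter> S = I N \<inter> S"
  using N[unfolded left_noetherian_def, rule_format, of "\<lambda>i. I i \<inter> S"] by blast
 have "I i \<subseteq> I N" if "i \<ge> N" for i
 proof fix z assume z: "z \<in> I i"
  then obtain u v where uv: "u \<in> S" "v \<in> T" "u \<otimes> z \<in> S" "v \<otimes> u = \<one>" using loc Ii by blast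
  then have "u \<otimes> z \<in> I N" using N Ii(4)[of u z i] z ST that by blast
  then have "v \<otimes> (u \<otimes> z) \<in> I N" using Ii uv by blast
  moreover have "u \<in> carrier R" "v \<in> carrier R" "z \<in> carrier R"
   using uv z Ii(1)[of i] subringE(1)[OF S] subringE(1)[OF T] by auto
  then have "v \<otimes> (u \<otimes> z) = z" using uv(4) by (simp flip: m_assoc)
  ultimately show "z \<in> I N" by simp
 qed
 then show "\<exists>N. \<forall>i\<ge>N. I i = I N" using Imono by blast
qed

text \<open>A relation zz' = 0 is moved into \<open>S\<close> by clearing the denominator of z on
  the left and that of z' on the right, which gives (uz)(z'u') = 0.\<close>

lemma nc_noetherian_domain_localization: fixes R (structure)
 assumes R: "ring R" and S: "subring S R" and T: "subring T R" and ST: "S \<subseteq> T"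
  and loc_l: "\<And>z. z \<in> T ==> \<exists>u\<in>S. \<exists>v\<in>T. u \<otimes> z \<in> S \<and> v \<otimes> u = \<one>"
  and loc_r: "\<And>z. z \<in> T ==> \<exists>u\<in>S. \<exists>v\<in>T. z \<otimes> u \<in> S \<and> u \<otimes> v = \<one>"
  and N: "nc_noetherian_domain (R\<lparr>carrier := S\<rparr>)"
 shows "nc_noetherian_domain (R\<lparr>carrier := T\<rparr>)"
proof - interpret ring R by fact have sub: "\<And>x. x \<in> S ==> x \<in> carrier R" "\<And>x. x \<in> T ==> x \<in> carrier R"
  using subringE(1)[OF S] subringE(1)[OF T] by auto
 have "z = \<zero> \<or> z' = \<zero>" if z: "z \<in> T" "z' \<in> T" "z \<otimes> z' = \<zero>" for z z'
 proof - obtain u v where uv: "u \<in> S" "v \<in> T" "u \<otimes> z \<in> S" "v \<otimes> u = \<one>" using loc_l z by blast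
  obtain u' v' where uv': "u' \<in> S" "v' \<in> T" "z' \<otimes> u' \<in> S" "u' \<otimes> v' = \<one>" using loc_r z by blast
  note c = sub(1)[OF uv(1)] sub(2)[OF uv(2)] sub(1)[OF uv'(1)] sub(2)[OF uv'(2)] sub(2)[OF z(1)] sub(2)[OF z(2)]
  have "(u \<otimes> z) \<otimes> (z' \<otimes> u') = u \<otimes> (z \<otimes> z') \<otimes> u'" using c by (simp add: m_assoc)
  also have "\<dots> = \<zero>" using z(3) c by simp
  finally have "u \<otimes> z = \<zero> \<or> z' \<otimes> u' = \<zero>"
   using N uv(3) uv'(3) by (auto simp: nc_noetherian_domain_def nc_domain_def)
  moreover have "v \<otimes> (u \<otimes> z) = z" using uv(4) c by (simp flip: m_assoc)
  moreover have "(z' \<otimes> u') \<otimes> v' = z'" using uv'(4) c by (simp add: m_assoc)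
  ultimately show ?thesis using c by (metis l_null r_null)
 qed
 then have "nc_domain (R\<lparr>carrier := T\<rparr>)"
  using N subring_is_ring[OF T] by (auto simp: nc_noetherian_domain_def nc_domain_def)
 moreover have "left_noetherian (R\<lparr>carrier := T\<rparr>)"
  using left_noetherian_localization[OF R S T ST loc_l] N by (simp add: nc_noetherian_domain_def)
 moreover have "left_noetherian ((opposite R)\<lparr>carrier := T\<rparr>)"
  using left_noetherian_localization[OF ring_opposite[OF R] subring_opposite[OF R S]
    subring_opposite[OF R T] ST] loc_r N by (simp add: nc_noetherian_domain_def)
 ultimately show ?thesis by (simp add: nc_noetherian_domain_def)
qed

text \<open>If \<open>B s\<close> and \<open>B a\<close> met only in \<open>0\<close>, then \<open>B s \<oplus> B s a \<oplus> B s a\<^sup>2 \<oplus> \<dots>\<close> would be an infinite direct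
 sum of left ideals.\<close>

lemma left_ore_condition: fixes R (structure)
 assumes R: "ring R" and B: "subring B R" and dom: "nc_domain (R\<lparr>carrier := B\<rparr>)"
  and N: "left_noetherian (R\<lparr>carrier := B\<rparr>)"
  and a: "a \<in> B" and s: "s \<in> B" "s \<noteq> \<zero>"
 shows "\<exists>s'\<in>B. \<exists>a'\<in>B. s' \<noteq> \<zero> \<and> s' \<otimes> a = a' \<otimes> s"
proof (cases "a = \<zero>") interpret ring R by fact case True
 then show ?thesis using s subringE[OF B] by (metis r_null l_null subsetD)
next interpret ring R by fact case False note Bsub = subringE[OF B]
 have c [simp]: "\<And>x. x \<in> B ==> x \<in> carrier R" using Bsub(1) by auto
 have int: "\<And>x y. x \<in> B ==> y \<in> B ==> x \<otimes> y = \<zero> ==> x = \<zero> \<or> y = \<zero>" using dom by (auto simp: nc_domain_def)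
 show ?thesis
 proof (rule ccontr) assume no: "\<not> ?thesis"
  \<comment> \<open>\<open>J n\<close> is Bs + Bsa + ... + Bsa^(n-1), in Horner form.\<close>
  define J where "J = rec_nat {\<zero>} (\<lambda>_ I. {b \<otimes> s \<oplus> j \<otimes> a | b j. b \<in> B \<and> j \<in> I})"
  have J0: "J 0 = {\<zero>}" and JS: "J (Suc n) = {b \<otimes> s \<oplus> j \<otimes> a | b j. b \<in> B \<and> j \<in> J n}" for n
   by (simp_all add: J_def)
  have JSI: "b \<in> B ==> j \<in> J n ==> b \<otimes> s \<oplus> j \<otimes> a \<in> J (Suc n)" for b j n unfolding JS by blast
  have ideal: "J n \<subseteq> B \<and> \<zero> \<in> J n \<and> (\<forall>x\<in>J n. \<forall>y\<in>J n. x \<oplus> y \<in> J n) \<and> (\<forall>r\<in>B. \<forall>x\<in>J n. r \<otimes> x \<in> J n)" for n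
  proof (induction n) case 0 then show ?case using Bsub(2) by (simp add: J0)
  next case (Suc n) have sub: "J n \<subseteq> carrier R" using Suc c by blast
   have JB: "j \<in> B" if "j \<in> J n" for j using Suc that by blast
   have "b \<otimes> s \<oplus> j \<otimes> a \<in> B" if "b \<in> B" "j \<in> J n" for b j
    using Bsub(7)[OF Bsub(6)[OF that(1) s(1)] Bsub(6)[OF JB[OF that(2)] a]] .
   then have "J (Suc n) \<subseteq> B" unfolding JS by blast
   moreover have "\<zero> \<in> J (Suc n)" using JSI[OF Bsub(2), of "\<zero>" n] Suc s a by simp
   moreover have "(b \<otimes> s \<oplus> j \<otimes> a) \<oplus> (b' \<otimes> s \<oplus> j' \<otimes> a) \<in> J (Suc n)"
    if "b \<in> B" "j \<in> J n" "b' \<in> B" "j' \<in> J n" for b j b' j'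
   proof - have "(b \<otimes> s \<oplus> j \<otimes> a) \<oplus> (b' \<otimes> s \<oplus> j' \<otimes> a) =
      (b \<oplus> b') \<otimes> s \<oplus> (j \<oplus> j') \<otimes> a"
     using that s a sub by (simp add: l_distr a_ac subset_iff)
    then show ?thesis using JSI[of "b \<oplus> b'" "j \<oplus> j'" n] that Suc Bsub(7) by simp
   qed
   moreover have "r \<otimes> (b \<otimes> s \<oplus> j \<otimes> a) \<in> J (Suc n)" if "b \<in> B" "j \<in> J n" "r \<in> B" for b j r
   proof - have "r \<otimes> (b \<otimes> s \<oplus> j \<otimes> a) = (r \<otimes> b) \<otimes> s \<oplus> (r \<otimes> j) \<otimes> a"
     using that s a sub by (simp add: r_distr m_assoc subset_iff)
    then show ?thesis using JSI[of "r \<otimes> b" "r \<otimes> j" n] that Suc Bsub(6) by simp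
   qed
   ultimately show ?case unfolding JS by blast
  qed
  have JJ: "J n \<subseteq> J (Suc n)" for n
  proof (induction n) case 0 then show ?case using ideal by (simp add: J0)
  next case (Suc n) have "b \<otimes> s \<oplus> j \<otimes> a \<in> J (Suc (Suc n))" if "b \<in> B" "j \<in> J n" for b j
    using JSI[OF that(1) subsetD[OF Suc that(2)]] .
   then show ?case unfolding JS[of n] by blast
  qed
  have "left_ideal (J i) (R\<lparr>carrier := B\<rparr>)" for i unfolding left_ideal_subring_iff[OF R B] by (rule ideal)
  then obtain n where n: "\<And>i. i \<ge> n ==> J i = J n" using left_noetherianE[of _ J, OF N _ JJ] by blast
  have pow: "a [^] k \<in> B" for k :: nat by (induction k) (use Bsub(3,6) a in auto)
  \<comment> \<open>A nonzero b would give a nonzero b', and b'a = bs would be the common multiple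
    that is assumed not to exist.\<close>
  have rel: "b = \<zero>" if "b \<in> B" "b' \<in> B" "b \<otimes> s = b' \<otimes> a" for b b'
  proof (rule ccontr) assume "b \<noteq> \<zero>" then have "b' \<noteq> \<zero>" using int[of b s] that s a by auto
   then show False using no that by metis
  qed
  \<comment> \<open>From sa^(k+1) = bs + ja one gets bs = (sa^k - j)a, so b = 0 and sa^k = j lies in
    \<open>J k\<close>. On the other hand sa^n always lies in \<open>J (n+1)\<close>, which equals
    \<open>J n\<close> once the chain is constant.\<close>
  have "s \<otimes> a [^] k \<notin> J k" for k
  proof (induction k) case 0 then show ?case using s by (simp add: J0)
  next case (Suc k) show ?case proof assume "s \<otimes> a [^] Suc k \<in> J (Suc k)"
    then obtain b j where bj: "b \<in> B" "j \<in> J k" "s \<otimes> a [^] Suc k = b \<otimes> s \<oplus> j \<otimes> a" unfolding JS by blast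
    define p where "p = s \<otimes> a [^] k"
    have p: "p \<in> B" using s pow[of k] Bsub(6) by (simp add: p_def)
    have j: "j \<in> B" using bj ideal by blast
    have eq: "p \<otimes> a = b \<otimes> s \<oplus> j \<otimes> a" using bj(3) s a pow by (simp add: p_def m_assoc)
    have "(p \<ominus> j) \<otimes> a = p \<otimes> a \<ominus> j \<otimes> a" using p j a by (simp add: minus_eq l_distr l_minus)
    also have "\<dots> = b \<otimes> s" unfolding eq using bj(1) s j a by (simp add: minus_eq a_assoc r_neg)
    finally have *: "b \<otimes> s = (p \<ominus> j) \<otimes> a" by simp
    have pj: "p \<ominus> j \<in> B" using p j Bsub(5,7) by (simp add: minus_eq)
    have "b = \<zero>" using rel[OF bj(1) pj *] .
    then have "p \<ominus> j = \<zero>" using * s int[OF pj a] False by simp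
    then have "p = j" using p j by simp
    then show False using Suc bj(2) by (simp add: p_def)
   qed
  qed
  moreover have "s \<otimes> a [^] n \<in> J n"
  proof - have "s \<otimes> a [^] k \<in> J (Suc k)" for k proof (induction k) case 0
    then show ?case using JSI[OF Bsub(3), of \<zero> 0] s a by (simp add: J0)
   next case (Suc k) then show ?case using JSI[OF Bsub(2) Suc] s a pow by (simp add: m_assoc)
   qed
   then have "s \<otimes> a [^] n \<in> J (Suc n)" .
   moreover have "J (Suc n) = J n" by (rule n) simp
   ultimately show ?thesis by (simp only:)
  qed
  ultimately show False by blast
 qed
qed

section \<open>Tensor products as quotients of free abelian groups, and their universal
  property\<close>

section \<open>Tensor products\<close>

text \<open>Abelian groups with a scalar action: this covers both tensor products of K-algebras and
  the rationalization of an abelian group.\<close>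

locale tensor_pair = M: abelian_group M + N: abelian_group N
 for R :: "'r ring" and M :: "('r, 'm) module" and N :: "('r, 'n) module" +
 assumes smult_M: "r \<in> carrier R ==> m \<in> carrier M ==> r \<odot>\<^bsub>M\<^esub> m \<in> carrier M"
  and smult_N: "r \<in> carrier R ==> n \<in> carrier N ==> r \<odot>\<^bsub>N\<^esub> n \<in> carrier N"
begin

abbreviation "FG \<equiv> free_Abelian_group (carrier M \<times> carrier N)"
abbreviation "Ker \<equiv> tensor_kernel R M N"
abbreviation "TG \<equiv> tensor_group R M N"
abbreviation "q \<equiv> tensor_coset R M N"

definition t where "t m n = q (frag_of (m, n))"

sublocale FG: comm_group FG by (rule abelian_free_Abelian_group)

lemma relations_carrier: "tensor_relations R M N \<subseteq> carrier FG"
proof - have fo: "frag_of (m, n) \<in> carrier FG" if "m \<in> carrier M" "n \<in> carrier N" for m n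
  using that by (simp only: frag_of_in_free_Abelian_group mem_Sigma_iff simp_thms)
 have d: "a - b \<in> carrier FG" if "a \<in> carrier FG" "b \<in> carrier FG" for a b
  using that keys_diff[of a b] by (auto simp only: carrier_free_Abelian_group_iff)
 show ?thesis unfolding tensor_relations_def
  using M.a_closed N.a_closed smult_M smult_N by (fastforce intro!: d fo simp only: )
qed

lemma Ker_subgroup: "subgroup Ker FG"
 unfolding tensor_kernel_def by (rule FG.generate_is_subgroup[OF relations_carrier])

lemma Ker_normal: "Ker \<lhd> FG" by (rule FG.subgroup_imp_normal[OF Ker_subgroup])

lemma Ker_carrier: "x \<in> Ker ==> x \<in> carrier FG" using subgroup.subset[OF Ker_subgroup] by (rule subsetD)

lemma Ker_zero: "0 \<in> Ker" using subgroup.one_closed[OF Ker_subgroup] by simp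

lemma Ker_add: "x \<in> Ker ==> y \<in> Ker ==> x + y \<in> Ker" using subgroup.m_closed[OF Ker_subgroup] by simp

lemma Ker_neg: "x \<in> Ker ==> - x \<in> Ker" using subgroup.m_inv_closed[OF Ker_subgroup, of x] Ker_carrier[of x]
 by (simp add: inv_free_Abelian_group)

lemma Ker_diff: "x \<in> Ker ==> y \<in> Ker ==> x - y \<in> Ker" using Ker_add[OF _ Ker_neg, of x y] by simp

lemma Ker_rel: "x \<in> tensor_relations R M N ==> x \<in> Ker" unfolding tensor_kernel_def by (rule generate.incl)

lemma Ker_induct [consumes 1, case_names zero rel neg add]:
 assumes "x \<in> Ker" "P 0" "\<And>x. x \<in> tensor_relations R M N ==> P x"
  "\<And>x. x \<in> tensor_relations R M N ==> P x ==> P (- x)" "\<And>x y. P x ==> P y ==> P (x + y)"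
 shows "P x"
 using assms(1) unfolding tensor_kernel_def
proof (induction rule: generate.induct) case one then show ?case using assms(2) by simp
next case (incl h) then show ?case by (rule assms(3))
next case (inv h) then have "h \<in> carrier FG" using relations_carrier by blast
 then have "inv\<^bsub>FG\<^esub> h = - h" by (simp add: inv_free_Abelian_group)
 then show ?case using assms(4)[OF inv assms(3)[OF inv]] by simp
next case (eng h1 h2) then show ?case using assms(5) by simp
qed

lemma q_iff: "y \<in> q x \<longleftrightarrow> y - x \<in> Ker"
proof - have "q x = (\<lambda>k. k + x) ` Ker" by (auto simp: tensor_coset_def r_coset_def)
 moreover have "y = (y - x) + x" by simp
 ultimately show ?thesis by (auto simp: image_iff intro!: bexI[of _ "y - x"])
qed

lemma q_eq_iff: "q x = q y \<longleftrightarrow> x - y \<in> Ker"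
proof assume "q x = q y" moreover have "x \<in> q x" by (simp add: q_iff Ker_zero)
 ultimately show "x - y \<in> Ker" using q_iff by blast
next assume xy: "x - y \<in> Ker" show "q x = q y" proof (intro equalityI subsetI) fix z assume "z \<in> q x"
  then have "(z - x) + (x - y) \<in> Ker" using Ker_add[OF _ xy] q_iff by blast
  then show "z \<in> q y" by (simp add: q_iff)
 next fix z assume "z \<in> q y" then have "(z - y) - (x - y) \<in> Ker" using Ker_diff[OF _ xy] q_iff by blast
  then show "z \<in> q x" by (simp add: q_iff)
 qed
qed

lemma q_carrier: "x \<in> carrier FG ==> y \<in> q x ==> y \<in> carrier FG"
proof - assume x: "x \<in> carrier FG" and "y \<in> q x"
 then have "y - x \<in> carrier FG" using Ker_carrier q_iff by blast
 then have "(y - x) \<otimes>\<^bsub>FG\<^esub> x \<in> carrier FG" using x by (rule FG.m_closed)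
 then show ?thesis by simp
qed

text \<open>The operations on cosets are defined as unions over representatives. When all
  representatives give the same set, the union collapses to the value at any one of them.\<close>

lemma UN_q: assumes x: "x \<in> carrier FG" and f: "\<And>y. y \<in> carrier FG ==> y - x \<in> Ker ==> f y = f x"
 shows "(\<Union>y\<in>q x. f y) = f x"
proof - have "f y = f x" if "y \<in> q x" for y using f[OF q_carrier[OF x that]] that q_iff by blast
 then have "(\<Union>y\<in>q x. f y) = (\<Union>y\<in>q x. f x)" by (rule SUP_cong[OF refl])
 moreover have "q x \<noteq> {}" using q_iff[of x x] Ker_zero by auto
 ultimately show ?thesis by simp
qed

sublocale TG: comm_group TG unfolding tensor_group_def by (rule FG.abelian_FactGroup[OF Ker_subgroup])

lemma carrier_TG: "carrier TG = q ` carrier FG"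
 by (auto simp: tensor_group_def tensor_coset_def FactGroup_def RCOSETS_def)

lemma q_closed: "x \<in> carrier FG ==> q x \<in> carrier TG" unfolding carrier_TG by (rule imageI)

lemma q_hom: "q \<in> hom FG TG"
 using normal.r_coset_hom_Mod[OF Ker_normal] unfolding tensor_group_def tensor_coset_def .

lemma q_add: "x \<in> carrier FG ==> y \<in> carrier FG ==> q (x + y) = q x \<otimes>\<^bsub>TG\<^esub> q y" using hom_mult[OF q_hom] by simp

lemma q_zero: "q 0 = \<one>\<^bsub>TG\<^esub>" using hom_one[OF q_hom FG.is_group TG.is_group] by simp

lemma q_neg: "x \<in> carrier FG ==> q (- x) = inv\<^bsub>TG\<^esub> q x"
proof - assume x: "x \<in> carrier FG"
 then have "- x \<in> carrier FG" using FG.inv_closed[OF x] by (simp add: inv_free_Abelian_group)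
 then have "q (- x) \<otimes>\<^bsub>TG\<^esub> q x = \<one>\<^bsub>TG\<^esub>" using q_add[of "- x" x] x q_zero by simp
 then show ?thesis using TG.inv_equality q_closed[OF x] q_closed[OF \<open>- x \<in> carrier FG\<close>] by metis
qed

lemma frag_of_carrier: "m \<in> carrier M ==> n \<in> carrier N ==> frag_of (m, n) \<in> carrier FG" by simp

lemma t_closed: "m \<in> carrier M ==> n \<in> carrier N ==> t m n \<in> carrier TG"
 unfolding t_def by (rule q_closed[OF frag_of_carrier])

lemma t_add_l: assumes "m \<in> carrier M" "m' \<in> carrier M" "n \<in> carrier N"
 shows "t (m \<oplus>\<^bsub>M\<^esub> m') n = t m n \<otimes>\<^bsub>TG\<^esub> t m' n"
proof - have "frag_of (m \<oplus>\<^bsub>M\<^esub> m', n) - frag_of (m, n) - frag_of (m', n) \<in> Ker"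
  by (rule Ker_rel) (use assms in \<open>unfold tensor_relations_def, blast\<close>)
 then have "frag_of (m \<oplus>\<^bsub>M\<^esub> m', n) - (frag_of (m, n) + frag_of (m', n)) \<in> Ker" by (simp only: diff_diff_add)
 then show ?thesis
  unfolding t_def q_add[symmetric, OF frag_of_carrier[OF assms(1,3)] frag_of_carrier[OF assms(2,3)]]
  by (simp only: q_eq_iff)
qed

lemma t_add_r: assumes "m \<in> carrier M" "n \<in> carrier N" "n' \<in> carrier N"
 shows "t m (n \<oplus>\<^bsub>N\<^esub> n') = t m n \<otimes>\<^bsub>TG\<^esub> t m n'"
proof - have "frag_of (m, n \<oplus>\<^bsub>N\<^esub> n') - frag_of (m, n) - frag_of (m, n') \<in> Ker"
  by (rule Ker_rel) (use assms in \<open>unfold tensor_relations_def, blast\<close>)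
 then have "frag_of (m, n \<oplus>\<^bsub>N\<^esub> n') - (frag_of (m, n) + frag_of (m, n')) \<in> Ker" by (simp only: diff_diff_add)
 then show ?thesis
  unfolding t_def q_add[symmetric, OF frag_of_carrier[OF assms(1,2)] frag_of_carrier[OF assms(1,3)]]
  by (simp only: q_eq_iff)
qed

lemma t_balanced: assumes "r \<in> carrier R" "m \<in> carrier M" "n \<in> carrier N"
 shows "t (r \<odot>\<^bsub>M\<^esub> m) n = t m (r \<odot>\<^bsub>N\<^esub> n)"
proof - have "frag_of (r \<odot>\<^bsub>M\<^esub> m, n) - frag_of (m, r \<odot>\<^bsub>N\<^esub> n) \<in> Ker"
  by (rule Ker_rel) (use assms in \<open>unfold tensor_relations_def, blast\<close>)
 then show ?thesis unfolding t_def by (simp only: q_eq_iff)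
qed

lemma t_zero_l: "n \<in> carrier N ==> t \<zero>\<^bsub>M\<^esub> n = \<one>\<^bsub>TG\<^esub>"
 using t_add_l[of "\<zero>\<^bsub>M\<^esub>" "\<zero>\<^bsub>M\<^esub>" n] t_closed[of "\<zero>\<^bsub>M\<^esub>" n] TG.r_cancel_one[of "t \<zero>\<^bsub>M\<^esub> n" "t \<zero>\<^bsub>M\<^esub> n"]
 by simp

lemma t_zero_r: "m \<in> carrier M ==> t m \<zero>\<^bsub>N\<^esub> = \<one>\<^bsub>TG\<^esub>"
 using t_add_r[of m "\<zero>\<^bsub>N\<^esub>" "\<zero>\<^bsub>N\<^esub>"] t_closed[of m "\<zero>\<^bsub>N\<^esub>"] TG.r_cancel_one[of "t m \<zero>\<^bsub>N\<^esub>" "t m \<zero>\<^bsub>N\<^esub>"]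
 by simp

lemma t_neg_l: "m \<in> carrier M ==> n \<in> carrier N ==> t (\<ominus>\<^bsub>M\<^esub> m) n = inv\<^bsub>TG\<^esub> t m n"
 using t_add_l[of "\<ominus>\<^bsub>M\<^esub> m" m n] t_zero_l[of n] t_closed
 by (intro TG.inv_equality[symmetric]) (simp_all add: M.l_neg)

text \<open>Pure tensors generate the group under addition alone, since the negative of a pure
  tensor is the pure tensor with negated first entry.\<close>

lemma TG_induct [consumes 1, case_names one gen add]: assumes z: "z \<in> carrier TG" and one: "P \<one>\<^bsub>TG\<^esub>"
  and gen: "\<And>m n. m \<in> carrier M ==> n \<in> carrier N ==> P (t m n)"
  and add: "\<And>x y. x \<in> carrier TG ==> y \<in> carrier TG ==> P x ==> P y ==> P (x \<otimes>\<^bsub>TG\<^esub> y)"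
 shows "P z"
proof - obtain x where x: "x \<in> carrier FG" "z = q x" using z carrier_TG by blast
 have "Poly_Mapping.keys x \<subseteq> carrier M \<times> carrier N" using x by simp
 \<comment> \<open>Both signs are carried along because the induction rule of the free abelian group
   forms differences.\<close>
 then have "P (q x) \<and> P (inv\<^bsub>TG\<^esub> (q x))"
 proof (induction rule: free_Abelian_group_induct[consumes 1, case_names zero diff gen]) case zero
  then show ?case using one by (simp add: q_zero)
 next case (diff x y) have xy: "x \<in> carrier FG" "y \<in> carrier FG" "- y \<in> carrier FG" using diff by simp_all
  note c = q_closed[OF xy(1)] q_closed[OF xy(2)]
  have eq: "q (x - y) = q x \<otimes>\<^bsub>TG\<^esub> inv\<^bsub>TG\<^esub> q y" using q_add[OF xy(1,3)] q_neg[OF xy(2)] by simp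
  have "inv\<^bsub>TG\<^esub> (q x \<otimes>\<^bsub>TG\<^esub> inv\<^bsub>TG\<^esub> q y) = q y \<otimes>\<^bsub>TG\<^esub> inv\<^bsub>TG\<^esub> q x" using c by (simp add: TG.inv_mult_group)
  then show ?case using diff c add unfolding eq by (metis TG.inv_closed)
 next case (gen a) then obtain m n where a: "a = (m, n)" "m \<in> carrier M" "n \<in> carrier N" by blast
  have "P (t m n)" "P (t (\<ominus>\<^bsub>M\<^esub> m) n)" using assms(3) a by simp_all
  then show ?case using t_neg_l a by (simp add: t_def)
 qed
 then show ?thesis using x by simp
qed

text \<open>The map extends to the free abelian group, kills each defining relation because it is
  biadditive and balanced, and so factors through the quotient.\<close>

lemma universal: fixes G :: "('c, 'x) monoid_scheme" assumes G: "comm_group G"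
  and cl: "\<And>m n. m \<in> carrier M ==> n \<in> carrier N ==> f m n \<in> carrier G"
  and add_l: "\<And>m m' n. m \<in> carrier M ==> m' \<in> carrier M ==> n \<in> carrier N ==> f (m \<oplus>\<^bsub>M\<^esub> m') n = f m n \<otimes>\<^bsub>G\<^esub> f m' n"
  and add_r: "\<And>m n n'. m \<in> carrier M ==> n \<in> carrier N ==> n' \<in> carrier N ==> f m (n \<oplus>\<^bsub>N\<^esub> n') = f m n \<otimes>\<^bsub>G\<^esub> f m n'"
  and bal: "\<And>r m n. r \<in> carrier R ==> m \<in> carrier M ==> n \<in> carrier N ==> f (r \<odot>\<^bsub>M\<^esub> m) n = f m (r \<odot>\<^bsub>N\<^esub> n)"
 obtains h where "h \<in> hom TG G" "\<And>m n. m \<in> carrier M ==> n \<in> carrier N ==> h (t m n) = f m n"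
proof - interpret G: comm_group G by fact
 have "(\<lambda>(m, n). f m n) ` (carrier M \<times> carrier N) \<subseteq> carrier G" using cl by auto
 then obtain h0 where h0: "h0 \<in> hom FG G"
  "\<And>x. x \<in> carrier M \<times> carrier N ==> h0 (frag_of x) = (\<lambda>(m, n). f m n) x"
  by (rule G.free_Abelian_group_universal) blast
 interpret h0: group_hom FG G h0 using h0(1) by (simp add: group_hom_def group_hom_axioms_def)
 have h0f: "h0 (frag_of (m, n)) = f m n" if "m \<in> carrier M" "n \<in> carrier N" for m n
  using h0(2)[of "(m, n)"] that by simp
 have h0d: "h0 (x - y) = h0 x \<otimes>\<^bsub>G\<^esub> inv\<^bsub>G\<^esub> h0 y" if "x \<in> carrier FG" "y \<in> carrier FG" for x y
 proof - have "- y \<in> carrier FG" using that by simp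
  from h0.hom_mult[OF that(1) this] have "h0 (x - y) = h0 x \<otimes>\<^bsub>G\<^esub> h0 (- y)" by simp
  moreover have "h0 (- y) = inv\<^bsub>G\<^esub> h0 y" using h0.hom_inv[OF that(2)] that(2) by (simp add: inv_free_Abelian_group)
  ultimately show ?thesis by simp
 qed
 have dc: "x - y \<in> carrier FG" if "x \<in> carrier FG" "y \<in> carrier FG" for x y
  using keys_diff[of x y] that by auto
 have rel: "h0 x = \<one>\<^bsub>G\<^esub>" if "x \<in> tensor_relations R M N" for x using that unfolding tensor_relations_def
 proof (elim UnE CollectE exE conjE)
  fix m m' n assume x: "x = frag_of (m \<oplus>\<^bsub>M\<^esub> m', n) - frag_of (m, n) - frag_of (m', n)"
   and c: "m \<in> carrier M" "m' \<in> carrier M" "n \<in> carrier N"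
  have "h0 x = f (m \<oplus>\<^bsub>M\<^esub> m') n \<otimes>\<^bsub>G\<^esub> inv\<^bsub>G\<^esub> f m n \<otimes>\<^bsub>G\<^esub> inv\<^bsub>G\<^esub> f m' n"
   unfolding x using c by (simp only: h0d h0f frag_of_carrier dc M.a_closed)
  also have "\<dots> = f m n \<otimes>\<^bsub>G\<^esub> inv\<^bsub>G\<^esub> f m n \<otimes>\<^bsub>G\<^esub> (f m' n \<otimes>\<^bsub>G\<^esub> inv\<^bsub>G\<^esub> f m' n)"
   unfolding add_l[OF c] using cl c by (simp only: G.m_ac cl G.inv_closed G.m_closed)
  also have "\<dots> = \<one>\<^bsub>G\<^esub>" using cl c by simp
  finally show ?thesis .
 next fix m n n' assume x: "x = frag_of (m, n \<oplus>\<^bsub>N\<^esub> n') - frag_of (m, n) - frag_of (m, n')"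
   and c: "m \<in> carrier M" "n \<in> carrier N" "n' \<in> carrier N"
  have "h0 x = f m (n \<oplus>\<^bsub>N\<^esub> n') \<otimes>\<^bsub>G\<^esub> inv\<^bsub>G\<^esub> f m n \<otimes>\<^bsub>G\<^esub> inv\<^bsub>G\<^esub> f m n'"
   unfolding x using c by (simp only: h0d h0f frag_of_carrier dc N.a_closed)
  also have "\<dots> = f m n \<otimes>\<^bsub>G\<^esub> inv\<^bsub>G\<^esub> f m n \<otimes>\<^bsub>G\<^esub> (f m n' \<otimes>\<^bsub>G\<^esub> inv\<^bsub>G\<^esub> f m n')"
   unfolding add_r[OF c] using cl c by (simp only: G.m_ac cl G.inv_closed G.m_closed)
  also have "\<dots> = \<one>\<^bsub>G\<^esub>" using cl c by simp
  finally show ?thesis .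
 next fix r m n assume x: "x = frag_of (r \<odot>\<^bsub>M\<^esub> m, n) - frag_of (m, r \<odot>\<^bsub>N\<^esub> n)"
   and c: "r \<in> carrier R" "m \<in> carrier M" "n \<in> carrier N"
  have "h0 x = f (r \<odot>\<^bsub>M\<^esub> m) n \<otimes>\<^bsub>G\<^esub> inv\<^bsub>G\<^esub> f m (r \<odot>\<^bsub>N\<^esub> n)"
   unfolding x using c by (simp only: h0d h0f frag_of_carrier dc smult_M smult_N)
  then show ?thesis using c smult_N cl by (simp add: bal)
 qed
 have "x \<in> carrier FG \<and> h0 x = \<one>\<^bsub>G\<^esub>" if "x \<in> Ker" for x using that
 proof (induction rule: Ker_induct) case zero then show ?case using h0.hom_one by simp
 next case (rel x)
  then show ?case using relations_carrier \<open>\<And>x. x \<in> tensor_relations R M N ==> h0 x = \<one>\<^bsub>G\<^esub>\<close> by blast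
 next case (neg x) then show ?case using h0d[of 0 x] h0.hom_one by simp
 next case (add x y) then have "h0 (x + y) = \<one>\<^bsub>G\<^esub>" using h0.hom_mult[of x y] by simp
  moreover have "x + y \<in> carrier FG" using FG.m_closed[of x y] add by (simp only: mult_free_Abelian_group)
  ultimately show ?case by simp
 qed
 then have "Ker \<subseteq> kernel FG G h0" by (auto simp: kernel_def)
 then obtain h where h: "h \<in> hom (FG Mod Ker) G" "\<And>x. x \<in> carrier FG ==> h (Ker #>\<^bsub>FG\<^esub> x) = h0 x"
  using h0.FactGroup_universal_kernel[OF Ker_normal] by blast
 show ?thesis
 proof (rule that) show "h \<in> hom TG G" using h(1) by (simp add: tensor_group_def)
  show "h (t m n) = f m n" if "m \<in> carrier M" "n \<in> carrier N" for m n
   using h(2)[OF frag_of_carrier[OF that]] h0f[OF that] by (simp only: t_def tensor_coset_def)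
 qed
qed

end

section \<open>The ring structure on the tensor product of two algebras\<close>

section \<open>The tensor product of two algebras\<close>

lemma frag_extend_fun_add: "frag_extend (\<lambda>i. f i + g i) x = frag_extend f x + frag_extend g x"
 by (simp add: frag_extend_def frag_cmul_distrib2 sum.distrib)

lemma frag_extend_fun_minus: "frag_extend (\<lambda>i. - f i) x = - frag_extend f x"
proof - have "frag_extend (\<lambda>i. - f i) x + frag_extend f x = frag_extend (\<lambda>_. 0) x"
  unfolding frag_extend_fun_add[symmetric] by simp
 also have "\<dots> = 0" by (rule frag_extend_eq_0) simp
 finally show ?thesis by (simp add: eq_neg_iff_add_eq_0)
qed

lemma K_algebra_opposite: assumes "K_algebra K A" shows "K_algebra K (opposite A)"
proof - interpret A: K_algebra K A by fact
 interpret op: ring "opposite A" by (rule ring_opposite[OF A.ring_axioms])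
 have "module K (opposite A)" by (rule moduleI)
   (simp_all add: A.R.cring_axioms op.abelian_group_axioms A.smult_l_distr A.smult_r_distr A.smult_assoc1)
 then show ?thesis by (intro K_algebra.intro K_algebra_axioms.intro)
   (simp_all add: op.ring_axioms A.K_field A.smult_mult_left A.smult_mult_right del: A.smult_closed)
qed

lemma K_algebra_tensor_pair: assumes "K_algebra K A" "K_algebra K B" shows "tensor_pair K A B"
proof - interpret A: K_algebra K A by fact interpret B: K_algebra K B by fact
 show ?thesis by unfold_locales auto
qed

locale tensor_product = A: K_algebra K A + B: K_algebra K B
 for K :: "'k ring" and A :: "('k, 'a) module" and B :: "('k, 'b) module"

sublocale tensor_product \<subseteq> tensor_pair K A B
 by (rule K_algebra_tensor_pair[OF A.K_algebra_axioms B.K_algebra_axioms])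

context tensor_product
begin

abbreviation "T \<equiv> tensor_algebra K A B"

text \<open>The biadditive product at the level of representatives; \<open>q_mult\<close> shows that
  it induces the product of cosets.\<close>

definition tm where "tm x y = frag_extend (\<lambda>(a, b). frag_extend (\<lambda>(a', b').
      frag_of (a \<otimes>\<^bsub>A\<^esub> a', b \<otimes>\<^bsub>B\<^esub> b')) y) x"

lemma T_simps [simp]: "carrier T = carrier TG" "add T = monoid.mult TG" "\<zero>\<^bsub>T\<^esub> = \<one>\<^bsub>TG\<^esub>"
 by (simp_all add: tensor_algebra_def tensor_group_def FactGroup_def)

lemma tm_add_l: "tm (x + x') y = tm x y + tm x' y" unfolding tm_def by (rule frag_extend_add)

lemma tm_neg_l: "tm (- x) y = - tm x y" unfolding tm_def by (rule frag_extend_minus)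

lemma tm_add_r: "tm x (y + y') = tm x y + tm x y'"
 unfolding tm_def by (simp add: frag_extend_add case_prod_unfold frag_extend_fun_add)

lemma tm_neg_r: "tm x (- y) = - tm x y"
 unfolding tm_def by (simp add: frag_extend_minus case_prod_unfold frag_extend_fun_minus)

lemma tm_zero [simp]: "tm 0 y = 0" "tm x 0 = 0" by (simp_all add: tm_def case_prod_unfold frag_extend_eq_0)

lemma tm_diff_l: "tm (x - x') y = tm x y - tm x' y" using tm_add_l[of x "- x'"] by (simp add: tm_neg_l)

lemma tm_diff_r: "tm x (y - y') = tm x y - tm x y'" using tm_add_r[of x y "- y'"] by (simp add: tm_neg_r)

lemma tm_frag_of [simp]: "tm (frag_of (a, b)) (frag_of (a', b')) = frag_of (a \<otimes>\<^bsub>A\<^esub> a', b \<otimes>\<^bsub>B\<^esub> b')"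
 by (simp add: tm_def)

lemma FG_diff: "x \<in> carrier FG ==> y \<in> carrier FG ==> x - y \<in> carrier FG" using keys_diff[of x y] by auto

lemma FG_induct [consumes 1, case_names zero diff gen]: assumes "x \<in> carrier FG" "P 0"
  "\<And>x y. x \<in> carrier FG ==> y \<in> carrier FG ==> P x ==> P y ==> P (x - y)"
  "\<And>a b. a \<in> carrier A ==> b \<in> carrier B ==> P (frag_of (a, b))"
 shows "P x"
 using assms(1) unfolding carrier_free_Abelian_group_iff
 by (rule free_Abelian_group_induct) (use assms in auto)

lemma tm_closed: "x \<in> carrier FG ==> y \<in> carrier FG ==> tm x y \<in> carrier FG"
proof (induction x rule: FG_induct) case (diff x1 x2)
 then show ?case unfolding tm_diff_l by (intro FG_diff) blast+
next case (gen a b) show ?case using gen(3) proof (induction y rule: FG_induct) case (diff x1 x2)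
  then show ?case unfolding tm_diff_r by (intro FG_diff)
 next case (gen a' b') then show ?case using \<open>a \<in> carrier A\<close> \<open>b \<in> carrier B\<close> by simp
 qed simp
qed simp

text \<open>A defining relation times a generator is again a defining relation, so the kernel is
  stable under products. Together with \<open>tm_Ker_r\<close> this makes the product of cosets well
  defined.\<close>

lemma tm_Ker_l: assumes "x \<in> Ker" "y \<in> carrier FG" shows "tm x y \<in> Ker" using assms(2)
proof (induction y rule: FG_induct) case zero then show ?case by (simp add: Ker_zero)
next case (diff x1 x2) then show ?case unfolding tm_diff_r by (intro Ker_diff)
next case (gen a b) show ?case using assms(1) proof (induction rule: Ker_induct) case (rel x)
  have "tm x (frag_of (a, b)) \<in> tensor_relations K A B" using rel[unfolded tensor_relations_def]
  proof (elim UnE CollectE exE conjE)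
   fix m m' n assume "x = frag_of (m \<oplus>\<^bsub>A\<^esub> m', n) - frag_of (m, n) - frag_of (m', n)"
    "m \<in> carrier A" "m' \<in> carrier A" "n \<in> carrier B"
   then have "tm x (frag_of (a, b)) = frag_of (m \<otimes>\<^bsub>A\<^esub> a \<oplus>\<^bsub>A\<^esub> m' \<otimes>\<^bsub>A\<^esub> a, n \<otimes>\<^bsub>B\<^esub> b)
     - frag_of (m \<otimes>\<^bsub>A\<^esub> a, n \<otimes>\<^bsub>B\<^esub> b) - frag_of (m' \<otimes>\<^bsub>A\<^esub> a, n \<otimes>\<^bsub>B\<^esub> b)"
     "m \<otimes>\<^bsub>A\<^esub> a \<in> carrier A" "m' \<otimes>\<^bsub>A\<^esub> a \<in> carrier A" "n \<otimes>\<^bsub>B\<^esub> b \<in> carrier B"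
    using gen by (simp_all add: tm_diff_l A.l_distr)
   then show ?thesis unfolding tensor_relations_def by blast
  next fix m n n' assume "x = frag_of (m, n \<oplus>\<^bsub>B\<^esub> n') - frag_of (m, n) - frag_of (m, n')"
    "m \<in> carrier A" "n \<in> carrier B" "n' \<in> carrier B"
   then have "tm x (frag_of (a, b)) = frag_of (m \<otimes>\<^bsub>A\<^esub> a, n \<otimes>\<^bsub>B\<^esub> b \<oplus>\<^bsub>B\<^esub> n' \<otimes>\<^bsub>B\<^esub> b)
     - frag_of (m \<otimes>\<^bsub>A\<^esub> a, n \<otimes>\<^bsub>B\<^esub> b) - frag_of (m \<otimes>\<^bsub>A\<^esub> a, n' \<otimes>\<^bsub>B\<^esub> b)"
     "m \<otimes>\<^bsub>A\<^esub> a \<in> carrier A" "n \<otimes>\<^bsub>B\<^esub> b \<in> carrier B" "n' \<otimes>\<^bsub>B\<^esub> b \<in> carrier B"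
    using gen by (simp_all add: tm_diff_l B.l_distr)
   then show ?thesis unfolding tensor_relations_def by blast
  next fix r m n assume "x = frag_of (r \<odot>\<^bsub>A\<^esub> m, n) - frag_of (m, r \<odot>\<^bsub>B\<^esub> n)"
    "r \<in> carrier K" "m \<in> carrier A" "n \<in> carrier B"
   then have "tm x (frag_of (a, b)) = frag_of (r \<odot>\<^bsub>A\<^esub> (m \<otimes>\<^bsub>A\<^esub> a), n \<otimes>\<^bsub>B\<^esub> b)
     - frag_of (m \<otimes>\<^bsub>A\<^esub> a, r \<odot>\<^bsub>B\<^esub> (n \<otimes>\<^bsub>B\<^esub> b))" "r \<in> carrier K"
     "m \<otimes>\<^bsub>A\<^esub> a \<in> carrier A" "n \<otimes>\<^bsub>B\<^esub> b \<in> carrier B"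
    using gen by (simp_all add: tm_diff_l A.smult_mult_left B.smult_mult_left)
   then show ?thesis unfolding tensor_relations_def by blast
  qed
  then show ?case by (rule Ker_rel)
 qed (simp_all add: Ker_zero tm_neg_l tm_add_l Ker_neg Ker_add)
qed

lemma tm_Ker_r: assumes "y \<in> Ker" "x \<in> carrier FG" shows "tm x y \<in> Ker" using assms(2)
proof (induction x rule: FG_induct) case zero then show ?case by (simp add: Ker_zero)
next case (diff x1 x2) then show ?case unfolding tm_diff_l by (intro Ker_diff)
next case (gen a b) show ?case using assms(1) proof (induction rule: Ker_induct) case (rel x)
  have "tm (frag_of (a, b)) x \<in> tensor_relations K A B" using rel[unfolded tensor_relations_def]
  proof (elim UnE CollectE exE conjE)
   fix m m' n assume "x = frag_of (m \<oplus>\<^bsub>A\<^esub> m', n) - frag_of (m, n) - frag_of (m', n)"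
    "m \<in> carrier A" "m' \<in> carrier A" "n \<in> carrier B"
   then have "tm (frag_of (a, b)) x = frag_of (a \<otimes>\<^bsub>A\<^esub> m \<oplus>\<^bsub>A\<^esub> a \<otimes>\<^bsub>A\<^esub> m', b \<otimes>\<^bsub>B\<^esub> n)
     - frag_of (a \<otimes>\<^bsub>A\<^esub> m, b \<otimes>\<^bsub>B\<^esub> n) - frag_of (a \<otimes>\<^bsub>A\<^esub> m', b \<otimes>\<^bsub>B\<^esub> n)"
     "a \<otimes>\<^bsub>A\<^esub> m \<in> carrier A" "a \<otimes>\<^bsub>A\<^esub> m' \<in> carrier A" "b \<otimes>\<^bsub>B\<^esub> n \<in> carrier B"
    using gen by (simp_all add: tm_diff_r A.r_distr)
   then show ?thesis unfolding tensor_relations_def by blast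
  next fix m n n' assume "x = frag_of (m, n \<oplus>\<^bsub>B\<^esub> n') - frag_of (m, n) - frag_of (m, n')"
    "m \<in> carrier A" "n \<in> carrier B" "n' \<in> carrier B"
   then have "tm (frag_of (a, b)) x = frag_of (a \<otimes>\<^bsub>A\<^esub> m, b \<otimes>\<^bsub>B\<^esub> n \<oplus>\<^bsub>B\<^esub> b \<otimes>\<^bsub>B\<^esub> n')
     - frag_of (a \<otimes>\<^bsub>A\<^esub> m, b \<otimes>\<^bsub>B\<^esub> n) - frag_of (a \<otimes>\<^bsub>A\<^esub> m, b \<otimes>\<^bsub>B\<^esub> n')"
     "a \<otimes>\<^bsub>A\<^esub> m \<in> carrier A" "b \<otimes>\<^bsub>B\<^esub> n \<in> carrier B" "b \<otimes>\<^bsub>B\<^esub> n' \<in> carrier B"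
    using gen by (simp_all add: tm_diff_r B.r_distr)
   then show ?thesis unfolding tensor_relations_def by blast
  next fix r m n assume "x = frag_of (r \<odot>\<^bsub>A\<^esub> m, n) - frag_of (m, r \<odot>\<^bsub>B\<^esub> n)"
    "r \<in> carrier K" "m \<in> carrier A" "n \<in> carrier B"
   then have "tm (frag_of (a, b)) x = frag_of (r \<odot>\<^bsub>A\<^esub> (a \<otimes>\<^bsub>A\<^esub> m), b \<otimes>\<^bsub>B\<^esub> n)
     - frag_of (a \<otimes>\<^bsub>A\<^esub> m, r \<odot>\<^bsub>B\<^esub> (b \<otimes>\<^bsub>B\<^esub> n))" "r \<in> carrier K"
     "a \<otimes>\<^bsub>A\<^esub> m \<in> carrier A" "b \<otimes>\<^bsub>B\<^esub> n \<in> carrier B"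
    using gen by (simp_all add: tm_diff_r A.smult_mult_right B.smult_mult_right)
   then show ?thesis unfolding tensor_relations_def by blast
  qed
  then show ?case by (rule Ker_rel)
 qed (simp_all add: Ker_zero tm_neg_r tm_add_r Ker_neg Ker_add)
qed

lemma q_mult: assumes x: "x \<in> carrier FG" and y: "y \<in> carrier FG" shows "q x \<otimes>\<^bsub>T\<^esub> q y = q (tm x y)"
proof - have "q x \<otimes>\<^bsub>T\<^esub> q y = (\<Union>x'\<in>q x. \<Union>y'\<in>q y. q (tm x' y'))" by (simp add: tensor_algebra_def tm_def)
 also have "\<dots> = (\<Union>x'\<in>q x. q (tm x' y))"
 proof (rule SUP_cong[OF refl]) fix x' assume x': "x' \<in> q x" show "(\<Union>y'\<in>q y. q (tm x' y')) = q (tm x' y)"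
  proof (rule UN_q[OF y]) fix y' assume "y' - y \<in> Ker"
   then have "tm x' (y' - y) \<in> Ker" using tm_Ker_r q_carrier[OF x x'] by blast
   then show "q (tm x' y') = q (tm x' y)" by (simp add: q_eq_iff tm_diff_r)
  qed
 qed
 also have "\<dots> = q (tm x y)"
 proof (rule UN_q[OF x]) fix x' assume "x' - x \<in> Ker"
  then have "tm (x' - x) y \<in> Ker" using tm_Ker_l y by blast
  then show "q (tm x' y) = q (tm x y)" by (simp add: q_eq_iff tm_diff_l)
 qed
 finally show ?thesis .
qed

lemma t_mult: assumes "a \<in> carrier A" "b \<in> carrier B" "a' \<in> carrier A" "b' \<in> carrier B"
 shows "t a b \<otimes>\<^bsub>T\<^esub> t a' b' = t (a \<otimes>\<^bsub>A\<^esub> a') (b \<otimes>\<^bsub>B\<^esub> b')"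
 unfolding t_def using q_mult[OF frag_of_carrier[OF assms(1,2)] frag_of_carrier[OF assms(3,4)]] by simp

lemma T_one: "\<one>\<^bsub>T\<^esub> = t \<one>\<^bsub>A\<^esub> \<one>\<^bsub>B\<^esub>" by (simp add: tensor_algebra_def t_def)

lemma TG_E: assumes "x \<in> carrier TG" obtains x' where "x' \<in> carrier FG" "x = q x'"
 using assms unfolding carrier_TG by (rule imageE) (rule that)

lemma T_mult_closed: "x \<in> carrier TG ==> y \<in> carrier TG ==> x \<otimes>\<^bsub>T\<^esub> y \<in> carrier TG"
 unfolding carrier_TG using q_mult tm_closed by force

lemma T_l_distr: assumes "x \<in> carrier TG" "y \<in> carrier TG" "z \<in> carrier TG"
 shows "(x \<otimes>\<^bsub>TG\<^esub> y) \<otimes>\<^bsub>T\<^esub> z = (x \<otimes>\<^bsub>T\<^esub> z) \<otimes>\<^bsub>TG\<^esub> (y \<otimes>\<^bsub>T\<^esub> z)"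
proof - obtain x' where x': "x' \<in> carrier FG" "x = q x'" using assms(1) by (rule TG_E)
 obtain y' where y': "y' \<in> carrier FG" "y = q y'" using assms(2) by (rule TG_E)
 obtain z' where z': "z' \<in> carrier FG" "z = q z'" using assms(3) by (rule TG_E)
 note * = x' y' z'
 have c: "x' + y' \<in> carrier FG" using FG.m_closed[OF *(1,3)] by (simp only: mult_free_Abelian_group)
 show ?thesis
  unfolding *(2,4,6) q_add[OF *(1,3), symmetric] q_mult[OF c *(5)] q_mult[OF *(1,5)] q_mult[OF *(3,5)]
   tm_add_l by (rule q_add[OF tm_closed[OF *(1,5)] tm_closed[OF *(3,5)]])
qed

lemma T_r_distr: assumes "x \<in> carrier TG" "y \<in> carrier TG" "z \<in> carrier TG"
 shows "z \<otimes>\<^bsub>T\<^esub> (x \<otimes>\<^bsub>TG\<^esub> y) = (z \<otimes>\<^bsub>T\<^esub> x) \<otimes>\<^bsub>TG\<^esub> (z \<otimes>\<^bsub>T\<^esub> y)"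
proof - obtain x' where x': "x' \<in> carrier FG" "x = q x'" using assms(1) by (rule TG_E)
 obtain y' where y': "y' \<in> carrier FG" "y = q y'" using assms(2) by (rule TG_E)
 obtain z' where z': "z' \<in> carrier FG" "z = q z'" using assms(3) by (rule TG_E)
 note * = x' y' z'
 have c: "x' + y' \<in> carrier FG" using FG.m_closed[OF *(1,3)] by (simp only: mult_free_Abelian_group)
 show ?thesis
  unfolding *(2,4,6) q_add[OF *(1,3), symmetric] q_mult[OF *(5) c] q_mult[OF *(5,1)] q_mult[OF *(5,3)]
   tm_add_r by (rule q_add[OF tm_closed[OF *(5,1)] tm_closed[OF *(5,3)]])
qed

lemma T_null: assumes "x \<in> carrier TG" shows "\<one>\<^bsub>TG\<^esub> \<otimes>\<^bsub>T\<^esub> x = \<one>\<^bsub>TG\<^esub>" "x \<otimes>\<^bsub>T\<^esub> \<one>\<^bsub>TG\<^esub> = \<one>\<^bsub>TG\<^esub>"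
proof - obtain x' where *: "x' \<in> carrier FG" "x = q x'" using assms by (rule TG_E)
 have z: "(0 :: 'a \<times> 'b \<Rightarrow>\<^sub>0 int) \<in> carrier FG" by simp
 show "\<one>\<^bsub>TG\<^esub> \<otimes>\<^bsub>T\<^esub> x = \<one>\<^bsub>TG\<^esub>" "x \<otimes>\<^bsub>T\<^esub> \<one>\<^bsub>TG\<^esub> = \<one>\<^bsub>TG\<^esub>"
  unfolding *(2) q_zero[symmetric] q_mult[OF *(1) z] q_mult[OF z *(1)] by simp_all
qed

lemma T_assoc_gen: assumes "x \<in> carrier TG" "y \<in> carrier TG" "z \<in> carrier TG"
 shows "x \<otimes>\<^bsub>T\<^esub> y \<otimes>\<^bsub>T\<^esub> z = x \<otimes>\<^bsub>T\<^esub> (y \<otimes>\<^bsub>T\<^esub> z)"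
 using assms(1)
proof (induction x rule: TG_induct) case one then show ?case using assms by (simp add: T_null T_mult_closed)
next case (add x x') then show ?case using assms by (simp add: T_l_distr T_mult_closed)
next case (gen a b) note tab = t_closed[OF gen] show ?case using assms(2) proof (induction y rule: TG_induct)
  case one
  then show ?case using assms tab by (simp add: T_null T_mult_closed)
 next case (add x x') then show ?case using assms tab by (simp add: T_l_distr T_r_distr T_mult_closed)
 next case (gen a' b') note tab' = t_closed[OF gen] show ?case using assms(3)
  proof (induction z rule: TG_induct) case one
   then show ?case using tab tab' by (simp add: T_null T_mult_closed)
  next case (add x x') then show ?case using tab tab' by (simp add: T_r_distr T_mult_closed)
  next case (gen a'' b'') then show ?case
    using \<open>a \<in> carrier A\<close> \<open>b \<in> carrier B\<close> \<open>a' \<in> carrier A\<close> \<open>b' \<in> carrier B\<close>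
    by (simp add: t_mult A.m_assoc B.m_assoc)
  qed
 qed
qed

lemma T_one_mult: assumes "x \<in> carrier TG" shows "\<one>\<^bsub>T\<^esub> \<otimes>\<^bsub>T\<^esub> x = x" "x \<otimes>\<^bsub>T\<^esub> \<one>\<^bsub>T\<^esub> = x"
proof - have 1: "t \<one>\<^bsub>A\<^esub> \<one>\<^bsub>B\<^esub> \<in> carrier TG" by (rule t_closed) auto
 have "t \<one>\<^bsub>A\<^esub> \<one>\<^bsub>B\<^esub> \<otimes>\<^bsub>T\<^esub> x = x \<and> x \<otimes>\<^bsub>T\<^esub> t \<one>\<^bsub>A\<^esub> \<one>\<^bsub>B\<^esub> = x" using assms
  by (induction x rule: TG_induct) (simp_all add: 1 T_null t_mult T_l_distr T_r_distr)
 then show "\<one>\<^bsub>T\<^esub> \<otimes>\<^bsub>T\<^esub> x = x" "x \<otimes>\<^bsub>T\<^esub> \<one>\<^bsub>T\<^esub> = x" by (simp_all add: T_one)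
qed

sublocale T: ring T
proof (rule ringI) show "abelian_group T" proof (rule abelian_groupI)
  fix x y z assume x: "x \<in> carrier T" "y \<in> carrier T" "z \<in> carrier T"
  show "x \<oplus>\<^bsub>T\<^esub> y \<oplus>\<^bsub>T\<^esub> z = x \<oplus>\<^bsub>T\<^esub> (y \<oplus>\<^bsub>T\<^esub> z)" using x by (simp add: TG.m_assoc)
 next fix x y assume x: "x \<in> carrier T" "y \<in> carrier T"
  show "x \<oplus>\<^bsub>T\<^esub> y = y \<oplus>\<^bsub>T\<^esub> x" using x by (simp add: TG.m_comm)
 next fix x assume x: "x \<in> carrier T" show "\<exists>y\<in>carrier T. y \<oplus>\<^bsub>T\<^esub> x = \<zero>\<^bsub>T\<^esub>"
   using x by (intro bexI[of _ "inv\<^bsub>TG\<^esub> x"]) simp_all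
 qed simp_all
 show "monoid T"
  by (rule monoidI) (simp_all add: T_mult_closed T_assoc_gen T_one_mult, simp add: T_one t_closed)
qed (simp_all add: T_l_distr T_r_distr)

end

section \<open>Linear functionals over division subrings\<close>

section \<open>Linear functionals\<close>

text \<open>By Zorn's lemma there is a maximal left \<open>E\<close>-subspace V containing
  \<open>W\<close> but not \<open>b\<close>. It is a complement of the line Eb, and \<phi> x is the
  coefficient of \<open>b\<close> in x modulo V.\<close>

lemma (in ring) exists_left_functional:
 assumes E: "subring E R" and div: "\<And>e. e \<in> E ==> e \<noteq> \<zero> ==> \<exists>e'\<in>E. e' \<otimes> e = \<one>"
  and W: "W \<subseteq> carrier R" "\<zero> \<in> W" "\<And>x y. x \<in> W ==> y \<in> W ==> x \<oplus> y \<in> W" "\<And>e x. e \<in> E ==> x \<in> W ==> e \<otimes> x \<in> W"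
  and b: "b \<in> carrier R" "b \<notin> W"
 obtains \<phi> where "\<And>x. x \<in> carrier R ==> \<phi> x \<in> E" "\<And>x y. x \<in> carrier R ==> y \<in> carrier R ==> \<phi> (x \<oplus> y) = \<phi> x \<oplus> \<phi> y"
  "\<And>e x. e \<in> E ==> x \<in> carrier R ==> \<phi> (e \<otimes> x) = e \<otimes> \<phi> x"
  "\<And>x. x \<in> W ==> \<phi> x = \<zero>" "\<phi> b = \<one>"
proof - note Es = subringE[OF E] have Ec: "e \<in> carrier R" if "e \<in> E" for e using Es(1) that by blast
 define sub where "sub V \<longleftrightarrow> V \<subseteq> carrier R \<and> W \<subseteq> V \<and> (\<forall>x\<in>V. \<forall>y\<in>V. x \<oplus> y \<in> V) \<and>
  (\<forall>e\<in>E. \<forall>x\<in>V. e \<otimes> x \<in> V)" for V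
 have "\<exists>M\<in>{V. sub V \<and> b \<notin> V}. \<forall>V\<in>{V. sub V \<and> b \<notin> V}. M \<subseteq> V \<longrightarrow> V = M"
 proof (rule subset_Zorn_nonempty) have "sub W" unfolding sub_def using W by blast
  then show "{V. sub V \<and> b \<notin> V} \<noteq> {}" using b(2) by blast
  fix C assume C: "C \<noteq> {}" "subset.chain {V. sub V \<and> b \<notin> V} C"
  have C1: "sub V" "b \<notin> V" if "V \<in> C" for V using C(2) that by (auto simp: subset.chain_def)
  have C2: "V \<subseteq> U \<or> U \<subseteq> V" if "V \<in> C" "U \<in> C" for U V using C(2) that by (auto simp: subset.chain_def)
  have plus: "x \<oplus> y \<in> \<Union>C" if xy: "x \<in> \<Union>C" "y \<in> \<Union>C" for x y
  proof - obtain U V where UV: "U \<in> C" "V \<in> C" "x \<in> U" "y \<in> V" using xy by blast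
   have "\<exists>Z\<in>C. x \<in> Z \<and> y \<in> Z" using C2[OF UV(1,2)] UV by blast
   then obtain Z where Z: "Z \<in> C" "x \<in> Z" "y \<in> Z" by blast
   have "x \<oplus> y \<in> Z" using C1(1)[OF Z(1)] Z(2,3) unfolding sub_def by blast
   then show ?thesis using Z(1) by blast
  qed
  have VC: "V \<subseteq> carrier R" "W \<subseteq> V" "\<And>e x. e \<in> E ==> x \<in> V ==> e \<otimes> x \<in> V" if "V \<in> C" for V
   using C1(1)[OF that] unfolding sub_def by blast+
  have "\<Union>C \<subseteq> carrier R" using VC(1) by (rule Union_least)
  moreover obtain V0 where "V0 \<in> C" using C(1) by blast
  then have "W \<subseteq> \<Union>C" using VC(2)[of V0] by blast
  moreover have "b \<notin> \<Union>C" using C1(2) by blast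
  moreover have "e \<otimes> x \<in> \<Union>C" if "e \<in> E" "x \<in> \<Union>C" for e x using VC(3) that by blast
  ultimately show "\<Union>C \<in> {V. sub V \<and> b \<notin> V}"
   using plus unfolding sub_def mem_Collect_eq by (intro conjI ballI) assumption+
 qed
 then obtain V where VA: "V \<in> {V. sub V \<and> b \<notin> V}"
  and Vmax: "\<forall>U\<in>{V. sub V \<and> b \<notin> V}. V \<subseteq> U \<longrightarrow> U = V" by (rule bexE)
 have V: "sub V" "b \<notin> V" using VA by blast+
 have max: "U = V" if "sub U" "b \<notin> U" "V \<subseteq> U" for U using Vmax that by blast
 have Vc: "x \<in> carrier R" if "x \<in> V" for x using V(1) that unfolding sub_def by blast
 have V0: "\<zero> \<in> V" using V(1) W(2) unfolding sub_def by blast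
 have Vadd: "x \<oplus> y \<in> V" if "x \<in> V" "y \<in> V" for x y using V(1) that unfolding sub_def by blast
 have Vm: "e \<otimes> x \<in> V" if "e \<in> E" "x \<in> V" for e x using V(1) that unfolding sub_def by blast
 have Vneg: "\<ominus> x \<in> V" if "x \<in> V" for x by (rule minus_mult_closed_subset[OF _ E _ that]) (use Vm Vc in auto)
 \<comment> \<open>If x is not in V, then V + Ex contains \<open>b\<close> by maximality, and the
   equation b = v + ex can be solved for x because e is nonzero, hence invertible in
   \<open>E\<close>.\<close>
 have ex: "\<exists>e\<in>E. x \<ominus> e \<otimes> b \<in> V" if x: "x \<in> carrier R" for x
 proof (cases "x \<in> V") case True then have "x \<ominus> \<zero> \<otimes> b \<in> V" using b x by (simp add: minus_eq)
  then show ?thesis using Es(2) by blast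
 next case False define U where "U = {v \<oplus> e \<otimes> x | v e. v \<in> V \<and> e \<in> E}"
  have UI: "v \<oplus> e \<otimes> x \<in> U" if "v \<in> V" "e \<in> E" for v e using that unfolding U_def by blast
  have "x' \<oplus> y' \<in> U" if U: "x' \<in> U" "y' \<in> U" for x' y'
  proof - obtain v e v' e' where *: "v \<in> V" "e \<in> E" "v' \<in> V" "e' \<in> E" "x' = v \<oplus> e \<otimes> x" "y' = v' \<oplus> e' \<otimes> x"
    using U unfolding U_def by blast
   have "x' \<oplus> y' = (v \<oplus> v') \<oplus> (e \<oplus> e') \<otimes> x"
    unfolding *(5,6) using Vc[OF *(1)] Vc[OF *(3)] Ec[OF *(2)] Ec[OF *(4)] x by (simp add: l_distr a_ac)
   then show ?thesis using UI[OF Vadd[OF *(1,3)] Es(7)[OF *(2,4)]] by simp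
  qed
  moreover have "d \<otimes> x' \<in> U" if U: "d \<in> E" "x' \<in> U" for d x'
  proof - obtain v e where *: "v \<in> V" "e \<in> E" "x' = v \<oplus> e \<otimes> x" using U unfolding U_def by blast
   have "d \<otimes> x' = d \<otimes> v \<oplus> (d \<otimes> e) \<otimes> x"
    unfolding *(3) using Vc[OF *(1)] Ec[OF *(2)] Ec[OF U(1)] x by (simp add: r_distr m_assoc)
   then show ?thesis using UI[OF Vm[OF U(1) *(1)] Es(6)[OF U(1) *(2)]] by simp
  qed
  moreover have VU: "V \<subseteq> U"
  proof fix v assume "v \<in> V" then show "v \<in> U" using UI[OF _ Es(2), of v] x Vc by simp
  qed
  moreover have "U \<subseteq> carrier R" using Vc Ec x unfolding U_def by auto
  ultimately have "sub U" using V(1) unfolding sub_def by (meson order_trans)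
  moreover have "x \<in> U" using UI[OF V0 Es(3)] x by simp
  ultimately have "b \<in> U" using max[of U] VU False by blast
  then obtain v e where *: "v \<in> V" "e \<in> E" "b = v \<oplus> e \<otimes> x" unfolding U_def by blast
  have "e \<noteq> \<zero>"
  proof assume "e = \<zero>" then have "b = v" using *(3) Vc[OF *(1)] x by simp
   then show False using *(1) V(2) by simp
  qed
  then obtain e' where e': "e' \<in> E" "e' \<otimes> e = \<one>" using div *(2) by blast
  note c = Vc[OF *(1)] Ec[OF *(2)] Ec[OF e'(1)] x
  have "e' \<otimes> b = e' \<otimes> v \<oplus> (e' \<otimes> e) \<otimes> x" unfolding *(3) using c by (simp add: r_distr m_assoc)
  then have "e' \<otimes> b = e' \<otimes> v \<oplus> x" using e'(2) c by simp
  then have "x \<ominus> e' \<otimes> b = \<ominus> (e' \<otimes> v)" using c by (simp add: minus_eq minus_add a_ac r_neg2)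
  with Vneg[OF Vm[OF e'(1) *(1)]] have "x \<ominus> e' \<otimes> b \<in> V" by simp
  then show ?thesis using e'(1) by blast
 qed
 have un: "e = e'" if "e \<in> E" "e' \<in> E" "x \<in> carrier R" "x \<ominus> e \<otimes> b \<in> V" "x \<ominus> e' \<otimes> b \<in> V" for x e e'
 proof (rule ccontr) assume ne: "e \<noteq> e'" note c = Ec[OF that(1)] Ec[OF that(2)] that(3) b(1)
  have "(x \<ominus> e' \<otimes> b) \<oplus> \<ominus> (x \<ominus> e \<otimes> b) = (e \<ominus> e') \<otimes> b"
   using c by (simp add: minus_eq minus_add l_distr l_minus a_ac r_neg r_neg2)
  then have m: "(e \<ominus> e') \<otimes> b \<in> V" using Vadd[OF that(5) Vneg[OF that(4)]] by simp
  have "e \<ominus> e' \<in> E" using that Es(5,7) by (simp add: minus_eq)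
  moreover have "e \<ominus> e' \<noteq> \<zero>" using ne c by simp
  ultimately obtain d where d: "d \<in> E" "d \<otimes> (e \<ominus> e') = \<one>" using div by blast
  have "d \<otimes> ((e \<ominus> e') \<otimes> b) \<in> V" using Vm[OF d(1) m] .
  moreover have "d \<otimes> ((e \<ominus> e') \<otimes> b) = d \<otimes> (e \<ominus> e') \<otimes> b" using c Ec[OF d(1)] by (simp add: m_assoc)
  ultimately show False using d(2) b V(2) by simp
 qed
 define \<phi> where "\<phi> x = (SOME e. e \<in> E \<and> x \<ominus> e \<otimes> b \<in> V)" for x
 have \<phi>: "\<phi> x \<in> E" "x \<ominus> \<phi> x \<otimes> b \<in> V" if "x \<in> carrier R" for x
  using someI_ex[of "\<lambda>e. e \<in> E \<and> x \<ominus> e \<otimes> b \<in> V"] ex[OF that] unfolding \<phi>_def by blast+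
 have eq: "\<phi> x = e" if "x \<in> carrier R" "e \<in> E" "x \<ominus> e \<otimes> b \<in> V" for x e
  using un[OF \<phi>(1)[OF that(1)] that(2,1) \<phi>(2)[OF that(1)] that(3)] .
 show ?thesis
 proof (rule that) show "\<phi> x \<in> E" if "x \<in> carrier R" for x using \<phi>(1) that .
  show "\<phi> (x \<oplus> y) = \<phi> x \<oplus> \<phi> y" if xy: "x \<in> carrier R" "y \<in> carrier R" for x y
  proof (rule eq) note c = xy Ec[OF \<phi>(1)[OF xy(1)]] Ec[OF \<phi>(1)[OF xy(2)]] b(1)
   have "x \<oplus> y \<ominus> (\<phi> x \<oplus> \<phi> y) \<otimes> b = (x \<ominus> \<phi> x \<otimes> b) \<oplus> (y \<ominus> \<phi> y \<otimes> b)"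
    using c by (simp add: minus_eq minus_add l_distr a_ac)
   then show "x \<oplus> y \<ominus> (\<phi> x \<oplus> \<phi> y) \<otimes> b \<in> V" using Vadd[OF \<phi>(2)[OF xy(1)] \<phi>(2)[OF xy(2)]] by simp
  qed (use xy \<phi>(1) Es(7) in auto)
  show "\<phi> (e \<otimes> x) = e \<otimes> \<phi> x" if ex: "e \<in> E" "x \<in> carrier R" for e x
  proof (rule eq) note c = Ec[OF ex(1)] ex(2) Ec[OF \<phi>(1)[OF ex(2)]] b(1)
   have "e \<otimes> x \<ominus> (e \<otimes> \<phi> x) \<otimes> b = e \<otimes> (x \<ominus> \<phi> x \<otimes> b)" using c by (simp add: minus_eq r_distr r_minus m_assoc)
   then show "e \<otimes> x \<ominus> (e \<otimes> \<phi> x) \<otimes> b \<in> V" using Vm[OF ex(1) \<phi>(2)[OF ex(2)]] by simp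
  qed (use ex \<phi>(1) Es(6) Ec in auto)
  show "\<phi> x = \<zero>" if x: "x \<in> W" for x
  proof (rule eq) have "x \<in> V" using x V(1) unfolding sub_def by blast
   then show "x \<ominus> \<zero> \<otimes> b \<in> V" "x \<in> carrier R" using Vc b by (simp_all add: minus_eq)
  qed (use Es(2) in simp)
  show "\<phi> b = \<one>"
  proof (rule eq) show "b \<ominus> \<one> \<otimes> b \<in> V" using b V0 by (simp add: minus_eq r_neg)
  qed (use b Es(3) in simp_all)
 qed
qed

lemma K_algebra_field: assumes "K_algebra K A" "k \<in> carrier K" "k \<noteq> \<zero>\<^bsub>K\<^esub>"
 obtains k' where "k' \<in> carrier K" "k' \<otimes>\<^bsub>K\<^esub> k = \<one>\<^bsub>K\<^esub>"
proof - interpret K: field K using assms(1) by (simp add: K_algebra_def K_algebra_axioms_def)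
 have "k \<in> Units K" using assms K.field_Units by blast
 then show ?thesis using that[of "inv\<^bsub>K\<^esub> k"] by simp
qed

lemma (in K_algebra) scalar_mult: assumes "k \<in> carrier K" "a \<in> carrier A"
 shows "(k \<odot>\<^bsub>A\<^esub> \<one>\<^bsub>A\<^esub>) \<otimes>\<^bsub>A\<^esub> a = k \<odot>\<^bsub>A\<^esub> a" "a \<otimes>\<^bsub>A\<^esub> (k \<odot>\<^bsub>A\<^esub> \<one>\<^bsub>A\<^esub>) = k \<odot>\<^bsub>A\<^esub> a"
 using smult_mult_left[of k "\<one>\<^bsub>A\<^esub>" a] smult_mult_right[of k a "\<one>\<^bsub>A\<^esub>"] assms by simp_all

lemma (in K_algebra) scalars_subring: "subring {k \<odot>\<^bsub>A\<^esub> \<one>\<^bsub>A\<^esub> | k. k \<in> carrier K} A"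
proof (rule subringI) show "\<one>\<^bsub>A\<^esub> \<in> {k \<odot>\<^bsub>A\<^esub> \<one>\<^bsub>A\<^esub> | k. k \<in> carrier K}"
  using smult_one[of "\<one>\<^bsub>A\<^esub>"] R.one_closed by (metis (mono_tags, lifting) mem_Collect_eq one_closed)
 fix x assume "x \<in> {k \<odot>\<^bsub>A\<^esub> \<one>\<^bsub>A\<^esub> | k. k \<in> carrier K}"
 then obtain k where k: "k \<in> carrier K" "x = k \<odot>\<^bsub>A\<^esub> \<one>\<^bsub>A\<^esub>" by blast
 have "\<ominus>\<^bsub>A\<^esub> x = (\<ominus>\<^bsub>K\<^esub> k) \<odot>\<^bsub>A\<^esub> \<one>\<^bsub>A\<^esub>" using k smult_l_minus by simp
 then show "\<ominus>\<^bsub>A\<^esub> x \<in> {k \<odot>\<^bsub>A\<^esub> \<one>\<^bsub>A\<^esub> | k. k \<in> carrier K}" using k(1) R.a_inv_closed by blast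
 fix y assume "y \<in> {k \<odot>\<^bsub>A\<^esub> \<one>\<^bsub>A\<^esub> | k. k \<in> carrier K}"
 then obtain l where l: "l \<in> carrier K" "y = l \<odot>\<^bsub>A\<^esub> \<one>\<^bsub>A\<^esub>" by blast
 have "x \<otimes>\<^bsub>A\<^esub> y = (k \<otimes>\<^bsub>K\<^esub> l) \<odot>\<^bsub>A\<^esub> \<one>\<^bsub>A\<^esub>" 
  unfolding k(2) l(2) using scalar_mult(1)[OF k(1), of "l \<odot>\<^bsub>A\<^esub> \<one>\<^bsub>A\<^esub>"] k(1) l(1)
  by (simp add: smult_assoc1)
 then show "x \<otimes>\<^bsub>A\<^esub> y \<in> {k \<odot>\<^bsub>A\<^esub> \<one>\<^bsub>A\<^esub> | k. k \<in> carrier K}" using k(1) l(1) R.m_closed by blast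
 have "x \<oplus>\<^bsub>A\<^esub> y = (k \<oplus>\<^bsub>K\<^esub> l) \<odot>\<^bsub>A\<^esub> \<one>\<^bsub>A\<^esub>" unfolding k(2) l(2) using k(1) l(1) by (simp add: smult_l_distr)
 then show "x \<oplus>\<^bsub>A\<^esub> y \<in> {k \<odot>\<^bsub>A\<^esub> \<one>\<^bsub>A\<^esub> | k. k \<in> carrier K}" using k(1) l(1) R.a_closed by blast
qed auto

text \<open>Functionals take their values in K1 inside the algebra rather than in K. They are then
  additive self-maps, and multiplication with their values needs no conversion.\<close>

definition functional :: "('k, 'm) ring_scheme \<Rightarrow> ('k, 'a, 'n) module_scheme \<Rightarrow> ('a \<Rightarrow> 'a) \<Rightarrow> bool" where
 "functional K D \<psi> \<longleftrightarrow> (\<forall>x\<in>carrier D. \<exists>k\<in>carrier K. \<psi> x = k \<odot>\<^bsub>D\<^esub> \<one>\<^bsub>D\<^esub>) \<and>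
  (\<forall>x\<in>carrier D. \<forall>y\<in>carrier D. \<psi> (x \<oplus>\<^bsub>D\<^esub> y) = \<psi> x \<oplus>\<^bsub>D\<^esub> \<psi> y) \<and>
  (\<forall>k\<in>carrier K. \<forall>x\<in>carrier D. \<psi> (k \<odot>\<^bsub>D\<^esub> x) = k \<odot>\<^bsub>D\<^esub> \<psi> x)"

lemma functionalD: assumes "functional K D \<psi>" "x \<in> carrier D" shows "\<exists>k\<in>carrier K. \<psi> x = k \<odot>\<^bsub>D\<^esub> \<one>\<^bsub>D\<^esub>"
  "y \<in> carrier D ==> \<psi> (x \<oplus>\<^bsub>D\<^esub> y) = \<psi> x \<oplus>\<^bsub>D\<^esub> \<psi> y"
  "k \<in> carrier K ==> \<psi> (k \<odot>\<^bsub>D\<^esub> x) = k \<odot>\<^bsub>D\<^esub> \<psi> x"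
 using assms unfolding functional_def by simp_all

lemma (in K_algebra) exists_functional:
 assumes W: "W \<subseteq> carrier A" "\<zero>\<^bsub>A\<^esub> \<in> W" "\<And>x y. x \<in> W ==> y \<in> W ==> x \<oplus>\<^bsub>A\<^esub> y \<in> W"
   "\<And>k x. k \<in> carrier K ==> x \<in> W ==> k \<odot>\<^bsub>A\<^esub> x \<in> W"
  and b: "b \<in> carrier A" "b \<notin> W"
 shows "\<exists>\<psi>. functional K A \<psi> \<and> (\<forall>x\<in>W. \<psi> x = \<zero>\<^bsub>A\<^esub>) \<and> \<psi> b = \<one>\<^bsub>A\<^esub>"
proof - let ?E = "{k \<odot>\<^bsub>A\<^esub> \<one>\<^bsub>A\<^esub> | k. k \<in> carrier K}"
 have div: "\<exists>e'\<in>?E. e' \<otimes>\<^bsub>A\<^esub> e = \<one>\<^bsub>A\<^esub>" if e: "e \<in> ?E" "e \<noteq> \<zero>\<^bsub>A\<^esub>" for e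
 proof - obtain k where k: "k \<in> carrier K" "e = k \<odot>\<^bsub>A\<^esub> \<one>\<^bsub>A\<^esub>" using e by blast
  have "k \<noteq> \<zero>\<^bsub>K\<^esub>" using e(2) k(2) smult_l_null by auto
  then obtain k' where k': "k' \<in> carrier K" "k' \<otimes>\<^bsub>K\<^esub> k = \<one>\<^bsub>K\<^esub>"
   using K_algebra_field[OF K_algebra_axioms k(1)] by blast
  have "(k' \<odot>\<^bsub>A\<^esub> \<one>\<^bsub>A\<^esub>) \<otimes>\<^bsub>A\<^esub> e = \<one>\<^bsub>A\<^esub>" unfolding k(2) using k(1) k' smult_assoc1[of k' k "\<one>\<^bsub>A\<^esub>"]
    scalar_mult(1)[OF k'(1), of "k \<odot>\<^bsub>A\<^esub> \<one>\<^bsub>A\<^esub>"] by simp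
  then show ?thesis using k'(1) by blast
 qed
 have WE: "e \<otimes>\<^bsub>A\<^esub> x \<in> W" if ex: "e \<in> ?E" "x \<in> W" for e x
 proof - obtain k where k: "k \<in> carrier K" "e = k \<odot>\<^bsub>A\<^esub> \<one>\<^bsub>A\<^esub>" using ex by blast
  have "x \<in> carrier A" using ex(2) W(1) by blast
  then show ?thesis unfolding k(2) using W(4)[OF k(1) ex(2)] scalar_mult[OF k(1)] by simp
 qed
 show ?thesis
 proof (rule exists_left_functional[OF scalars_subring, of W b])
  show "\<exists>e'\<in>?E. e' \<otimes>\<^bsub>A\<^esub> e = \<one>\<^bsub>A\<^esub>" if "e \<in> ?E" "e \<noteq> \<zero>\<^bsub>A\<^esub>" for e by (rule div[OF that])
  show "e \<otimes>\<^bsub>A\<^esub> x \<in> W" if "e \<in> ?E" "x \<in> W" for e x by (rule WE[OF that])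
  fix \<phi> assume \<phi>: "\<And>x. x \<in> carrier A ==> \<phi> x \<in> ?E"
   "\<And>x y. x \<in> carrier A ==> y \<in> carrier A ==> \<phi> (x \<oplus>\<^bsub>A\<^esub> y) = \<phi> x \<oplus>\<^bsub>A\<^esub> \<phi> y"
   "\<And>e x. e \<in> ?E ==> x \<in> carrier A ==> \<phi> (e \<otimes>\<^bsub>A\<^esub> x) = e \<otimes>\<^bsub>A\<^esub> \<phi> x"
   "\<And>x. x \<in> W ==> \<phi> x = \<zero>\<^bsub>A\<^esub>" "\<phi> b = \<one>\<^bsub>A\<^esub>"
  have \<phi>E: "\<exists>k\<in>carrier K. \<phi> x = k \<odot>\<^bsub>A\<^esub> \<one>\<^bsub>A\<^esub>" if "x \<in> carrier A" for x using \<phi>(1)[OF that] by blast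
  have "\<phi> (k \<odot>\<^bsub>A\<^esub> x) = k \<odot>\<^bsub>A\<^esub> \<phi> x" if kx: "k \<in> carrier K" "x \<in> carrier A" for k x
  proof - have "\<phi> x \<in> carrier A" using \<phi>E[OF kx(2)] by auto
   moreover have "k \<odot>\<^bsub>A\<^esub> \<one>\<^bsub>A\<^esub> \<in> ?E" using kx(1) by blast
   ultimately show ?thesis using \<phi>(3)[of "k \<odot>\<^bsub>A\<^esub> \<one>\<^bsub>A\<^esub>" x] kx by (simp add: scalar_mult)
  qed
  then show ?thesis using \<phi>E \<phi>(2,4,5) unfolding functional_def by (intro exI[of _ \<phi>]) simp
 qed (rule W(1,2,3) b(1,2); assumption)+
qed

section \<open>Slice maps and the subrings spanned by products of two commuting subalgebras\<close>

section \<open>Slice maps\<close>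

definition additive_span :: "('k, 'a) module \<Rightarrow> 'a set \<Rightarrow> 'a set" where "additive_span R G =
  \<Inter>{Y. G \<subseteq> Y \<and> \<zero>\<^bsub>R\<^esub> \<in> Y \<and> (\<forall>x\<in>Y. \<forall>y\<in>Y. x \<oplus>\<^bsub>R\<^esub> y \<in> Y)}"

lemma additive_span_zero: "\<zero>\<^bsub>R\<^esub> \<in> additive_span R G" and additive_span_gen: "x \<in> G ==> x \<in> additive_span R G"
 and additive_span_add: "x \<in> additive_span R G ==> y \<in> additive_span R G ==> x \<oplus>\<^bsub>R\<^esub> y \<in> additive_span R G"
 unfolding additive_span_def by blast+

lemma additive_span_least: assumes "G \<subseteq> Y" "\<zero>\<^bsub>R\<^esub> \<in> Y" "\<And>x y. x \<in> Y ==> y \<in> Y ==> x \<oplus>\<^bsub>R\<^esub> y \<in> Y"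
 shows "additive_span R G \<subseteq> Y"
 unfolding additive_span_def using assms by (intro Inter_lower) simp

lemma additive_span_mono: "G \<subseteq> Y ==> additive_span R G \<subseteq> additive_span R Y"
 unfolding additive_span_def by (intro Inter_anti_mono) blast

lemma additive_span_opposite: "additive_span (opposite R) G = additive_span R G"
 by (simp add: additive_span_def)

lemma K_subalgebraE: assumes "K_subalgebra K A C"
 shows "subring C A" "C \<subseteq> carrier A" "\<zero>\<^bsub>A\<^esub> \<in> C" "\<And>x y. x \<in> C ==> y \<in> C ==> x \<oplus>\<^bsub>A\<^esub> y \<in> C"
  "\<And>k x. k \<in> carrier K ==> x \<in> C ==> k \<odot>\<^bsub>A\<^esub> x \<in> C"
proof - show C: "subring C A" using assms by (simp add: K_subalgebra_def)
 show "C \<subseteq> carrier A" "\<zero>\<^bsub>A\<^esub> \<in> C" by (rule subringE[OF C])+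
 show "x \<oplus>\<^bsub>A\<^esub> y \<in> C" if "x \<in> C" "y \<in> C" for x y by (rule subringE(7)[OF C that])
 show "k \<odot>\<^bsub>A\<^esub> x \<in> C" if "k \<in> carrier K" "x \<in> C" for k x using assms that by (simp add: K_subalgebra_def)
qed

text \<open>The model is \<open>T = A \<otimes>\<^sub>K B\<close> with \<open>\<alpha> a = a \<otimes> 1\<close>; the elements of \<open>\<Phi>\<close> are the maps \<open>id \<otimes> f\<close> for
 linear functionals \<open>f\<close> on \<open>B\<close>.  The axioms are invariant under passing to opposite rings.\<close>

locale slice_algebra = A: K_algebra K A + T: ring T
 for K :: "'k ring" and A :: "('k, 'a) module" and T :: "('k, 't) module" (structure) +
 fixes \<alpha> :: "'a \<Rightarrow> 't" and B :: "'t set" and \<Phi> :: "('t \<Rightarrow> 'a) set"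
 assumes \<alpha>: "\<alpha> \<in> ring_hom A T" and B: "subring B T" and commute: "a \<in> carrier A ==> b \<in> B ==> \<alpha> a \<otimes> b = b \<otimes> \<alpha> a"
  and \<Phi>_closed: "\<phi> \<in> \<Phi> ==> z \<in> carrier T ==> \<phi> z \<in> carrier A"
  and \<Phi>_add: "\<phi> \<in> \<Phi> ==> z \<in> carrier T ==> z' \<in> carrier T ==> \<phi> (z \<oplus> z') = \<phi> z \<oplus>\<^bsub>A\<^esub> \<phi> z'"
  and \<Phi>_left: "\<phi> \<in> \<Phi> ==> a \<in> carrier A ==> z \<in> carrier T ==> \<phi> (\<alpha> a \<otimes> z) = a \<otimes>\<^bsub>A\<^esub> \<phi> z"
  and \<Phi>_right: "\<phi> \<in> \<Phi> ==> a \<in> carrier A ==> z \<in> carrier T ==> \<phi> (z \<otimes> \<alpha> a) = \<phi> z \<otimes>\<^bsub>A\<^esub> a"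
  and \<Phi>_B: "\<phi> \<in> \<Phi> ==> b \<in> B ==> \<exists>k\<in>carrier K. \<phi> b = k \<odot>\<^bsub>A\<^esub> \<one>\<^bsub>A\<^esub>"
  and sep: "z \<in> carrier T ==> (\<And>\<phi>. \<phi> \<in> \<Phi> ==> \<phi> z = \<zero>\<^bsub>A\<^esub>) ==> z = \<zero>"
begin

lemma opposite_slice_algebra: "slice_algebra K (opposite A) (opposite T) \<alpha> B \<Phi>"
 unfolding slice_algebra_def slice_algebra_axioms_def opposite_simps
 using K_algebra_opposite[OF A.K_algebra_axioms] ring_opposite[OF T.ring_axioms]
  ring_hom_opposite[OF \<alpha>] subring_opposite[OF T.ring_axioms B] commute
  \<Phi>_closed \<Phi>_add \<Phi>_left \<Phi>_right \<Phi>_B sep by simp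

interpretation \<alpha>: ring_hom_ring A T \<alpha> by (rule ring_hom_ringI2[OF A.ring_axioms T.ring_axioms \<alpha>])

lemma B_carr: "b \<in> B ==> b \<in> carrier T" using subringE(1)[OF B] by blast

text \<open>The subset written C \<otimes> B' on paper, realised inside \<open>T\<close>.\<close>

definition tens :: "'a set \<Rightarrow> 't set \<Rightarrow> 't set" where
 "tens C B' = additive_span T {\<alpha> c \<otimes> b | c b. c \<in> C \<and> b \<in> B'}"

lemma tens_gen: "c \<in> C ==> b \<in> B' ==> \<alpha> c \<otimes> b \<in> tens C B'" unfolding tens_def by (rule additive_span_gen) blast

lemma tens_zero: "\<zero> \<in> tens C B'" unfolding tens_def by (rule additive_span_zero)

lemma tens_add: "x \<in> tens C B' ==> y \<in> tens C B' ==> x \<oplus> y \<in> tens C B'"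
 unfolding tens_def by (rule additive_span_add)

lemma tens_least: assumes "\<And>c b. c \<in> C ==> b \<in> B' ==> \<alpha> c \<otimes> b \<in> Y" "\<zero> \<in> Y" "\<And>x y. x \<in> Y ==> y \<in> Y ==> x \<oplus> y \<in> Y"
 shows "tens C B' \<subseteq> Y"
 unfolding tens_def by (rule additive_span_least) (use assms in auto)

lemma tens_mono: "C \<subseteq> C' ==> B' \<subseteq> B'' ==> tens C B' \<subseteq> tens C' B''"
 unfolding tens_def by (rule additive_span_mono) blast

lemma tens_carrier: assumes "C \<subseteq> carrier A" "B' \<subseteq> B" shows "tens C B' \<subseteq> carrier T"
proof (rule tens_least) fix c b assume "c \<in> C" "b \<in> B'"
 then have "c \<in> carrier A" "b \<in> carrier T" using assms B_carr by blast+
 then show "\<alpha> c \<otimes> b \<in> carrier T" by simp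
qed auto

lemma tens_opposite: assumes "C \<subseteq> carrier A" "B' \<subseteq> B"
 shows "slice_algebra.tens (opposite T) \<alpha> C B' = tens C B'"
proof - interpret op: slice_algebra K "opposite A" "opposite T" \<alpha> B \<Phi> by (rule opposite_slice_algebra)
 have "{\<alpha> c \<otimes>\<^bsub>opposite T\<^esub> b | c b. c \<in> C \<and> b \<in> B'} = {\<alpha> c \<otimes> b | c b. c \<in> C \<and> b \<in> B'}"
  using commute assms by (intro Collect_cong ex_cong1) (auto simp: subset_iff)
 then show ?thesis unfolding op.tens_def tens_def by (simp add: additive_span_opposite)
qed

lemma tens_mult_left: assumes C: "C \<subseteq> carrier A" and B': "B' \<subseteq> B" and s: "s \<in> carrier T"
  and gen: "\<And>c b. c \<in> C ==> b \<in> B' ==> s \<otimes> (\<alpha> c \<otimes> b) \<in> tens C' B''"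
  and z: "z \<in> tens C B'"
 shows "s \<otimes> z \<in> tens C' B''"
proof - have "tens C B' \<subseteq> {z \<in> carrier T. s \<otimes> z \<in> tens C' B''}" proof (rule tens_least)
  fix c b assume "c \<in> C" "b \<in> B'"
  then show "\<alpha> c \<otimes> b \<in> {z \<in> carrier T. s \<otimes> z \<in> tens C' B''}"
   using gen C B' B_carr by (auto simp: subset_iff)
 qed (use s tens_zero tens_add in \<open>auto simp: T.r_distr\<close>)
 then show ?thesis using z by blast
qed

lemma gen_mult: assumes "c \<in> carrier A" "b \<in> B" "c' \<in> carrier A" "b' \<in> carrier T"
 shows "(\<alpha> c \<otimes> b) \<otimes> (\<alpha> c' \<otimes> b') = \<alpha> (c \<otimes>\<^bsub>A\<^esub> c') \<otimes> (b \<otimes> b')"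
proof - note c = B_carr[OF assms(2)] assms(4) \<alpha>.hom_closed[OF assms(1)] \<alpha>.hom_closed[OF assms(3)]
 have "(\<alpha> c \<otimes> b) \<otimes> (\<alpha> c' \<otimes> b') = \<alpha> c \<otimes> (b \<otimes> \<alpha> c') \<otimes> b'" using c by (simp add: T.m_assoc)
 also have "\<dots> = \<alpha> c \<otimes> (\<alpha> c' \<otimes> b) \<otimes> b'" unfolding commute[OF assms(3,2)] ..
 also have "\<dots> = \<alpha> (c \<otimes>\<^bsub>A\<^esub> c') \<otimes> (b \<otimes> b')" using c assms by (simp add: T.m_assoc)
 finally show ?thesis .
qed

lemma tens_subring: assumes C: "subring C A" and B': "subring B' T" and B'B: "B' \<subseteq> B"
 shows "subring (tens C B') T"
proof - note Cs = subringE[OF C] and Bs = subringE[OF B']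
 have tc: "z \<in> carrier T" if "z \<in> tens C B'" for z using tens_carrier[OF Cs(1) B'B] that by blast
 have mult: "z' \<otimes> z \<in> tens C B'" if z: "z \<in> tens C B'" and z': "z' \<in> tens C B'" for z z'
 proof - have "tens C B' \<subseteq> {z' \<in> carrier T. z' \<otimes> z \<in> tens C B'}" proof (rule tens_least)
   fix c b assume cb: "c \<in> C" "b \<in> B'"
   have cb': "c \<in> carrier A" "b \<in> B" using cb Cs(1) B'B by blast+
   have "(\<alpha> c \<otimes> b) \<otimes> z \<in> tens C B'"
   proof (rule tens_mult_left[OF Cs(1) B'B _ _ z]) show "\<alpha> c \<otimes> b \<in> carrier T" using cb' B_carr by simp
    fix c' b' assume cb2: "c' \<in> C" "b' \<in> B'"
    have c2: "c' \<in> carrier A" "b' \<in> carrier T" using cb2 Cs(1) Bs(1) by blast+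
    show "(\<alpha> c \<otimes> b) \<otimes> (\<alpha> c' \<otimes> b') \<in> tens C B'"
     unfolding gen_mult[OF cb' c2] by (rule tens_gen[OF Cs(6)[OF cb(1) cb2(1)] Bs(6)[OF cb(2) cb2(2)]])
   qed
   then show "\<alpha> c \<otimes> b \<in> {z' \<in> carrier T. z' \<otimes> z \<in> tens C B'}" using cb' B_carr by simp
  next show "\<zero> \<in> {z' \<in> carrier T. z' \<otimes> z \<in> tens C B'}" using tc[OF z] tens_zero by simp
  next fix x y assume "x \<in> {z' \<in> carrier T. z' \<otimes> z \<in> tens C B'}" "y \<in> {z' \<in> carrier T. z' \<otimes> z \<in> tens C B'}"
   then show "x \<oplus> y \<in> {z' \<in> carrier T. z' \<otimes> z \<in> tens C B'}"
    using tc[OF z] tens_add by (simp add: T.l_distr)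
  qed
  then show ?thesis using z' by blast
 qed
 have one: "\<one> \<in> tens C B'" using tens_gen[OF Cs(3) Bs(3)] by simp
 have "\<alpha> (\<ominus>\<^bsub>A\<^esub> \<one>\<^bsub>A\<^esub>) \<otimes> \<one> \<in> tens C B'" by (rule tens_gen) (use Cs(3,5) Bs(3) in auto)
 then have mone: "\<ominus> \<one> \<in> tens C B'" by simp
 show ?thesis
 proof (rule T.subringI) show "\<ominus> h \<in> tens C B'" if "h \<in> tens C B'" for h
   using mult[OF that mone] tc[OF that] by (simp add: T.l_minus)
 qed (use one mult tens_add tc in auto)
qed

text \<open>A slice takes \<alpha> c b to a scalar multiple of c, since the value of the slice at b
  is a scalar.\<close>

lemma slice_tens: assumes C: "C \<subseteq> carrier A" "\<zero>\<^bsub>A\<^esub> \<in> C" "\<And>x y. x \<in> C ==> y \<in> C ==> x \<oplus>\<^bsub>A\<^esub> y \<in> C"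
   "\<And>k x. k \<in> carrier K ==> x \<in> C ==> k \<odot>\<^bsub>A\<^esub> x \<in> C"
  and B'B: "B' \<subseteq> B" and \<phi>: "\<phi> \<in> \<Phi>" and z: "z \<in> tens C B'"
 shows "\<phi> z \<in> C"
proof - have 0: "\<phi> \<zero> = \<zero>\<^bsub>A\<^esub>" using \<Phi>_left[OF \<phi>, of "\<zero>\<^bsub>A\<^esub>" "\<zero>"] \<Phi>_closed[OF \<phi>, of "\<zero>"] by simp
 have "tens C B' \<subseteq> {z \<in> carrier T. \<phi> z \<in> C}"
 proof (rule tens_least) fix c b assume cb: "c \<in> C" "b \<in> B'"
  then have cb': "c \<in> carrier A" "b \<in> B" using C(1) B'B by blast+
  obtain k where k: "k \<in> carrier K" "\<phi> b = k \<odot>\<^bsub>A\<^esub> \<one>\<^bsub>A\<^esub>" using \<Phi>_B[OF \<phi> cb'(2)] by blast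
  have "\<phi> (\<alpha> c \<otimes> b) = k \<odot>\<^bsub>A\<^esub> c"
   unfolding \<Phi>_left[OF \<phi> cb'(1) B_carr[OF cb'(2)]] k(2) by (rule A.scalar_mult(2)[OF k(1) cb'(1)])
  then show "\<alpha> c \<otimes> b \<in> {z \<in> carrier T. \<phi> z \<in> C}" using C(4)[OF k(1) cb(1)] cb' B_carr by simp
 next show "\<zero> \<in> {z \<in> carrier T. \<phi> z \<in> C}" using 0 C(2) by simp
 next fix x y assume "x \<in> {z \<in> carrier T. \<phi> z \<in> C}" "y \<in> {z \<in> carrier T. \<phi> z \<in> C}"
  then show "x \<oplus> y \<in> {z \<in> carrier T. \<phi> z \<in> C}" using C(3) \<Phi>_add[OF \<phi>] by simp
 qed
 then show ?thesis using z by blast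
qed

text \<open>As \<alpha> x commutes with the elements of \<open>B'\<close>, the commutation rule
  between \<open>x\<close> and \<open>C\<close> passes to each product \<alpha> c b, and hence to
  sums.\<close>

lemma tens_comm_l: assumes C: "subring C A" and B': "subring B' T" and B'B: "B' \<subseteq> B" and x: "x \<in> carrier A"
  and comm: "\<And>c. c \<in> C ==> \<exists>c1\<in>C. \<exists>c2\<in>C. x \<otimes>\<^bsub>A\<^esub> c = c1 \<otimes>\<^bsub>A\<^esub> x \<oplus>\<^bsub>A\<^esub> c2"
  and s: "s \<in> tens C B'"
 shows "\<exists>s1\<in>tens C B'. \<exists>s2\<in>tens C B'. \<alpha> x \<otimes> s = s1 \<otimes> \<alpha> x \<oplus> s2"
proof - note Cs = subringE[OF C] and Bs = subringE[OF B']
 have tc: "z \<in> carrier T" if "z \<in> tens C B'" for z using tens_carrier[OF Cs(1) B'B] that by blast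
 let ?P = "\<lambda>s. \<exists>s1\<in>tens C B'. \<exists>s2\<in>tens C B'. \<alpha> x \<otimes> s = s1 \<otimes> \<alpha> x \<oplus> s2"
 have "tens C B' \<subseteq> {s \<in> carrier T. ?P s}"
 proof (rule tens_least) fix c b assume cb: "c \<in> C" "b \<in> B'"
  then have cb': "c \<in> carrier A" "b \<in> B" "b \<in> carrier T" using Cs(1) B'B Bs(1) by blast+
  obtain c1 c2 where c12: "c1 \<in> C" "c2 \<in> C" "x \<otimes>\<^bsub>A\<^esub> c = c1 \<otimes>\<^bsub>A\<^esub> x \<oplus>\<^bsub>A\<^esub> c2" using comm[OF cb(1)] by blast
  then have c12': "c1 \<in> carrier A" "c2 \<in> carrier A" using Cs(1) by blast+
  have "\<alpha> x \<otimes> (\<alpha> c \<otimes> b) = \<alpha> (x \<otimes>\<^bsub>A\<^esub> c) \<otimes> b" using cb' x by (simp add: T.m_assoc)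
  also have "\<dots> = \<alpha> c1 \<otimes> (\<alpha> x \<otimes> b) \<oplus> \<alpha> c2 \<otimes> b"
   unfolding c12(3) using cb' c12' x by (simp add: T.l_distr T.m_assoc)
  also have "\<dots> = (\<alpha> c1 \<otimes> b) \<otimes> \<alpha> x \<oplus> \<alpha> c2 \<otimes> b"
   unfolding commute[OF x cb'(2)] using cb' c12' x by (simp add: T.m_assoc)
  finally have "?P (\<alpha> c \<otimes> b)" using tens_gen[OF c12(1) cb(2)] tens_gen[OF c12(2) cb(2)] by blast
  then show "\<alpha> c \<otimes> b \<in> {s \<in> carrier T. ?P s}" using cb' by simp
 next have "\<alpha> x \<otimes> \<zero> = \<zero> \<otimes> \<alpha> x \<oplus> \<zero>" using x by simp
  then show "\<zero> \<in> {s \<in> carrier T. ?P s}" using tens_zero by blast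
 next fix y z assume "y \<in> {s \<in> carrier T. ?P s}" "z \<in> {s \<in> carrier T. ?P s}"
  then obtain s1 s2 s3 s4 where *: "y \<in> carrier T" "z \<in> carrier T" "s1 \<in> tens C B'" "s2 \<in> tens C B'"
   "s3 \<in> tens C B'" "s4 \<in> tens C B'" "\<alpha> x \<otimes> y = s1 \<otimes> \<alpha> x \<oplus> s2" "\<alpha> x \<otimes> z = s3 \<otimes> \<alpha> x \<oplus> s4"
   by blast
  have "\<alpha> x \<otimes> (y \<oplus> z) = \<alpha> x \<otimes> y \<oplus> \<alpha> x \<otimes> z" using * x by (simp add: T.r_distr)
  also have "\<dots> = (s1 \<oplus> s3) \<otimes> \<alpha> x \<oplus> (s2 \<oplus> s4)"
   unfolding *(7,8) using tc[OF *(3)] tc[OF *(4)] tc[OF *(5)] tc[OF *(6)] x by (simp add: T.l_distr T.a_ac)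
  finally have "?P (y \<oplus> z)" using tens_add[OF *(3,5)] tens_add[OF *(4,6)] by blast
  then show "y \<oplus> z \<in> {s \<in> carrier T. ?P s}" using * by simp
 qed
 then show ?thesis using s by blast
qed

text \<open>Freeness is tested on slices. If \<alpha> x g lies in C \<otimes> B', then every slice
  \<phi> gives x \<phi>(g) = \<phi>(\<alpha> x g) in \<open>C\<close>, so \<phi>(g) = 0 by freeness
  of \<open>x\<close> over \<open>C\<close>; as slices separate points, g = 0. The commutation rules
  and generation carry over directly.\<close>

theorem tens_ore_free:
 assumes ore: "ore_free A C C' x" and C: "K_subalgebra K A C" and C': "K_subalgebra K A C'"
  and B': "subring B' T" and B'B: "B' \<subseteq> B"
 shows "ore_free T (tens C B') (tens C' B') (\<alpha> x)"
proof - interpret O: ore_free A C C' x by fact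
 interpret op: slice_algebra K "opposite A" "opposite T" \<alpha> B \<Phi> by (rule opposite_slice_algebra)
 note Cs = K_subalgebraE[OF C] and Cs' = K_subalgebraE[OF C']
 note S = tens_subring[OF Cs(1) B' B'B] and S' = tens_subring[OF Cs'(1) B' B'B]
 note Bs = subringE[OF B']
 have x: "x \<in> carrier A" "x \<in> C'" using O.xS' Cs'(2) by blast+
 have ax: "\<alpha> x \<in> tens C' B'" using tens_gen[OF x(2) Bs(3)] x(1) by simp
 have tc: "z \<in> carrier T" if "z \<in> tens C' B'" for z using subringE(1)[OF S'] that by blast
 show ?thesis
 proof (intro ore_free.intro ore_generated.intro ore_generated_axioms.intro ore_free_axioms.intro)
  show "ring T" by (rule T.ring_axioms)
  show "subring (tens C B') T" "subring (tens C' B') T" by fact+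
  show "tens C B' \<subseteq> tens C' B'" by (rule tens_mono[OF O.SS' order_refl])
  show "\<alpha> x \<in> tens C' B'" by fact
  show "\<exists>s'\<in>tens C B'. \<exists>s''\<in>tens C B'. \<alpha> x \<otimes> s = s' \<otimes> \<alpha> x \<oplus> s''" if "s \<in> tens C B'" for s
   by (rule tens_comm_l[OF Cs(1) B' B'B x(1) O.comm_l that])
  show "\<exists>s'\<in>tens C B'. \<exists>s''\<in>tens C B'. s \<otimes> \<alpha> x = \<alpha> x \<otimes> s' \<oplus> s''" if "s \<in> tens C B'" for s
   using op.tens_comm_l[OF subring_opposite[OF A.ring_axioms Cs(1)] subring_opposite[OF T.ring_axioms B'] B'B,
     of x s] x O.comm_r that unfolding tens_opposite[OF Cs(2) B'B] by simp
  show "tens C' B' \<subseteq> D" if D: "subring D T" and CD: "tens C B' \<subseteq> D" and xD: "\<alpha> x \<in> D" for D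
  proof - note Ds = subringE[OF D] have "subring {c \<in> carrier A. \<alpha> c \<in> D} A"
    by (rule A.subringI) (use Ds in auto)
   moreover have "C \<subseteq> {c \<in> carrier A. \<alpha> c \<in> D}"
   proof fix c assume c: "c \<in> C" then have "c \<in> carrier A" using Cs(2) by blast
    moreover have "\<alpha> c \<otimes> \<one> \<in> D" using tens_gen[OF c Bs(3)] CD by blast
    ultimately show "c \<in> {c \<in> carrier A. \<alpha> c \<in> D}" by simp
   qed
   moreover have "x \<in> {c \<in> carrier A. \<alpha> c \<in> D}" using x xD by simp
   ultimately have C'D: "C' \<subseteq> {c \<in> carrier A. \<alpha> c \<in> D}" by (rule O.gen)
   have "b \<in> D" if "b \<in> B'" for b
   proof - have "\<alpha> \<one>\<^bsub>A\<^esub> \<otimes> b \<in> D" using tens_gen[OF subringE(3)[OF Cs(1)] that] CD by blast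
    then show ?thesis using Bs(1) that by (simp add: subset_iff)
   qed
   note bD = this
   show ?thesis
   proof (rule tens_least) show "\<alpha> c \<otimes> b \<in> D" if "c \<in> C'" "b \<in> B'" for c b
     using Ds(6)[OF _ bD[OF that(2)], of "\<alpha> c"] C'D that(1) by blast
   qed (rule Ds(2,7); assumption)+
  qed
  show "g = \<zero>" if g: "g \<in> tens C' B'" "\<alpha> x \<otimes> g \<in> tens C B'" for g
  proof (rule sep[OF tc[OF g(1)]]) fix \<phi> assume \<phi>: "\<phi> \<in> \<Phi>"
   have "\<phi> g \<in> C'" by (rule slice_tens[OF Cs'(2-5) B'B \<phi> g(1)])
   moreover have "\<phi> (\<alpha> x \<otimes> g) \<in> C" by (rule slice_tens[OF Cs(2-5) B'B \<phi> g(2)])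
   then have "x \<otimes>\<^bsub>A\<^esub> \<phi> g \<in> C" unfolding \<Phi>_left[OF \<phi> x(1) tc[OF g(1)]] .
   ultimately show "\<phi> g = \<zero>\<^bsub>A\<^esub>" by (rule O.free_l)
  qed
  show "g = \<zero>" if g: "g \<in> tens C' B'" "g \<otimes> \<alpha> x \<in> tens C B'" for g
  proof (rule sep[OF tc[OF g(1)]]) fix \<phi> assume \<phi>: "\<phi> \<in> \<Phi>"
   have "\<phi> g \<in> C'" by (rule slice_tens[OF Cs'(2-5) B'B \<phi> g(1)])
   moreover have "\<phi> (g \<otimes> \<alpha> x) \<in> C" by (rule slice_tens[OF Cs(2-5) B'B \<phi> g(2)])
   then have "\<phi> g \<otimes>\<^bsub>A\<^esub> x \<in> C" unfolding \<Phi>_right[OF \<phi> x(1) tc[OF g(1)]] .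
   ultimately show "\<phi> g = \<zero>\<^bsub>A\<^esub>" by (rule O.free_r)
  qed
 qed
qed

text \<open>A left ideal \<open>I\<close> of \<open>A\<close> is recovered from the left ideal \<open>I \<otimes> B\<close> of \<open>T\<close> by a slice map.\<close>

lemma left_noetherian_slice:
 assumes N: "left_noetherian T" and one: "\<one> \<noteq> \<zero>" and T: "tens (carrier A) B = carrier T"
 shows "left_noetherian A"
 unfolding left_noetherian_def
proof (intro allI impI) fix I assume I: "\<forall>i::nat. left_ideal (I i) A \<and> I i \<subseteq> I (Suc i)"
 \<comment> \<open>A slice that does not kill 1 sends \<alpha> a to ka with a nonzero scalar k, and
   k can be divided out inside a left ideal.\<close>
 obtain \<phi> where \<phi>: "\<phi> \<in> \<Phi>" "\<phi> \<one> \<noteq> \<zero>\<^bsub>A\<^esub>" using sep[OF T.one_closed] one by blast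
 note Bs = subringE[OF B]
 obtain k where k: "k \<in> carrier K" "\<phi> \<one> = k \<odot>\<^bsub>A\<^esub> \<one>\<^bsub>A\<^esub>" using \<Phi>_B[OF \<phi>(1) Bs(3)] by blast
 have "k \<noteq> \<zero>\<^bsub>K\<^esub>" using \<phi>(2) k by auto
 then obtain k' where k': "k' \<in> carrier K" "k' \<otimes>\<^bsub>K\<^esub> k = \<one>\<^bsub>K\<^esub>"
  using K_algebra_field[OF A.K_algebra_axioms k(1)] by blast
 have Ii: "I i \<subseteq> carrier A" "\<zero>\<^bsub>A\<^esub> \<in> I i" "\<And>a b. a \<in> I i ==> b \<in> I i ==> a \<oplus>\<^bsub>A\<^esub> b \<in> I i"
  "\<And>r a. r \<in> carrier A ==> a \<in> I i ==> r \<otimes>\<^bsub>A\<^esub> a \<in> I i" for i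
  using I left_ideal_iff[OF A.ring_axioms] by auto
 have Ik: "l \<odot>\<^bsub>A\<^esub> a \<in> I i" if "l \<in> carrier K" "a \<in> I i" for l a i
  using Ii(4)[of "l \<odot>\<^bsub>A\<^esub> \<one>\<^bsub>A\<^esub>" a i] A.scalar_mult(1)[of l a] that Ii(1)[of i] by auto
 have J: "left_ideal (tens (I i) B) T" for i unfolding left_ideal_iff[OF T.ring_axioms]
 proof (intro conjI ballI) show "tens (I i) B \<subseteq> carrier T" by (rule tens_carrier[OF Ii(1) order_refl])
  show "\<zero> \<in> tens (I i) B" by (rule tens_zero)
  show "x \<oplus> y \<in> tens (I i) B" if "x \<in> tens (I i) B" "y \<in> tens (I i) B" for x y using that by (rule tens_add)
  fix r z assume r: "r \<in> carrier T" and z: "z \<in> tens (I i) B"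
  have zc: "z \<in> carrier T" using tens_carrier[OF Ii(1) order_refl] z by blast
  have "tens (carrier A) B \<subseteq> {r \<in> carrier T. r \<otimes> z \<in> tens (I i) B}"
  proof (rule tens_least) fix c b assume cb: "c \<in> carrier A" "b \<in> B" have "(\<alpha> c \<otimes> b) \<otimes> z \<in> tens (I i) B"
   proof (rule tens_mult_left[OF Ii(1) order_refl _ _ z])
    show "\<alpha> c \<otimes> b \<in> carrier T" using cb B_carr by simp
    fix c' b' assume cb2: "c' \<in> I i" "b' \<in> B"
    then have c': "c' \<in> carrier A" using Ii(1) by blast
    show "(\<alpha> c \<otimes> b) \<otimes> (\<alpha> c' \<otimes> b') \<in> tens (I i) B" unfolding gen_mult[OF cb c' B_carr[OF cb2(2)]]
     by (rule tens_gen[OF Ii(4)[OF cb(1) cb2(1)] Bs(6)[OF cb(2) cb2(2)]])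
   qed
   then show "\<alpha> c \<otimes> b \<in> {r \<in> carrier T. r \<otimes> z \<in> tens (I i) B}" using cb B_carr by simp
  next show "\<zero> \<in> {r \<in> carrier T. r \<otimes> z \<in> tens (I i) B}" using tens_zero zc by simp
  next
   fix x y assume "x \<in> {r \<in> carrier T. r \<otimes> z \<in> tens (I i) B}" "y \<in> {r \<in> carrier T. r \<otimes> z \<in> tens (I i) B}"
   then show "x \<oplus> y \<in> {r \<in> carrier T. r \<otimes> z \<in> tens (I i) B}" using tens_add zc by (simp add: T.l_distr)
  qed
  then show "r \<otimes> z \<in> tens (I i) B" using r T by blast
 qed
 have "tens (I i) B \<subseteq> tens (I (Suc i)) B" for i by (rule tens_mono[OF _ order_refl]) (use I in blast)
 with J obtain M where M: "\<And>i. i \<ge> M ==> tens (I i) B = tens (I M) B"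
  using left_noetherianE[OF N, of "\<lambda>i. tens (I i) B"] by blast
 have Imono: "i \<le> j ==> I i \<subseteq> I j" for i j using I lift_Suc_mono_le[of I] by blast
 have "I i \<subseteq> I M" if i: "i \<ge> M" for i
 proof fix a assume a: "a \<in> I i" then have ac: "a \<in> carrier A" using Ii(1) by blast
  have "\<alpha> a \<otimes> \<one> \<in> tens (I i) B" by (rule tens_gen[OF a Bs(3)])
  then have "\<alpha> a \<otimes> \<one> \<in> tens (I M) B" unfolding M[OF i] .
  then have "\<phi> (\<alpha> a \<otimes> \<one>) \<in> I M" by (rule slice_tens[OF _ _ _ _ order_refl \<phi>(1), rotated 4]) (fact Ii Ik)+
  then have "k \<odot>\<^bsub>A\<^esub> a \<in> I M" unfolding \<Phi>_left[OF \<phi>(1) ac T.one_closed] k(2) A.scalar_mult(2)[OF k(1) ac] .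
  then have "k' \<odot>\<^bsub>A\<^esub> (k \<odot>\<^bsub>A\<^esub> a) \<in> I M" by (rule Ik[OF k'(1)])
  then show "a \<in> I M" using A.smult_assoc1[OF k'(1) k(1) ac] k'(2) ac by simp
 qed
 then have "I i = I M" if "i \<ge> M" for i using Imono[OF that] that by blast
 then show "\<exists>N. \<forall>i\<ge>N. I i = I N" by blast
qed

end

text \<open>A slice that does not kill 1 sends \<alpha> a to a nonzero scalar multiple of a.\<close>

lemma (in slice_algebra) \<alpha>_eq_zero: assumes one: "\<one> \<noteq> \<zero>" and a: "a \<in> carrier A" "\<alpha> a = \<zero>" shows "a = \<zero>\<^bsub>A\<^esub>"
proof - obtain \<phi> where \<phi>: "\<phi> \<in> \<Phi>" "\<phi> \<one> \<noteq> \<zero>\<^bsub>A\<^esub>" using sep[OF T.one_closed] one by blast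
 obtain k where k: "k \<in> carrier K" "\<phi> \<one> = k \<odot>\<^bsub>A\<^esub> \<one>\<^bsub>A\<^esub>" using \<Phi>_B[OF \<phi>(1) subringE(3)[OF B]] by blast
 have "k \<noteq> \<zero>\<^bsub>K\<^esub>" using \<phi>(2) k by auto
 then obtain k' where k': "k' \<in> carrier K" "k' \<otimes>\<^bsub>K\<^esub> k = \<one>\<^bsub>K\<^esub>"
  using K_algebra_field[OF A.K_algebra_axioms k(1)] by blast
 have "\<phi> (\<zero> \<otimes> \<one>) = a \<otimes>\<^bsub>A\<^esub> \<phi> \<one>" using \<Phi>_left[OF \<phi>(1) a(1) T.one_closed] a(2) by simp
 moreover have "\<phi> \<zero> = \<zero>\<^bsub>A\<^esub>"
  using \<Phi>_add[OF \<phi>(1) T.zero_closed T.zero_closed] \<Phi>_closed[OF \<phi>(1) T.zero_closed] by simp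
 ultimately have "k \<odot>\<^bsub>A\<^esub> a = \<zero>\<^bsub>A\<^esub>" using k a(1) A.scalar_mult(2)[OF k(1) a(1)] by simp
 then have "k' \<odot>\<^bsub>A\<^esub> (k \<odot>\<^bsub>A\<^esub> a) = \<zero>\<^bsub>A\<^esub>" using k'(1) by simp
 then show ?thesis using A.smult_assoc1[OF k'(1) k(1) a(1)] k'(2) a(1) by simp
qed

section \<open>Separation of the points of a tensor product by functionals on one factor\<close>

section \<open>Slices separate the points of a tensor product\<close>

text \<open>A group generated by pure tensors, without reference to how it is built. The two
  instances \<open>balanced_map_t\<close> and \<open>balanced_map_r\<close> exchange the factors, so
  functionals can be applied on either side.\<close>

locale balanced_map = A: K_algebra K A + B: K_algebra K B + H: comm_group H
 for K :: "'k ring" and A :: "('k, 'a) module" and B :: "('k, 'b) module" and H :: "('h, 'm) monoid_scheme" +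
 fixes t :: "'a \<Rightarrow> 'b \<Rightarrow> 'h"
 assumes t_closed: "a \<in> carrier A ==> b \<in> carrier B ==> t a b \<in> carrier H"
  and t_add_l: "a \<in> carrier A ==> a' \<in> carrier A ==> b \<in> carrier B ==> t (a \<oplus>\<^bsub>A\<^esub> a') b = t a b \<otimes>\<^bsub>H\<^esub> t a' b"
  and t_add_r: "a \<in> carrier A ==> b \<in> carrier B ==> b' \<in> carrier B ==> t a (b \<oplus>\<^bsub>B\<^esub> b') = t a b \<otimes>\<^bsub>H\<^esub> t a b'"
  and t_balanced: "k \<in> carrier K ==> a \<in> carrier A ==> b \<in> carrier B ==> t (k \<odot>\<^bsub>A\<^esub> a) b = t a (k \<odot>\<^bsub>B\<^esub> b)"
  and H_induct: "z \<in> carrier H ==> P \<one>\<^bsub>H\<^esub> ==>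
   (\<And>a b. a \<in> carrier A ==> b \<in> carrier B ==> P (t a b)) ==>
   (\<And>x y. x \<in> carrier H ==> y \<in> carrier H ==> P x ==> P y ==> P (x \<otimes>\<^bsub>H\<^esub> y)) ==> P z"
begin

definition val :: "('a \<times> 'b) list \<Rightarrow> 'h" where "val zs = foldr (\<lambda>(a, b) z. t a b \<otimes>\<^bsub>H\<^esub> z) zs \<one>\<^bsub>H\<^esub>"

lemma val_simps [simp]: "val [] = \<one>\<^bsub>H\<^esub>" "val ((a, b) # zs) = t a b \<otimes>\<^bsub>H\<^esub> val zs" by (simp_all add: val_def)

abbreviation "ok zs \<equiv> set zs \<subseteq> carrier A \<times> carrier B"

lemma val_closed: "ok zs ==> val zs \<in> carrier H" by (induction zs) (auto simp: t_closed)

lemma val_append: "ok zs ==> ok zs' ==> val (zs @ zs') = val zs \<otimes>\<^bsub>H\<^esub> val zs'"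
 by (induction zs) (auto simp: t_closed val_closed H.m_assoc)

lemma val_surj: assumes "z \<in> carrier H" obtains zs where "ok zs" "z = val zs"
proof - have "\<exists>zs. ok zs \<and> z = val zs" proof (rule H_induct[OF assms])
  show "\<exists>zs. ok zs \<and> \<one>\<^bsub>H\<^esub> = val zs" by (rule exI[of _ "[]"]) simp
  show "\<exists>zs. ok zs \<and> t a b = val zs" if "a \<in> carrier A" "b \<in> carrier B" for a b
   by (rule exI[of _ "[(a, b)]"]) (use that t_closed in simp)
  fix x y assume "\<exists>zs. ok zs \<and> x = val zs" "\<exists>zs. ok zs \<and> y = val zs"
  then obtain zs zs' where *: "ok zs" "x = val zs" "ok zs'" "y = val zs'" by blast
  then show "\<exists>zs. ok zs \<and> x \<otimes>\<^bsub>H\<^esub> y = val zs" by (intro exI[of _ "zs @ zs'"]) (simp add: val_append)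
 qed
 then show ?thesis using that by blast
qed

lemma t_zero_l: "b \<in> carrier B ==> t \<zero>\<^bsub>A\<^esub> b = \<one>\<^bsub>H\<^esub>"
 using t_add_l[of "\<zero>\<^bsub>A\<^esub>" "\<zero>\<^bsub>A\<^esub>" b] t_closed[of "\<zero>\<^bsub>A\<^esub>" b] H.r_cancel_one[of "t \<zero>\<^bsub>A\<^esub> b" "t \<zero>\<^bsub>A\<^esub> b"]
 by simp

lemma t_zero_r: "a \<in> carrier A ==> t a \<zero>\<^bsub>B\<^esub> = \<one>\<^bsub>H\<^esub>"
 using t_add_r[of a "\<zero>\<^bsub>B\<^esub>" "\<zero>\<^bsub>B\<^esub>"] t_closed[of a "\<zero>\<^bsub>B\<^esub>"] H.r_cancel_one[of "t a \<zero>\<^bsub>B\<^esub>" "t a \<zero>\<^bsub>B\<^esub>"]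
 by simp

end

text \<open>Write an element as \<open>\<Sum> a\<^sub>i \<otimes> b\<^sub>i\<close> with as few terms as possible.  Then \<open>b\<^sub>1\<close> is not in the span
 of the other \<open>b\<^sub>i\<close>, and a functional separating it from them picks out \<open>a\<^sub>1\<close>.\<close>

lemma (in balanced_map) slices_separate: fixes g :: "'b \<Rightarrow> 'e" and D :: "('k, 'e) module"
  and f :: "'a \<Rightarrow> 'f" and D' :: "('k, 'f) module"
 assumes D: "K_algebra K D" and D': "K_algebra K D'" and g: "\<And>b. b \<in> carrier B ==> g b \<in> carrier D"
   "\<And>b b'. b \<in> carrier B ==> b' \<in> carrier B ==> g (b \<oplus>\<^bsub>B\<^esub> b') = g b \<oplus>\<^bsub>D\<^esub> g b'"
   "\<And>k b. k \<in> carrier K ==> b \<in> carrier B ==> g (k \<odot>\<^bsub>B\<^esub> b) = k \<odot>\<^bsub>D\<^esub> g b"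
   "\<And>b. b \<in> carrier B ==> g b = \<zero>\<^bsub>D\<^esub> ==> b = \<zero>\<^bsub>B\<^esub>"
  and f: "\<And>a. a \<in> carrier A ==> f a \<in> carrier D'" "\<And>a. a \<in> carrier A ==> f a = \<zero>\<^bsub>D'\<^esub> ==> a = \<zero>\<^bsub>A\<^esub>"
  and z: "z \<in> carrier H"
  and slices: "\<And>\<psi>. functional K D \<psi> ==> \<exists>F. F \<in> hom H (add_monoid D') \<and>
   (\<forall>k\<in>carrier K. \<forall>a\<in>carrier A. \<forall>b\<in>carrier B. \<psi> (g b) = k \<odot>\<^bsub>D\<^esub> \<one>\<^bsub>D\<^esub> \<longrightarrow> F (t a b) = k \<odot>\<^bsub>D'\<^esub> f a) \<and>
   F z = \<zero>\<^bsub>D'\<^esub>"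
 shows "z = \<one>\<^bsub>H\<^esub>"
proof - interpret D: K_algebra K D by fact interpret D': K_algebra K D' by fact
 \<comment> \<open>Those b for which any term a \<otimes> b can be absorbed into every sum with
   second entries \<open>bs\<close> by changing only the first entries. This is a linear subspace
   containing the members of \<open>bs\<close>, that is, what the span of \<open>bs\<close> is
   needed for.\<close>
 define W where "W bs = {b \<in> carrier B. \<forall>a\<in>carrier A. \<forall>zs. ok zs \<and> map snd zs = bs \<longrightarrow>
  (\<exists>zs'. ok zs' \<and> map snd zs' = bs \<and> t a b \<otimes>\<^bsub>H\<^esub> val zs = val zs')}" for bs
 have WD: "\<exists>zs'. ok zs' \<and> map snd zs' = bs \<and> t a b \<otimes>\<^bsub>H\<^esub> val zs = val zs'"
  if "b \<in> W bs" "a \<in> carrier A" "ok zs" "map snd zs = bs" for a b bs zs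
  using that unfolding W_def by blast
 have Wc: "b \<in> carrier B" if "b \<in> W bs" for b bs using that by (simp add: W_def)
 have W_zero: "\<zero>\<^bsub>B\<^esub> \<in> W bs" for bs unfolding W_def using t_zero_r val_closed by auto
 have W_add: "b \<oplus>\<^bsub>B\<^esub> b' \<in> W bs" if b: "b \<in> W bs" "b' \<in> W bs" for b b' bs
 proof - note c = Wc[OF b(1)] Wc[OF b(2)]
  have "\<exists>zs'. ok zs' \<and> map snd zs' = bs \<and> t a (b \<oplus>\<^bsub>B\<^esub> b') \<otimes>\<^bsub>H\<^esub> val zs = val zs'"
   if a: "a \<in> carrier A" "ok zs" "map snd zs = bs" for a zs
  proof -
   obtain zs1 where 1: "ok zs1" "map snd zs1 = bs" "t a b' \<otimes>\<^bsub>H\<^esub> val zs = val zs1" using WD[OF b(2) a] by blast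
   obtain zs2 where 2: "ok zs2" "map snd zs2 = bs" "t a b \<otimes>\<^bsub>H\<^esub> val zs1 = val zs2"
    using WD[OF b(1) a(1) 1(1,2)] by blast
   have "t a (b \<oplus>\<^bsub>B\<^esub> b') \<otimes>\<^bsub>H\<^esub> val zs = val zs2"
    unfolding 2(3)[symmetric] 1(3)[symmetric] using a(1,2) c by (simp add: t_add_r t_closed val_closed H.m_assoc)
   then show ?thesis using 2 by blast
  qed
  then show ?thesis using c by (simp add: W_def)
 qed
 have W_smult: "k \<odot>\<^bsub>B\<^esub> b \<in> W bs" if k: "k \<in> carrier K" and b: "b \<in> W bs" for k b bs
  using WD[OF b A.smult_closed[OF k]] Wc[OF b] k by (simp add: W_def t_balanced[symmetric])
 have W_mem: "b \<in> W bs" if b: "b \<in> set bs" "b \<in> carrier B" for b bs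
 proof - have "\<exists>zs'. ok zs' \<and> map snd zs' = map snd zs \<and> t a b \<otimes>\<^bsub>H\<^esub> val zs = val zs'"
   if "b \<in> snd ` set zs" "ok zs" "a \<in> carrier A" for a zs
   using that
  proof (induction zs) case (Cons ab zs) obtain a1 b1 where ab: "ab = (a1, b1)" by (rule prod.exhaust)
   have c: "a1 \<in> carrier A" "b1 \<in> carrier B" "ok zs" using Cons.prems(2) ab by auto
   note cl = t_closed[OF Cons.prems(3) b(2)] t_closed[OF c(1,2)] val_closed[OF c(3)]
   show ?case
   proof (cases "b = b1") case True have "t a b \<otimes>\<^bsub>H\<^esub> val (ab # zs) = val ((a \<oplus>\<^bsub>A\<^esub> a1, b1) # zs)"
     using cl t_add_l[OF Cons.prems(3) c(1,2)] True ab by (simp add: H.m_assoc)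
    then show ?thesis using c Cons.prems(3) ab by (intro exI[of _ "(a \<oplus>\<^bsub>A\<^esub> a1, b1) # zs"]) simp
   next case False
    then obtain zs' where zs': "ok zs'" "map snd zs' = map snd zs" "t a b \<otimes>\<^bsub>H\<^esub> val zs = val zs'"
     using Cons ab c(3) by auto
    have "t a b \<otimes>\<^bsub>H\<^esub> val (ab # zs) = val (ab # zs')"
     using cl ab by (simp add: zs'(3)[symmetric] H.m_lcomm)
    then show ?thesis using zs' c ab by (intro exI[of _ "ab # zs'"]) simp
   qed
  qed simp
  then show ?thesis using b unfolding W_def by auto
 qed
 have g_inj: "b = b'" if b: "b \<in> carrier B" "b' \<in> carrier B" "g b = g b'" for b b'
 proof - have m: "\<ominus>\<^bsub>K\<^esub> \<one>\<^bsub>K\<^esub> \<in> carrier K" by simp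
  have "g (b \<oplus>\<^bsub>B\<^esub> (\<ominus>\<^bsub>K\<^esub> \<one>\<^bsub>K\<^esub>) \<odot>\<^bsub>B\<^esub> b') = g b' \<oplus>\<^bsub>D\<^esub> (\<ominus>\<^bsub>K\<^esub> \<one>\<^bsub>K\<^esub>) \<odot>\<^bsub>D\<^esub> g b'"
   using g(2)[OF b(1) B.smult_closed[OF m b(2)]] g(3)[OF m b(2)] b(3) by simp
  also have "\<dots> = \<zero>\<^bsub>D\<^esub>" using D.smult_l_minus[of "\<one>\<^bsub>K\<^esub>" "g b'"] g(1)[OF b(2)] by (simp add: D.r_neg)
  finally have "b \<oplus>\<^bsub>B\<^esub> (\<ominus>\<^bsub>K\<^esub> \<one>\<^bsub>K\<^esub>) \<odot>\<^bsub>B\<^esub> b' = \<zero>\<^bsub>B\<^esub>" using g(4)[OF B.a_closed[OF b(1) B.smult_closed[OF m b(2)]]] by blast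
  then have "b \<oplus>\<^bsub>B\<^esub> \<ominus>\<^bsub>B\<^esub> b' = \<zero>\<^bsub>B\<^esub>" using B.smult_l_minus[of "\<one>\<^bsub>K\<^esub>" b'] b(2) by simp
  then show ?thesis using B.minus_equality[of b "\<ominus>\<^bsub>B\<^esub> b'"] b(1,2) by simp
 qed
 \<comment> \<open>Induction on the number of terms. If the first b can be absorbed, the sum gets
   shorter. Otherwise some functional is 1 at g b and 0 on the image of \<open>W\<close>; its slice
   takes z to f a, so a = 0 and the first term disappears.\<close>
 have "z = \<one>\<^bsub>H\<^esub>" if "ok zs" "z = val zs" for zs using that
 proof (induction "length zs" arbitrary: zs) case 0 then show ?case by simp
 next case (Suc n) then obtain a b zs' where zs: "zs = (a, b) # zs'" by (metis length_Suc_conv prod.exhaust)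
  have c: "a \<in> carrier A" "b \<in> carrier B" "ok zs'" "length zs' = n" using Suc zs by auto
  show ?case
  proof (cases "b \<in> W (map snd zs')") case True
   then obtain zs'' where "map snd zs'' = map snd zs'" "ok zs''" "t a b \<otimes>\<^bsub>H\<^esub> val zs' = val zs''"
    using WD[OF _ c(1,3)] by blast
   moreover from this(1) have "length zs'' = length zs'" by (rule map_eq_imp_length_eq)
   ultimately show ?thesis using Suc.hyps(1)[of zs''] c(4) Suc.prems(2) zs by simp
  next case False let ?W = "g ` W (map snd zs')"
   have "\<exists>\<psi>. functional K D \<psi> \<and> (\<forall>x\<in>?W. \<psi> x = \<zero>\<^bsub>D\<^esub>) \<and> \<psi> (g b) = \<one>\<^bsub>D\<^esub>"
   proof (rule D.exists_functional) show "?W \<subseteq> carrier D" using g(1) Wc by blast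
    have "g \<zero>\<^bsub>B\<^esub> = \<zero>\<^bsub>D\<^esub>" using g(3)[OF A.R.zero_closed B.zero_closed] g(1)[OF B.zero_closed] by simp
    then show "\<zero>\<^bsub>D\<^esub> \<in> ?W" using W_zero by (metis imageI)
    show "x \<oplus>\<^bsub>D\<^esub> y \<in> ?W" if "x \<in> ?W" "y \<in> ?W" for x y using that W_add g(2)[OF Wc Wc, symmetric] by auto
    show "k \<odot>\<^bsub>D\<^esub> x \<in> ?W" if "k \<in> carrier K" "x \<in> ?W" for k x
     using that W_smult g(3)[OF _ Wc, symmetric] by auto
    show "g b \<in> carrier D" by (rule g(1)[OF c(2)])
    show "g b \<notin> ?W" using False g_inj[OF c(2) Wc] by blast
   qed
   then obtain \<psi> where \<psi>: "functional K D \<psi>" "\<And>x. x \<in> ?W ==> \<psi> x = \<zero>\<^bsub>D\<^esub>" "\<psi> (g b) = \<one>\<^bsub>D\<^esub>" by blast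
   then obtain F where F: "F \<in> hom H (add_monoid D')" "F z = \<zero>\<^bsub>D'\<^esub>"
    "\<And>k a b. k \<in> carrier K ==> a \<in> carrier A ==> b \<in> carrier B ==> \<psi> (g b) = k \<odot>\<^bsub>D\<^esub> \<one>\<^bsub>D\<^esub> ==> F (t a b) = k \<odot>\<^bsub>D'\<^esub> f a"
    using slices[OF \<psi>(1)] by blast
   interpret F: group_hom H "add_monoid D'" F
    using F(1) D'.a_group H.is_group by (simp add: group_hom_def group_hom_axioms_def)
   have Fm: "F (x \<otimes>\<^bsub>H\<^esub> y) = F x \<oplus>\<^bsub>D'\<^esub> F y" if "x \<in> carrier H" "y \<in> carrier H" for x y
    using F.hom_mult[OF that] by simp
   have "F (val ys) = \<zero>\<^bsub>D'\<^esub>" if "set ys \<subseteq> set zs'" for ys using that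
   proof (induction ys) case Nil then show ?case using F.hom_one by simp
   next case (Cons ab ys) obtain a1 b1 where ab: "ab = (a1, b1)" by (rule prod.exhaust)
    have c1: "a1 \<in> carrier A" "b1 \<in> carrier B" "ok ys" using Cons.prems c(3) ab by auto
    have "b1 \<in> snd ` set zs'" using Cons.prems ab by force
    then have "\<psi> (g b1) = \<zero>\<^bsub>D\<^esub>" using \<psi>(2) W_mem[of b1 "map snd zs'"] c1(2) by simp
    then have "\<psi> (g b1) = \<zero>\<^bsub>K\<^esub> \<odot>\<^bsub>D\<^esub> \<one>\<^bsub>D\<^esub>" by simp
    then have "F (t a1 b1) = \<zero>\<^bsub>D'\<^esub>" using F(3)[OF A.R.zero_closed c1(1,2)] f(1)[OF c1(1)] by simp
    then show ?case using Cons Fm[OF t_closed[OF c1(1,2)] val_closed[OF c1(3)]] ab by simp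
   qed
   from this[of zs'] have "F (val zs') = \<zero>\<^bsub>D'\<^esub>" by simp
   moreover have "F (t a b) = f a" using F(3)[OF A.R.one_closed c(1,2)] \<psi>(3) f(1)[OF c(1)] by simp
   ultimately have "F z = f a"
    unfolding Suc.prems(2) zs using Fm[OF t_closed[OF c(1,2)] val_closed[OF c(3)]] f(1)[OF c(1)] by simp
   then have "a = \<zero>\<^bsub>A\<^esub>" using F(2) f(2)[OF c(1)] by simp
   then have "z = val zs'" using Suc.prems(2) zs t_zero_l[OF c(2)] val_closed[OF c(3)] by simp
   then show ?thesis using Suc.hyps(1)[of zs'] c by simp
  qed
 qed
 then show ?thesis using val_surj[OF z] by blast
qed

lemma (in tensor_product) balanced_map_t: "balanced_map K A B TG t"
proof (intro balanced_map.intro balanced_map_axioms.intro)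
 show "P z" if "z \<in> carrier TG" "P \<one>\<^bsub>TG\<^esub>" "\<And>a b. a \<in> carrier A ==> b \<in> carrier B ==> P (t a b)"
  "\<And>x y. x \<in> carrier TG ==> y \<in> carrier TG ==> P x ==> P y ==> P (x \<otimes>\<^bsub>TG\<^esub> y)" for P z
  using that by (rule TG_induct)
qed (fact A.K_algebra_axioms B.K_algebra_axioms TG.comm_group_axioms t_closed t_add_l t_add_r t_balanced)+

section \<open>Slices of the enveloping algebra along its left and right factors\<close>

section \<open>Enveloping algebras\<close>

locale enveloping = D: K_algebra K D for K :: "'k ring" and D :: "('k, 'd) module" (structure) +
 assumes nontrivial: "\<one> \<noteq> \<zero>"

sublocale enveloping \<subseteq> E: tensor_product K D "opposite D"
 by (intro tensor_product.intro D.K_algebra_axioms K_algebra_opposite)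

context enveloping
begin

abbreviation "De \<equiv> tensor_algebra K D (opposite D)"
abbreviation De_mult (infixl "\<cdot>" 70) where "x \<cdot> y \<equiv> x \<otimes>\<^bsub>De\<^esub> y"
abbreviation "\<alpha> a \<equiv> E.t a \<one>"
abbreviation "\<beta> b \<equiv> E.t \<one> b"

lemma t_closed [simp]: "a \<in> carrier D ==> b \<in> carrier D ==> E.t a b \<in> carrier E.TG" using E.t_closed by simp

lemma t_mult: "a \<in> carrier D ==> b \<in> carrier D ==> a' \<in> carrier D ==> b' \<in> carrier D ==>
  E.t a b \<cdot> E.t a' b' = E.t (a \<otimes> a') (b' \<otimes> b)"
 using E.t_mult[of a b a' b'] by simp

lemma t_factor: assumes "a \<in> carrier D" "b \<in> carrier D" shows "\<alpha> a \<cdot> \<beta> b = E.t a b" "\<beta> b \<cdot> \<alpha> a = E.t a b"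
 using t_mult[of a "\<one>" "\<one>" b] t_mult[of "\<one>" b a "\<one>"] assms by simp_all

lemma \<alpha>_hom: "\<alpha> \<in> ring_hom D De"
proof (rule ring_hom_memI) show "\<alpha> (x \<oplus> y) = \<alpha> x \<oplus>\<^bsub>De\<^esub> \<alpha> y" if "x \<in> carrier D" "y \<in> carrier D" for x y
  using E.t_add_l[OF that, of "\<one>"] by simp
 show "\<alpha> \<one> = \<one>\<^bsub>De\<^esub>" using E.T_one by simp
qed (simp_all add: t_mult)

lemma \<beta>_hom: "\<beta> \<in> ring_hom (opposite D) De"
proof (rule ring_hom_memI)
 show "\<beta> (x \<oplus>\<^bsub>opposite D\<^esub> y) = \<beta> x \<oplus>\<^bsub>De\<^esub> \<beta> y" if "x \<in> carrier (opposite D)" "y \<in> carrier (opposite D)" for x y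
  using E.t_add_r[of "\<one>" x y] that by simp
 show "\<beta> \<one>\<^bsub>opposite D\<^esub> = \<one>\<^bsub>De\<^esub>" using E.T_one by simp
qed (simp_all add: t_mult)

lemma balanced_map_r: "balanced_map K (opposite D) D E.TG (\<lambda>b a. E.t a b)"
proof (intro balanced_map.intro balanced_map_axioms.intro)
 show "P z" if "z \<in> carrier E.TG" "P \<one>\<^bsub>E.TG\<^esub>" "\<And>b a. b \<in> carrier (opposite D) ==> a \<in> carrier D ==> P (E.t a b)"
  "\<And>x y. x \<in> carrier E.TG ==> y \<in> carrier E.TG ==> P x ==> P y ==> P (x \<otimes>\<^bsub>E.TG\<^esub> y)" for P z
  using that(1,2) that(3) that(4) by (rule E.TG_induct)
qed (auto simp: D.K_algebra_axioms E.B.K_algebra_axioms E.TG.comm_group_axioms E.t_add_l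
  E.t_add_r[simplified] E.t_balanced[simplified])

text \<open>The maps a \<otimes> b \<mapsto> a \<psi>(b) and a \<otimes> b \<mapsto> \<psi>(a) b for
  an arbitrary K-linear self-map \<psi>. Scalar-valued \<psi> give the slices proper; \<psi> linear
  over a division subalgebra will describe \<open>kernel_ideal\<close>.\<close>

lemma exists_slice: assumes \<psi>: "\<And>b. b \<in> carrier D ==> \<psi> b \<in> carrier D"
  "\<And>x y. x \<in> carrier D ==> y \<in> carrier D ==> \<psi> (x \<oplus> y) = \<psi> x \<oplus> \<psi> y"
  "\<And>k x. k \<in> carrier K ==> x \<in> carrier D ==> \<psi> (k \<odot> x) = k \<odot> \<psi> x"
 shows "\<exists>F\<in>hom E.TG (add_monoid D). \<forall>a\<in>carrier D. \<forall>b\<in>carrier D. F (E.t a b) = a \<otimes> \<psi> b"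
  and "\<exists>F\<in>hom E.TG (add_monoid D). \<forall>a\<in>carrier D. \<forall>b\<in>carrier D. F (E.t a b) = \<psi> a \<otimes> b"
proof - obtain F where "F \<in> hom E.TG (add_monoid D)"
  "\<And>a b. a \<in> carrier D ==> b \<in> carrier (opposite D) ==> F (E.t a b) = a \<otimes> \<psi> b"
 proof (rule E.universal[of "add_monoid D" "\<lambda>a b. a \<otimes> \<psi> b"])
  show "comm_group (add_monoid D)" by (rule D.a_comm_group)
 qed (use \<psi> in \<open>auto simp: D.l_distr D.r_distr D.smult_mult_left D.smult_mult_right[symmetric]\<close>)
 then show "\<exists>F\<in>hom E.TG (add_monoid D). \<forall>a\<in>carrier D. \<forall>b\<in>carrier D. F (E.t a b) = a \<otimes> \<psi> b" by auto
 obtain F where "F \<in> hom E.TG (add_monoid D)"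
  "\<And>a b. a \<in> carrier D ==> b \<in> carrier (opposite D) ==> F (E.t a b) = \<psi> a \<otimes> b"
 proof (rule E.universal[of "add_monoid D" "\<lambda>a b. \<psi> a \<otimes> b"])
  show "comm_group (add_monoid D)" by (rule D.a_comm_group)
 qed (use \<psi> in \<open>auto simp: D.l_distr D.r_distr D.smult_mult_left D.smult_mult_right[symmetric]\<close>)
 then show "\<exists>F\<in>hom E.TG (add_monoid D). \<forall>a\<in>carrier D. \<forall>b\<in>carrier D. F (E.t a b) = \<psi> a \<otimes> b" by auto
qed

definition \<Phi>l where "\<Phi>l = {F \<in> hom E.TG (add_monoid D).
  \<exists>\<psi>. functional K D \<psi> \<and> (\<forall>a\<in>carrier D. \<forall>b\<in>carrier D. F (E.t a b) = a \<otimes> \<psi> b)}"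

definition \<Phi>r where "\<Phi>r = {F \<in> hom E.TG (add_monoid D).
  \<exists>\<psi>. functional K D \<psi> \<and> (\<forall>a\<in>carrier D. \<forall>b\<in>carrier D. F (E.t a b) = \<psi> a \<otimes> b)}"

lemma functional_carrier: "functional K D \<psi> ==> b \<in> carrier D ==> \<psi> b \<in> carrier D"
 using functionalD(1)[of K D \<psi> b] by auto

lemma functional_central: assumes "functional K D \<psi>" "b \<in> carrier D" "a \<in> carrier D" shows "a \<otimes> \<psi> b = \<psi> b \<otimes> a"
proof - obtain k where k: "k \<in> carrier K" "\<psi> b = k \<odot> \<one>" using functionalD(1)[OF assms(1,2)] by blast
 show ?thesis unfolding k(2) D.scalar_mult[OF k(1) assms(3)] ..
qed

lemma exists_\<Phi>l: assumes "functional K D \<psi>"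
 obtains F where "F \<in> \<Phi>l" "\<And>a b. a \<in> carrier D ==> b \<in> carrier D ==> F (E.t a b) = a \<otimes> \<psi> b"
proof - have "\<exists>F\<in>hom E.TG (add_monoid D). \<forall>a\<in>carrier D. \<forall>b\<in>carrier D. F (E.t a b) = a \<otimes> \<psi> b"
  by (rule exists_slice(1)) (rule functional_carrier[OF assms] functionalD(2,3)[OF assms]; assumption)+
 then obtain F where F: "F \<in> hom E.TG (add_monoid D)"
  "\<forall>a\<in>carrier D. \<forall>b\<in>carrier D. F (E.t a b) = a \<otimes> \<psi> b" by (rule bexE)
 have "F \<in> \<Phi>l" unfolding \<Phi>l_def using F assms by blast
 then show ?thesis using that[of F] F(2) by simp
qed

lemma exists_\<Phi>r: assumes "functional K D \<psi>"
 obtains F where "F \<in> \<Phi>r" "\<And>a b. a \<in> carrier D ==> b \<in> carrier D ==> F (E.t a b) = \<psi> a \<otimes> b"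
proof - have "\<exists>F\<in>hom E.TG (add_monoid D). \<forall>a\<in>carrier D. \<forall>b\<in>carrier D. F (E.t a b) = \<psi> a \<otimes> b"
  by (rule exists_slice(2)) (rule functional_carrier[OF assms] functionalD(2,3)[OF assms]; assumption)+
 then obtain F where F: "F \<in> hom E.TG (add_monoid D)"
  "\<forall>a\<in>carrier D. \<forall>b\<in>carrier D. F (E.t a b) = \<psi> a \<otimes> b" by (rule bexE)
 have "F \<in> \<Phi>r" unfolding \<Phi>r_def using F assms by blast
 then show ?thesis using that[of F] F(2) by simp
qed

lemma slice_hom: assumes "F \<in> hom E.TG (add_monoid D)" shows "x \<in> carrier E.TG ==> F x \<in> carrier D"
  "x \<in> carrier E.TG ==> y \<in> carrier E.TG ==> F (x \<otimes>\<^bsub>E.TG\<^esub> y) = F x \<oplus> F y"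
  "F \<one>\<^bsub>E.TG\<^esub> = \<zero>"
proof - show "x \<in> carrier E.TG ==> F x \<in> carrier D" using assms by (auto simp: hom_def)
 show "x \<in> carrier E.TG ==> y \<in> carrier E.TG ==> F (x \<otimes>\<^bsub>E.TG\<^esub> y) = F x \<oplus> F y" using assms by (auto simp: hom_def)
 show "F \<one>\<^bsub>E.TG\<^esub> = \<zero>" using hom_one[OF assms E.TG.is_group D.a_group] by simp
qed

lemma slice_l_mult: assumes F: "F \<in> \<Phi>l" and a: "a \<in> carrier D" and z: "z \<in> carrier E.TG"
 shows "F (\<alpha> a \<cdot> z) = a \<otimes> F z" "F (z \<cdot> \<alpha> a) = F z \<otimes> a"
proof - obtain \<psi> where \<psi>: "functional K D \<psi>" "\<And>a b. a \<in> carrier D ==> b \<in> carrier D ==> F (E.t a b) = a \<otimes> \<psi> b"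
  and Fh: "F \<in> hom E.TG (add_monoid D)" using F unfolding \<Phi>l_def by blast
 note h = slice_hom[OF Fh]
 have aT: "\<alpha> a \<in> carrier E.TG" using a by simp
 note Tcl = E.T_mult_closed
 have "F (\<alpha> a \<cdot> z) = a \<otimes> F z \<and> F (z \<cdot> \<alpha> a) = F z \<otimes> a" using z
 proof (induction z rule: E.TG_induct) case one then show ?case using E.T_null[OF aT] h(3) a by simp
 next case (gen b c) then have gen: "b \<in> carrier D" "c \<in> carrier D" by simp_all
  note p = functional_carrier[OF \<psi>(1) gen(2)]
  have "F (\<alpha> a \<cdot> E.t b c) = a \<otimes> F (E.t b c)" using a gen p by (simp add: t_mult \<psi>(2) D.m_assoc)
  moreover have "F (E.t b c \<cdot> \<alpha> a) = F (E.t b c) \<otimes> a"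
   using a gen p functional_central[OF \<psi>(1) gen(2) a] by (simp add: t_mult \<psi>(2) D.m_assoc)
  ultimately show ?case ..
 next case (add x y) then show ?case using aT a h(1)[of x] h(1)[of y] Tcl
   by (simp add: E.T_l_distr E.T_r_distr h(2) D.l_distr D.r_distr)
 qed
 then show "F (\<alpha> a \<cdot> z) = a \<otimes> F z" "F (z \<cdot> \<alpha> a) = F z \<otimes> a" by blast+
qed

lemma slice_r_mult: assumes F: "F \<in> \<Phi>r" and a: "a \<in> carrier D" and z: "z \<in> carrier E.TG"
 shows "F (\<beta> a \<cdot> z) = F z \<otimes> a" "F (z \<cdot> \<beta> a) = a \<otimes> F z"
proof - obtain \<psi> where \<psi>: "functional K D \<psi>" "\<And>a b. a \<in> carrier D ==> b \<in> carrier D ==> F (E.t a b) = \<psi> a \<otimes> b"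
  and Fh: "F \<in> hom E.TG (add_monoid D)" using F unfolding \<Phi>r_def by blast
 note h = slice_hom[OF Fh]
 have aT: "\<beta> a \<in> carrier E.TG" using a by simp
 note Tcl = E.T_mult_closed
 have "F (\<beta> a \<cdot> z) = F z \<otimes> a \<and> F (z \<cdot> \<beta> a) = a \<otimes> F z" using z
 proof (induction z rule: E.TG_induct) case one then show ?case using E.T_null[OF aT] h(3) a by simp
 next case (gen b c) then have gen: "b \<in> carrier D" "c \<in> carrier D" by simp_all
  note p = functional_carrier[OF \<psi>(1) gen(1)]
  have "F (\<beta> a \<cdot> E.t b c) = F (E.t b c) \<otimes> a" using a gen p by (simp add: t_mult \<psi>(2) D.m_assoc)
  moreover have "F (E.t b c \<cdot> \<beta> a) = \<psi> b \<otimes> a \<otimes> c" using a gen p by (simp add: t_mult \<psi>(2) D.m_assoc)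
  then have "F (E.t b c \<cdot> \<beta> a) = a \<otimes> F (E.t b c)"
   using a gen p functional_central[OF \<psi>(1) gen(1) a, symmetric] by (simp add: \<psi>(2) D.m_assoc)
  ultimately show ?case ..
 next case (add x y) then show ?case using aT a h(1)[of x] h(1)[of y] Tcl
   by (simp add: E.T_l_distr E.T_r_distr h(2) D.l_distr D.r_distr)
 qed
 then show "F (\<beta> a \<cdot> z) = F z \<otimes> a" "F (z \<cdot> \<beta> a) = a \<otimes> F z" by blast+
qed

lemma sep_l: assumes z: "z \<in> carrier E.TG" and 0: "\<And>F. F \<in> \<Phi>l ==> F z = \<zero>" shows "z = \<one>\<^bsub>E.TG\<^esub>"
proof (rule balanced_map.slices_separate[OF E.balanced_map_t D.K_algebra_axioms D.K_algebra_axioms, of "\<lambda>b. b" "\<lambda>a. a"])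
 fix \<psi> assume \<psi>: "functional K D \<psi>"
 obtain F where F: "F \<in> \<Phi>l" "\<And>a b. a \<in> carrier D ==> b \<in> carrier D ==> F (E.t a b) = a \<otimes> \<psi> b"
  using exists_\<Phi>l[OF \<psi>] by blast
 show "\<exists>F. F \<in> hom E.TG (add_monoid D) \<and> (\<forall>k\<in>carrier K. \<forall>a\<in>carrier D. \<forall>b\<in>carrier (opposite D).
   \<psi> b = k \<odot> \<one> \<longrightarrow> F (E.t a b) = k \<odot> a) \<and> F z = \<zero>"
 proof (intro exI[of _ F] conjI ballI impI)
  show "F \<in> hom E.TG (add_monoid D)" using F(1) unfolding \<Phi>l_def by blast
  show "F z = \<zero>" by (rule 0[OF F(1)])
  fix k a b assume k: "k \<in> carrier K" "a \<in> carrier D" "b \<in> carrier (opposite D)" "\<psi> b = k \<odot> \<one>"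
  show "F (E.t a b) = k \<odot> a" using F(2)[of a b] D.scalar_mult(2)[OF k(1,2)] k(2,3,4) by simp
 qed
qed (use z in simp_all)

lemma sep_r: assumes z: "z \<in> carrier E.TG" and 0: "\<And>F. F \<in> \<Phi>r ==> F z = \<zero>" shows "z = \<one>\<^bsub>E.TG\<^esub>"
proof (rule balanced_map.slices_separate[OF balanced_map_r D.K_algebra_axioms D.K_algebra_axioms, of "\<lambda>b. b" "\<lambda>a. a"])
 fix \<psi> assume \<psi>: "functional K D \<psi>"
 obtain F where F: "F \<in> \<Phi>r" "\<And>a b. a \<in> carrier D ==> b \<in> carrier D ==> F (E.t a b) = \<psi> a \<otimes> b"
  using exists_\<Phi>r[OF \<psi>] by blast
 show "\<exists>F. F \<in> hom E.TG (add_monoid D) \<and> (\<forall>k\<in>carrier K. \<forall>a\<in>carrier (opposite D). \<forall>b\<in>carrier D.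
   \<psi> b = k \<odot> \<one> \<longrightarrow> F (E.t b a) = k \<odot> a) \<and> F z = \<zero>"
 proof (intro exI[of _ F] conjI ballI impI)
  show "F \<in> hom E.TG (add_monoid D)" using F(1) unfolding \<Phi>r_def by blast
  show "F z = \<zero>" by (rule 0[OF F(1)])
  fix k a b assume k: "k \<in> carrier K" "a \<in> carrier (opposite D)" "b \<in> carrier D" "\<psi> b = k \<odot> \<one>"
  show "F (E.t b a) = k \<odot> a" using F(2)[of b a] D.scalar_mult(1)[of k a] k by simp
 qed
qed (use z in simp_all)

lemma \<beta>_image_subring: "subring C D ==> subring (\<beta> ` C) De"
proof - assume C: "subring C D" interpret \<beta>: ring_hom_ring "opposite D" De \<beta>
  by (rule ring_hom_ringI2[OF E.B.ring_axioms E.T.ring_axioms \<beta>_hom])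
 show ?thesis by (rule \<beta>.img_is_subring[OF subring_opposite[OF D.ring_axioms C]])
qed

lemma \<alpha>_image_subring: "subring C D ==> subring (\<alpha> ` C) De"
proof - assume C: "subring C D" interpret \<alpha>: ring_hom_ring D De \<alpha>
  by (rule ring_hom_ringI2[OF D.ring_axioms E.T.ring_axioms \<alpha>_hom])
 show ?thesis by (rule \<alpha>.img_is_subring[OF C])
qed

text \<open>One ring carries two slice structures: \<open>sl\<close> for the left factor D with the
  right factor as coefficients, and \<open>sr\<close> for the right factor, an opposite algebra,
  with the left factor as coefficients. This allows Ore variables to be adjoined on either
  side.\<close>

sublocale sl: slice_algebra K D De \<alpha> "\<beta> ` carrier D" \<Phi>l
proof (intro slice_algebra.intro slice_algebra_axioms.intro)
 show "subring (\<beta> ` carrier D) De" by (rule \<beta>_image_subring[OF D.carrier_is_subring])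
 show "\<alpha> a \<cdot> b = b \<cdot> \<alpha> a" if "a \<in> carrier D" "b \<in> \<beta> ` carrier D" for a b using that t_factor by auto
 fix \<phi> assume \<phi>: "\<phi> \<in> \<Phi>l"
 then obtain \<psi> where \<psi>: "functional K D \<psi>" "\<And>a b. a \<in> carrier D ==> b \<in> carrier D ==> \<phi> (E.t a b) = a \<otimes> \<psi> b"
  and \<phi>h: "\<phi> \<in> hom E.TG (add_monoid D)" unfolding \<Phi>l_def by blast
 show "\<phi> z \<in> carrier D" if "z \<in> carrier De" for z using slice_hom(1)[OF \<phi>h] that by simp
 show "\<phi> (z \<oplus>\<^bsub>De\<^esub> z') = \<phi> z \<oplus> \<phi> z'" if "z \<in> carrier De" "z' \<in> carrier De" for z z'
  using slice_hom(2)[OF \<phi>h] that by simp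
 show "\<phi> (\<alpha> a \<cdot> z) = a \<otimes> \<phi> z" "\<phi> (z \<cdot> \<alpha> a) = \<phi> z \<otimes> a" if "a \<in> carrier D" "z \<in> carrier De" for a z
  using slice_l_mult[OF \<phi> that(1)] that(2) by simp_all
 show "\<exists>k\<in>carrier K. \<phi> b = k \<odot> \<one>" if b: "b \<in> \<beta> ` carrier D" for b
 proof - obtain c where c: "c \<in> carrier D" "b = \<beta> c" using b by blast
  have "\<phi> b = \<psi> c" unfolding c(2) using c(1) functional_carrier[OF \<psi>(1) c(1)] by (simp add: \<psi>(2))
  then show ?thesis using functionalD(1)[OF \<psi>(1) c(1)] by simp
 qed
next show "z = \<zero>\<^bsub>De\<^esub>" if "z \<in> carrier De" "\<And>\<phi>. \<phi> \<in> \<Phi>l ==> \<phi> z = \<zero>" for z using sep_l that by simp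
qed (fact D.K_algebra_axioms E.T.ring_axioms \<alpha>_hom)+

sublocale sr: slice_algebra K "opposite D" De \<beta> "\<alpha> ` carrier D" \<Phi>r
proof (intro slice_algebra.intro slice_algebra_axioms.intro)
 show "subring (\<alpha> ` carrier D) De" by (rule \<alpha>_image_subring[OF D.carrier_is_subring])
 show "\<beta> a \<cdot> b = b \<cdot> \<beta> a" if "a \<in> carrier (opposite D)" "b \<in> \<alpha> ` carrier D" for a b
  using that t_factor by auto
 fix \<phi> assume \<phi>: "\<phi> \<in> \<Phi>r"
 then obtain \<psi> where \<psi>: "functional K D \<psi>" "\<And>a b. a \<in> carrier D ==> b \<in> carrier D ==> \<phi> (E.t a b) = \<psi> a \<otimes> b"
  and \<phi>h: "\<phi> \<in> hom E.TG (add_monoid D)" unfolding \<Phi>r_def by blast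
 show "\<phi> z \<in> carrier (opposite D)" if "z \<in> carrier De" for z using slice_hom(1)[OF \<phi>h] that by simp
 show "\<phi> (z \<oplus>\<^bsub>De\<^esub> z') = \<phi> z \<oplus>\<^bsub>opposite D\<^esub> \<phi> z'" if "z \<in> carrier De" "z' \<in> carrier De" for z z'
  using slice_hom(2)[OF \<phi>h] that by simp
 show "\<phi> (\<beta> a \<cdot> z) = a \<otimes>\<^bsub>opposite D\<^esub> \<phi> z" "\<phi> (z \<cdot> \<beta> a) = \<phi> z \<otimes>\<^bsub>opposite D\<^esub> a"
  if "a \<in> carrier (opposite D)" "z \<in> carrier De" for a z
  using slice_r_mult[OF \<phi>, of a z] that by simp_all
 show "\<exists>k\<in>carrier K. \<phi> b = k \<odot>\<^bsub>opposite D\<^esub> \<one>\<^bsub>opposite D\<^esub>" if b: "b \<in> \<alpha> ` carrier D" for b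
 proof - obtain c where c: "c \<in> carrier D" "b = \<alpha> c" using b by blast
  have "\<phi> b = \<psi> c" unfolding c(2) using c(1) functional_carrier[OF \<psi>(1) c(1)] by (simp add: \<psi>(2))
  then show ?thesis using functionalD(1)[OF \<psi>(1) c(1)] by simp
 qed
next show "z = \<zero>\<^bsub>De\<^esub>" if "z \<in> carrier De" "\<And>\<phi>. \<phi> \<in> \<Phi>r ==> \<phi> z = \<zero>\<^bsub>opposite D\<^esub>" for z using sep_r that by simp
qed (fact E.B.K_algebra_axioms E.T.ring_axioms \<beta>_hom)+

end

lemma (in ring) a_eq_if_minus_zero: "x \<in> carrier R ==> y \<in> carrier R ==> x \<oplus> \<ominus> y = \<zero> ==> x = y"
 using minus_equality[of x "\<ominus> y"] by (simp add: minus_minus)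

section \<open>Division subalgebras and homomorphic images inside a division algebra\<close>

section \<open>Subalgebras of division algebras\<close>

lemma K_algebra_subalgebra: assumes A: "K_algebra K A" and B: "K_subalgebra K A B"
 shows "K_algebra K (A\<lparr>carrier := B\<rparr>)"
proof - interpret A: K_algebra K A by fact note Bs = K_subalgebraE[OF B]
 have Bc: "b \<in> carrier A" if "b \<in> B" for b using Bs(2) that by blast
 interpret B: ring "A\<lparr>carrier := B\<rparr>" by (rule A.subring_is_ring[OF Bs(1)])
 have "module K (A\<lparr>carrier := B\<rparr>)" by (rule moduleI)
   (simp_all add: A.R.cring_axioms B.abelian_group_axioms Bs(5) Bc A.smult_l_distr A.smult_r_distr A.smult_assoc1)
 then show ?thesis by (intro K_algebra.intro K_algebra_axioms.intro)
   (simp_all add: B.ring_axioms A.K_field A.smult_mult_left A.smult_mult_right Bc)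
qed

lemma (in K_algebra) division_cancel:
 assumes U: "Units A = carrier A - {\<zero>\<^bsub>A\<^esub>}" and c: "x \<in> carrier A" "y \<in> carrier A" and 0: "x \<otimes>\<^bsub>A\<^esub> y = \<zero>\<^bsub>A\<^esub>"
 shows "x = \<zero>\<^bsub>A\<^esub> \<or> y = \<zero>\<^bsub>A\<^esub>"
proof (rule ccontr) assume "\<not> (x = \<zero>\<^bsub>A\<^esub> \<or> y = \<zero>\<^bsub>A\<^esub>)" then have "x \<in> Units A" "y \<in> Units A" using c U by blast+
 then have "x \<otimes>\<^bsub>A\<^esub> y \<in> Units A" by (rule Units_m_closed)
 then show False using 0 U by blast
qed

lemma division_subalgebraE: assumes "division_subalgebra K D E"
 shows "K_subalgebra K D E" "subring E D" "\<one>\<^bsub>D\<^esub> \<noteq> \<zero>\<^bsub>D\<^esub>"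
  "\<And>e. e \<in> E ==> e \<noteq> \<zero>\<^bsub>D\<^esub> ==> \<exists>e'\<in>E. e' \<otimes>\<^bsub>D\<^esub> e = \<one>\<^bsub>D\<^esub> \<and> e \<otimes>\<^bsub>D\<^esub> e' = \<one>\<^bsub>D\<^esub>"
proof - show K: "K_subalgebra K D E" using assms by (simp add: division_subalgebra_def)
 then show S: "subring E D" by (simp add: K_subalgebra_def)
 have U: "Units (D\<lparr>carrier := E\<rparr>) = E - {\<zero>\<^bsub>D\<^esub>}"
  using assms by (simp add: division_subalgebra_def division_algebra_def)
 interpret E: K_algebra K "D\<lparr>carrier := E\<rparr>"
  using assms by (simp add: division_subalgebra_def division_algebra_def)
 have "\<one>\<^bsub>D\<^esub> \<in> Units (D\<lparr>carrier := E\<rparr>)" using E.Units_one_closed by simp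
 then show "\<one>\<^bsub>D\<^esub> \<noteq> \<zero>\<^bsub>D\<^esub>" unfolding U by blast
 show "\<exists>e'\<in>E. e' \<otimes>\<^bsub>D\<^esub> e = \<one>\<^bsub>D\<^esub> \<and> e \<otimes>\<^bsub>D\<^esub> e' = \<one>\<^bsub>D\<^esub>" if "e \<in> E" "e \<noteq> \<zero>\<^bsub>D\<^esub>" for e
 proof - have "e \<in> Units (D\<lparr>carrier := E\<rparr>)" unfolding U using that by blast
  then show ?thesis by (auto simp: Units_def)
 qed
qed

lemma division_subalgebraI: assumes D: "K_algebra K D" and E: "K_subalgebra K D E" and one: "\<one>\<^bsub>D\<^esub> \<noteq> \<zero>\<^bsub>D\<^esub>"
  and inv: "\<And>e. e \<in> E ==> e \<noteq> \<zero>\<^bsub>D\<^esub> ==> \<exists>e'\<in>E. e' \<otimes>\<^bsub>D\<^esub> e = \<one>\<^bsub>D\<^esub> \<and> e \<otimes>\<^bsub>D\<^esub> e' = \<one>\<^bsub>D\<^esub>"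
 shows "division_subalgebra K D E"
proof - interpret D: K_algebra K D by fact note Es = K_subalgebraE[OF E]
 have "Units (D\<lparr>carrier := E\<rparr>) = E - {\<zero>\<^bsub>D\<^esub>}"
 proof (intro equalityI subsetI) fix e assume "e \<in> Units (D\<lparr>carrier := E\<rparr>)"
  then obtain e' where e: "e \<in> E" "e' \<in> E" "e' \<otimes>\<^bsub>D\<^esub> e = \<one>\<^bsub>D\<^esub>" by (auto simp: Units_def)
  have "e' \<in> carrier D" using e(2) Es(2) by blast
  then show "e \<in> E - {\<zero>\<^bsub>D\<^esub>}" using e one by auto
 next fix e assume "e \<in> E - {\<zero>\<^bsub>D\<^esub>}"
  then show "e \<in> Units (D\<lparr>carrier := E\<rparr>)" using inv[of e] by (auto simp: Units_def)
 qed
 then show ?thesis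
  using K_algebra_subalgebra[OF D E] E by (simp add: division_subalgebra_def division_algebra_def)
qed

lemma algebra_hom_image_subalgebra:
 assumes "K_algebra K A" "K_algebra K D" "h \<in> algebra_hom K A D" "K_subalgebra K A C"
 shows "K_subalgebra K D (h ` C)"
proof - interpret A: K_algebra K A by fact interpret D: K_algebra K D by fact
 have h: "h \<in> ring_hom A D" "\<And>k a. k \<in> carrier K ==> a \<in> carrier A ==> h (k \<odot>\<^bsub>A\<^esub> a) = k \<odot>\<^bsub>D\<^esub> h a"
  using assms(3) by (auto simp: algebra_hom_def)
 interpret h: ring_hom_ring A D h by (rule ring_hom_ringI2[OF A.ring_axioms D.ring_axioms h(1)])
 note Cs = K_subalgebraE[OF assms(4)]
 have "k \<odot>\<^bsub>D\<^esub> h c \<in> h ` C" if "k \<in> carrier K" "c \<in> C" for k c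
 proof - have "h (k \<odot>\<^bsub>A\<^esub> c) \<in> h ` C" using Cs(5)[OF that] by (rule imageI)
  then show ?thesis using h(2)[OF that(1)] Cs(2) that(2) by (simp add: subset_iff)
 qed
 then show ?thesis using h.img_is_subring[OF Cs(1)] unfolding K_subalgebra_def by blast
qed

section \<open>From left independence of powers to two-sided freeness of an Ore variable\<close>

section \<open>Ore extensions\<close>

lemma ore_free_image: assumes R': "ring R'" and h: "h \<in> ring_hom R R'" and inj: "inj_on h (carrier R)"
  and O: "ore_free R S S' x"
 shows "ore_free R' (h ` S) (h ` S') (h x)"
proof - interpret O: ore_free R S S' x by fact interpret R': ring R' by fact
 interpret h: ring_hom_ring R R' h by (rule ring_hom_ringI2[OF O.ring_axioms R' h])
 have h0: "a = \<zero>\<^bsub>R\<^esub>" if "a \<in> carrier R" "h a = \<zero>\<^bsub>R'\<^esub>" for a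
  using inj that h.hom_zero O.zero_closed by (metis inj_onD)
 have Sc: "s \<in> carrier R" if "s \<in> S" for s using O.S_carr that by blast
 have S'c: "s \<in> carrier R" if "s \<in> S'" for s using O.S'_carr that by blast
 note xc = O.x_carr
 have mem: "a \<in> S" if "a \<in> carrier R" "h a \<in> h ` S" for a using inj that Sc by (metis imageE inj_onD)
 show ?thesis
 proof (intro ore_free.intro ore_generated.intro ore_generated_axioms.intro ore_free_axioms.intro)
  show "ring R'" by fact
  show "subring (h ` S) R'" "subring (h ` S') R'" by (rule h.img_is_subring O.S O.S')+
  show "h ` S \<subseteq> h ` S'" using O.SS' by (rule image_mono)
  show "h x \<in> h ` S'" using O.xS' by (rule imageI)
  show "\<exists>s'\<in>h ` S. \<exists>s''\<in>h ` S. h x \<otimes>\<^bsub>R'\<^esub> s = s' \<otimes>\<^bsub>R'\<^esub> h x \<oplus>\<^bsub>R'\<^esub> s''" if s: "s \<in> h ` S" for s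
  proof - obtain a where a: "a \<in> S" "s = h a" using s by blast
   obtain b c where bc: "b \<in> S" "c \<in> S" "x \<otimes>\<^bsub>R\<^esub> a = b \<otimes>\<^bsub>R\<^esub> x \<oplus>\<^bsub>R\<^esub> c" using O.comm_l[OF a(1)] by blast
   have "h x \<otimes>\<^bsub>R'\<^esub> s = h (x \<otimes>\<^bsub>R\<^esub> a)" using a Sc xc by simp
   also have "\<dots> = h b \<otimes>\<^bsub>R'\<^esub> h x \<oplus>\<^bsub>R'\<^esub> h c" unfolding bc(3) using bc(1,2) Sc xc by simp
   finally show ?thesis using bc(1,2) by blast
  qed
  show "\<exists>s'\<in>h ` S. \<exists>s''\<in>h ` S. s \<otimes>\<^bsub>R'\<^esub> h x = h x \<otimes>\<^bsub>R'\<^esub> s' \<oplus>\<^bsub>R'\<^esub> s''" if s: "s \<in> h ` S" for s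
  proof - obtain a where a: "a \<in> S" "s = h a" using s by blast
   obtain b c where bc: "b \<in> S" "c \<in> S" "a \<otimes>\<^bsub>R\<^esub> x = x \<otimes>\<^bsub>R\<^esub> b \<oplus>\<^bsub>R\<^esub> c" using O.comm_r[OF a(1)] by blast
   have "s \<otimes>\<^bsub>R'\<^esub> h x = h (a \<otimes>\<^bsub>R\<^esub> x)" using a Sc xc by simp
   also have "\<dots> = h x \<otimes>\<^bsub>R'\<^esub> h b \<oplus>\<^bsub>R'\<^esub> h c" unfolding bc(3) using bc(1,2) Sc xc by simp
   finally show ?thesis using bc(1,2) by blast
  qed
  show "h ` S' \<subseteq> C" if C: "subring C R'" "h ` S \<subseteq> C" "h x \<in> C" for C
  proof - note Cs = subringE[OF C(1)] have "subring {a \<in> carrier R. h a \<in> C} R"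
    by (rule O.subringI) (use Cs in auto)
   moreover have "S \<subseteq> {a \<in> carrier R. h a \<in> C}" using Sc C(2) by blast
   moreover have "x \<in> {a \<in> carrier R. h a \<in> C}" using xc C(3) by blast
   ultimately have "S' \<subseteq> {a \<in> carrier R. h a \<in> C}" by (rule O.gen)
   then show ?thesis by blast
  qed
  show "g = \<zero>\<^bsub>R'\<^esub>" if g: "g \<in> h ` S'" "h x \<otimes>\<^bsub>R'\<^esub> g \<in> h ` S" for g
  proof - obtain a where a: "a \<in> S'" "g = h a" using g(1) by blast
   have "h (x \<otimes>\<^bsub>R\<^esub> a) \<in> h ` S" using g(2) a S'c xc by simp
   then have "x \<otimes>\<^bsub>R\<^esub> a \<in> S" using mem O.m_closed[OF xc S'c[OF a(1)]] by blast
   then show ?thesis using O.free_l[OF a(1)] a(2) h.hom_zero by simp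
  qed
  show "g = \<zero>\<^bsub>R'\<^esub>" if g: "g \<in> h ` S'" "g \<otimes>\<^bsub>R'\<^esub> h x \<in> h ` S" for g
  proof - obtain a where a: "a \<in> S'" "g = h a" using g(1) by blast
   have "h (a \<otimes>\<^bsub>R\<^esub> x) \<in> h ` S" using g(2) a S'c xc by simp
   then have "a \<otimes>\<^bsub>R\<^esub> x \<in> S" using mem O.m_closed[OF S'c[OF a(1)] xc] by blast
   then show ?thesis using O.free_r[OF a(1)] a(2) h.hom_zero by simp
  qed
 qed
qed

text \<open>Uses the right-hand Horner form, because freeness of an Ore extension is stated for
  coefficients to the left of the powers.\<close>

lemma (in ore_generated) F_left_coefficients: assumes "g \<in> F (Suc n)"
 shows "\<exists>c. (\<forall>i\<le>n. c i \<in> S) \<and> g = (\<Oplus>i\<in>{..n}. c i \<otimes> x [^] i)"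
 using assms
proof (induction n arbitrary: g) case 0 then have "g \<in> S" by (simp add: F_one)
 then show ?case by (intro exI[of _ "\<lambda>_. g"]) simp
next case (Suc n) obtain h s where h: "h \<in> F (Suc n)" "s \<in> S" "g = h \<otimes> x \<oplus> s"
  using Suc.prems unfolding F_Suc_right[of "Suc n"] by blast
 obtain c where c: "\<forall>i\<le>n. c i \<in> S" "h = (\<Oplus>i\<in>{..n}. c i \<otimes> x [^] i)" using Suc.IH[OF h(1)] by blast
 define d where "d i = (case i of 0 \<Rightarrow> s | Suc j \<Rightarrow> c j)" for i
 have dS: "\<forall>i\<le>Suc n. d i \<in> S" using c(1) h(2) by (auto simp: d_def split: nat.split)
 have cc: "(\<lambda>i. c i \<otimes> x [^] i) \<in> {..n} \<rightarrow> carrier R" using c(1) by auto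
 have dc: "(\<lambda>i. d i \<otimes> x [^] i) \<in> {..Suc n} \<rightarrow> carrier R" using dS by auto
 have "(\<Oplus>i\<in>{..Suc n}. d i \<otimes> x [^] i) = (\<Oplus>i\<in>{..n}. d (Suc i) \<otimes> x [^] (Suc i)) \<oplus> d 0 \<otimes> x [^] (0::nat)"
  by (rule finsum_Suc2[OF dc])
 also have "(\<Oplus>i\<in>{..n}. d (Suc i) \<otimes> x [^] (Suc i)) = (\<Oplus>i\<in>{..n}. (c i \<otimes> x [^] i) \<otimes> x)"
  by (rule finsum_cong') (use c(1) in \<open>auto simp: d_def m_assoc\<close>)
 also have "\<dots> = h \<otimes> x" unfolding c(2) by (rule finsum_ldistr[symmetric]) (use cc in auto)
 finally have "g = (\<Oplus>i\<in>{..Suc n}. d i \<otimes> x [^] i)" using h(2,3) by (simp add: d_def)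
 then show ?case using dS by blast
qed

text \<open>Left independence of the powers yields \<open>free_r\<close> directly. The other side
  uses \<open>twist\<close>: the leading coefficient r' of xr vanishes only when r does. For an Ore
  extension r' is \<sigma> r, and injectivity of \<sigma> provides this.\<close>

lemma (in ore_generated) ore_freeI:
 assumes free: "\<And>(m :: nat) c. (\<And>i. i \<le> m ==> c i \<in> S) ==> (\<Oplus>i\<in>{..m}. c i \<otimes> x [^] i) = \<zero> ==>
   (\<And>i. i \<le> m ==> c i = \<zero>)"
  and twist: "\<And>r. r \<in> S ==> \<exists>r'\<in>S. \<exists>r''\<in>S. x \<otimes> r = r' \<otimes> x \<oplus> r'' \<and> (r' = \<zero> \<longrightarrow> r = \<zero>)"
 shows "ore_free R S S' x"
proof - have free_r: "g = \<zero>" if g: "g \<in> S'" "g \<otimes> x \<in> S" for g proof -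
  obtain n where "g \<in> F n" using S'_F[OF g(1)] by blast
  then have "g \<in> F (Suc n)" by (rule F_Suc)
  then obtain c where c: "\<forall>i\<le>n. c i \<in> S" "g = (\<Oplus>i\<in>{..n}. c i \<otimes> x [^] i)" using F_left_coefficients by blast
  \<comment> \<open>With constant term -gx, which lies in \<open>S\<close> by assumption, the
    coefficients of gx are completed to a vanishing polynomial.\<close>
  define s where "s = \<ominus> (g \<otimes> x)"
  define d where "d i = (case i of 0 \<Rightarrow> s | Suc j \<Rightarrow> c j)" for i
  have s: "s \<in> S" using g(2) by (simp add: s_def)
  have dS: "d i \<in> S" if "i \<le> Suc n" for i using c(1) s that by (auto simp: d_def split: nat.split)
  have cc: "(\<lambda>i. c i \<otimes> x [^] i) \<in> {..n} \<rightarrow> carrier R" using c(1) by auto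
  have dc: "(\<lambda>i. d i \<otimes> x [^] i) \<in> {..Suc n} \<rightarrow> carrier R" using dS by auto
  have "(\<Oplus>i\<in>{..Suc n}. d i \<otimes> x [^] i) = (\<Oplus>i\<in>{..n}. d (Suc i) \<otimes> x [^] (Suc i)) \<oplus> d 0 \<otimes> x [^] (0::nat)"
   by (rule finsum_Suc2[OF dc])
  also have "(\<Oplus>i\<in>{..n}. d (Suc i) \<otimes> x [^] (Suc i)) = (\<Oplus>i\<in>{..n}. (c i \<otimes> x [^] i) \<otimes> x)"
   by (rule finsum_cong') (use c(1) in \<open>auto simp: d_def m_assoc\<close>)
  also have "\<dots> = g \<otimes> x" unfolding c(2) by (rule finsum_ldistr[symmetric]) (use cc in auto)
  finally have "(\<Oplus>i\<in>{..Suc n}. d i \<otimes> x [^] i) = g \<otimes> x \<oplus> s" using s by (simp add: d_def)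
  also have "\<dots> = \<zero>" unfolding s_def using g(1) by (simp add: r_neg)
  finally have "d i = \<zero>" if "i \<le> Suc n" for i using free[of "Suc n" d i] dS that by blast
  then have "c i = \<zero>" if "i \<le> n" for i using that by (force simp: d_def split: nat.split)
  then have "(\<Oplus>i\<in>{..n}. c i \<otimes> x [^] i) = (\<Oplus>i\<in>{..n}. \<zero>)" by (intro finsum_cong') auto
  then show ?thesis unfolding c(2) by simp
 qed
 \<comment> \<open>Degree cancellation on the right: ux^k has degree at least k unless u =
   0.\<close>
 have cancel: "u = \<zero>" if "u \<in> S'" "u \<otimes> x [^] k \<in> F k" for u k using that
 proof (induction k) case 0 then show ?case by simp
 next case (Suc k) obtain g s where g: "g \<in> F k" "s \<in> S" "u \<otimes> x [^] Suc k = g \<otimes> x \<oplus> s"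
   using Suc.prems(2) unfolding F_Suc_right by blast
  have uk: "u \<otimes> x [^] k \<in> S'" using Suc.prems(1) by simp
  have gS: "g \<in> S'" using F_S'[OF g(1)] .
  note c = S'_carr[OF Suc.prems(1)] S'_carr[OF uk] S'_carr[OF gS] S_carr[OF g(2)]
  have "(u \<otimes> x [^] k \<oplus> \<ominus> g) \<otimes> x = u \<otimes> x [^] Suc k \<oplus> \<ominus> (g \<otimes> x)"
   using c by (simp add: l_distr l_minus m_assoc)
  also have "\<dots> = s \<oplus> (g \<otimes> x \<oplus> \<ominus> (g \<otimes> x))" unfolding g(3) using c by (simp add: a_ac del: r_neg)
  also have "\<dots> = s" using c by (simp add: r_neg)
  finally have "u \<otimes> x [^] k \<oplus> \<ominus> g = \<zero>" using free_r[of "u \<otimes> x [^] k \<oplus> \<ominus> g"] uk gS g(2) by simp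
  then have "u \<otimes> x [^] k = g" using a_eq_if_minus_zero c by blast
  then show ?case using Suc.IH[OF Suc.prems(1)] g(1) by simp
 qed
 \<comment> \<open>Induction on the degree of g: if r is the coefficient of x^n in g, then xg has r'
   as coefficient of x^(n+1). All other terms, and xg itself, have smaller degree, so r' = 0 and
   therefore r = 0.\<close>
 have free_l: "g = \<zero>" if "g \<in> F n" "x \<otimes> g \<in> S" for g n using that
 proof (induction n arbitrary: g) case 0 then show ?case by simp
 next case (Suc n) interpret op: ore_generated "opposite R" S S' x by (rule opposite_ore_generated)
  have pow_op: "x [^]\<^bsub>opposite R\<^esub> (m::nat) = x [^] m" for m
  proof (induction m) case (Suc m) then show ?case using x_pow[of m] by simp
  qed simp
  obtain r f where r: "r \<in> S" "f \<in> F n" "g = r \<otimes> x [^] n \<oplus> f"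
   using op.F_top[of g n] Suc.prems(1) unfolding opposite_F pow_op by auto
  obtain r' r'' where r': "r' \<in> S" "r'' \<in> S" "x \<otimes> r = r' \<otimes> x \<oplus> r''" "r' = \<zero> \<longrightarrow> r = \<zero>"
   using twist[OF r(1)] by blast
  have p: "x [^] n \<in> carrier R" by simp
  note c = S_carr[OF r(1)] F_carr[OF r(2)] S_carr[OF r'(1)] S_carr[OF r'(2)]
  have "x \<otimes> g = (x \<otimes> r) \<otimes> x [^] n \<oplus> x \<otimes> f" unfolding r(3) using c by (simp add: r_distr m_assoc)
  also have "\<dots> = r' \<otimes> x [^] Suc n \<oplus> (r'' \<otimes> x [^] n \<oplus> x \<otimes> f)"
   unfolding r'(3) x_pow[symmetric] using c by (simp add: l_distr m_assoc a_assoc)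
  finally have eq: "x \<otimes> g = r' \<otimes> x [^] Suc n \<oplus> (r'' \<otimes> x [^] n \<oplus> x \<otimes> f)" .
  have "x [^] n \<otimes> \<one> \<in> F (n + Suc 0)" by (rule F_pow[OF S_F]) simp
  then have "x [^] n \<in> F (Suc n)" by simp
  then have w: "r'' \<otimes> x [^] n \<oplus> x \<otimes> f \<in> F (Suc n)" using F_add[OF F_S_left[OF _ r'(2)] F_x[OF r(2)]] by blast
  note wc = F_carr[OF w]
  have "r' \<otimes> x [^] Suc n = x \<otimes> g \<oplus> \<ominus> (r'' \<otimes> x [^] n \<oplus> x \<otimes> f)"
   unfolding eq using wc c by (simp add: a_assoc r_neg)
  moreover have "x \<otimes> g \<oplus> \<ominus> (r'' \<otimes> x [^] n \<oplus> x \<otimes> f) \<in> F (Suc n)"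
   by (rule F_add[OF S_F[OF Suc.prems(2)] F_neg[OF w]])
  ultimately have "r' = \<zero>" using cancel[of r' "Suc n"] r'(1) SS' by auto
  then have "r = \<zero>" using r'(4) by simp
  then have "g = f" using r(3) c by simp
  then show ?case using Suc.IH[of f] r(2) Suc.prems(2) by simp
 qed
 show ?thesis
 proof (intro ore_free.intro ore_free_axioms.intro)
  show "ore_generated R S S' x" by (rule ore_generated_axioms)
  show "g = \<zero>" if "g \<in> S'" "g \<otimes> x \<in> S" for g by (rule free_r[OF that])
  show "g = \<zero>" if g: "g \<in> S'" "x \<otimes> g \<in> S" for g
  proof - obtain n where "g \<in> F n" using S'_F[OF g(1)] by blast then show ?thesis using free_l g(2) by blast
  qed
 qed
qed

lemma nat_pow_carrier_update [simp]: "x [^]\<^bsub>R\<lparr>carrier := C\<rparr>\<^esub> (n::nat) = x [^]\<^bsub>R\<^esub> n"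
 by (induction n) (simp_all add: nat_pow_def)

lemma (in monoid) inv_nat_pow: assumes "x \<in> Units G" shows "inv (x [^] (n :: nat)) = inv x [^] n"
proof (rule inv_char) have c: "x \<in> carrier G" "inv x \<in> carrier G" using assms by auto
 then show "x [^] n \<in> carrier G" "inv x [^] n \<in> carrier G" by simp_all
 have "x [^] n \<otimes> inv x [^] n = (x \<otimes> inv x) [^] n" "inv x [^] n \<otimes> x [^] n = (inv x \<otimes> x) [^] n"
  by (rule pow_mult_distrib[symmetric]; use c assms in simp)+
 then show "x [^] n \<otimes> inv x [^] n = \<one>" "inv x [^] n \<otimes> x [^] n = \<one>" using assms by simp_all
qed

lemma (in ring) finsum_subring: assumes C: "subring C R" and f: "\<And>i. i \<in> I ==> f i \<in> C"
 shows "finsum (R\<lparr>carrier := C\<rparr>) f I = finsum R f I"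
proof - interpret C: ring "R\<lparr>carrier := C\<rparr>" by (rule subring_is_ring[OF C]) show ?thesis using f
 proof (induction I rule: infinite_finite_induct) case (insert i I)
  have "f \<in> I \<rightarrow> carrier R" "f i \<in> carrier R" using insert.prems subringE(1)[OF C] by auto
  then show ?case using insert by (simp add: C.finsum_insert Pi_iff)
 qed simp_all
qed

text \<open>Surjectivity of \<sigma> turns the commutation rule around: for s = \<sigma> a it reads
  sx = xa - \<delta> a. Injectivity of \<sigma> supplies the condition \<open>twist\<close> of
  \<open>ore_freeI\<close>.\<close>

lemma ore_extension_imp_ore_free: fixes K :: "'k ring" and A :: "('k, 'a) module" (structure)
 assumes A: "K_algebra K A" and C': "K_subalgebra K A C'"
  and ore: "ore_extension K (A\<lparr>carrier := C'\<rparr>) C x \<sigma> \<delta>"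
 shows "ore_free A C C' x"
proof - interpret A: K_algebra K A by fact note C's = K_subalgebraE[OF C'] let ?S = "A\<lparr>carrier := C'\<rparr>"
 have S: "K_subalgebra K ?S C" and xC: "x \<in> C'" and \<sigma>: "\<sigma> \<in> algebra_iso K (A\<lparr>carrier := C\<rparr>) (A\<lparr>carrier := C\<rparr>)"
  and \<delta>: "skew_derivation K (A\<lparr>carrier := C\<rparr>) \<sigma> \<delta>"
  and comm: "\<And>a. a \<in> C ==> x \<otimes> a = \<sigma> a \<otimes> x \<oplus> \<delta> a"
  and gen: "\<And>B. K_subalgebra K ?S B ==> insert x C \<subseteq> B ==> B = C'"
  and free: "\<And>(m :: nat) c i. (\<forall>i\<le>m. c i \<in> C) ==>
    (\<Oplus>\<^bsub>?S\<^esub>i\<in>{..m}. c i \<otimes> (x [^] i)) = \<zero> ==> i \<le> m ==> c i = \<zero>"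
  using ore unfolding ore_extension_def by simp_all
 have CC': "C \<subseteq> C'" using K_subalgebraE(2)[OF S] by simp
 have CK: "k \<odot> c \<in> C" if "k \<in> carrier K" "c \<in> C" for k c using K_subalgebraE(5)[OF S that] by simp
 have C: "subring C A"
 proof (rule A.ring_incl_imp_subring) show "C \<subseteq> carrier A" using CC' C's(2) by blast
  show "ring (A\<lparr>carrier := C\<rparr>)"
   using ring.subring_is_ring[OF A.subring_is_ring[OF C's(1)] K_subalgebraE(1)[OF S]] by simp
 qed
 note Cs = subringE[OF C]
 have Cc: "c \<in> carrier A" if "c \<in> C" for c using that Cs(1) by blast
 have xc: "x \<in> carrier A" using xC C's(2) by blast
 have \<sigma>C: "\<sigma> a \<in> C" "\<delta> a \<in> C" if "a \<in> C" for a
  using \<sigma> \<delta> that by (auto simp: algebra_iso_def bij_betw_def skew_derivation_def)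
 have \<sigma>bij: "bij_betw \<sigma> C C" using \<sigma> by (simp add: algebra_iso_def)
 have \<sigma>h: "\<sigma> \<in> ring_hom (A\<lparr>carrier := C\<rparr>) (A\<lparr>carrier := C\<rparr>)" using \<sigma> by (simp add: algebra_iso_def algebra_hom_def)
 interpret AC: ring "A\<lparr>carrier := C\<rparr>" by (rule A.subring_is_ring[OF C])
 interpret \<sigma>: ring_hom_ring "A\<lparr>carrier := C\<rparr>" "A\<lparr>carrier := C\<rparr>" \<sigma>
  by (rule ring_hom_ringI2[OF AC.ring_axioms AC.ring_axioms \<sigma>h])
 interpret G: ore_generated A C C' x
 proof (intro ore_generated.intro ore_generated_axioms.intro) show "ring A" by (rule A.ring_axioms)
  show "subring C A" "subring C' A" "C \<subseteq> C'" "x \<in> C'" by (fact C C's(1) CC' xC)+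
  show "\<exists>s'\<in>C. \<exists>s''\<in>C. x \<otimes> s = s' \<otimes> x \<oplus> s''" if "s \<in> C" for s using comm[OF that] \<sigma>C[OF that] by blast
  show "\<exists>s'\<in>C. \<exists>s''\<in>C. s \<otimes> x = x \<otimes> s' \<oplus> s''" if s: "s \<in> C" for s
  proof - have "s \<in> \<sigma> ` C" using \<sigma>bij s by (simp add: bij_betw_def)
   then obtain a where a: "a \<in> C" "s = \<sigma> a" by blast
   note c = Cc[OF a(1)] Cc[OF \<sigma>C(1)[OF a(1)]] Cc[OF \<sigma>C(2)[OF a(1)]]
   have "x \<otimes> a \<oplus> \<ominus> \<delta> a = s \<otimes> x" unfolding comm[OF a(1)] a(2) using c xc by (simp add: A.a_assoc A.r_neg)
   then show ?thesis using a(1) Cs(5)[OF \<sigma>C(2)[OF a(1)]] by metis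
  qed
  \<comment> \<open>Generation is given for K-subalgebras and wanted for subrings. A subring
    containing \<open>C\<close> contains the scalars k1, and is therefore stable under scalar
    multiplication.\<close>
  show "C' \<subseteq> B" if B: "subring B A" "C \<subseteq> B" "x \<in> B" for B
  proof - note Bs = subringE[OF B(1)]
   have BC: "subring (B \<inter> C') A" by (rule A.subring_inter[OF B(1) C's(1)])
   interpret S: ring ?S by (rule A.subring_is_ring[OF C's(1)])
   have "subring (B \<inter> C') ?S"
   proof (rule S.ring_incl_imp_subring) show "B \<inter> C' \<subseteq> carrier ?S" by simp
    show "ring (?S\<lparr>carrier := B \<inter> C'\<rparr>)" using A.subring_is_ring[OF BC] by simp
   qed
   moreover have "k \<odot> b \<in> B \<inter> C'" if kb: "k \<in> carrier K" "b \<in> B \<inter> C'" for k b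
   proof - have "k \<odot> \<one> \<in> B" using CK[OF kb(1) Cs(3)] B(2) by blast
    then have "(k \<odot> \<one>) \<otimes> b \<in> B" using Bs(6) kb(2) by blast
    moreover have "b \<in> carrier A" using kb(2) Bs(1) by blast
    ultimately have "k \<odot> b \<in> B" using A.scalar_mult(1)[OF kb(1)] by simp
    then show ?thesis using C's(5)[OF kb(1)] kb(2) by blast
   qed
   ultimately have "K_subalgebra K ?S (B \<inter> C')" by (simp add: K_subalgebra_def)
   then have "B \<inter> C' = C'" by (rule gen) (use B CC' xC in blast)
   then show ?thesis by blast
  qed
 qed
 show ?thesis
 proof (rule G.ore_freeI) fix m :: nat and c i assume c: "\<And>i. i \<le> m ==> c i \<in> C"
   and 0: "(\<Oplus>i\<in>{..m}. c i \<otimes> x [^] i) = \<zero>" and i: "i \<le> m"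
  have "c i \<otimes> x [^] i \<in> C'" if "i \<in> {..m}" for i
   using subringE(6)[OF C's(1)] c[of i] that CC' G.pow_S'[of i] by blast
  then have "(\<Oplus>\<^bsub>?S\<^esub>i\<in>{..m}. c i \<otimes> (x [^] i)) = \<zero>"
   using A.finsum_subring[OF C's(1), of "{..m}" "\<lambda>i. c i \<otimes> x [^] i"] 0 by simp
  then show "c i = \<zero>" using free[of m c i] c i by blast
 next fix r assume r: "r \<in> C" have "r = \<zero>" if "\<sigma> r = \<zero>" proof -
   have "\<sigma> r = \<sigma> \<zero>" using that \<sigma>.hom_zero by simp
   then show ?thesis using \<sigma>bij r Cs(2) by (auto simp: bij_betw_def dest: inj_onD)
  qed
  then show "\<exists>r'\<in>C. \<exists>r''\<in>C. x \<otimes> r = r' \<otimes> x \<oplus> r'' \<and> (r' = \<zero> \<longrightarrow> r = \<zero>)" using comm[OF r] \<sigma>C[OF r] by blast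
 qed
qed

section \<open>The enveloping algebra of a quotient division algebra is a Noetherian domain\<close>

section \<open>Noetherian enveloping algebras\<close>

context enveloping
begin

lemma sl_gens: assumes "C \<subseteq> carrier D" "C' \<subseteq> carrier D"
 shows "{\<alpha> c \<cdot> b | c b. c \<in> C \<and> b \<in> \<beta> ` C'} = {E.t a b | a b. a \<in> C \<and> b \<in> C'}"
proof - have "{\<alpha> c \<cdot> b | c b. c \<in> C \<and> b \<in> \<beta> ` C'} = (\<lambda>(a, b). \<alpha> a \<cdot> \<beta> b) ` (C \<times> C')" by auto
 also have "\<dots> = (\<lambda>(a, b). E.t a b) ` (C \<times> C')"
 proof (rule image_cong[OF refl]) fix p assume "p \<in> C \<times> C'"
  then have "fst p \<in> carrier D" "snd p \<in> carrier D" using assms by auto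
  then show "(case p of (a, b) \<Rightarrow> \<alpha> a \<cdot> \<beta> b) = (case p of (a, b) \<Rightarrow> E.t a b)"
   unfolding case_prod_unfold by (rule t_factor(1))
 qed
 also have "\<dots> = {E.t a b | a b. a \<in> C \<and> b \<in> C'}" by auto
 finally show ?thesis .
qed

lemma sr_gens: assumes "C \<subseteq> carrier D" "C' \<subseteq> carrier D"
 shows "{\<beta> c \<cdot> b | c b. c \<in> C' \<and> b \<in> \<alpha> ` C} = {E.t a b | a b. a \<in> C \<and> b \<in> C'}"
proof - have "{\<beta> c \<cdot> b | c b. c \<in> C' \<and> b \<in> \<alpha> ` C} = (\<lambda>(a, b). \<beta> b \<cdot> \<alpha> a) ` (C \<times> C')" by auto
 also have "\<dots> = (\<lambda>(a, b). E.t a b) ` (C \<times> C')"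
 proof (rule image_cong[OF refl]) fix p assume "p \<in> C \<times> C'"
  then have "fst p \<in> carrier D" "snd p \<in> carrier D" using assms by auto
  then show "(case p of (a, b) \<Rightarrow> \<beta> b \<cdot> \<alpha> a) = (case p of (a, b) \<Rightarrow> E.t a b)"
   unfolding case_prod_unfold by (rule t_factor(2))
 qed
 also have "\<dots> = {E.t a b | a b. a \<in> C \<and> b \<in> C'}" by auto
 finally show ?thesis .
qed

text \<open>C \<otimes> C' inside the enveloping algebra, independent of which factor is regarded as
  coefficients: both \<open>sl.tens\<close> and \<open>sr.tens\<close> reduce to it.\<close>

definition sub_tensor :: "'d set \<Rightarrow> 'd set \<Rightarrow> ('d \<times> 'd \<Rightarrow>\<^sub>0 int) set set" where
 "sub_tensor C C' = additive_span De {E.t a b | a b. a \<in> C \<and> b \<in> C'}"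

lemma sl_tens: "C \<subseteq> carrier D ==> C' \<subseteq> carrier D ==> sl.tens C (\<beta> ` C') = sub_tensor C C'"
 unfolding sl.tens_def sub_tensor_def sl_gens ..

lemma sr_tens: "C \<subseteq> carrier D ==> C' \<subseteq> carrier D ==> sr.tens C' (\<alpha> ` C) = sub_tensor C C'"
 unfolding sr.tens_def sub_tensor_def sr_gens ..

lemma sub_tensor_gen: "a \<in> C ==> b \<in> C' ==> E.t a b \<in> sub_tensor C C'"
 unfolding sub_tensor_def by (rule additive_span_gen) blast

lemma sub_tensor_add: "x \<in> sub_tensor C C' ==> y \<in> sub_tensor C C' ==> x \<otimes>\<^bsub>E.TG\<^esub> y \<in> sub_tensor C C'"
 unfolding sub_tensor_def using additive_span_add[of x De _ y] by simp

lemma sub_tensor_least: assumes "\<And>a b. a \<in> C ==> b \<in> C' ==> E.t a b \<in> Y" "\<one>\<^bsub>E.TG\<^esub> \<in> Y"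
  "\<And>x y. x \<in> Y ==> y \<in> Y ==> x \<otimes>\<^bsub>E.TG\<^esub> y \<in> Y"
 shows "sub_tensor C C' \<subseteq> Y"
 unfolding sub_tensor_def by (rule additive_span_least) (use assms in auto)

lemma sub_tensor_all: "sub_tensor (carrier D) (carrier D) = carrier De"
proof show "sub_tensor (carrier D) (carrier D) \<subseteq> carrier De" by (rule sub_tensor_least) simp_all
 show "carrier De \<subseteq> sub_tensor (carrier D) (carrier D)"
 proof fix z assume "z \<in> carrier De" then have "z \<in> carrier E.TG" by simp
  then show "z \<in> sub_tensor (carrier D) (carrier D)"
  proof (induction z rule: E.TG_induct) case one
   then show ?case using additive_span_zero[of De] unfolding sub_tensor_def by simp
  next case (gen m n) then show ?case by (intro sub_tensor_gen) simp_all
  next case (add x y) then show ?case by (intro sub_tensor_add)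
  qed
 qed
qed

lemma sub_tensor_subring: assumes "subring C D" "subring C' D" shows "subring (sub_tensor C C') De"
proof - note C = subringE(1)[OF assms(1)] and C' = subringE(1)[OF assms(2)] show ?thesis
  unfolding sl_tens[OF C C', symmetric]
  by (rule sl.tens_subring[OF assms(1) \<beta>_image_subring[OF assms(2)] image_mono[OF C']])
qed

text \<open>Chains of left or right ideals of D descend from the enveloping algebra by slicing, and
  zero divisors of D would become zero divisors there under the embedding a \<mapsto> a \<otimes>
  1.\<close>

lemma De_nontrivial_imp: assumes "nc_noetherian_domain De" shows "nc_noetherian_domain D"
proof - have dom: "nc_domain De" and l: "left_noetherian De" and r: "left_noetherian (opposite De)"
  using assms by (simp_all add: nc_noetherian_domain_def)
 have one: "\<one>\<^bsub>De\<^esub> \<noteq> \<zero>\<^bsub>De\<^esub>" using dom by (simp add: nc_domain_def)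
 have all: "sl.tens (carrier D) (\<beta> ` carrier D) = carrier De"
  unfolding sl_tens[OF order_refl order_refl] by (rule sub_tensor_all)
 interpret op: slice_algebra K "opposite D" "opposite De" \<alpha> "\<beta> ` carrier D" \<Phi>l
  by (rule sl.opposite_slice_algebra)
 have "left_noetherian D" by (rule sl.left_noetherian_slice[OF l one all])
 moreover have "left_noetherian (opposite D)"
 proof (rule op.left_noetherian_slice[OF r]) show "\<one>\<^bsub>opposite De\<^esub> \<noteq> \<zero>\<^bsub>opposite De\<^esub>" using one by simp
  show "op.tens (carrier (opposite D)) (\<beta> ` carrier D) = carrier (opposite De)"
   using sl.tens_opposite[OF order_refl order_refl] all by simp
 qed
 moreover have "a = \<zero> \<or> b = \<zero>" if ab: "a \<in> carrier D" "b \<in> carrier D" "a \<otimes> b = \<zero>" for a b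
 proof - have "\<alpha> a \<cdot> \<alpha> b = \<alpha> (a \<otimes> b)" using ab(1,2) by (simp add: t_mult)
  also have "\<dots> = \<zero>\<^bsub>De\<^esub>" unfolding ab(3) using E.t_zero_l[of "\<one>"] by simp
  finally have "\<alpha> a = \<zero>\<^bsub>De\<^esub> \<or> \<alpha> b = \<zero>\<^bsub>De\<^esub>"
   using dom ab(1,2) unfolding nc_domain_def by (metis E.T_simps(1) D.one_closed t_closed)
  then show ?thesis using sl.\<alpha>_eq_zero[OF one] ab(1,2) by blast
 qed
 then have "nc_domain D" using D.ring_axioms nontrivial by (simp add: nc_domain_def)
 ultimately show ?thesis by (simp add: nc_noetherian_domain_def)
qed

end

lemma enveloping_nontrivial: assumes G: "K_algebra K \<Gamma>" and dom: "nc_domain (enveloping_algebra K \<Gamma>)"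
 shows "enveloping K \<Gamma>"
proof - interpret G: K_algebra K \<Gamma> by fact interpret E: tensor_product K \<Gamma> "opposite \<Gamma>"
  by (intro tensor_product.intro G K_algebra_opposite)
 have "\<one>\<^bsub>\<Gamma>\<^esub> \<noteq> \<zero>\<^bsub>\<Gamma>\<^esub>"
 proof assume "\<one>\<^bsub>\<Gamma>\<^esub> = \<zero>\<^bsub>\<Gamma>\<^esub>" then have "\<one>\<^bsub>E.T\<^esub> = \<zero>\<^bsub>E.T\<^esub>" using E.T_one E.t_zero_l[of "\<zero>\<^bsub>\<Gamma>\<^esub>"] by simp
  then show False using dom by (simp add: nc_domain_def enveloping_algebra_def)
 qed
 then show ?thesis using G by (simp add: enveloping_def enveloping_axioms_def)
qed

theorem nc_noetherian_domain_of_enveloping: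
 assumes G: "K_algebra K \<Gamma>" and N: "nc_noetherian_domain (enveloping_algebra K \<Gamma>)"
 shows "nc_noetherian_domain \<Gamma>"
proof - interpret enveloping K \<Gamma> using enveloping_nontrivial[OF G] N by (simp add: nc_noetherian_domain_def)
 show ?thesis by (rule De_nontrivial_imp) (use N in \<open>simp add: enveloping_algebra_def\<close>)
qed

text \<open>The map f \<otimes> f from \<Gamma>^e into D^e is a ring homomorphism with image C_0
  \<otimes> C_0. It is injective because the slices of D^e, composed with it, already separate the
  points of \<Gamma>^e; here \<open>f\<close> plays the role of the embedding of both factors in
  \<open>slices_separate\<close>.\<close>

lemma (in enveloping) sub_tensor_image:
 assumes G: "K_algebra K \<Gamma>" and f: "f \<in> algebra_hom K \<Gamma> D" and inj: "inj_on f (carrier \<Gamma>)"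
  and N: "nc_noetherian_domain (enveloping_algebra K \<Gamma>)"
 shows "nc_noetherian_domain (De\<lparr>carrier := sub_tensor (f ` carrier \<Gamma>) (f ` carrier \<Gamma>)\<rparr>)"
proof - interpret G: K_algebra K \<Gamma> by fact interpret G: tensor_product K \<Gamma> "opposite \<Gamma>"
  by (intro tensor_product.intro G K_algebra_opposite)
 have fh: "f \<in> ring_hom \<Gamma> D" and fk: "\<And>k a. k \<in> carrier K ==> a \<in> carrier \<Gamma> ==> f (k \<odot>\<^bsub>\<Gamma>\<^esub> a) = k \<odot> f a"
  using f by (auto simp: algebra_hom_def)
 interpret f: ring_hom_ring \<Gamma> D f by (rule ring_hom_ringI2[OF G.ring_axioms D.ring_axioms fh])
 have f0: "a = \<zero>\<^bsub>\<Gamma>\<^esub>" if "a \<in> carrier \<Gamma>" "f a = \<zero>" for a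
  using inj that f.hom_zero G.zero_closed by (metis inj_onD)
 have "\<exists>h. h \<in> hom G.TG E.TG \<and> (\<forall>a\<in>carrier \<Gamma>. \<forall>b\<in>carrier \<Gamma>. h (G.t a b) = E.t (f a) (f b))"
 proof (rule G.universal[of E.TG "\<lambda>a b. E.t (f a) (f b)"])
  show "comm_group E.TG" by (rule E.TG.comm_group_axioms)
  fix h assume "h \<in> hom G.TG E.TG" "\<And>m n. m \<in> carrier \<Gamma> ==> n \<in> carrier (opposite \<Gamma>) ==> h (G.t m n) = E.t (f m) (f n)"
  then show ?thesis by (intro exI[of _ h]) simp
 next fix a b assume "a \<in> carrier \<Gamma>" "b \<in> carrier (opposite \<Gamma>)"
  then show "E.t (f a) (f b) \<in> carrier E.TG" by simp
 next fix a a' b assume "a \<in> carrier \<Gamma>" "a' \<in> carrier \<Gamma>" "b \<in> carrier (opposite \<Gamma>)"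
  then show "E.t (f (a \<oplus>\<^bsub>\<Gamma>\<^esub> a')) (f b) = E.t (f a) (f b) \<otimes>\<^bsub>E.TG\<^esub> E.t (f a') (f b)"
   using E.t_add_l[of "f a" "f a'" "f b"] by simp
 next fix a b b' assume "a \<in> carrier \<Gamma>" "b \<in> carrier (opposite \<Gamma>)" "b' \<in> carrier (opposite \<Gamma>)"
  then show "E.t (f a) (f (b \<oplus>\<^bsub>opposite \<Gamma>\<^esub> b')) = E.t (f a) (f b) \<otimes>\<^bsub>E.TG\<^esub> E.t (f a) (f b')"
   using E.t_add_r[of "f a" "f b" "f b'"] by simp
 next fix k a b assume "k \<in> carrier K" "a \<in> carrier \<Gamma>" "b \<in> carrier (opposite \<Gamma>)"
  then show "E.t (f (k \<odot>\<^bsub>\<Gamma>\<^esub> a)) (f b) = E.t (f a) (f (k \<odot>\<^bsub>opposite \<Gamma>\<^esub> b))"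
   using E.t_balanced[of k "f a" "f b"] by (simp add: fk)
 qed
 then obtain h where h: "h \<in> hom G.TG E.TG"
  "\<And>a b. a \<in> carrier \<Gamma> ==> b \<in> carrier \<Gamma> ==> h (G.t a b) = E.t (f a) (f b)" by blast
 have hc: "h x \<in> carrier E.TG" if "x \<in> carrier G.TG" for x using h(1) that by (auto simp: hom_def)
 have hadd: "h (x \<otimes>\<^bsub>G.TG\<^esub> y) = h x \<otimes>\<^bsub>E.TG\<^esub> h y" if "x \<in> carrier G.TG" "y \<in> carrier G.TG" for x y
  using h(1) that by (auto simp: hom_def)
 have h1: "h \<one>\<^bsub>G.TG\<^esub> = \<one>\<^bsub>E.TG\<^esub>" by (rule hom_one[OF h(1) G.TG.is_group E.TG.is_group])
 have hmult: "h (x \<otimes>\<^bsub>G.T\<^esub> y) = h x \<cdot> h y" if "x \<in> carrier G.TG" "y \<in> carrier G.TG" for x y using that(1)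
 proof (induction x rule: G.TG_induct) case one
  then show ?case using that(2) hc by (simp add: G.T_null E.T_null h1)
 next case (add x x')
  then show ?case using that(2) hc by (simp add: G.T_l_distr E.T_l_distr hadd G.T_mult_closed)
 next case (gen a b) then have ab: "a \<in> carrier \<Gamma>" "b \<in> carrier \<Gamma>" by simp_all
  have tc: "G.t a b \<in> carrier G.TG" using gen by (rule G.t_closed)
  show ?case using that(2)
  proof (induction y rule: G.TG_induct) case one
   then show ?case using tc hc by (simp add: G.T_null E.T_null h1)
  next case (add x x')
   then show ?case using tc hc by (simp add: G.T_r_distr E.T_r_distr hadd G.T_mult_closed)
  next case (gen c d) then have cd: "c \<in> carrier \<Gamma>" "d \<in> carrier \<Gamma>" by simp_all
   show ?case using ab cd G.t_mult[of a b c d] by (simp add: h(2) t_mult)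
  qed
 qed
 have hring: "h \<in> ring_hom G.T De"
 proof (rule ring_hom_memI)
  show "h \<one>\<^bsub>G.T\<^esub> = \<one>\<^bsub>De\<^esub>" unfolding G.T_one E.T_one using h(2)[of "\<one>\<^bsub>\<Gamma>\<^esub>" "\<one>\<^bsub>\<Gamma>\<^esub>"] by simp
 qed (simp_all add: hc hmult hadd)
 have h0: "z = \<one>\<^bsub>G.TG\<^esub>" if z: "z \<in> carrier G.TG" "h z = \<one>\<^bsub>E.TG\<^esub>" for z
 proof (rule balanced_map.slices_separate[OF G.balanced_map_t D.K_algebra_axioms D.K_algebra_axioms, of f f])
  fix \<psi> assume \<psi>: "functional K D \<psi>"
  obtain F where F: "F \<in> \<Phi>l" "\<And>a b. a \<in> carrier D ==> b \<in> carrier D ==> F (E.t a b) = a \<otimes> \<psi> b"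
   using exists_\<Phi>l[OF \<psi>] by blast
  have Fh: "F \<in> hom E.TG (add_monoid D)" using F(1) unfolding \<Phi>l_def by blast
  show "\<exists>F. F \<in> hom G.TG (add_monoid D) \<and> (\<forall>k\<in>carrier K. \<forall>a\<in>carrier \<Gamma>. \<forall>b\<in>carrier (opposite \<Gamma>).
    \<psi> (f b) = k \<odot> \<one> \<longrightarrow> F (G.t a b) = k \<odot> f a) \<and> F z = \<zero>"
  proof (intro exI[of _ "F \<circ> h"] conjI ballI impI) show "F \<circ> h \<in> hom G.TG (add_monoid D)"
    by (rule homI) (simp_all add: slice_hom[OF Fh] hc hadd)
   show "(F \<circ> h) z = \<zero>" using z(2) slice_hom(3)[OF Fh] by simp
   fix k a b assume k: "k \<in> carrier K" "a \<in> carrier \<Gamma>" "b \<in> carrier (opposite \<Gamma>)" "\<psi> (f b) = k \<odot> \<one>"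
   then show "(F \<circ> h) (G.t a b) = k \<odot> f a"
    using F(2)[of "f a" "f b"] D.scalar_mult(2)[of k "f a"] by (simp add: h(2))
  qed
 qed (use z f0 in \<open>simp_all add: fk\<close>)
 have hinj: "inj_on h (carrier G.T)"
 proof (rule inj_onI) fix x y assume xy: "x \<in> carrier G.T" "y \<in> carrier G.T" "h x = h y"
  then have c: "x \<in> carrier G.TG" "y \<in> carrier G.TG" "inv\<^bsub>G.TG\<^esub> y \<in> carrier G.TG" by simp_all
  have "h y \<otimes>\<^bsub>E.TG\<^esub> h (inv\<^bsub>G.TG\<^esub> y) = \<one>\<^bsub>E.TG\<^esub>" using hadd[OF c(2,3)] h1 c by simp
  then have "h (x \<otimes>\<^bsub>G.TG\<^esub> inv\<^bsub>G.TG\<^esub> y) = \<one>\<^bsub>E.TG\<^esub>" using hadd[OF c(1,3)] xy(3) by simp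
  then have "x \<otimes>\<^bsub>G.TG\<^esub> inv\<^bsub>G.TG\<^esub> y = \<one>\<^bsub>G.TG\<^esub>" using h0 c by simp
  then show "x = y" using c G.TG.inv_equality[of x "inv\<^bsub>G.TG\<^esub> y"] by simp
 qed
 have fG: "f ` carrier \<Gamma> \<subseteq> carrier D" using f.hom_closed by blast
 have im: "h ` carrier G.T = sub_tensor (f ` carrier \<Gamma>) (f ` carrier \<Gamma>)"
 proof show "h ` carrier G.T \<subseteq> sub_tensor (f ` carrier \<Gamma>) (f ` carrier \<Gamma>)" proof
   fix w assume "w \<in> h ` carrier G.T"
   then obtain z where z: "z \<in> carrier G.TG" "w = h z" by auto
   have "h z \<in> sub_tensor (f ` carrier \<Gamma>) (f ` carrier \<Gamma>)" using z(1)
   proof (induction z rule: G.TG_induct) case one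
    then show ?case using additive_span_zero[of De] unfolding sub_tensor_def h1 by simp
   next case (gen a b) then show ?case by (simp add: h(2) sub_tensor_gen)
   next case (add x y) then show ?case by (simp add: hadd sub_tensor_add)
   qed
   then show "w \<in> sub_tensor (f ` carrier \<Gamma>) (f ` carrier \<Gamma>)" using z(2) by simp
  qed
  show "sub_tensor (f ` carrier \<Gamma>) (f ` carrier \<Gamma>) \<subseteq> h ` carrier G.T"
  proof (rule sub_tensor_least) fix a b assume "a \<in> f ` carrier \<Gamma>" "b \<in> f ` carrier \<Gamma>"
   then obtain a' b' where ab: "a' \<in> carrier \<Gamma>" "a = f a'" "b' \<in> carrier \<Gamma>" "b = f b'" by blast
   have "E.t a b = h (G.t a' b')" using h(2) ab by simp
   then show "E.t a b \<in> h ` carrier G.T" using G.t_closed[of a' b'] ab by simp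
  next show "\<one>\<^bsub>E.TG\<^esub> \<in> h ` carrier G.T" using h1 by (metis G.T_simps(1) G.TG.one_closed imageI)
  next fix x y assume "x \<in> h ` carrier G.T" "y \<in> h ` carrier G.T"
   then obtain x' y' where xy: "x' \<in> carrier G.TG" "x = h x'" "y' \<in> carrier G.TG" "y = h y'" by auto
   have "x \<otimes>\<^bsub>E.TG\<^esub> y = h (x' \<otimes>\<^bsub>G.TG\<^esub> y')" using hadd xy by simp
   then show "x \<otimes>\<^bsub>E.TG\<^esub> y \<in> h ` carrier G.T" using G.TG.m_closed[OF xy(1,3)] by simp
  qed
 qed
 show ?thesis using nc_noetherian_domain_image[OF E.T.ring_axioms hring hinj] N
  unfolding im by (simp add: enveloping_algebra_def)
qed

text \<open>A common denominator s \<otimes> t for a finite sum of tensors, found by clearing one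
  tensor after another. In the second factor products are reversed, so a left denominator there is a
  right denominator in D.\<close>

lemma (in enveloping) sub_tensor_fractions: assumes U: "Units D = carrier D - {\<zero>}" and B: "subring B D"
  and fl: "\<And>q. q \<in> carrier D ==> \<exists>s\<in>B - {\<zero>}. s \<otimes> q \<in> B"
  and fr: "\<And>q. q \<in> carrier D ==> \<exists>s\<in>B - {\<zero>}. q \<otimes> s \<in> B"
  and z: "z \<in> carrier E.TG"
 shows "\<exists>s\<in>B - {\<zero>}. \<exists>t\<in>B - {\<zero>}. E.t s t \<cdot> z \<in> sub_tensor B B" (is "?L z")
  and "\<exists>s\<in>B - {\<zero>}. \<exists>t\<in>B - {\<zero>}. z \<cdot> E.t s t \<in> sub_tensor B B" (is "?R z")
proof - note Bs = subringE[OF B] have Bc: "b \<in> carrier D" if "b \<in> B" for b using Bs(1) that by blast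
 note S = sub_tensor_subring[OF B B]
 note Ss = subringE[OF S]
 have S0: "\<one>\<^bsub>E.TG\<^esub> \<in> sub_tensor B B" using Ss(2) by simp
 have nz: "a \<otimes> b \<in> B - {\<zero>}" if "a \<in> B - {\<zero>}" "b \<in> B - {\<zero>}" for a b
  using D.division_cancel[OF U, of a b] Bs(6)[of a b] Bc that by blast
 have one: "\<one> \<in> B - {\<zero>}" using Bs(3) nontrivial by simp
 \<comment> \<open>Strengthened for the induction: the new denominator is to be a multiple of any
   prescribed one, so that clearing the second summand keeps the first one cleared.\<close>
 have L: "\<exists>a\<in>B - {\<zero>}. \<exists>b\<in>B - {\<zero>}. E.t (a \<otimes> s) (t \<otimes> b) \<cdot> z \<in> sub_tensor B B"
  if "z \<in> carrier E.TG" "s \<in> B - {\<zero>}" "t \<in> B - {\<zero>}" for z s t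
  using that
 proof (induction z arbitrary: s t rule: E.TG_induct) case one': one
  then have "E.t (\<one> \<otimes> s) (t \<otimes> \<one>) \<cdot> \<one>\<^bsub>E.TG\<^esub> \<in> sub_tensor B B" using S0 E.T_null(2) Bc by simp
  then show ?case using one by blast
 next case (gen x y)
  then have c: "x \<in> carrier D" "y \<in> carrier D" "s \<in> carrier D" "t \<in> carrier D" using Bc by simp_all
  obtain a where a: "a \<in> B - {\<zero>}" "a \<otimes> (s \<otimes> x) \<in> B" using fl[of "s \<otimes> x"] c by auto
  obtain b where b: "b \<in> B - {\<zero>}" "(y \<otimes> t) \<otimes> b \<in> B" using fr[of "y \<otimes> t"] c by auto
  have "a \<in> carrier D" "b \<in> carrier D" using a b Bc by blast+
  then have "E.t (a \<otimes> s) (t \<otimes> b) \<cdot> E.t x y = E.t (a \<otimes> (s \<otimes> x)) ((y \<otimes> t) \<otimes> b)"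
   using c by (simp add: t_mult D.m_assoc)
  then have "E.t (a \<otimes> s) (t \<otimes> b) \<cdot> E.t x y \<in> sub_tensor B B" using sub_tensor_gen[OF a(2) b(2)] by simp
  then show ?case using a(1) b(1) by blast
 next case (add x y)
  obtain a b where ab: "a \<in> B - {\<zero>}" "b \<in> B - {\<zero>}" "E.t (a \<otimes> s) (t \<otimes> b) \<cdot> x \<in> sub_tensor B B"
   using add.IH(1)[OF add.prems] by blast
  obtain a' b' where ab': "a' \<in> B - {\<zero>}" "b' \<in> B - {\<zero>}"
   "E.t (a' \<otimes> (a \<otimes> s)) ((t \<otimes> b) \<otimes> b') \<cdot> y \<in> sub_tensor B B"
   using add.IH(2)[OF nz[OF ab(1) add.prems(1)] nz[OF add.prems(2) ab(2)]] by blast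
  have c: "a \<in> carrier D" "b \<in> carrier D" "a' \<in> carrier D" "b' \<in> carrier D" "s \<in> carrier D" "t \<in> carrier D"
   using ab(1,2) ab'(1,2) add.prems Bc by blast+
  let ?u = "E.t ((a' \<otimes> a) \<otimes> s) (t \<otimes> (b \<otimes> b'))"
  have y: "?u \<cdot> y \<in> sub_tensor B B" using ab'(3) c by (simp add: D.m_assoc)
  have "?u \<cdot> x = E.t a' b' \<cdot> (E.t (a \<otimes> s) (t \<otimes> b) \<cdot> x)"
   using E.T_assoc_gen[of "E.t a' b'" "E.t (a \<otimes> s) (t \<otimes> b)" x] c add.hyps by (simp add: t_mult D.m_assoc)
  then have x: "?u \<cdot> x \<in> sub_tensor B B" using Ss(6)[OF sub_tensor_gen ab(3), of a' b'] ab'(1,2) by simp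
  have "?u \<cdot> (x \<otimes>\<^bsub>E.TG\<^esub> y) \<in> sub_tensor B B"
   using sub_tensor_add[OF x y] E.T_r_distr[OF add.hyps, of ?u] c by simp
  then show ?case using nz[OF ab'(1) ab(1)] nz[OF ab(2) ab'(2)] by blast
 qed
 have R: "\<exists>a\<in>B - {\<zero>}. \<exists>b\<in>B - {\<zero>}. z \<cdot> E.t (s \<otimes> a) (b \<otimes> t) \<in> sub_tensor B B"
  if "z \<in> carrier E.TG" "s \<in> B - {\<zero>}" "t \<in> B - {\<zero>}" for z s t
  using that
 proof (induction z arbitrary: s t rule: E.TG_induct) case one': one
  then have "\<one>\<^bsub>E.TG\<^esub> \<cdot> E.t (s \<otimes> \<one>) (\<one> \<otimes> t) \<in> sub_tensor B B" using S0 E.T_null(1) Bc by simp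
  then show ?case using one by blast
 next case (gen x y)
  then have c: "x \<in> carrier D" "y \<in> carrier D" "s \<in> carrier D" "t \<in> carrier D" using Bc by simp_all
  obtain a where a: "a \<in> B - {\<zero>}" "(x \<otimes> s) \<otimes> a \<in> B" using fr[of "x \<otimes> s"] c by auto
  obtain b where b: "b \<in> B - {\<zero>}" "b \<otimes> (t \<otimes> y) \<in> B" using fl[of "t \<otimes> y"] c by auto
  have "a \<in> carrier D" "b \<in> carrier D" using a b Bc by blast+
  then have "E.t x y \<cdot> E.t (s \<otimes> a) (b \<otimes> t) = E.t ((x \<otimes> s) \<otimes> a) (b \<otimes> (t \<otimes> y))"
   using c by (simp add: t_mult D.m_assoc)
  then have "E.t x y \<cdot> E.t (s \<otimes> a) (b \<otimes> t) \<in> sub_tensor B B" using sub_tensor_gen[OF a(2) b(2)] by simp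
  then show ?case using a(1) b(1) by blast
 next case (add x y)
  obtain a b where ab: "a \<in> B - {\<zero>}" "b \<in> B - {\<zero>}" "x \<cdot> E.t (s \<otimes> a) (b \<otimes> t) \<in> sub_tensor B B"
   using add.IH(1)[OF add.prems] by blast
  obtain a' b' where ab': "a' \<in> B - {\<zero>}" "b' \<in> B - {\<zero>}"
   "y \<cdot> E.t ((s \<otimes> a) \<otimes> a') (b' \<otimes> (b \<otimes> t)) \<in> sub_tensor B B"
   using add.IH(2)[OF nz[OF add.prems(1) ab(1)] nz[OF ab(2) add.prems(2)]] by blast
  have c: "a \<in> carrier D" "b \<in> carrier D" "a' \<in> carrier D" "b' \<in> carrier D" "s \<in> carrier D" "t \<in> carrier D"
   using ab(1,2) ab'(1,2) add.prems Bc by blast+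
  let ?u = "E.t (s \<otimes> (a \<otimes> a')) ((b' \<otimes> b) \<otimes> t)"
  have y: "y \<cdot> ?u \<in> sub_tensor B B" using ab'(3) c by (simp add: D.m_assoc)
  have "x \<cdot> ?u = (x \<cdot> E.t (s \<otimes> a) (b \<otimes> t)) \<cdot> E.t a' b'"
   using E.T_assoc_gen[of x "E.t (s \<otimes> a) (b \<otimes> t)" "E.t a' b'"] c add.hyps by (simp add: t_mult D.m_assoc)
  then have x: "x \<cdot> ?u \<in> sub_tensor B B" using Ss(6)[OF ab(3) sub_tensor_gen, of a' b'] ab'(1,2) by simp
  have "(x \<otimes>\<^bsub>E.TG\<^esub> y) \<cdot> ?u \<in> sub_tensor B B"
   using sub_tensor_add[OF x y] E.T_l_distr[OF add.hyps, of ?u] c by simp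
  then show ?case using nz[OF ab(1) ab'(1)] nz[OF ab'(2) ab(2)] by blast
 qed
 show "?L z"
 proof - obtain a b where *: "a \<in> B - {\<zero>}" "b \<in> B - {\<zero>}" "E.t (a \<otimes> \<one>) (\<one> \<otimes> b) \<cdot> z \<in> sub_tensor B B"
   using L[OF z one one] by blast
  then show ?thesis using Bc by (intro bexI[of _ a] bexI[of _ b]) simp_all
 qed
 show "?R z"
 proof - obtain a b where *: "a \<in> B - {\<zero>}" "b \<in> B - {\<zero>}" "z \<cdot> E.t (\<one> \<otimes> a) (b \<otimes> \<one>) \<in> sub_tensor B B"
   using R[OF z one one] by blast
  then show ?thesis using Bc by (intro bexI[of _ a] bexI[of _ b]) simp_all
 qed
qed

text \<open>Climb from C_0 \<otimes> C_0 to C_n \<otimes> C_0, then to C_n \<otimes> C_n, one Ore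
  variable at a time, and finish by localizing at the elements s \<otimes> t, whose inverses are the
  tensors of the inverses.\<close>

theorem (in enveloping) nc_noetherian_domain_De: assumes U: "Units D = carrier D - {\<zero>}"
  and C: "\<And>i. i \<le> n ==> K_subalgebra K D (C i)"
  and O: "\<And>i. i < n ==> ore_free D (C i) (C (Suc i)) (x i)"
  and base: "nc_noetherian_domain (De\<lparr>carrier := sub_tensor (C 0) (C 0)\<rparr>)"
  and fl: "\<And>q. q \<in> carrier D ==> \<exists>s\<in>C n - {\<zero>}. s \<otimes> q \<in> C n"
  and fr: "\<And>q. q \<in> carrier D ==> \<exists>s\<in>C n - {\<zero>}. q \<otimes> s \<in> C n"
 shows "nc_noetherian_domain De"
proof - have Cr: "subring (C i) D" and Cc: "C i \<subseteq> carrier D" if "i \<le> n" for i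
  using K_subalgebraE(1,2)[OF C[OF that]] by blast+
 have Cop: "K_subalgebra K (opposite D) (C i)" if "i \<le> n" for i
  using C[OF that] subring_opposite[OF D.ring_axioms Cr[OF that]] by (simp add: K_subalgebra_def)
 have 1: "nc_noetherian_domain (De\<lparr>carrier := sub_tensor (C i) (C 0)\<rparr>)" if "i \<le> n" for i using that
 proof (induction i) case 0 then show ?case using base by simp
 next case (Suc i) then have i: "i < n" "i \<le> n" "Suc i \<le> n" "0 \<le> n" by simp_all
  have "ore_free De (sl.tens (C i) (\<beta> ` C 0)) (sl.tens (C (Suc i)) (\<beta> ` C 0)) (\<alpha> (x i))"
   by (rule sl.tens_ore_free[OF O[OF i(1)] C[OF i(2)] C[OF i(3)] \<beta>_image_subring[OF Cr[OF i(4)]] image_mono[OF Cc[OF i(4)]]])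
  then have "ore_free De (sub_tensor (C i) (C 0)) (sub_tensor (C (Suc i)) (C 0)) (\<alpha> (x i))"
   unfolding sl_tens[OF Cc[OF i(2)] Cc[OF i(4)]] sl_tens[OF Cc[OF i(3)] Cc[OF i(4)]] .
  then show ?case by (rule ore_free.nc_noetherian_domain_ore_free) (use Suc.IH i in simp)
 qed
 \<comment> \<open>The right factor is treated as an Ore tower of the opposite algebra; the freeness
   condition is symmetric, so the same steps apply.\<close>
 have 2: "nc_noetherian_domain (De\<lparr>carrier := sub_tensor (C n) (C i)\<rparr>)" if "i \<le> n" for i using that
 proof (induction i) case 0 then show ?case using 1 by simp
 next case (Suc i) then have i: "i < n" "i \<le> n" "Suc i \<le> n" "n \<le> n" by simp_all
  have "ore_free De (sr.tens (C i) (\<alpha> ` C n)) (sr.tens (C (Suc i)) (\<alpha> ` C n)) (\<beta> (x i))"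
   by (rule sr.tens_ore_free[OF ore_free.opposite_ore_free[OF O[OF i(1)]] Cop[OF i(2)] Cop[OF i(3)]
      \<alpha>_image_subring[OF Cr[OF i(4)]] image_mono[OF Cc[OF i(4)]]])
  then have "ore_free De (sub_tensor (C n) (C i)) (sub_tensor (C n) (C (Suc i))) (\<beta> (x i))"
   unfolding sr_tens[OF Cc[OF i(4)] Cc[OF i(2)]] sr_tens[OF Cc[OF i(4)] Cc[OF i(3)]] .
  then show ?case by (rule ore_free.nc_noetherian_domain_ore_free) (use Suc.IH i in simp)
 qed
 note Cn = Cr[OF order_refl]
 have inv: "E.t s t \<in> sub_tensor (C n) (C n)" "E.t (inv s) (inv t) \<in> carrier De"
  "E.t (inv s) (inv t) \<cdot> E.t s t = \<one>\<^bsub>De\<^esub>" "E.t s t \<cdot> E.t (inv s) (inv t) = \<one>\<^bsub>De\<^esub>"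
  if st: "s \<in> C n - {\<zero>}" "t \<in> C n - {\<zero>}" for s t
 proof - have u: "s \<in> Units D" "t \<in> Units D" using st Cc[OF order_refl] unfolding U by auto
  then have c: "s \<in> carrier D" "t \<in> carrier D" "inv s \<in> carrier D" "inv t \<in> carrier D" by auto
  show "E.t s t \<in> sub_tensor (C n) (C n)" using st by (intro sub_tensor_gen) auto
  show "E.t (inv s) (inv t) \<in> carrier De" using c by simp
  show "E.t (inv s) (inv t) \<cdot> E.t s t = \<one>\<^bsub>De\<^esub>" "E.t s t \<cdot> E.t (inv s) (inv t) = \<one>\<^bsub>De\<^esub>"
   using c u E.T_one by (simp_all add: t_mult)
 qed
 have "nc_noetherian_domain (De\<lparr>carrier := carrier De\<rparr>)"
 proof (rule nc_noetherian_domain_localization[OF E.T.ring_axioms sub_tensor_subring[OF Cn Cn] E.T.carrier_is_subring])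
  show "sub_tensor (C n) (C n) \<subseteq> carrier De" by (rule subringE(1)[OF sub_tensor_subring[OF Cn Cn]])
  show "nc_noetherian_domain (De\<lparr>carrier := sub_tensor (C n) (C n)\<rparr>)" by (rule 2) simp
  fix z assume "z \<in> carrier De"
  then have z: "z \<in> carrier E.TG" by simp
  obtain s t where st: "s \<in> C n - {\<zero>}" "t \<in> C n - {\<zero>}" "E.t s t \<cdot> z \<in> sub_tensor (C n) (C n)"
   using sub_tensor_fractions(1)[OF U Cn fl fr z] by blast
  then show "\<exists>u\<in>sub_tensor (C n) (C n). \<exists>v\<in>carrier De. u \<cdot> z \<in> sub_tensor (C n) (C n) \<and> v \<cdot> u = \<one>\<^bsub>De\<^esub>"
   using inv[OF st(1,2)] by blast
  obtain s t where st: "s \<in> C n - {\<zero>}" "t \<in> C n - {\<zero>}" "z \<cdot> E.t s t \<in> sub_tensor (C n) (C n)"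
   using sub_tensor_fractions(2)[OF U Cn fl fr z] by blast
  then show "\<exists>u\<in>sub_tensor (C n) (C n). \<exists>v\<in>carrier De. z \<cdot> u \<in> sub_tensor (C n) (C n) \<and> u \<cdot> v = \<one>\<^bsub>De\<^esub>"
   using inv[OF st(1,2)] by blast
 qed
 then show ?thesis by (simp del: E.T_simps)
qed

section \<open>The chain condition and finite generation for division subalgebras\<close>

section \<open>Division subalgebras\<close>

text \<open>If every finite subset could be enlarged by one element of \<open>S\<close> so as to
  change the value of f, iterating such a choice would produce a chain on which f never becomes
  constant.\<close>

lemma acc_finite_subset: fixes f :: "'a set \<Rightarrow> 'b set"
 assumes acc: "\<And>Z :: nat \<Rightarrow> 'a set. (\<And>i. finite (Z i)) ==> (\<And>i. Z i \<subseteq> S) ==> (\<And>i. Z i \<subseteq> Z (Suc i)) ==>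
   \<exists>N. \<forall>i\<ge>N. f (Z i) = f (Z N)"
 obtains Z where "finite Z" "Z \<subseteq> S" "\<And>e. e \<in> S ==> f (insert e Z) = f Z"
proof (rule ccontr) assume "\<not> thesis"
 then have "\<forall>Z. \<exists>e. finite Z \<and> Z \<subseteq> S \<longrightarrow> e \<in> S \<and> f (insert e Z) \<noteq> f Z" using that by blast
 then obtain c where c: "\<And>Z. finite Z ==> Z \<subseteq> S ==> c Z \<in> S" "\<And>Z. finite Z ==> Z \<subseteq> S ==> f (insert (c Z) Z) \<noteq> f Z"
  by metis
 define Z where "Z = rec_nat {} (\<lambda>_ Z. insert (c Z) Z)"
 have Z0: "Z 0 = {}" and ZS: "Z (Suc i) = insert (c (Z i)) (Z i)" for i by (simp_all add: Z_def)
 have fin: "finite (Z i) \<and> Z i \<subseteq> S" for i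
 proof (induction i) case (Suc i) then show ?case using c(1)[of "Z i"] by (simp add: ZS)
 qed (simp add: Z0)
 have "Z i \<subseteq> Z (Suc i)" for i unfolding ZS by blast
 then obtain N where N: "\<forall>i\<ge>N. f (Z i) = f (Z N)" using acc[of Z] fin by blast
 have "f (Z (Suc N)) = f (Z N)" using N[rule_format, of "Suc N"] by simp
 then show False using c(2)[of "Z N"] fin[of N] by (simp add: ZS)
qed

context enveloping
begin

text \<open>The element e \<otimes> 1 - 1 \<otimes> e, which measures whether e can be moved across
  the tensor sign.\<close>

definition dlt where "dlt e = \<alpha> e \<otimes>\<^bsub>E.TG\<^esub> \<beta> (\<ominus> e)"

text \<open>F is a \<otimes> b \<mapsto> a \<psi>(b) with \<psi> left linear over E. These are maps
  that factor through D \<otimes>_E D.\<close>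

definition slice_over where "slice_over E \<psi> F \<longleftrightarrow> (\<forall>x\<in>carrier D. \<psi> x \<in> carrier D) \<and>
  (\<forall>x\<in>carrier D. \<forall>y\<in>carrier D. \<psi> (x \<oplus> y) = \<psi> x \<oplus> \<psi> y) \<and>
  (\<forall>k\<in>carrier K. \<forall>x\<in>carrier D. \<psi> (k \<odot> x) = k \<odot> \<psi> x) \<and>
  (\<forall>e\<in>E. \<forall>x\<in>carrier D. \<psi> (e \<otimes> x) = e \<otimes> \<psi> x) \<and>
  F \<in> hom E.TG (add_monoid D) \<and> (\<forall>a\<in>carrier D. \<forall>b\<in>carrier D. F (E.t a b) = a \<otimes> \<psi> b)"

text \<open>For a division subalgebra \<open>E\<close> this is the kernel of \<open>D \<otimes>\<^sub>K D\<^sup>o \<rightarrow> D \<otimes>\<^sub>E D\<close>.\<close>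

definition kernel_ideal where "kernel_ideal E = {z \<in> carrier E.TG. \<forall>\<psi> F. slice_over E \<psi> F \<longrightarrow> F z = \<zero>}"

lemma dlt_closed: "e \<in> carrier D ==> dlt e \<in> carrier E.TG" by (simp add: dlt_def)

lemma slice_overE: assumes "slice_over E \<psi> F" shows "\<And>x. x \<in> carrier D ==> \<psi> x \<in> carrier D"
  "\<And>x y. x \<in> carrier D ==> y \<in> carrier D ==> \<psi> (x \<oplus> y) = \<psi> x \<oplus> \<psi> y"
  "\<And>k x. k \<in> carrier K ==> x \<in> carrier D ==> \<psi> (k \<odot> x) = k \<odot> \<psi> x"
  "\<And>e x. e \<in> E ==> x \<in> carrier D ==> \<psi> (e \<otimes> x) = e \<otimes> \<psi> x"
  "F \<in> hom E.TG (add_monoid D)"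
  "\<And>a b. a \<in> carrier D ==> b \<in> carrier D ==> F (E.t a b) = a \<otimes> \<psi> b"
 using assms unfolding slice_over_def by blast+

lemma slice_over_dlt: assumes S: "slice_over E \<psi> F" and e: "e \<in> carrier D" shows "F (dlt e) = e \<otimes> \<psi> \<one> \<oplus> \<ominus> \<psi> e"
proof - note S = slice_overE[OF S] have "\<psi> (\<ominus> e) = \<ominus> \<psi> e"
  using S(3)[of "\<ominus>\<^bsub>K\<^esub> \<one>\<^bsub>K\<^esub>" e] D.smult_l_minus[of "\<one>\<^bsub>K\<^esub>"] e S(1)[OF e] by simp
 then show ?thesis unfolding dlt_def using e S(1) by (simp add: slice_hom(2)[OF S(5)] S(6))
qed

text \<open>Linearity over a larger set leaves fewer maps that have to vanish.\<close>

lemma kernel_ideal_mono: "E \<subseteq> E' ==> kernel_ideal E \<subseteq> kernel_ideal E'"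
 unfolding kernel_ideal_def slice_over_def by blast

lemma dlt_kernel_ideal: assumes "E \<subseteq> carrier D" "e \<in> E" shows "dlt e \<in> kernel_ideal E"
proof - have e: "e \<in> carrier D" using assms by blast have "F (dlt e) = \<zero>" if S: "slice_over E \<psi> F" for \<psi> F
  using slice_over_dlt[OF S e] slice_overE(4)[OF S assms(2) D.one_closed] slice_overE(1)[OF S] e
  by (simp add: D.r_neg)
 then show ?thesis using dlt_closed[OF e] by (simp add: kernel_ideal_def)
qed

text \<open>Multiplication by a \<otimes> b turns the slice along \<psi> into a times the slice
  along x \<mapsto> \<psi>(xb), and the latter map is again left linear over E.\<close>

lemma kernel_ideal_left_ideal: assumes Ec: "E \<subseteq> carrier D" shows "left_ideal (kernel_ideal E) De"
 unfolding left_ideal_iff[OF E.T.ring_axioms]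
proof (intro conjI ballI) note sh = slice_hom[OF slice_overE(5)]
 show "kernel_ideal E \<subseteq> carrier De" by (auto simp: kernel_ideal_def)
 show "\<zero>\<^bsub>De\<^esub> \<in> kernel_ideal E" using sh(3) by (simp add: kernel_ideal_def)
 show "a \<oplus>\<^bsub>De\<^esub> b \<in> kernel_ideal E" if ab: "a \<in> kernel_ideal E" "b \<in> kernel_ideal E" for a b
 proof - have c: "a \<in> carrier E.TG" "b \<in> carrier E.TG" using ab by (simp_all add: kernel_ideal_def)
  have "F (a \<otimes>\<^bsub>E.TG\<^esub> b) = \<zero>" if S: "slice_over E \<psi> F" for \<psi> F
  proof - have "F a = \<zero>" "F b = \<zero>" using ab S unfolding kernel_ideal_def by blast+
   then show ?thesis using sh(2)[OF S c] by simp
  qed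
  then show ?thesis using c by (simp add: kernel_ideal_def)
 qed
 fix r z assume r: "r \<in> carrier De" and z: "z \<in> kernel_ideal E"
 have zc: "z \<in> carrier E.TG" using z by (simp add: kernel_ideal_def)
 have "F (r \<cdot> z) = \<zero>" if S: "slice_over E \<psi> F" for \<psi> F
 proof - note h = sh[OF S] and S' = slice_overE[OF S] have "r \<in> carrier E.TG" using r by simp
  then show ?thesis
  proof (induction r rule: E.TG_induct) case one then show ?case using E.T_null(1)[OF zc] h(3) by simp
  next case (add x y) then show ?case using E.T_l_distr[OF add.hyps zc] h(2) E.T_mult_closed zc by simp
  next case (gen a b) then have ab: "a \<in> carrier D" "b \<in> carrier D" by simp_all
   have "\<exists>F'\<in>hom E.TG (add_monoid D). \<forall>c\<in>carrier D. \<forall>d\<in>carrier D. F' (E.t c d) = c \<otimes> \<psi> (d \<otimes> b)"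
    by (rule exists_slice(1)) (use ab S'(1-3) in \<open>simp_all add: D.l_distr D.smult_mult_left\<close>)
   then obtain F' where F': "F' \<in> hom E.TG (add_monoid D)"
    "\<And>c d. c \<in> carrier D ==> d \<in> carrier D ==> F' (E.t c d) = c \<otimes> \<psi> (d \<otimes> b)" by blast
   have "slice_over E (\<lambda>x. \<psi> (x \<otimes> b)) F'"
    unfolding slice_over_def using F' ab S'(1-4) Ec by (simp add: D.l_distr D.smult_mult_left D.m_assoc subset_iff)
   then have z0: "F' z = \<zero>" using z by (simp add: kernel_ideal_def)
   have "F (E.t a b \<cdot> w) = a \<otimes> F' w" if "w \<in> carrier E.TG" for w using that
   proof (induction w rule: E.TG_induct) case one
    then show ?case using E.T_null(2)[of "E.t a b"] h(3) slice_hom(3)[OF F'(1)] ab by simp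
   next case (add x y) then show ?case
     using E.T_r_distr[OF add.hyps, of "E.t a b"] h(2) slice_hom(1,2)[OF F'(1)] E.T_mult_closed ab
     by (simp add: D.r_distr)
   next case (gen c d) then show ?case using ab S'(1) by (simp add: t_mult S'(6) F'(2) D.m_assoc)
   qed
   then show ?case using zc z0 ab by simp
  qed
 qed
 then show "r \<cdot> z \<in> kernel_ideal E" using E.T_mult_closed[of r z] r zc by (simp add: kernel_ideal_def)
qed

text \<open>For e outside E there is a left E-linear \<psi> with \<psi>(E) = 0 and \<psi>(e) = 1.
  The corresponding slice of e \<otimes> 1 - 1 \<otimes> e is e \<psi>(1) - \<psi>(e) = -1.\<close>

lemma kernel_ideal_separates:
 assumes E: "division_subalgebra K D E" and e: "e \<in> carrier D" and mem: "dlt e \<in> kernel_ideal E"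
 shows "e \<in> E"
proof (rule ccontr) assume ne: "e \<notin> E" note EK = division_subalgebraE[OF E] note Es = subringE[OF EK(2)]
 have Ec: "d \<in> carrier D" if "d \<in> E" for d using Es(1) that by blast
 have "\<exists>\<psi> F. slice_over E \<psi> F \<and> \<psi> \<one> = \<zero> \<and> \<psi> e = \<one>"
 proof (rule D.exists_left_functional[OF EK(2), of E e])
  show "\<exists>e'\<in>E. e' \<otimes> d = \<one>" if "d \<in> E" "d \<noteq> \<zero>" for d using EK(4)[OF that] by blast
  fix \<psi> assume \<psi>: "\<And>x. x \<in> carrier D ==> \<psi> x \<in> E"
   "\<And>x y. x \<in> carrier D ==> y \<in> carrier D ==> \<psi> (x \<oplus> y) = \<psi> x \<oplus> \<psi> y"
   "\<And>d x. d \<in> E ==> x \<in> carrier D ==> \<psi> (d \<otimes> x) = d \<otimes> \<psi> x"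
   "\<And>x. x \<in> E ==> \<psi> x = \<zero>" "\<psi> e = \<one>"
  have \<psi>c: "\<psi> x \<in> carrier D" if "x \<in> carrier D" for x using \<psi>(1)[OF that] Ec by blast
  have \<psi>k: "\<psi> (k \<odot> x) = k \<odot> \<psi> x" if kx: "k \<in> carrier K" "x \<in> carrier D" for k x
   using \<psi>(3)[OF K_subalgebraE(5)[OF EK(1) kx(1) Es(3)] kx(2)] D.scalar_mult(1)[OF kx(1)] kx(2) \<psi>c by simp
  have "\<exists>F\<in>hom E.TG (add_monoid D). \<forall>a\<in>carrier D. \<forall>b\<in>carrier D. F (E.t a b) = a \<otimes> \<psi> b"
   by (rule exists_slice(1)) (rule \<psi>c \<psi>(2) \<psi>k; assumption)+
  then obtain F where F: "F \<in> hom E.TG (add_monoid D)"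
   "\<forall>a\<in>carrier D. \<forall>b\<in>carrier D. F (E.t a b) = a \<otimes> \<psi> b" by (rule bexE)
  have "slice_over E \<psi> F"
   unfolding slice_over_def by (intro conjI ballI F) (rule \<psi>c \<psi>(2,3) \<psi>k F(2)[rule_format]; assumption)+
  then show ?thesis using \<psi>(4)[OF Es(3)] \<psi>(5) by (intro exI conjI)
 qed (fact Es(1,2,6,7) e ne)+
 then obtain \<psi> F where S: "slice_over E \<psi> F" and \<psi>: "\<psi> \<one> = \<zero>" "\<psi> e = \<one>" by blast
 have "F (dlt e) = \<zero>" using mem S unfolding kernel_ideal_def by blast
 then have "\<ominus> \<one> = \<zero>" using slice_over_dlt[OF S e] \<psi> e by simp
 then have "\<ominus> (\<ominus> \<one>) = \<ominus> \<zero>" by simp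
 then show False using nontrivial by simp
qed

theorem acc_division_subalgebras: assumes N: "left_noetherian De"
  and E: "\<And>i. division_subalgebra K D (E i)" "\<And>i :: nat. E i \<subseteq> E (Suc i)"
 shows "\<exists>N. \<forall>i\<ge>N. E i = E N"
proof - have Ec: "E i \<subseteq> carrier D" for i by (rule subringE(1)[OF division_subalgebraE(2)[OF E(1)]])
 obtain N where N: "\<And>i. i \<ge> N ==> kernel_ideal (E i) = kernel_ideal (E N)"
  using left_noetherianE[of _ "\<lambda>i. kernel_ideal (E i)", OF N kernel_ideal_left_ideal[OF Ec] kernel_ideal_mono[OF E(2)]]
  by blast
 have "E i = E N" if i: "i \<ge> N" for i
 proof show "E N \<subseteq> E i" by (rule lift_Suc_mono_le[of E, OF E(2) i]) show "E i \<subseteq> E N" proof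
   fix e assume e: "e \<in> E i"
   then have "dlt e \<in> kernel_ideal (E i)" by (rule dlt_kernel_ideal[OF Ec])
   then have "dlt e \<in> kernel_ideal (E N)" unfolding N[OF i] .
   then show "e \<in> E N" using kernel_ideal_separates[OF E(1)] e Ec by blast
  qed
 qed
 then show ?thesis by blast
qed

text \<open>The ideals are taken for finite subsets of E. Choose Z so large that adjoining any
  element e of E leaves the ideal of Z unchanged; then the ideal of Z contains e \<otimes> 1 - 1
  \<otimes> e, and every division subalgebra containing Z contains e.\<close>

theorem division_subalgebra_finitely_generated:
 assumes N: "left_noetherian De" and E: "division_subalgebra K D E"
 shows "finitely_generated_division_algebra K (D\<lparr>carrier := E\<rparr>)"
proof - have Ec: "E \<subseteq> carrier D" by (rule subringE(1)[OF division_subalgebraE(2)[OF E]])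
 obtain Z where Z: "finite Z" "Z \<subseteq> E" "\<And>e. e \<in> E ==> kernel_ideal (insert e Z) = kernel_ideal Z"
 proof (rule acc_finite_subset[of E kernel_ideal])
  fix Z :: "nat \<Rightarrow> 'd set" assume Z: "\<And>i. Z i \<subseteq> E" "\<And>i. Z i \<subseteq> Z (Suc i)"
  have Zc: "Z i \<subseteq> carrier D" for i using Z(1) Ec by (rule order_trans)
  obtain M where "\<And>i. i \<ge> M ==> kernel_ideal (Z i) = kernel_ideal (Z M)"
   using left_noetherianE[of _ "\<lambda>i. kernel_ideal (Z i)", OF N kernel_ideal_left_ideal[OF Zc] kernel_ideal_mono[OF Z(2)]]
   by blast
  then show "\<exists>N. \<forall>i\<ge>N. kernel_ideal (Z i) = kernel_ideal (Z N)" by blast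
 qed blast
 have "E' = E" if E': "division_subalgebra K (D\<lparr>carrier := E\<rparr>) E'" "Z \<subseteq> E'" for E'
 proof show E'E: "E' \<subseteq> E" using K_subalgebraE(2)[OF division_subalgebraE(1)[OF E'(1)]] by simp
  have sub: "subring E' D"
  proof (rule D.ring_incl_imp_subring) show "E' \<subseteq> carrier D" using E'E Ec by blast
   show "ring (D\<lparr>carrier := E'\<rparr>)"
    using ring.subring_is_ring[OF D.subring_is_ring[OF division_subalgebraE(2)[OF E]] division_subalgebraE(2)[OF E'(1)]]
    by simp
  qed
  have "division_subalgebra K D E'"
   using E'(1) sub unfolding division_subalgebra_def K_subalgebra_def by simp
  note sep = kernel_ideal_separates[OF this]
  show "E \<subseteq> E'"
  proof fix e assume e: "e \<in> E"
   have "dlt e \<in> kernel_ideal (insert e Z)" by (rule dlt_kernel_ideal) (use e Z(2) Ec in auto)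
   then have "dlt e \<in> kernel_ideal Z" unfolding Z(3)[OF e] .
   then have "dlt e \<in> kernel_ideal E'" using kernel_ideal_mono[OF E'(2)] by blast
   then show "e \<in> E'" using sep e Ec by blast
  qed
 qed
 then show ?thesis unfolding finitely_generated_division_algebra_def
  using E Z(1,2) by (auto simp: division_subalgebra_def)
qed

end

section \<open>Finitely generated abelian groups: finite torsion, and a basis modulo torsion\<close>

section \<open>Finitely generated abelian groups\<close>

context comm_group
begin

lemma generate_insert: assumes S: "S \<subseteq> carrier G" and a: "a \<in> carrier G"
 shows "generate G (insert a S) = {h \<otimes> a [^] (k :: int) | h k. h \<in> generate G S}" (is "_ = ?H")
proof note sub = generate_is_subgroup[OF S]
 have gc: "h \<in> carrier G" if "h \<in> generate G S" for h using generate_in_carrier[OF S that] .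
 show "generate G (insert a S) \<subseteq> ?H"
 proof (rule generate_subgroup_incl) show "insert a S \<subseteq> ?H" proof fix x assume "x \<in> insert a S"
   then consider "x = a" | "x \<in> S" by blast
   then show "x \<in> ?H"
   proof cases case 1 have "x = \<one> \<otimes> a [^] (1 :: int)" using 1 a by simp
    then show ?thesis using generate.one by blast
   next case 2 have "x = x \<otimes> a [^] (0 :: int)" using 2 S by (simp add: subset_iff)
    then show ?thesis using generate.incl[OF 2] by blast
   qed
  qed
  show "subgroup ?H G"
  proof (rule subgroupI) show "?H \<subseteq> carrier G" using gc a by auto show "?H \<noteq> {}" using generate.one by blast
   fix x assume "x \<in> ?H"
   then obtain h and k :: int where x: "h \<in> generate G S" "x = h \<otimes> a [^] k" by blast
   have "inv x = inv h \<otimes> a [^] (- k)" using gc[OF x(1)] a x(2) by (simp add: inv_mult int_pow_neg)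
   then show "inv x \<in> ?H" using subgroup.m_inv_closed[OF sub x(1)] by blast
   fix y assume "y \<in> ?H"
   then obtain h' and k' :: int where y: "h' \<in> generate G S" "y = h' \<otimes> a [^] k'" by blast
   have "x \<otimes> y = (h \<otimes> h') \<otimes> a [^] (k + k')"
    using gc[OF x(1)] gc[OF y(1)] a x(2) y(2) by (simp add: int_pow_mult m_ac)
   then show "x \<otimes> y \<in> ?H" using subgroup.m_closed[OF sub x(1) y(1)] by blast
  qed
 qed
 show "?H \<subseteq> generate G (insert a S)"
 proof fix x assume "x \<in> ?H"
  then obtain h and k :: int where x: "h \<in> generate G S" "x = h \<otimes> a [^] k" by blast
  have sub': "subgroup (generate G (insert a S)) G" using S a by (intro generate_is_subgroup) blast
  have "h \<in> generate G (insert a S)" using mono_generate[of S "insert a S"] x(1) by blast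
  moreover have "a [^] k \<in> generate G (insert a S)"
   by (rule subgroup_int_pow_closed[OF sub']) (rule generate.incl, simp)
  ultimately show "x \<in> generate G (insert a S)" unfolding x(2) by (rule subgroup.m_closed[OF sub'])
 qed
qed

lemma torsion_subgroup_subgroup: "subgroup (torsion_subgroup G) G"
proof (rule subgroupI) show "torsion_subgroup G \<subseteq> carrier G" by (auto simp: torsion_subgroup_def)
 have "\<one> \<in> torsion_subgroup G" unfolding torsion_subgroup_def by (auto intro: exI[of _ "1 :: nat"])
 then show "torsion_subgroup G \<noteq> {}" by blast
 fix a assume "a \<in> torsion_subgroup G"
 then obtain n :: nat where a: "a \<in> carrier G" "n > 0" "a [^] n = \<one>" unfolding torsion_subgroup_def by blast
 have "inv a [^] n = \<one>" using a nat_pow_inv[OF a(1), of n] by simp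
 then show "inv a \<in> torsion_subgroup G" unfolding torsion_subgroup_def using a by blast
 fix b assume "b \<in> torsion_subgroup G"
 then obtain m :: nat where b: "b \<in> carrier G" "m > 0" "b [^] m = \<one>" unfolding torsion_subgroup_def by blast
 have "a [^] (n * m) = \<one>" using a nat_pow_pow[OF a(1), of n m] by simp
 moreover have "b [^] (n * m) = \<one>" using b nat_pow_pow[OF b(1), of m n] by (simp add: mult.commute)
 ultimately have "(a \<otimes> b) [^] (n * m) = \<one>" using nat_pow_distrib[OF a(1) b(1)] by simp
 moreover have "n * m > 0" "a \<otimes> b \<in> carrier G" using a b by simp_all
 ultimately show "a \<otimes> b \<in> torsion_subgroup G" unfolding torsion_subgroup_def by blast
qed

lemma torsion_int_powD: assumes "a \<in> carrier G" "k \<noteq> 0" "a [^] (k :: int) \<in> torsion_subgroup G"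
 shows "a \<in> torsion_subgroup G"
proof -
 obtain n :: nat where n: "n > 0" "(a [^] k) [^] n = \<one>" using assms(3) unfolding torsion_subgroup_def by blast
 have 1: "a [^] (k * int n) = \<one>" using n(2) int_pow_pow[OF assms(1), of k "int n"] by (simp add: int_pow_int)
 have "a [^] (\<bar>k\<bar> * int n) = \<one>"
 proof (cases "k \<ge> 0") case False then have "\<bar>k\<bar> * int n = - (k * int n)" by simp
  then show ?thesis using 1 int_pow_neg[OF assms(1), of "k * int n"] by simp
 qed (use 1 in simp)
 then have "a [^] (nat \<bar>k\<bar> * n) = \<one>"
  by (metis int_pow_int nat_int nat_abs_mult_distrib abs_of_nat of_nat_mult int_nat_eq abs_ge_zero)
 then show ?thesis unfolding torsion_subgroup_def using assms n by (auto intro!: exI[of _ "nat \<bar>k\<bar> * n"])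
qed

text \<open>The exponent of each generator can be reduced modulo its order.\<close>

lemma finite_generate_torsion: assumes "finite S" "S \<subseteq> torsion_subgroup G" shows "finite (generate G S)"
 using assms
proof (induction S rule: finite_induct) case empty then show ?case by (simp add: generate_empty)
next case (insert a S)
 have c: "S \<subseteq> carrier G" "a \<in> carrier G" using insert.prems by (auto simp: torsion_subgroup_def)
 obtain n :: nat where n: "n > 0" "a [^] n = \<one>" using insert.prems by (auto simp: torsion_subgroup_def)
 have n': "a [^] (int n) = \<one>" using n(2) by (simp add: int_pow_int)
 have "generate G (insert a S) \<subseteq> (\<lambda>(h, k). h \<otimes> a [^] k) ` (generate G S \<times> {0..<int n})"
 proof fix x assume "x \<in> generate G (insert a S)"
  then obtain h and k :: int where x: "h \<in> generate G S" "x = h \<otimes> a [^] k"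
   unfolding generate_insert[OF c] by blast
  have "a [^] k = a [^] (int n * (k div int n) + k mod int n)" by simp
  also have "\<dots> = (a [^] int n) [^] (k div int n) \<otimes> a [^] (k mod int n)"
   using c(2) by (simp only: int_pow_mult int_pow_pow)
  also have "\<dots> = a [^] (k mod int n)" using c(2) unfolding n' by simp
  finally have "a [^] k = a [^] (k mod int n)" .
  then have "x = (\<lambda>(h, k). h \<otimes> a [^] k) (h, k mod int n)" using x(2) by simp
  moreover have "(h, k mod int n) \<in> generate G S \<times> {0..<int n}" using x(1) n(1) by simp
  ultimately show "x \<in> (\<lambda>(h, k). h \<otimes> a [^] k) ` (generate G S \<times> {0..<int n})" by (rule image_eqI)
 qed
 moreover have "finite (generate G S)" using insert by simp
 ultimately show ?case by (meson finite_SigmaI finite_atLeastLessThan_int finite_imageI finite_subset)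
qed

definition int_comb :: "('i \<Rightarrow> 'a) \<Rightarrow> ('i \<Rightarrow> int) \<Rightarrow> 'i set \<Rightarrow> 'a" where "int_comb g n I = (\<Otimes>i\<in>I. g i [^] n i)"

lemma int_comb_closed [simp]: "g \<in> I \<rightarrow> carrier G ==> int_comb g n I \<in> carrier G"
 unfolding int_comb_def by (rule finprod_closed) auto

lemma int_comb_cong: "g \<in> I \<rightarrow> carrier G ==> (\<And>i. i \<in> I ==> n i = m i) ==> int_comb g n I = int_comb g m I"
 unfolding int_comb_def by (rule finprod_cong') auto

lemma int_comb_add: assumes g: "g \<in> I \<rightarrow> carrier G"
 shows "int_comb g (\<lambda>i. n i + m i) I = int_comb g n I \<otimes> int_comb g m I"
proof - have gi: "g i \<in> carrier G" if "i \<in> I" for i using g that by blast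
 have "(\<Otimes>i\<in>I. g i [^] (n i + m i)) = (\<Otimes>i\<in>I. g i [^] n i \<otimes> g i [^] m i)"
  by (rule finprod_cong') (simp_all add: gi int_pow_mult)
 also have "\<dots> = (\<Otimes>i\<in>I. g i [^] n i) \<otimes> (\<Otimes>i\<in>I. g i [^] m i)" by (rule finprod_multf) (simp_all add: gi)
 finally show ?thesis by (simp only: int_comb_def)
qed

lemma int_comb_zero: "g \<in> I \<rightarrow> carrier G ==> int_comb g (\<lambda>_. 0) I = \<one>"
 unfolding int_comb_def by (rule finprod_one_eqI) simp

lemma int_comb_uminus: assumes g: "g \<in> I \<rightarrow> carrier G" shows "int_comb g (\<lambda>i. - n i) I = inv (int_comb g n I)"
proof - have "int_comb g (\<lambda>i. - n i) I \<otimes> int_comb g n I = \<one>"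
  unfolding int_comb_add[OF g, symmetric] using int_comb_zero[OF g] by simp
 then show ?thesis using g by (intro inv_equality[symmetric]) simp_all
qed

lemma int_comb_single: assumes "i \<in> I" "g \<in> I \<rightarrow> carrier G" "finite I"
 shows "int_comb g (\<lambda>j. if j = i then 1 else 0) I = g i"
proof - have "int_comb g (\<lambda>j. if j = i then 1 else 0) I = (\<Otimes>j\<in>I. if i = j then g j else \<one>)"
  unfolding int_comb_def by (rule finprod_cong') (use assms in \<open>auto simp: Pi_iff\<close>)
 also have "\<dots> = g i" by (rule finprod_singleton) (use assms in auto)
 finally show ?thesis .
qed

lemma int_comb_insert: "finite I ==> i \<notin> I ==> g \<in> insert i I \<rightarrow> carrier G ==>
  int_comb g n (insert i I) = g i [^] n i \<otimes> int_comb g n I"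
 unfolding int_comb_def by (rule finprod_insert) auto

text \<open>The elementary basis change: adding e times the i-th generator to the j-th is
  compensated by lowering the i-th coefficient by e times the j-th.\<close>

lemma int_comb_change: assumes I: "finite I" and ij: "i \<in> I" "j \<in> I" "i \<noteq> j" and g: "g \<in> I \<rightarrow> carrier G"
 shows "int_comb g n I = int_comb (g(j := g j \<otimes> g i [^] (e :: int))) (n(i := n i - e * n j)) I"
proof - define J where "J = I - {i, j}"
 have I': "I = insert i (insert j J)" and J: "finite J" "i \<notin> insert j J" "j \<notin> J"
  unfolding J_def using I ij by auto
 define g' where "g' = g(j := g j \<otimes> g i [^] e)"
 define n' where "n' = n(i := n i - e * n j)"
 have c: "g i \<in> carrier G" "g j \<in> carrier G" using g ij by auto
 have gJ: "g \<in> insert j J \<rightarrow> carrier G" "g \<in> J \<rightarrow> carrier G" "g \<in> insert i (insert j J) \<rightarrow> carrier G"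
  using g unfolding I' by auto
 have g'J: "g' \<in> insert j J \<rightarrow> carrier G" "g' \<in> J \<rightarrow> carrier G" "g' \<in> insert i (insert j J) \<rightarrow> carrier G"
  using gJ c ij(3) unfolding g'_def by (auto simp: Pi_iff)
 have "int_comb g' n' J = int_comb g n J"
  unfolding int_comb_def by (rule finprod_cong') (use J gJ in \<open>auto simp: g'_def n'_def\<close>)
 then have "int_comb g' n' I = g i [^] (n i - e * n j) \<otimes> ((g j \<otimes> g i [^] e) [^] n j \<otimes> int_comb g n J)"
  unfolding I' int_comb_insert[OF finite.insertI[OF J(1)] J(2) g'J(3)] int_comb_insert[OF J(1,3) g'J(1)]
  using ij(3) by (simp add: g'_def n'_def)
 also have "\<dots> = (g i [^] (n i - e * n j) \<otimes> g i [^] (e * n j)) \<otimes> (g j [^] n j \<otimes> int_comb g n J)"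
  using c gJ(2) by (simp add: int_pow_distrib int_pow_pow m_ac)
 also have "g i [^] (n i - e * n j) \<otimes> g i [^] (e * n j) = g i [^] n i" using c by (simp flip: int_pow_mult)
 also have "g i [^] n i \<otimes> (g j [^] n j \<otimes> int_comb g n J) = int_comb g n I"
  unfolding I' int_comb_insert[OF finite.insertI[OF J(1)] J(2) gJ(3)] int_comb_insert[OF J(1,3) gJ(1)] ..
 finally show ?thesis unfolding g'_def n'_def by (rule sym)
qed

definition spans_mod_torsion :: "('i \<Rightarrow> 'a) \<Rightarrow> 'i set \<Rightarrow> bool" where "spans_mod_torsion g I \<longleftrightarrow> g \<in> I \<rightarrow> carrier G \<and>
  (\<forall>h\<in>carrier G. \<exists>\<tau>\<in>torsion_subgroup G. \<exists>n. h = \<tau> \<otimes> int_comb g n I)"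

lemma spans_mod_torsion_change:
 assumes I: "finite I" and ij: "i \<in> I" "j \<in> I" "i \<noteq> j" and g: "spans_mod_torsion g I"
 shows "spans_mod_torsion (g(j := g j \<otimes> g i [^] (e :: int))) I"
proof - have gc: "g \<in> I \<rightarrow> carrier G" using g by (simp add: spans_mod_torsion_def)
 have "g(j := g j \<otimes> g i [^] e) \<in> I \<rightarrow> carrier G" using gc ij by (auto simp: Pi_iff)
 moreover have "\<exists>\<tau>\<in>torsion_subgroup G. \<exists>n. h = \<tau> \<otimes> int_comb (g(j := g j \<otimes> g i [^] e)) n I" if h: "h \<in> carrier G" for h
 proof - obtain \<tau> n where "\<tau> \<in> torsion_subgroup G" "h = \<tau> \<otimes> int_comb g n I"
   using g h unfolding spans_mod_torsion_def by blast
  then show ?thesis using int_comb_change[OF I ij gc, of n e] by auto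
 qed
 ultimately show ?thesis by (simp add: spans_mod_torsion_def)
qed

text \<open>Euclid's algorithm: among the spanning tuples of minimal length, a nontrivial relation with
 \<open>\<Sum>|n\<^sub>i|\<close> minimal would have a single nonzero coefficient.\<close>

lemma spans_mod_torsion_independent: fixes g :: "'i \<Rightarrow> 'a"
 assumes I: "finite I" and min: "\<And>I' (g' :: 'i \<Rightarrow> 'a). finite I' ==> spans_mod_torsion g' I' ==> card I \<le> card I'"
  and g: "spans_mod_torsion g I" and rel: "int_comb g n I \<in> torsion_subgroup G"
 shows "\<forall>i\<in>I. n i = 0"
 using g rel
proof (induction "\<Sum>i\<in>I. nat \<bar>n i\<bar>" arbitrary: g n rule: less_induct) case less
 have gc: "g \<in> I \<rightarrow> carrier G" using less.prems(1) by (simp add: spans_mod_torsion_def)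
 show ?case
 proof (rule ccontr) assume "\<not> (\<forall>i\<in>I. n i = 0)" then obtain i0 where i0: "i0 \<in> I" "n i0 \<noteq> 0" by blast
  show False
  proof (cases "\<exists>j\<in>I. j \<noteq> i0 \<and> n j \<noteq> 0") case True
   then obtain j0 where j0: "j0 \<in> I" "j0 \<noteq> i0" "n j0 \<noteq> 0" by blast
   obtain i j where ij: "i \<in> I" "j \<in> I" "i \<noteq> j" "n i \<noteq> 0" "n j \<noteq> 0" "\<bar>n j\<bar> \<le> \<bar>n i\<bar>"
    using i0 j0 by (metis linear)
   \<comment> \<open>The sign for which n i - e n j has absolute value |n i| - |n j|, so that the
     i-th coefficient gets strictly smaller.\<close>
   define e where "e = sgn (n i) * sgn (n j)"
   have "e * n j = sgn (n i) * \<bar>n j\<bar>" by (simp add: e_def mult.assoc abs_sgn[of "n j"] mult.commute)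
   then have lt: "\<bar>n i - e * n j\<bar> < \<bar>n i\<bar>"
    using ij(4-6) by (cases "n i > 0"; cases "n j > 0") (auto simp: e_def)
   let ?g = "g(j := g j \<otimes> g i [^] e)" and ?n = "n(i := n i - e * n j)"
   have "(\<Sum>k\<in>I. nat \<bar>?n k\<bar>) < (\<Sum>k\<in>I. nat \<bar>n k\<bar>)"
    by (rule sum_strict_mono_ex1[OF I]) (use lt ij(1) in \<open>auto intro!: bexI[of _ i]\<close>)
   moreover have "spans_mod_torsion ?g I" by (rule spans_mod_torsion_change[OF I ij(1-3) less.prems(1)])
   moreover have "int_comb ?g ?n I \<in> torsion_subgroup G"
    using less.prems(2) unfolding int_comb_change[OF I ij(1-3) gc, of n e] .
   ultimately have "\<forall>k\<in>I. ?n k = 0" by (rule less.hyps)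
   then show False using ij(2,3,5) by auto
  \<comment> \<open>With a single nonzero coefficient the relation makes a multiple of
    \<open>g i0\<close> torsion, hence \<open>g i0\<close> itself. It can then be absorbed into the
    torsion part, which leaves a shorter spanning tuple.\<close>
  next case False define J where "J = I - {i0}"
   have J: "I = insert i0 J" "finite J" "i0 \<notin> J" using i0 I by (auto simp: J_def)
   have gI: "g \<in> insert i0 J \<rightarrow> carrier G" "g \<in> J \<rightarrow> carrier G" "g i0 \<in> carrier G" using gc J by auto
   have "int_comb g n J = int_comb g (\<lambda>_. 0) J" by (rule int_comb_cong[OF gI(2)]) (use False J in auto)
   then have "int_comb g n I = g i0 [^] n i0"
    unfolding J(1) int_comb_insert[OF J(2,3) gI(1)] int_comb_zero[OF gI(2)] using gI(3) by simp
   then have g0: "g i0 \<in> torsion_subgroup G" using torsion_int_powD[OF gI(3) i0(2)] less.prems(2) by simp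
   have "spans_mod_torsion g J" unfolding spans_mod_torsion_def
   proof (intro conjI ballI) show "g \<in> J \<rightarrow> carrier G" by fact fix h assume "h \<in> carrier G"
    then obtain \<tau> m where \<tau>: "\<tau> \<in> torsion_subgroup G" "h = \<tau> \<otimes> int_comb g m I"
     using less.prems(1) unfolding spans_mod_torsion_def by blast
    have \<tau>c: "\<tau> \<in> carrier G" using \<tau>(1) by (simp add: torsion_subgroup_def)
    have "h = (\<tau> \<otimes> g i0 [^] m i0) \<otimes> int_comb g m J"
     unfolding \<tau>(2) J(1) int_comb_insert[OF J(2,3) gI(1)] using \<tau>c gI by (simp add: m_assoc)
    moreover have "\<tau> \<otimes> g i0 [^] m i0 \<in> torsion_subgroup G"
     by (rule subgroup.m_closed[OF torsion_subgroup_subgroup \<tau>(1)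
        subgroup_int_pow_closed[OF torsion_subgroup_subgroup g0]])
    ultimately show "\<exists>\<tau>\<in>torsion_subgroup G. \<exists>n. h = \<tau> \<otimes> int_comb g n J" by blast
   qed
   then have "card I \<le> card J" by (rule min[OF J(2)])
   then show False using J by simp
  qed
 qed
qed

text \<open>A spanning tuple modulo torsion of minimal length is independent by
  \<open>spans_mod_torsion_independent\<close>; the rest is a re-indexing by an initial segment of
  the naturals.\<close>

lemma finitely_generated_basis: assumes "finite S" "S \<subseteq> carrier G" "generate G S = carrier G"
 obtains r :: nat and g where "spans_mod_torsion g {..<r}"
  "\<And>n. int_comb g n {..<r} \<in> torsion_subgroup G ==> \<forall>i<r. n i = 0"
proof - obtain f :: "nat \<Rightarrow> 'a" where f: "bij_betw f {..<card S} S"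
  using ex_bij_betw_nat_finite[OF assms(1)] by (auto simp: atLeast0LessThan)
 have fc: "f \<in> {..<card S} \<rightarrow> carrier G" using f assms(2) by (auto simp: bij_betw_def)
 have "spans_mod_torsion f {..<card S}" unfolding spans_mod_torsion_def
 proof (intro conjI ballI) show "f \<in> {..<card S} \<rightarrow> carrier G" by fact fix h assume "h \<in> carrier G"
  then have "h \<in> generate G S" using assms(3) by simp
  have single: "\<exists>n. h = int_comb f n {..<card S}" if h: "h \<in> S" for h
  proof - have "h \<in> f ` {..<card S}" using f h by (simp add: bij_betw_def)
   then obtain i where i: "i < card S" "h = f i" by blast
   then show ?thesis using int_comb_single[OF _ fc, of i] by (intro exI[of _ "\<lambda>j. if j = i then 1 else 0"]) simp
  qed
  from \<open>h \<in> generate G S\<close> have "\<exists>n. h = int_comb f n {..<card S}"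
  proof (induction rule: generate.induct) case one show ?case using int_comb_zero[OF fc] by metis
  next case (incl h) then show ?case using single by metis
  next case (inv h) then show ?case using single int_comb_uminus[OF fc] by metis
  next case (eng h1 h2) then show ?case using int_comb_add[OF fc] by metis
  qed
  then obtain n where n: "h = int_comb f n {..<card S}" by blast
  have "h = \<one> \<otimes> int_comb f n {..<card S}" using n fc by simp
  then show "\<exists>\<tau>\<in>torsion_subgroup G. \<exists>n. h = \<tau> \<otimes> int_comb f n {..<card S}"
   using subgroup.one_closed[OF torsion_subgroup_subgroup] by blast
 qed
 define P where "P k \<longleftrightarrow> (\<exists>I (g :: nat \<Rightarrow> 'a). finite I \<and> card I = k \<and> spans_mod_torsion g I)" for k
 define k where "k = (LEAST k. P k)"
 have "P (card S)" unfolding P_def using \<open>spans_mod_torsion f {..<card S}\<close> finite_lessThan card_lessThan by blast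
 then have "P k" unfolding k_def by (rule LeastI)
 then obtain I and g :: "nat \<Rightarrow> 'a" where I: "finite I" "card I = k" "spans_mod_torsion g I" unfolding P_def by blast
 have min: "card I \<le> card I'" if I': "finite I'" "spans_mod_torsion g' I'" for I' and g' :: "nat \<Rightarrow> 'a"
 proof - have "P (card I')" unfolding P_def using I' by blast
  then show ?thesis unfolding I(2) k_def by (rule Least_le)
 qed
 have gc: "g \<in> I \<rightarrow> carrier G" using I(3) by (simp add: spans_mod_torsion_def)
 obtain b where b: "bij_betw b {..<k} I"
  using ex_bij_betw_nat_finite[OF I(1)] I(2) by (auto simp: atLeast0LessThan)
 have binj: "inj_on b {..<k}" and bim: "b ` {..<k} = I" using b by (auto simp: bij_betw_def)
 have re: "int_comb (g \<circ> b) (n \<circ> b) {..<k} = int_comb g n I" for n unfolding int_comb_def bim[symmetric]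
  by (subst finprod_reindex[OF _ binj]) (use gc bim in auto)
 have re': "\<exists>n'. int_comb (g \<circ> b) n {..<k} = int_comb g n' I \<and> (\<forall>i<k. n i = n' (b i))" for n
 proof - define n' where "n' = n \<circ> inv_into {..<k} b"
  have n': "n' (b i) = n i" if "i < k" for i using that binj by (simp add: n'_def)
  have "int_comb (g \<circ> b) n {..<k} = int_comb (g \<circ> b) (n' \<circ> b) {..<k}"
   by (rule int_comb_cong) (use gc bim n' in auto)
  then show ?thesis using re[of n'] n' by metis
 qed
 show ?thesis
 proof (rule that[of "g \<circ> b" k]) show "spans_mod_torsion (g \<circ> b) {..<k}" unfolding spans_mod_torsion_def
  proof (intro conjI ballI) show "g \<circ> b \<in> {..<k} \<rightarrow> carrier G" using gc bim by auto
   fix h assume "h \<in> carrier G"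
   then obtain \<tau> n where "\<tau> \<in> torsion_subgroup G" "h = \<tau> \<otimes> int_comb g n I"
    using I(3) unfolding spans_mod_torsion_def by blast
   then show "\<exists>\<tau>\<in>torsion_subgroup G. \<exists>n. h = \<tau> \<otimes> int_comb (g \<circ> b) n {..<k}" using re[of n] by metis
  qed
  fix n assume n: "int_comb (g \<circ> b) n {..<k} \<in> torsion_subgroup G"
  obtain n' where n': "int_comb (g \<circ> b) n {..<k} = int_comb g n' I" "\<forall>i<k. n i = n' (b i)" using re' by blast
  have "\<forall>i\<in>I. n' i = 0"
  proof (rule spans_mod_torsion_independent[OF I(1) _ I(3)])
   show "card I \<le> card I'" if "finite I'" "spans_mod_torsion g' I'" for I' and g' :: "nat \<Rightarrow> 'a"
    using that by (rule min)
   show "int_comb g n' I \<in> torsion_subgroup G" using n n'(1) by simp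
  qed
  then show "\<forall>i<k. n i = 0" using n'(2) bim by auto
 qed
qed

end

text \<open>Integer coordinates of a group modulo torsion.\<close>

locale basis_mod_torsion = comm_group G for G :: "'a monoid" (structure) + fixes g :: "nat \<Rightarrow> 'a" and r :: nat
 assumes spans: "spans_mod_torsion g {..<r}"
  and independent: "\<And>n. int_comb g n {..<r} \<in> torsion_subgroup G ==> \<forall>i<r. n i = 0"
begin

abbreviation "tors \<equiv> torsion_subgroup G"
abbreviation "comb n \<equiv> int_comb g n {..<r}"

lemma gc: "g \<in> {..<r} \<rightarrow> carrier G" using spans by (simp add: spans_mod_torsion_def)

lemma tors_carrier: "x \<in> tors ==> x \<in> carrier G" by (simp add: torsion_subgroup_def)

lemma decomposition: assumes "h \<in> carrier G" obtains \<tau> n where "\<tau> \<in> tors" "h = \<tau> \<otimes> comb n"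
 using spans assms unfolding spans_mod_torsion_def by blast

lemma unique: assumes "\<tau> \<in> tors" "\<tau>' \<in> tors" "\<tau> \<otimes> comb n = \<tau>' \<otimes> comb m" shows "\<forall>i<r. n i = m i" "\<tau> = \<tau>'"
proof -
 note c = tors_carrier[OF assms(1)] tors_carrier[OF assms(2)] int_comb_closed[OF gc, of n] int_comb_closed[OF gc, of m]
 have "comb (\<lambda>i. n i + - m i) = comb n \<otimes> inv (comb m)"
  unfolding int_comb_add[OF gc] int_comb_uminus[OF gc] ..
 also have "\<dots> = inv \<tau> \<otimes> (\<tau> \<otimes> comb n) \<otimes> inv (comb m)" using c by (simp add: m_assoc[symmetric])
 also have "\<dots> = inv \<tau> \<otimes> \<tau>'" unfolding assms(3) using c by (simp add: m_assoc)
 finally have "comb (\<lambda>i. n i + - m i) \<in> tors"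
  using subgroup.m_closed[OF torsion_subgroup_subgroup subgroup.m_inv_closed[OF torsion_subgroup_subgroup assms(1)] assms(2)]
  by simp
 then show nm: "\<forall>i<r. n i = m i" using independent by fastforce
 have "comb n = comb m" by (rule int_comb_cong[OF gc]) (use nm in simp)
 then show "\<tau> = \<tau>'" using assms(3) c by simp
qed

text \<open>The choice determines only the values at indices below \<open>r\<close>; there it is
  unique by \<open>unique\<close>.\<close>

definition coord :: "'a \<Rightarrow> nat \<Rightarrow> int" where "coord h = (SOME n. \<exists>\<tau>\<in>tors. h = \<tau> \<otimes> comb n)"

lemma coordE: assumes "h \<in> carrier G" obtains \<tau> where "\<tau> \<in> tors" "h = \<tau> \<otimes> comb (coord h)"
proof - have "\<exists>n. \<exists>\<tau>\<in>tors. h = \<tau> \<otimes> comb n" using decomposition[OF assms] by metis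
 then have "\<exists>\<tau>\<in>tors. h = \<tau> \<otimes> comb (coord h)" unfolding coord_def by (rule someI_ex)
 then show ?thesis using that by blast
qed

lemma coord_eq: assumes "\<tau> \<in> tors" "i < r" shows "coord (\<tau> \<otimes> comb n) i = n i"
proof - have "\<tau> \<otimes> comb n \<in> carrier G" using tors_carrier[OF assms(1)] int_comb_closed[OF gc] by simp
 then obtain \<tau>' where "\<tau>' \<in> tors" "\<tau> \<otimes> comb n = \<tau>' \<otimes> comb (coord (\<tau> \<otimes> comb n))" by (rule coordE)
 then show ?thesis using unique(1)[OF assms(1)] assms(2) by metis
qed

lemma coord_mult: assumes "h \<in> carrier G" "h' \<in> carrier G" "i < r"
 shows "coord (h \<otimes> h') i = coord h i + coord h' i"
proof - obtain \<tau> where \<tau>: "\<tau> \<in> tors" "h = \<tau> \<otimes> comb (coord h)" using assms(1) by (rule coordE)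
 obtain \<tau>' where \<tau>': "\<tau>' \<in> tors" "h' = \<tau>' \<otimes> comb (coord h')" using assms(2) by (rule coordE)
 note c = tors_carrier[OF \<tau>(1)] tors_carrier[OF \<tau>'(1)] int_comb_closed[OF gc, of "coord h"] int_comb_closed[OF gc, of "coord h'"]
 have "(\<tau> \<otimes> comb (coord h)) \<otimes> (\<tau>' \<otimes> comb (coord h')) = (\<tau> \<otimes> \<tau>') \<otimes> comb (\<lambda>i. coord h i + coord h' i)"
  unfolding int_comb_add[OF gc] using c by (simp add: m_ac)
 then have "h \<otimes> h' = (\<tau> \<otimes> \<tau>') \<otimes> comb (\<lambda>i. coord h i + coord h' i)" using \<tau>(2) \<tau>'(2) by simp
 then show ?thesis using coord_eq[OF subgroup.m_closed[OF torsion_subgroup_subgroup \<tau>(1) \<tau>'(1)] assms(3)] by simp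
qed

lemma g_as_comb: "i < r ==> g i = comb (\<lambda>j. if j = i then 1 else 0)"
 using int_comb_single[OF _ gc, of i] by simp

lemma coord_g: assumes "i < r" "j < r" shows "coord (g i) j = (if j = i then 1 else 0)"
proof - have "coord (\<one> \<otimes> comb (\<lambda>j. if j = i then 1 else 0)) j = (if j = i then 1 else 0)"
  by (rule coord_eq[OF subgroup.one_closed[OF torsion_subgroup_subgroup] assms(2)])
 then show ?thesis using g_as_comb[OF assms(1)] int_comb_closed[OF gc] by simp
qed

lemma structure_iso: "G \<cong> (G\<lparr>carrier := tors\<rparr>) \<times>\<times> product_group {..<r} (\<lambda>_. integer_group)"
proof - let ?H = "(G\<lparr>carrier := tors\<rparr>) \<times>\<times> product_group {..<r} (\<lambda>_. integer_group)"
 let ?f = "\<lambda>(\<tau>, n). \<tau> \<otimes> comb n"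
 have cH: "carrier ?H = tors \<times> (\<Pi>\<^sub>E i\<in>{..<r}. UNIV)" by (simp add: DirProd_def)
 have gT: "group (G\<lparr>carrier := tors\<rparr>)" by (rule subgroup.subgroup_is_group[OF torsion_subgroup_subgroup is_group])
 have gH: "group ?H" by (rule DirProd_group[OF gT]) simp
 have "?f \<in> iso ?H G"
 proof (rule isoI) show "?f \<in> hom ?H G" proof (rule homI) fix x assume "x \<in> carrier ?H"
   then show "?f x \<in> carrier G" unfolding cH using tors_carrier int_comb_closed[OF gc] by auto
  next fix x y assume xy: "x \<in> carrier ?H" "y \<in> carrier ?H"
   obtain \<tau> n \<tau>' n' where *: "x = (\<tau>, n)" "y = (\<tau>', n')" by (metis prod.exhaust)
   have t: "\<tau> \<in> carrier G" "\<tau>' \<in> carrier G" using xy tors_carrier unfolding cH * by auto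
   have "x \<otimes>\<^bsub>?H\<^esub> y = (\<tau> \<otimes> \<tau>', \<lambda>i\<in>{..<r}. n i + n' i)" by (simp add: * DirProd_def)
   then have "?f (x \<otimes>\<^bsub>?H\<^esub> y) = (\<tau> \<otimes> \<tau>') \<otimes> comb (\<lambda>i\<in>{..<r}. n i + n' i)" by simp
   also have "comb (\<lambda>i\<in>{..<r}. n i + n' i) = comb (\<lambda>i. n i + n' i)" by (rule int_comb_cong[OF gc]) simp
   also have "(\<tau> \<otimes> \<tau>') \<otimes> comb (\<lambda>i. n i + n' i) = ?f x \<otimes> ?f y"
    unfolding int_comb_add[OF gc] using t int_comb_closed[OF gc, of n] int_comb_closed[OF gc, of n'] by (simp add: * m_ac)
   finally show "?f (x \<otimes>\<^bsub>?H\<^esub> y) = ?f x \<otimes> ?f y" .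
  qed
  show "bij_betw ?f (carrier ?H) (carrier G)"
  proof (rule bij_betw_imageI) show "inj_on ?f (carrier ?H)" proof (rule inj_onI)
    fix x y assume xy: "x \<in> carrier ?H" "y \<in> carrier ?H" "?f x = ?f y"
    obtain \<tau> n \<tau>' n' where *: "x = (\<tau>, n)" "y = (\<tau>', n')" by (metis prod.exhaust)
    have t: "\<tau> \<in> tors" "\<tau>' \<in> tors" "n \<in> (\<Pi>\<^sub>E i\<in>{..<r}. UNIV)" "n' \<in> (\<Pi>\<^sub>E i\<in>{..<r}. UNIV)"
     using xy(1,2) unfolding cH * by auto
    have eq: "\<tau> \<otimes> comb n = \<tau>' \<otimes> comb n'" using xy(3) by (simp add: *)
    have "n = n'" by (rule PiE_ext[OF t(3,4)]) (use unique(1)[OF t(1,2) eq] in simp)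
    then show "x = y" using unique(2)[OF t(1,2) eq] by (simp add: *)
   qed
   show "?f ` carrier ?H = carrier G"
   proof show "?f ` carrier ?H \<subseteq> carrier G" unfolding cH using tors_carrier int_comb_closed[OF gc] by auto
    show "carrier G \<subseteq> ?f ` carrier ?H"
    proof fix h assume "h \<in> carrier G"
     then obtain \<tau> n where \<tau>: "\<tau> \<in> tors" "h = \<tau> \<otimes> comb n" by (rule decomposition)
     have "comb n = comb (restrict n {..<r})" by (rule int_comb_cong[OF gc]) simp
     then have "h = ?f (\<tau>, restrict n {..<r})" using \<tau>(2) by simp
     moreover have "(\<tau>, restrict n {..<r}) \<in> carrier ?H" unfolding cH using \<tau>(1) by auto
     ultimately show "h \<in> ?f ` carrier ?H" by (rule image_eqI)
    qed
   qed
  qed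
 qed
 then have "?H \<cong> G" by (auto simp: is_iso_def)
 then show ?thesis by (rule group.iso_sym[OF gH])
qed

end

section \<open>The rank, computed in the rationalization\<close>

section \<open>The rank\<close>

text \<open>Applying f to the first entries sends defining relations to defining relations, so the
  union over representatives is a single coset.\<close>

lemma (in tensor_pair) tensor_map_left_t: assumes f: "\<And>m. m \<in> carrier M ==> f m \<in> carrier M"
  "\<And>m m'. m \<in> carrier M ==> m' \<in> carrier M ==> f (m \<oplus>\<^bsub>M\<^esub> m') = f m \<oplus>\<^bsub>M\<^esub> f m'"
  "\<And>r m. r \<in> carrier R ==> m \<in> carrier M ==> f (r \<odot>\<^bsub>M\<^esub> m) = r \<odot>\<^bsub>M\<^esub> f m"
  and mn: "m \<in> carrier M" "n \<in> carrier N"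
 shows "tensor_map_left R M N f (t m n) = t (f m) n"
proof -
 define fe :: "('m \<times> 'n \<Rightarrow>\<^sub>0 int) \<Rightarrow> ('m \<times> 'n \<Rightarrow>\<^sub>0 int)" where "fe = frag_extend (\<lambda>(m, n). frag_of (f m, n))"
 have fe_diff: "fe (x - y) = fe x - fe y" for x y unfolding fe_def by (rule frag_extend_diff)
 have fe_add: "fe (x + y) = fe x + fe y" for x y unfolding fe_def by (rule frag_extend_add)
 have fe_of: "fe (frag_of (m, n)) = frag_of (f m, n)" for m n by (simp add: fe_def)
 have K: "fe x \<in> Ker" if "x \<in> Ker" for x using that
 proof (induction rule: Ker_induct) case zero then show ?case by (simp add: fe_def Ker_zero)
 next case (rel x) have "fe x \<in> tensor_relations R M N" using rel[unfolded tensor_relations_def]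
  proof (elim UnE CollectE exE conjE)
   fix m m' n assume x: "x = frag_of (m \<oplus>\<^bsub>M\<^esub> m', n) - frag_of (m, n) - frag_of (m', n)"
    and c: "m \<in> carrier M" "m' \<in> carrier M" "n \<in> carrier N"
   have "fe x = frag_of (f m \<oplus>\<^bsub>M\<^esub> f m', n) - frag_of (f m, n) - frag_of (f m', n)"
    unfolding x fe_diff fe_of f(2)[OF c(1,2)] ..
   then show ?thesis using f(1)[OF c(1)] f(1)[OF c(2)] c(3) unfolding tensor_relations_def by blast
  next fix m n n' assume x: "x = frag_of (m, n \<oplus>\<^bsub>N\<^esub> n') - frag_of (m, n) - frag_of (m, n')"
    and c: "m \<in> carrier M" "n \<in> carrier N" "n' \<in> carrier N"
   have "fe x = frag_of (f m, n \<oplus>\<^bsub>N\<^esub> n') - frag_of (f m, n) - frag_of (f m, n')"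
    unfolding x fe_diff fe_of ..
   then show ?thesis using f(1)[OF c(1)] c(2,3) unfolding tensor_relations_def by blast
  next fix r m n assume x: "x = frag_of (r \<odot>\<^bsub>M\<^esub> m, n) - frag_of (m, r \<odot>\<^bsub>N\<^esub> n)"
    and c: "r \<in> carrier R" "m \<in> carrier M" "n \<in> carrier N"
   have "fe x = frag_of (r \<odot>\<^bsub>M\<^esub> f m, n) - frag_of (f m, r \<odot>\<^bsub>N\<^esub> n)"
    unfolding x fe_diff fe_of f(3)[OF c(1,2)] ..
   then show ?thesis using f(1)[OF c(2)] c(1,3) unfolding tensor_relations_def by blast
  qed
  then show ?case by (rule Ker_rel)
 next case (neg x) have "fe (- x) = - fe x" using fe_diff[of 0 x] by (simp add: fe_def)
  then show ?case using neg Ker_neg by simp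
 next case (add x y) then show ?case unfolding fe_add by (rule Ker_add)
 qed
 have "tensor_map_left R M N f (t m n) = (\<Union>z\<in>q (frag_of (m, n)). q (fe z))"
  by (simp add: tensor_map_left_def t_def fe_def)
 also have "\<dots> = q (fe (frag_of (m, n)))"
 proof (rule UN_q[OF frag_of_carrier[OF mn]]) fix y assume "y - frag_of (m, n) \<in> Ker"
  then have "fe y - fe (frag_of (m, n)) \<in> Ker" using K unfolding fe_diff[symmetric] by blast
  then show "q (fe y) = q (fe (frag_of (m, n)))" by (simp only: q_eq_iff)
 qed
 finally show ?thesis by (simp only: fe_of t_def)
qed

context basis_mod_torsion
begin

abbreviation "GZ \<equiv> group_int_module G"

lemma tensor_pair_rat: "tensor_pair int_ring rat_int_module GZ"
proof (intro tensor_pair.intro tensor_pair_axioms.intro) show "abelian_group rat_int_module"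
 proof (rule abelian_groupI) fix x :: rat
  show "\<exists>y\<in>carrier rat_int_module. y \<oplus>\<^bsub>rat_int_module\<^esub> x = \<zero>\<^bsub>rat_int_module\<^esub>"
   by (rule bexI[of _ "- x"]) (simp_all add: rat_int_module_def)
 qed (simp_all add: rat_int_module_def)
 show "abelian_group GZ"
 proof (rule abelian_groupI) fix x assume "x \<in> carrier GZ" then show "\<exists>y\<in>carrier GZ. y \<oplus>\<^bsub>GZ\<^esub> x = \<zero>\<^bsub>GZ\<^esub>"
   by (intro bexI[of _ "inv x"]) (simp_all add: group_int_module_def)
 next fix x y assume "x \<in> carrier GZ" "y \<in> carrier GZ"
  then show "x \<oplus>\<^bsub>GZ\<^esub> y = y \<oplus>\<^bsub>GZ\<^esub> x" by (simp add: group_int_module_def m_comm)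
 qed (simp_all add: group_int_module_def m_assoc)
qed (simp_all add: rat_int_module_def group_int_module_def)

interpretation Q: tensor_pair int_ring rat_int_module GZ by (rule tensor_pair_rat)

abbreviation "V \<equiv> rationalization G"

lemma GZ_simps [simp]: "carrier GZ = carrier G" "x \<oplus>\<^bsub>GZ\<^esub> y = x \<otimes> y" "z \<odot>\<^bsub>GZ\<^esub> x = x [^] z" "\<zero>\<^bsub>GZ\<^esub> = \<one>"
 by (simp_all add: group_int_module_def)

lemma rat_simps [simp]: "carrier rat_int_module = UNIV" "p \<oplus>\<^bsub>rat_int_module\<^esub> p' = p + p'"
 "z \<odot>\<^bsub>rat_int_module\<^esub> p = of_int z * p" "\<zero>\<^bsub>rat_int_module\<^esub> = 0"
 by (simp_all add: rat_int_module_def)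

lemma V_simps: "carrier V = carrier Q.TG" "x \<oplus>\<^bsub>V\<^esub> y = x \<otimes>\<^bsub>Q.TG\<^esub> y" "\<zero>\<^bsub>V\<^esub> = \<one>\<^bsub>Q.TG\<^esub>"
 by (simp_all add: rationalization_def Let_def)

lemma V_smult: assumes "h \<in> carrier G" shows "p \<odot>\<^bsub>V\<^esub> Q.t p' h = Q.t (p * p') h"
proof - have "tensor_map_left int_ring rat_int_module GZ (\<lambda>p'. p * p') (Q.t p' h) = Q.t (p * p') h"
  by (rule Q.tensor_map_left_t) (use assms in \<open>simp_all add: distrib_left mult.left_commute\<close>)
 then show ?thesis by (simp add: rationalization_def Let_def)
qed

interpretation V: abelian_group V
proof (rule abelian_groupI) fix x y z assume "x \<in> carrier V" "y \<in> carrier V" "z \<in> carrier V"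
 then show "x \<oplus>\<^bsub>V\<^esub> y \<oplus>\<^bsub>V\<^esub> z = x \<oplus>\<^bsub>V\<^esub> (y \<oplus>\<^bsub>V\<^esub> z)" by (simp add: V_simps Q.TG.m_assoc)
next fix x y assume "x \<in> carrier V" "y \<in> carrier V"
 then show "x \<oplus>\<^bsub>V\<^esub> y = y \<oplus>\<^bsub>V\<^esub> x" by (simp add: V_simps Q.TG.m_comm)
next fix x assume "x \<in> carrier V" then show "\<exists>y\<in>carrier V. y \<oplus>\<^bsub>V\<^esub> x = \<zero>\<^bsub>V\<^esub>"
  by (intro bexI[of _ "inv\<^bsub>Q.TG\<^esub> x"]) (simp_all add: V_simps)
qed (simp_all add: V_simps)

lemma t_carrier [simp]: "h \<in> carrier G ==> Q.t p h \<in> carrier V" using Q.t_closed[of p h] by (simp add: V_simps)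

lemma t_add_l: "h \<in> carrier G ==> Q.t (p + p') h = Q.t p h \<oplus>\<^bsub>V\<^esub> Q.t p' h"
 using Q.t_add_l[of p p' h] by (simp add: V_simps)

lemma t_mult_r: "h \<in> carrier G ==> h' \<in> carrier G ==> Q.t p (h \<otimes> h') = Q.t p h \<oplus>\<^bsub>V\<^esub> Q.t p h'"
 using Q.t_add_r[of p h h'] by (simp add: V_simps)

lemma t_pow: "h \<in> carrier G ==> Q.t p (h [^] (z :: int)) = Q.t (of_int z * p) h"
 using Q.t_balanced[of z p h] by simp

lemma t_zero: "h \<in> carrier G ==> Q.t 0 h = \<zero>\<^bsub>V\<^esub>" "Q.t p \<one> = \<zero>\<^bsub>V\<^esub>"
 using Q.t_zero_l[of h] Q.t_zero_r[of p] by (simp_all add: V_simps)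

text \<open>Torsion dies rationally: p \<otimes> \<tau> = (p/n) \<otimes> \<tau>^n = 0 if \<tau>^n =
  1.\<close>

lemma t_tors: assumes "\<tau> \<in> tors" shows "Q.t p \<tau> = \<zero>\<^bsub>V\<^esub>"
proof -
 obtain n :: nat where n: "\<tau> \<in> carrier G" "n > 0" "\<tau> [^] n = \<one>" using assms unfolding torsion_subgroup_def by blast
 have "Q.t p \<tau> = Q.t (of_int (int n) * (p / of_nat n)) \<tau>" using n(2) by simp
 also have "\<dots> = Q.t (p / of_nat n) (\<tau> [^] int n)" by (rule t_pow[OF n(1), symmetric])
 also have "\<dots> = \<zero>\<^bsub>V\<^esub>" using n(3) t_zero(2) by (simp add: int_pow_int)
 finally show ?thesis .
qed

lemma coord_int_pow: assumes "h \<in> carrier G" "i < r" shows "coord (h [^] (z :: int)) i = z * coord h i"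
proof - have "(\<lambda>h. coord h i) \<in> hom G integer_group" by (rule homI) (simp_all add: coord_mult assms(2))
 then show ?thesis using hom_int_pow[OF _ assms(1) is_group group_integer_group] by simp
qed

text \<open>The map sending (p, h) to p times the i-th integer coordinate of h is biadditive and
  balanced over the integers, so the universal property applies.\<close>

lemma exists_coordinate: assumes i: "i < r"
 shows "\<exists>\<chi>. (\<forall>x\<in>carrier V. \<forall>y\<in>carrier V. \<chi> (x \<oplus>\<^bsub>V\<^esub> y) = \<chi> x + \<chi> y) \<and>
  (\<forall>p. \<forall>h\<in>carrier G. \<chi> (Q.t p h) = p * of_int (coord h i))"
proof - let ?R = "\<lparr>carrier = UNIV, monoid.mult = (+), one = 0\<rparr> :: rat monoid" have R: "comm_group ?R"
 proof (rule comm_groupI) fix x :: rat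
  show "\<exists>y\<in>carrier ?R. y \<otimes>\<^bsub>?R\<^esub> x = \<one>\<^bsub>?R\<^esub>" by (rule bexI[of _ "- x"]) simp_all
 qed simp_all
 have "\<exists>\<chi>. \<chi> \<in> hom Q.TG ?R \<and> (\<forall>p. \<forall>h\<in>carrier G. \<chi> (Q.t p h) = p * of_int (coord h i))"
 proof (rule Q.universal[OF R, of "\<lambda>p h. p * of_int (coord h i)"]) fix \<chi> assume "\<chi> \<in> hom Q.TG ?R"
   "\<And>p h. p \<in> carrier rat_int_module ==> h \<in> carrier GZ ==> \<chi> (Q.t p h) = p * of_int (coord h i)"
  then show ?thesis by (intro exI[of _ \<chi>]) simp
 qed (simp_all add: coord_mult coord_int_pow i algebra_simps)
 then obtain \<chi> where "\<chi> \<in> hom Q.TG ?R" "\<forall>p. \<forall>h\<in>carrier G. \<chi> (Q.t p h) = p * of_int (coord h i)" by blast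
 then show ?thesis by (intro exI[of _ \<chi>]) (simp add: V_simps hom_def)
qed

lemma t_comb: assumes "finite I" "g \<in> I \<rightarrow> carrier G"
 shows "Q.t p (int_comb g n I) = (\<Oplus>\<^bsub>V\<^esub>i\<in>I. Q.t (of_int (n i) * p) (g i))"
 using assms
proof (induction I rule: finite_induct) case empty then show ?case using t_zero(2) by (simp add: int_comb_def)
next case (insert i I) have c: "g \<in> I \<rightarrow> carrier G" "g i \<in> carrier G" using insert.prems by auto
 have "(\<lambda>i. Q.t (of_int (n i) * p) (g i)) \<in> I \<rightarrow> carrier V" using c by (auto simp: Pi_iff)
 then have "(\<Oplus>\<^bsub>V\<^esub>i\<in>insert i I. Q.t (of_int (n i) * p) (g i)) =
   Q.t (of_int (n i) * p) (g i) \<oplus>\<^bsub>V\<^esub> (\<Oplus>\<^bsub>V\<^esub>i\<in>I. Q.t (of_int (n i) * p) (g i))"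
  using insert.hyps c by (intro V.finsum_insert) auto
 moreover have "Q.t p (int_comb g n (insert i I)) = Q.t p (g i [^] n i) \<oplus>\<^bsub>V\<^esub> Q.t p (int_comb g n I)"
  unfolding int_comb_insert[OF insert.hyps insert.prems] by (rule t_mult_r) (use c int_comb_closed in auto)
 ultimately show ?case using insert.IH[OF c(1)] t_pow[OF c(2)] by simp
qed

text \<open>The elements 1 \<otimes> g_i form a basis of the rationalization. Every tensor expands
  in them because torsion vanishes, and the coordinate functions read off the coefficients, which
  gives uniqueness.\<close>

theorem rank: "has_rank G r"
proof - obtain \<chi> where \<chi>': "\<forall>i\<in>{..<r}. (\<forall>x\<in>carrier V. \<forall>y\<in>carrier V. \<chi> i (x \<oplus>\<^bsub>V\<^esub> y) = \<chi> i x + \<chi> i y) \<and>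
  (\<forall>p. \<forall>h\<in>carrier G. \<chi> i (Q.t p h) = p * of_int (coord h i))"
  using bchoice[of "{..<r}" "\<lambda>i \<chi>. (\<forall>x\<in>carrier V. \<forall>y\<in>carrier V. \<chi> (x \<oplus>\<^bsub>V\<^esub> y) = \<chi> x + \<chi> y) \<and>
  (\<forall>p. \<forall>h\<in>carrier G. \<chi> (Q.t p h) = p * of_int (coord h i))"] exists_coordinate by blast
 have \<chi>: "\<And>x y. x \<in> carrier V ==> y \<in> carrier V ==> \<chi> i (x \<oplus>\<^bsub>V\<^esub> y) = \<chi> i x + \<chi> i y"
  "\<And>p h. h \<in> carrier G ==> \<chi> i (Q.t p h) = p * of_int (coord h i)" if "i < r" for i
  using \<chi>' that by simp_all
 have gi: "g i \<in> carrier G" if "i < r" for i using gc that by auto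
 have \<chi>0: "\<chi> i \<zero>\<^bsub>V\<^esub> = 0" if "i < r" for i using \<chi>(1)[OF that, of "\<zero>\<^bsub>V\<^esub>" "\<zero>\<^bsub>V\<^esub>"] by simp
 have \<chi>sum: "\<chi> j (\<Oplus>\<^bsub>V\<^esub>i\<in>I. Q.t (d i) (g i)) = (\<Sum>i\<in>I. d i * of_int (coord (g i) j))"
  if "finite I" "I \<subseteq> {..<r}" "j < r" for I d j
  using that
 proof (induction I rule: finite_induct) case empty then show ?case using \<chi>0 by simp
 next case (insert i I)
  have c: "(\<lambda>i. Q.t (d i) (g i)) \<in> I \<rightarrow> carrier V" "g i \<in> carrier G" using insert.prems gi by auto
  have "(\<Oplus>\<^bsub>V\<^esub>i\<in>insert i I. Q.t (d i) (g i)) = Q.t (d i) (g i) \<oplus>\<^bsub>V\<^esub> (\<Oplus>\<^bsub>V\<^esub>i\<in>I. Q.t (d i) (g i))"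
   using insert.hyps c by (intro V.finsum_insert) auto
  then have "\<chi> j (\<Oplus>\<^bsub>V\<^esub>i\<in>insert i I. Q.t (d i) (g i)) = \<chi> j (Q.t (d i) (g i)) + \<chi> j (\<Oplus>\<^bsub>V\<^esub>i\<in>I. Q.t (d i) (g i))"
   using \<chi>(1)[OF insert.prems(2) t_carrier[OF c(2)] V.finsum_closed[OF c(1)]] by simp
  then show ?case using insert \<chi>(2)[OF insert.prems(2) c(2)] by simp
 qed
 have \<chi>coord: "\<chi> j (\<Oplus>\<^bsub>V\<^esub>i\<in>{..<r}. Q.t (d i) (g i)) = d j" if "j < r" for d j
 proof - have "\<chi> j (\<Oplus>\<^bsub>V\<^esub>i\<in>{..<r}. Q.t (d i) (g i)) = (\<Sum>i\<in>{..<r}. d i * of_int (coord (g i) j))"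
   by (rule \<chi>sum) (use that in auto)
  also have "\<dots> = (\<Sum>i\<in>{..<r}. if i = j then d i else 0)" by (rule sum.cong) (use coord_g that in auto)
  also have "\<dots> = d j" using that by (simp add: sum.delta')
  finally show ?thesis .
 qed
 have expand: "v = (\<Oplus>\<^bsub>V\<^esub>i\<in>{..<r}. Q.t (\<chi> i v) (g i))" if "v \<in> carrier V" for v
 proof - have "v \<in> carrier Q.TG" using that by (simp add: V_simps) then show ?thesis
  proof (induction v rule: Q.TG_induct) case one
   have "(\<Oplus>\<^bsub>V\<^esub>i\<in>{..<r}. Q.t (\<chi> i \<zero>\<^bsub>V\<^esub>) (g i)) = (\<Oplus>\<^bsub>V\<^esub>i\<in>{..<r}. \<zero>\<^bsub>V\<^esub>)"
    by (rule V.finsum_cong') (simp_all add: \<chi>0 t_zero gi)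
   then show ?case unfolding V_simps(3)[symmetric] by simp
  next case (gen p h) then have h: "h \<in> carrier G" by simp
   obtain \<tau> where \<tau>: "\<tau> \<in> tors" "h = \<tau> \<otimes> comb (coord h)" using h by (rule coordE)
   have "Q.t p h = Q.t p \<tau> \<oplus>\<^bsub>V\<^esub> Q.t p (comb (coord h))"
    using t_mult_r[OF tors_carrier[OF \<tau>(1)] int_comb_closed[OF gc], of p "coord h"] \<tau>(2) by simp
   also have "\<dots> = (\<Oplus>\<^bsub>V\<^esub>i\<in>{..<r}. Q.t (of_int (coord h i) * p) (g i))"
    unfolding t_tors[OF \<tau>(1)] t_comb[OF finite_lessThan gc]
    by (intro V.l_zero V.finsum_closed) (simp add: gi)
   also have "\<dots> = (\<Oplus>\<^bsub>V\<^esub>i\<in>{..<r}. Q.t (\<chi> i (Q.t p h)) (g i))"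
    by (rule V.finsum_cong') (simp_all add: \<chi>(2) h gi mult.commute)
   finally show ?case .
  next case (add x y) then have xy: "x \<in> carrier V" "y \<in> carrier V" by (simp_all add: V_simps)
   have "x \<oplus>\<^bsub>V\<^esub> y = (\<Oplus>\<^bsub>V\<^esub>i\<in>{..<r}. Q.t (\<chi> i x) (g i)) \<oplus>\<^bsub>V\<^esub> (\<Oplus>\<^bsub>V\<^esub>i\<in>{..<r}. Q.t (\<chi> i y) (g i))"
    using add.IH by simp
   also have "\<dots> = (\<Oplus>\<^bsub>V\<^esub>i\<in>{..<r}. Q.t (\<chi> i x) (g i) \<oplus>\<^bsub>V\<^esub> Q.t (\<chi> i y) (g i))"
    by (rule V.finsum_addf[symmetric]) (auto simp: gi)
   also have "\<dots> = (\<Oplus>\<^bsub>V\<^esub>i\<in>{..<r}. Q.t (\<chi> i (x \<oplus>\<^bsub>V\<^esub> y)) (g i))"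
    by (rule V.finsum_cong') (simp_all add: \<chi>(1) xy gi t_add_l)
   finally show ?case by (simp add: V_simps)
  qed
 qed
 define b where "b i = Q.t 1 (g i)" for i
 have \<chi>b: "\<chi> j (b i) = (if j = i then 1 else 0)" if "i < r" "j < r" for i j
  unfolding b_def using \<chi>(2)[OF that(2) gi[OF that(1)]] coord_g[OF that] by simp
 have binj: "inj_on b {..<r}"
 proof (rule inj_onI) fix i j assume "i \<in> {..<r}" "j \<in> {..<r}" "b i = b j"
  then show "i = j" using \<chi>b[of i i] \<chi>b[of j i] by (auto split: if_splits)
 qed
 have bs: "p \<odot>\<^bsub>V\<^esub> b i = Q.t p (g i)" if "i < r" for i p unfolding b_def using V_smult[OF gi[OF that]] by simp
 have sumB: "(\<Oplus>\<^bsub>V\<^esub>x\<in>b ` {..<r}. c x \<odot>\<^bsub>V\<^esub> x) = (\<Oplus>\<^bsub>V\<^esub>i\<in>{..<r}. Q.t (c (b i)) (g i))" for c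
 proof - have "(\<Oplus>\<^bsub>V\<^esub>x\<in>b ` {..<r}. c x \<odot>\<^bsub>V\<^esub> x) = (\<Oplus>\<^bsub>V\<^esub>i\<in>{..<r}. c (b i) \<odot>\<^bsub>V\<^esub> b i)"
   by (rule V.finsum_reindex[OF _ binj]) (auto simp: bs gi)
  also have "\<dots> = (\<Oplus>\<^bsub>V\<^esub>i\<in>{..<r}. Q.t (c (b i)) (g i))" by (rule V.finsum_cong') (simp_all add: bs gi)
  finally show ?thesis .
 qed
 show ?thesis unfolding has_rank_def has_dimension_def
 proof (intro exI[of _ "b ` {..<r}"] conjI ballI) show "finite (b ` {..<r})" by simp
  show "b ` {..<r} \<subseteq> carrier V" using gi by (auto simp: b_def)
  show "card (b ` {..<r}) = r" using binj by (simp add: card_image)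
  fix v assume v: "v \<in> carrier V"
  define c where "c = (\<lambda>x\<in>b ` {..<r}. \<chi> (inv_into {..<r} b x) v)"
  have cb: "c (b i) = \<chi> i v" if "i < r" for i using that binj by (simp add: c_def)
  show "\<exists>!c. c \<in> b ` {..<r} \<rightarrow>\<^sub>E carrier rat_field \<and> v = (\<Oplus>\<^bsub>V\<^esub>x\<in>b ` {..<r}. c x \<odot>\<^bsub>V\<^esub> x)"
  proof (rule ex1I[of _ c]) have "(\<Oplus>\<^bsub>V\<^esub>i\<in>{..<r}. Q.t (c (b i)) (g i)) = (\<Oplus>\<^bsub>V\<^esub>i\<in>{..<r}. Q.t (\<chi> i v) (g i))"
    by (rule V.finsum_cong') (simp_all add: cb gi)
   then have "v = (\<Oplus>\<^bsub>V\<^esub>x\<in>b ` {..<r}. c x \<odot>\<^bsub>V\<^esub> x)" unfolding sumB using expand[OF v] by (rule trans[rotated, OF sym])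
   then show "c \<in> b ` {..<r} \<rightarrow>\<^sub>E carrier rat_field \<and> v = (\<Oplus>\<^bsub>V\<^esub>x\<in>b ` {..<r}. c x \<odot>\<^bsub>V\<^esub> x)"
    by (intro conjI) (auto simp: c_def rat_field_def)
   fix d assume d: "d \<in> b ` {..<r} \<rightarrow>\<^sub>E carrier rat_field \<and> v = (\<Oplus>\<^bsub>V\<^esub>x\<in>b ` {..<r}. d x \<odot>\<^bsub>V\<^esub> x)"
   show "d = c"
   proof (rule PiE_ext) show "d \<in> b ` {..<r} \<rightarrow>\<^sub>E carrier rat_field" using d by blast
    show "c \<in> b ` {..<r} \<rightarrow>\<^sub>E carrier rat_field" by (auto simp: c_def rat_field_def)
    fix x assume "x \<in> b ` {..<r}"
    then obtain i where i: "i < r" "x = b i" by blast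
    have "\<chi> i v = \<chi> i (\<Oplus>\<^bsub>V\<^esub>i\<in>{..<r}. Q.t (d (b i)) (g i))" using d unfolding sumB by (intro arg_cong[of v _ "\<chi> i"]) (rule conjunct2)
    then have "\<chi> i v = d (b i)" using \<chi>coord[OF i(1), of "\<lambda>i. d (b i)"] by simp
    then show "d x = c x" unfolding i(2) cb[OF i(1)] by simp
   qed
  qed
 qed
qed

end

section \<open>Ore fractions inside a given division algebra\<close>

section \<open>Quotient division algebras of Noetherian subdomains\<close>

lemma division_algebra_nc_domain: assumes "K_algebra K D" "Units D = carrier D - {\<zero>\<^bsub>D\<^esub>}" shows "nc_domain D"
proof - interpret D: K_algebra K D by fact have "\<one>\<^bsub>D\<^esub> \<noteq> \<zero>\<^bsub>D\<^esub>" using D.Units_one_closed assms(2) by blast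
 then show ?thesis using D.ring_axioms D.division_cancel[OF assms(2)] by (simp add: nc_domain_def)
qed

text \<open>The fractions of B are taken inside the division algebra D, so no abstract localization
  is constructed; the Ore condition shows that they form a division subalgebra.\<close>

locale noetherian_subdomain = D: K_algebra K D for K :: "'k ring" and D :: "('k, 'd) module" (structure) +
 fixes B :: "'d set"
 assumes U: "Units D = carrier D - {\<zero>}" and B: "K_subalgebra K D B"
  and N: "nc_noetherian_domain (D\<lparr>carrier := B\<rparr>)"
begin

lemmas Bs = K_subalgebraE[OF B]
lemmas Br = subringE[OF Bs(1)]

lemma B_carrier: "b \<in> B ==> b \<in> carrier D" using Bs(2) by blast

lemma one_not_zero: "\<one> \<noteq> \<zero>" using D.Units_one_closed U by blast

lemma nonzero_unit: "b \<in> carrier D ==> b \<noteq> \<zero> ==> b \<in> Units D" using U by blast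

lemma nonzero_mult: "a \<in> B - {\<zero>} ==> b \<in> B - {\<zero>} ==> a \<otimes> b \<in> B - {\<zero>}"
 using D.division_cancel[OF U, of a b] Br(6)[of a b] B_carrier by blast

lemma left_ore: "a \<in> B ==> s \<in> B - {\<zero>} ==> \<exists>s'\<in>B - {\<zero>}. \<exists>a'\<in>B. s' \<otimes> a = a' \<otimes> s"
 using left_ore_condition[OF D.ring_axioms Bs(1), of a s] N unfolding nc_noetherian_domain_def by auto

lemma right_ore: "a \<in> B ==> s \<in> B - {\<zero>} ==> \<exists>s'\<in>B - {\<zero>}. \<exists>a'\<in>B. a \<otimes> s' = s \<otimes> a'"
 using left_ore_condition[OF ring_opposite[OF D.ring_axioms] subring_opposite[OF D.ring_axioms Bs(1)], of a s]
  nc_noetherian_domain_opposite[OF N] unfolding nc_noetherian_domain_def by auto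

abbreviation "Q \<equiv> frac_in D B"

text \<open>Membership in terms of sq in B, without inverses; closure under the operations then
  amounts to finding denominators.\<close>

lemma mem_Q_left: "q \<in> Q \<longleftrightarrow> q \<in> carrier D \<and> (\<exists>s\<in>B - {\<zero>}. s \<otimes> q \<in> B)"
proof assume "q \<in> Q"
 then obtain s b where s: "s \<in> B - {\<zero>}" "b \<in> B" "q = inv s \<otimes> b" unfolding frac_in_def by blast
 have u: "s \<in> Units D" using s(1) B_carrier nonzero_unit by blast
 have c: "s \<in> carrier D" "b \<in> carrier D" "inv s \<in> carrier D" using s(1,2) B_carrier u by auto
 have "s \<otimes> q = b" unfolding s(3) using c u by (simp flip: D.m_assoc)
 then have "s \<otimes> q \<in> B" using s(2) by simp
 moreover have "q \<in> carrier D" unfolding s(3) using c by simp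
 ultimately show "q \<in> carrier D \<and> (\<exists>s\<in>B - {\<zero>}. s \<otimes> q \<in> B)" using s(1) by blast
next assume "q \<in> carrier D \<and> (\<exists>s\<in>B - {\<zero>}. s \<otimes> q \<in> B)"
 then obtain s where s: "q \<in> carrier D" "s \<in> B - {\<zero>}" "s \<otimes> q \<in> B" by blast
 have u: "s \<in> Units D" using s(2) B_carrier nonzero_unit by blast
 have c: "s \<in> carrier D" "inv s \<in> carrier D" using s(2) B_carrier u by auto
 have "q = inv s \<otimes> (s \<otimes> q)" using c u s(1) by (simp flip: D.m_assoc)
 then show "q \<in> Q" unfolding frac_in_def using s by blast
qed

lemma mem_Q_right: assumes "q \<in> Q" shows "\<exists>s\<in>B - {\<zero>}. q \<otimes> s \<in> B"
proof - obtain s b where s: "s \<in> B - {\<zero>}" "b \<in> B" "q = inv s \<otimes> b" using assms unfolding frac_in_def by blast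
 obtain t a where t: "t \<in> B - {\<zero>}" "a \<in> B" "b \<otimes> t = s \<otimes> a" using right_ore[OF s(2,1)] by blast
 have u: "s \<in> Units D" using s(1) B_carrier nonzero_unit by blast
 have c: "s \<in> carrier D" "b \<in> carrier D" "t \<in> carrier D" "a \<in> carrier D" "inv s \<in> carrier D"
  using s(1,2) t(1,2) B_carrier u by auto
 have "q \<otimes> t = inv s \<otimes> (b \<otimes> t)" unfolding s(3) using c by (simp add: D.m_assoc)
 also have "\<dots> = a" unfolding t(3) using c u by (simp flip: D.m_assoc)
 finally show ?thesis using t(1,2) by blast
qed

lemma B_subset_Q: "B \<subseteq> Q"
proof fix b assume b: "b \<in> B" have "\<one> \<in> B - {\<zero>}" using Br(3) one_not_zero by simp
 moreover have "\<one> \<otimes> b \<in> B" using b B_carrier by simp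
 ultimately show "b \<in> Q" unfolding mem_Q_left using b B_carrier by blast
qed

text \<open>If sq = b is a nonzero element of B, then b times the inverse of q is s, so b is a
  denominator of the inverse.\<close>

lemma Q_inverse: assumes "q \<in> Q" "q \<noteq> \<zero>" shows "inv q \<in> Q"
proof -
 obtain s where s: "q \<in> carrier D" "s \<in> B - {\<zero>}" "s \<otimes> q \<in> B" using assms(1) unfolding mem_Q_left by blast
 have u: "q \<in> Units D" using s(1) assms(2) nonzero_unit by blast
 have c: "s \<in> carrier D" "inv q \<in> carrier D" using s(2) B_carrier u by auto
 have "(s \<otimes> q) \<otimes> inv q = s" using c s(1) u by (simp add: D.m_assoc)
 moreover have "s \<otimes> q \<noteq> \<zero>" using D.division_cancel[OF U c(1) s(1)] s(2) assms(2) by blast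
 ultimately show ?thesis unfolding mem_Q_left using s c(2) by (metis Diff_iff singletonD)
qed

text \<open>The Ore condition moves the denominator s' of q' past the numerator sq of q: from a(sq)
  = cs' follows (as)(qq') = c(s'q').\<close>

lemma Q_mult: assumes q: "q \<in> Q" "q' \<in> Q" shows "q \<otimes> q' \<in> Q"
proof - obtain s where s: "q \<in> carrier D" "s \<in> B - {\<zero>}" "s \<otimes> q \<in> B" using q(1) unfolding mem_Q_left by blast
 obtain s' where s': "q' \<in> carrier D" "s' \<in> B - {\<zero>}" "s' \<otimes> q' \<in> B" using q(2) unfolding mem_Q_left by blast
 obtain a c where a: "a \<in> B - {\<zero>}" "c \<in> B" "a \<otimes> (s \<otimes> q) = c \<otimes> s'" using left_ore[OF s(3) s'(2)] by blast
 have cc: "s \<in> carrier D" "s' \<in> carrier D" "a \<in> carrier D" "c \<in> carrier D" using s(2) s'(2) a(1,2) B_carrier by blast+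
 have "(a \<otimes> s) \<otimes> (q \<otimes> q') = (a \<otimes> (s \<otimes> q)) \<otimes> q'" using cc s(1) s'(1) by (simp add: D.m_assoc)
 also have "\<dots> = c \<otimes> (s' \<otimes> q')" unfolding a(3) using cc s'(1) by (simp add: D.m_assoc)
 finally have "(a \<otimes> s) \<otimes> (q \<otimes> q') \<in> B" using Br(6)[OF a(2) s'(3)] by simp
 then show ?thesis unfolding mem_Q_left using nonzero_mult[OF a(1) s(2)] D.m_closed[OF s(1) s'(1)] by blast
qed

lemma Q_add: assumes q: "q \<in> Q" "q' \<in> Q" shows "q \<oplus> q' \<in> Q"
proof - obtain s where s: "q \<in> carrier D" "s \<in> B - {\<zero>}" "s \<otimes> q \<in> B" using q(1) unfolding mem_Q_left by blast
 obtain s' where s': "q' \<in> carrier D" "s' \<in> B - {\<zero>}" "s' \<otimes> q' \<in> B" using q(2) unfolding mem_Q_left by blast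
 obtain a c where a: "a \<in> B - {\<zero>}" "c \<in> B" "a \<otimes> s = c \<otimes> s'" using left_ore[of s s'] s(2) s'(2) by blast
 have cc: "s \<in> carrier D" "s' \<in> carrier D" "a \<in> carrier D" "c \<in> carrier D" using s(2) s'(2) a(1,2) B_carrier by blast+
 have "(a \<otimes> s) \<otimes> (q \<oplus> q') = (a \<otimes> s) \<otimes> q \<oplus> (c \<otimes> s') \<otimes> q'"
  unfolding a(3)[symmetric] using cc s(1) s'(1) by (simp add: D.r_distr)
 also have "\<dots> = a \<otimes> (s \<otimes> q) \<oplus> c \<otimes> (s' \<otimes> q')" using cc s(1) s'(1) by (simp add: D.m_assoc)
 also have "\<dots> \<in> B" using Br(7)[OF Br(6)[OF _ s(3)] Br(6)[OF a(2) s'(3)], of a] a(1) by blast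
 finally show ?thesis unfolding mem_Q_left using nonzero_mult[OF a(1) s(2)] D.a_closed[OF s(1) s'(1)] by blast
qed

lemma Q_smult: assumes k: "k \<in> carrier K" and q: "q \<in> Q" shows "k \<odot> q \<in> Q"
proof - obtain s where s: "q \<in> carrier D" "s \<in> B - {\<zero>}" "s \<otimes> q \<in> B" using q unfolding mem_Q_left by blast
 have "s \<in> carrier D" using s(2) B_carrier by blast
 then have "s \<otimes> (k \<odot> q) \<in> B" using D.smult_mult_right[OF k _ s(1), of s] Bs(5)[OF k s(3)] by simp
 then show ?thesis unfolding mem_Q_left using s(2) D.smult_closed[OF k s(1)] by blast
qed

lemma Q_subalgebra: "K_subalgebra K D Q" unfolding K_subalgebra_def
proof (intro conjI ballI) show "subring Q D" proof (rule D.subringI)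
  show "Q \<subseteq> carrier D" using mem_Q_left by blast
  show "\<one> \<in> Q" using B_subset_Q Br(3) by blast
  fix q assume q: "q \<in> Q"
  have "\<ominus> \<one> \<in> Q" using B_subset_Q Br(5)[OF Br(3)] by blast
  then have "\<ominus> \<one> \<otimes> q \<in> Q" using q by (rule Q_mult)
  then show "\<ominus> q \<in> Q" using q unfolding mem_Q_left[of q] by (simp add: D.l_minus)
 qed (fact Q_mult Q_add)+
 show "k \<odot> q \<in> Q" if "k \<in> carrier K" "q \<in> Q" for k q by (rule Q_smult[OF that])
qed

lemma Q_division_subalgebra: "division_subalgebra K D Q"
proof (rule division_subalgebraI[OF D.K_algebra_axioms Q_subalgebra one_not_zero])
 fix q assume q: "q \<in> Q" "q \<noteq> \<zero>"
 have "q \<in> Units D" using q nonzero_unit unfolding mem_Q_left by blast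
 then show "\<exists>e'\<in>Q. e' \<otimes> q = \<one> \<and> q \<otimes> e' = \<one>" using Q_inverse[OF q] by (intro bexI[of _ "inv q"]) simp_all
qed

lemma Q_m_inv: assumes "q \<in> Q" "q \<noteq> \<zero>" shows "inv\<^bsub>D\<lparr>carrier := Q\<rparr>\<^esub> q = inv q"
proof - interpret QR: ring "D\<lparr>carrier := Q\<rparr>" by (rule D.subring_is_ring[OF K_subalgebraE(1)[OF Q_subalgebra]])
 have u: "q \<in> Units D" using assms nonzero_unit unfolding mem_Q_left by blast
 have "inv q \<in> Q" by (rule Q_inverse[OF assms])
 then show ?thesis using u assms(1) by (intro QR.inv_char) simp_all
qed

lemma Q_quotient: "quotient_division_algebra K (D\<lparr>carrier := B\<rparr>) (\<lambda>b. b) (D\<lparr>carrier := Q\<rparr>)"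
 unfolding quotient_division_algebra_def
proof (intro conjI ballI)
 show "division_algebra K (D\<lparr>carrier := Q\<rparr>)" using Q_division_subalgebra by (simp add: division_subalgebra_def)
 show "(\<lambda>b. b) \<in> algebra_hom K (D\<lparr>carrier := B\<rparr>) (D\<lparr>carrier := Q\<rparr>)"
  using B_subset_Q by (auto simp: algebra_hom_def ring_hom_def)
 fix q assume "q \<in> carrier (D\<lparr>carrier := Q\<rparr>)"
 then have q: "q \<in> Q" by simp
 show "\<exists>s\<in>carrier (D\<lparr>carrier := B\<rparr>) - {\<zero>\<^bsub>D\<lparr>carrier := B\<rparr>\<^esub>}. \<exists>a\<in>carrier (D\<lparr>carrier := B\<rparr>).
   q = inv\<^bsub>D\<lparr>carrier := Q\<rparr>\<^esub> s \<otimes>\<^bsub>D\<lparr>carrier := Q\<rparr>\<^esub> a"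
 proof - obtain s b where s: "s \<in> B - {\<zero>}" "b \<in> B" "q = inv s \<otimes> b" using q unfolding frac_in_def by blast
  have "inv\<^bsub>D\<lparr>carrier := Q\<rparr>\<^esub> s = inv s" using Q_m_inv[of s] s(1) B_subset_Q by blast
  then show ?thesis using s by (intro bexI[of _ s] bexI[of _ b]) simp_all
 qed
 show "\<exists>s\<in>carrier (D\<lparr>carrier := B\<rparr>) - {\<zero>\<^bsub>D\<lparr>carrier := B\<rparr>\<^esub>}. \<exists>a\<in>carrier (D\<lparr>carrier := B\<rparr>).
   q = a \<otimes>\<^bsub>D\<lparr>carrier := Q\<rparr>\<^esub> inv\<^bsub>D\<lparr>carrier := Q\<rparr>\<^esub> s"
 proof - obtain s where s: "s \<in> B - {\<zero>}" "q \<otimes> s \<in> B" using mem_Q_right[OF q] by blast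
  have u: "s \<in> Units D" using s(1) B_carrier nonzero_unit by blast
  have c: "s \<in> carrier D" "q \<in> carrier D" "inv s \<in> carrier D" using s(1) B_carrier q u unfolding mem_Q_left by auto
  have "q = (q \<otimes> s) \<otimes> inv s" using c u by (simp add: D.m_assoc)
  moreover have "inv\<^bsub>D\<lparr>carrier := Q\<rparr>\<^esub> s = inv s" using Q_m_inv[of s] s(1) B_subset_Q by blast
  ultimately show ?thesis using s by (intro bexI[of _ s] bexI[of _ "q \<otimes> s"]) simp_all
 qed
qed simp

end

lemma frac_in_mono: "B \<subseteq> C ==> frac_in D B \<subseteq> frac_in D C" unfolding frac_in_def by blast

section \<open>Gradings by an abelian group in which nonzero homogeneous elements are
  invertible\<close>

section \<open>Graded division algebras\<close>

definition homogeneous_sums :: "('k, 'd) module \<Rightarrow> ('g \<Rightarrow> 'd set) \<Rightarrow> 'g set \<Rightarrow> 'd set" where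
 "homogeneous_sums D V F = {(\<Oplus>\<^bsub>D\<^esub>l\<in>S. u l) | S u. finite S \<and> S \<subseteq> F \<and> (\<forall>l\<in>S. u l \<in> V l)}"

text \<open>The model is \<open>G = Ev(\<Delta>)\<close> and \<open>V \<lambda> = D\<^sub>\<lambda>\<close>.\<close>

locale graded_division = D: K_algebra K D + comm_group G
 for K :: "'k ring" and D :: "('k, 'd) module" (structure) and G :: "'g monoid" +
 fixes V :: "'g \<Rightarrow> 'd set"
 assumes U: "Units D = carrier D - {\<zero>}" and V_carrier: "l \<in> carrier G ==> u \<in> V l ==> u \<in> carrier D"
  and V_zero: "l \<in> carrier G ==> \<zero> \<in> V l"
  and V_add: "l \<in> carrier G ==> u \<in> V l ==> v \<in> V l ==> u \<oplus> v \<in> V l"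
  and V_smult: "l \<in> carrier G ==> k \<in> carrier K ==> u \<in> V l ==> k \<odot> u \<in> V l"
  and V_one: "\<one> \<in> V \<one>\<^bsub>G\<^esub>"
  and V_mult: "l \<in> carrier G ==> m \<in> carrier G ==> u \<in> V l ==> v \<in> V m ==> u \<otimes> v \<in> V (l \<otimes>\<^bsub>G\<^esub> m)"
  and V_inv: "l \<in> carrier G ==> u \<in> V l ==> u \<noteq> \<zero> ==> inv u \<in> V (inv\<^bsub>G\<^esub> l)"
  and V_nonzero: "l \<in> carrier G ==> \<exists>u\<in>V l. u \<noteq> \<zero>"
  and V_independent: "finite S ==> S \<subseteq> carrier G ==> (\<And>l. l \<in> S ==> f l \<in> V l) ==>
   (\<Oplus>l\<in>S. f l) = \<zero> ==> l \<in> S ==> f l = \<zero>"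
begin

abbreviation "ES \<equiv> homogeneous_sums D V"
abbreviation "V0 \<equiv> V \<one>\<^bsub>G\<^esub>"

text \<open>The degree group is commutative, so the same components grade the opposite algebra. All
  right-hand statements, including the right dimension, are obtained through this.\<close>

lemma opposite_graded_division: "graded_division K (opposite D) G V"
proof (intro graded_division.intro graded_division_axioms.intro)
 show "u \<otimes>\<^bsub>opposite D\<^esub> v \<in> V (l \<otimes>\<^bsub>G\<^esub> m)" if "l \<in> carrier G" "m \<in> carrier G" "u \<in> V l" "v \<in> V m" for l m u v
  using V_mult[OF that(2,1) that(4,3)] m_comm[OF that(1,2)] by simp
 show "u l = \<zero>\<^bsub>opposite D\<^esub>" if "finite S" "S \<subseteq> carrier G" "\<And>l. l \<in> S ==> u l \<in> V l"
  "(\<Oplus>\<^bsub>opposite D\<^esub>l\<in>S. u l) = \<zero>\<^bsub>opposite D\<^esub>" "l \<in> S" for S u l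
  using V_independent[OF that(1-3) _ that(5)] that(4) by simp
qed (use K_algebra_opposite[OF D.K_algebra_axioms] comm_group_axioms U V_carrier V_zero V_add V_smult V_one
  V_inv V_nonzero in simp_all)

lemma opposite_ES: "homogeneous_sums (opposite D) V F = ES F" by (simp add: homogeneous_sums_def)

lemma unit: "u \<in> carrier D ==> u \<noteq> \<zero> ==> u \<in> Units D" using U by blast

lemma one_not_zero: "\<one> \<noteq> \<zero>" using D.Units_one_closed U by blast

lemma V_neg: "l \<in> carrier G ==> u \<in> V l ==> \<ominus> u \<in> V l"
 using V_smult[of l "\<ominus>\<^bsub>K\<^esub> \<one>\<^bsub>K\<^esub>" u] V_carrier[of l u] D.smult_l_minus[of "\<one>\<^bsub>K\<^esub>" u] by simp

lemma ES_zero: "\<zero> \<in> ES F" unfolding homogeneous_sums_def by (auto intro!: exI[of _ "{}"])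

lemma ES_gen: assumes "F \<subseteq> carrier G" "l \<in> F" "v \<in> V l" shows "v \<in> ES F"
proof - have "v \<in> carrier D" using V_carrier[of l v] assms by blast then have "v = (\<Oplus>l\<in>{l}. v)" by simp
 then show ?thesis unfolding homogeneous_sums_def using assms(2,3) by (auto intro!: exI[of _ "{l}"] exI[of _ "\<lambda>_. v"])
qed

lemma ES_mono: "F \<subseteq> F' ==> ES F \<subseteq> ES F'" unfolding homogeneous_sums_def by blast

lemma finsum_extend: assumes "finite S'" "S \<subseteq> S'" "\<And>l. l \<in> S ==> u l \<in> carrier D"
 shows "(\<Oplus>l\<in>S. u l) = (\<Oplus>l\<in>S'. if l \<in> S then u l else \<zero>)"
 by (rule D.add.finprod_mono_neutral_cong_left) (use assms in auto)

lemma ES_add: assumes F: "F \<subseteq> carrier G" and xy: "x \<in> ES F" "y \<in> ES F" shows "x \<oplus> y \<in> ES F"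
proof - obtain S u where x: "finite S" "S \<subseteq> F" "\<forall>l\<in>S. u l \<in> V l" "x = (\<Oplus>l\<in>S. u l)"
  using xy(1) unfolding homogeneous_sums_def by blast
 obtain S' u' where y: "finite S'" "S' \<subseteq> F" "\<forall>l\<in>S'. u' l \<in> V l" "y = (\<Oplus>l\<in>S'. u' l)"
  using xy(2) unfolding homogeneous_sums_def by blast
 have uc: "u l \<in> carrier D" if "l \<in> S" for l using V_carrier[of l "u l"] x that F by blast
 have u'c: "u' l \<in> carrier D" if "l \<in> S'" for l using V_carrier[of l "u' l"] y that F by blast
 let ?w = "\<lambda>l. if l \<in> S then u l else \<zero>" and ?w' = "\<lambda>l. if l \<in> S' then u' l else \<zero>"
 have fin: "finite (S \<union> S')" using x(1) y(1) by blast
 have "x = (\<Oplus>l\<in>S \<union> S'. ?w l)" unfolding x(4) by (rule finsum_extend[OF fin _ uc]) auto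
 moreover have "y = (\<Oplus>l\<in>S \<union> S'. ?w' l)" unfolding y(4) by (rule finsum_extend[OF fin _ u'c]) auto
 moreover have "(\<Oplus>l\<in>S \<union> S'. ?w l \<oplus> ?w' l) = (\<Oplus>l\<in>S \<union> S'. ?w l) \<oplus> (\<Oplus>l\<in>S \<union> S'. ?w' l)"
  by (rule D.finsum_addf) (use uc u'c in auto)
 ultimately have eq: "x \<oplus> y = (\<Oplus>l\<in>S \<union> S'. ?w l \<oplus> ?w' l)" by simp
 have "?w l \<oplus> ?w' l \<in> V l" if "l \<in> S \<union> S'" for l
 proof - have l: "l \<in> carrier G" using that x(2) y(2) F by blast
  show ?thesis by (rule V_add[OF l]) (use x(3) y(3) V_zero[OF l] in auto)
 qed
 moreover have "S \<union> S' \<subseteq> F" using x(2) y(2) by blast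
 ultimately show ?thesis unfolding homogeneous_sums_def eq using fin by blast
qed

lemma ES_least: assumes F: "F \<subseteq> carrier G" and gen: "\<And>l v. l \<in> F ==> v \<in> V l ==> v \<in> Y"
  and zero: "\<zero> \<in> Y" and add: "\<And>x y. x \<in> Y ==> y \<in> Y ==> x \<oplus> y \<in> Y"
 shows "ES F \<subseteq> Y"
proof fix z assume "z \<in> ES F" then obtain S u where z: "finite S" "S \<subseteq> F" "\<forall>l\<in>S. u l \<in> V l" "z = (\<Oplus>l\<in>S. u l)"
  unfolding homogeneous_sums_def by blast
 have "(\<Oplus>l\<in>S. u l) \<in> Y" using z(1-3)
 proof (induction S rule: finite_induct) case empty then show ?case using zero by simp
 next case (insert l S) have uc: "u m \<in> carrier D" if "m \<in> insert l S" for m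
   using V_carrier[of m "u m"] insert.prems that F by blast
  have "(\<Oplus>l\<in>insert l S. u l) = u l \<oplus> (\<Oplus>l\<in>S. u l)" using insert.hyps uc by (intro D.finsum_insert) auto
  moreover have "u l \<in> Y" using gen[of l "u l"] insert.prems by blast
  moreover have "(\<Oplus>l\<in>S. u l) \<in> Y" using insert.IH insert.prems by blast
  ultimately show ?case using add by simp
 qed
 then show "z \<in> Y" using z(4) by simp
qed

lemma ES_carrier: "F \<subseteq> carrier G ==> ES F \<subseteq> carrier D" by (rule ES_least) (use V_carrier in auto)

lemma ES_induct [consumes 2, case_names gen zero add]: assumes F: "F \<subseteq> carrier G" and z: "z \<in> ES F"
  and P: "\<And>l v. l \<in> F ==> v \<in> V l ==> P v" "P \<zero>" "\<And>x y. x \<in> carrier D ==> y \<in> carrier D ==> P x ==> P y ==> P (x \<oplus> y)"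
 shows "P z"
proof - have "ES F \<subseteq> {z \<in> carrier D. P z}" by (rule ES_least[OF F]) (use V_carrier F P in auto)
 then show ?thesis using z by blast
qed

lemma ES_mult: assumes F: "F \<subseteq> carrier G" "F' \<subseteq> carrier G" "F'' \<subseteq> carrier G"
  and FF: "\<And>l l'. l \<in> F ==> l' \<in> F' ==> l \<otimes>\<^bsub>G\<^esub> l' \<in> F''"
  and xy: "x \<in> ES F" "y \<in> ES F'"
 shows "x \<otimes> y \<in> ES F''"
 using F(1) xy(1)
proof (induction x rule: ES_induct) case (gen l v)
 then have l: "l \<in> carrier G" and vc: "v \<in> carrier D" using F(1) V_carrier by blast+
 show ?case using F(2) xy(2)
 proof (induction y rule: ES_induct) case (gen m w) then have m: "m \<in> carrier G" using F(2) by blast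
  show ?case by (rule ES_gen[OF F(3) FF[OF \<open>l \<in> F\<close> gen(1)] V_mult[OF l m \<open>v \<in> V l\<close> gen(2)]])
 qed (use vc ES_zero ES_add[OF F(3)] in \<open>simp_all add: D.r_distr\<close>)
qed (use xy(2) ES_carrier[OF F(2)] ES_zero ES_add[OF F(3)] in \<open>simp_all add: D.l_distr subset_iff\<close>)

lemma ES_smult: assumes F: "F \<subseteq> carrier G" and k: "k \<in> carrier K" and x: "x \<in> ES F" shows "k \<odot> x \<in> ES F"
 using F x
proof (induction x rule: ES_induct) case (gen l v) then have "l \<in> carrier G" using F by blast
 then show ?case using ES_gen[OF F gen(1) V_smult[OF _ k gen(2)]] by blast
qed (use k ES_zero ES_add[OF F] in \<open>simp_all add: D.smult_r_distr\<close>)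

lemma ES_neg: "F \<subseteq> carrier G ==> x \<in> ES F ==> \<ominus> x \<in> ES F"
 using ES_smult[of F "\<ominus>\<^bsub>K\<^esub> \<one>\<^bsub>K\<^esub>" x] ES_carrier[of F] D.smult_l_minus[of "\<one>\<^bsub>K\<^esub>" x] by auto

lemma ES_subalgebra: assumes F: "F \<subseteq> carrier G" "\<one>\<^bsub>G\<^esub> \<in> F" "\<And>l m. l \<in> F ==> m \<in> F ==> l \<otimes>\<^bsub>G\<^esub> m \<in> F"
 shows "K_subalgebra K D (ES F)"
 unfolding K_subalgebra_def
proof (intro conjI ballI) show "subring (ES F) D" proof (rule D.subringI)
  show "ES F \<subseteq> carrier D" by (rule ES_carrier[OF F(1)])
  show "\<one> \<in> ES F" by (rule ES_gen[OF F(1,2) V_one])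
  show "\<ominus> h \<in> ES F" if "h \<in> ES F" for h by (rule ES_neg[OF F(1) that])
  show "h \<otimes> h' \<in> ES F" if "h \<in> ES F" "h' \<in> ES F" for h h' by (rule ES_mult[OF F(1,1,1) F(3) that])
  show "h \<oplus> h' \<in> ES F" if "h \<in> ES F" "h' \<in> ES F" for h h' by (rule ES_add[OF F(1) that])
 qed
 show "k \<odot> h \<in> ES F" if "k \<in> carrier K" "h \<in> ES F" for k h by (rule ES_smult[OF F(1) that])
qed

lemma ES_subgroup_subalgebra: "subgroup H G ==> K_subalgebra K D (ES H)"
 by (rule ES_subalgebra) (auto dest: subgroup.subset subgroup.one_closed intro: subgroup.m_closed)

text \<open>Decompositions of z and of -z over disjoint sets of degrees add up to one relation
  between components of different degrees.\<close>

lemma ES_disjoint: assumes F: "F \<subseteq> carrier G" "F' \<subseteq> carrier G" "F \<inter> F' = {}" and z: "z \<in> ES F" "z \<in> ES F'"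
 shows "z = \<zero>"
proof - obtain S u where x: "finite S" "S \<subseteq> F" "\<forall>l\<in>S. u l \<in> V l" "z = (\<Oplus>l\<in>S. u l)"
  using z(1) unfolding homogeneous_sums_def by blast
 obtain S' u' where y: "finite S'" "S' \<subseteq> F'" "\<forall>l\<in>S'. u' l \<in> V l" "\<ominus> z = (\<Oplus>l\<in>S'. u' l)"
  using ES_neg[OF F(2) z(2)] unfolding homogeneous_sums_def by blast
 have uc: "u l \<in> carrier D" if "l \<in> S" for l using V_carrier[of l "u l"] x that F by blast
 have u'c: "u' l \<in> carrier D" if "l \<in> S'" for l using V_carrier[of l "u' l"] y that F by blast
 have disj: "S \<inter> S' = {}" using x(2) y(2) F(3) by blast
 let ?w = "\<lambda>l. if l \<in> S then u l else u' l"
 have zc: "z \<in> carrier D" using z(1) ES_carrier[OF F(1)] by blast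
 have "(\<Oplus>l\<in>S \<union> S'. ?w l) = (\<Oplus>l\<in>S. ?w l) \<oplus> (\<Oplus>l\<in>S'. ?w l)"
  by (rule D.finsum_Un_disjoint[OF x(1) y(1) disj]) (use uc u'c disj in auto)
 also have "(\<Oplus>l\<in>S. ?w l) = z" unfolding x(4) by (rule D.finsum_cong') (use uc in auto)
 also have "(\<Oplus>l\<in>S'. ?w l) = \<ominus> z" unfolding y(4) by (rule D.finsum_cong') (use u'c disj in auto)
 finally have sum: "(\<Oplus>l\<in>S \<union> S'. ?w l) = \<zero>" using zc by (simp add: D.r_neg)
 have fin: "finite (S \<union> S')" and sub: "S \<union> S' \<subseteq> carrier G" using x(1,2) y(1,2) F(1,2) by blast+
 have wV: "?w l \<in> V l" if "l \<in> S \<union> S'" for l using that x(3) y(3) by auto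
 have "u l = \<zero>" if "l \<in> S" for l using V_independent[OF fin sub wV sum, of l] that by simp
 then have "(\<Oplus>l\<in>S. u l) = (\<Oplus>l\<in>S. \<zero>)" by (intro D.finsum_cong') auto
 then show ?thesis unfolding x(4) by simp
qed

lemma ES_homogeneous: assumes F: "F \<subseteq> carrier G" and l: "l \<in> carrier G" and v: "v \<in> V l" "v \<in> ES F" "v \<noteq> \<zero>"
 shows "l \<in> F"
proof (rule ccontr) assume "l \<notin> F" then have "{l} \<inter> F = {}" by blast
 moreover have "v \<in> ES {l}" by (rule ES_gen) (use l v in auto)
 ultimately show False using ES_disjoint[of "{l}" F v] l F v by blast
qed

text \<open>Each member is minus the sum of the others, hence supported in two disjoint sets of
  degrees.\<close>

lemma ES_family_independent: assumes I: "finite I" and F: "\<And>i. i \<in> I ==> F i \<subseteq> carrier G"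
  and disj: "\<And>i j. i \<in> I ==> j \<in> I ==> i \<noteq> j ==> F i \<inter> F j = {}"
  and z: "\<And>i. i \<in> I ==> z i \<in> ES (F i)" and sum: "(\<Oplus>i\<in>I. z i) = \<zero>" and j: "j \<in> I"
 shows "z j = \<zero>"
proof - define J where "J = I - {j}" define F' where "F' = (\<Union>i\<in>J. F i)"
 have I': "I = insert j J" "finite J" "j \<notin> J" using I j by (auto simp: J_def)
 have F': "F' \<subseteq> carrier G" using F by (auto simp: F'_def J_def)
 have zc: "z i \<in> carrier D" if "i \<in> I" for i using z[OF that] ES_carrier[OF F[OF that]] by blast
 have Jsum: "(\<Oplus>i\<in>J'. z i) \<in> ES F'" if "finite J'" "J' \<subseteq> J" for J' using that
 proof (induction J' rule: finite_induct) case empty then show ?case by (simp add: ES_zero)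
 next case (insert i J') have "(\<Oplus>i\<in>insert i J'. z i) = z i \<oplus> (\<Oplus>i\<in>J'. z i)"
   using insert zc by (intro D.finsum_insert) (auto simp: J_def)
  moreover have "F i \<subseteq> F'" using insert.prems by (auto simp: F'_def)
  then have "z i \<in> ES F'" using ES_mono[of "F i" F'] z[of i] insert.prems by (auto simp: J_def)
  ultimately show ?case using insert ES_add[OF F'] by simp
 qed
 have sc: "(\<Oplus>i\<in>J. z i) \<in> carrier D" using zc by (intro D.finsum_closed) (auto simp: J_def)
 have "z j \<oplus> (\<Oplus>i\<in>J. z i) = \<zero>"
 proof - have "(\<Oplus>i\<in>insert j J. z i) = z j \<oplus> (\<Oplus>i\<in>J. z i)"
   by (rule D.finsum_insert[OF I'(2,3)]) (use zc j in \<open>auto simp: J_def\<close>)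
  then show ?thesis using sum unfolding I'(1)[symmetric] by simp
 qed
 then have zj: "\<ominus> (\<Oplus>i\<in>J. z i) = z j" by (rule D.minus_equality[OF _ sc zc[OF j]])
 have "z j \<in> ES F'" using ES_neg[OF F' Jsum[OF I'(2) order_refl]] unfolding zj .
 moreover have "F j \<inter> F' = {}" using disj j by (auto simp: F'_def J_def)
 ultimately show ?thesis using ES_disjoint[OF F[OF j] F' _ z[OF j]] by blast
qed

lemma pow_V: assumes "l \<in> carrier G" "u \<in> V l" shows "u [^] (n :: nat) \<in> V (l [^]\<^bsub>G\<^esub> n)"
proof (induction n) case 0 then show ?case by (simp add: V_one)
next case (Suc n) show ?case using V_mult[OF nat_pow_closed[OF assms(1)] assms(1) Suc.IH assms(2)] by simp
qed

text \<open>With l neutral this says that \<open>V m\<close> is the line V0 u for any nonzero u in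
  it: each component is one-dimensional over \<open>V0\<close>.\<close>

lemma V_mult_inv: assumes "l \<in> carrier G" "m \<in> carrier G" "v \<in> V (l \<otimes>\<^bsub>G\<^esub> m)" "u \<in> V m" "u \<noteq> \<zero>"
 shows "v \<otimes> inv u \<in> V l" "v = (v \<otimes> inv u) \<otimes> u"
proof - have lm: "l \<otimes>\<^bsub>G\<^esub> m \<in> carrier G" using assms by simp
 have u: "u \<in> Units D" using V_carrier[OF assms(2,4)] assms(5) unit by blast
 show "v = (v \<otimes> inv u) \<otimes> u" using V_carrier[OF lm assms(3)] u by (simp add: D.m_assoc D.Units_closed)
 have "v \<otimes> inv u \<in> V (l \<otimes>\<^bsub>G\<^esub> m \<otimes>\<^bsub>G\<^esub> inv\<^bsub>G\<^esub> m)"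
  by (rule V_mult[OF lm _ assms(3) V_inv[OF assms(2,4,5)]]) (use assms in simp)
 then show "v \<otimes> inv u \<in> V l" using assms by (simp add: m_assoc)
qed

lemma ES_trivial: "ES {\<one>\<^bsub>G\<^esub>} = V0"
proof show "ES {\<one>\<^bsub>G\<^esub>} \<subseteq> V0" by (rule ES_least) (use V_zero V_add in auto)
 show "V0 \<subseteq> ES {\<one>\<^bsub>G\<^esub>}" using ES_gen[of "{\<one>\<^bsub>G\<^esub>}" "\<one>\<^bsub>G\<^esub>"] by auto
qed

lemma V_one_division: "division_subalgebra K D V0"
proof (rule division_subalgebraI[OF D.K_algebra_axioms _ one_not_zero])
 show "K_subalgebra K D V0" using ES_subalgebra[of "{\<one>\<^bsub>G\<^esub>}"] unfolding ES_trivial by simp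
 fix e assume e: "e \<in> V0" "e \<noteq> \<zero>"
 have "inv e \<in> V0" using V_inv[OF one_closed e] by simp
 moreover have "e \<in> Units D" using e V_carrier[OF one_closed] unit by blast
 ultimately show "\<exists>e'\<in>V0. e' \<otimes> e = \<one> \<and> e \<otimes> e' = \<one>" by (intro bexI[of _ "inv e"]) simp_all
qed

lemma left_noetherian_V_one: "left_noetherian (D\<lparr>carrier := V0\<rparr>)" unfolding left_noetherian_def
proof (intro allI impI) note E = division_subalgebraE[OF V_one_division]
 fix I assume I: "\<forall>i::nat. left_ideal (I i) (D\<lparr>carrier := V0\<rparr>) \<and> I i \<subseteq> I (Suc i)"
 have Ii: "I i \<subseteq> V0" "\<zero> \<in> I i" "\<And>r a. r \<in> V0 ==> a \<in> I i ==> r \<otimes> a \<in> I i" for i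
  using I unfolding left_ideal_subring_iff[OF D.ring_axioms E(2)] by blast+
 have Imono: "i \<le> j ==> I i \<subseteq> I j" for i j using I lift_Suc_mono_le[of I] by blast
 show "\<exists>N. \<forall>i\<ge>N. I i = I N"
 proof (cases "\<exists>N. \<exists>a\<in>I N. a \<noteq> \<zero>") case True then obtain N a where a: "a \<in> I N" "a \<noteq> \<zero>" by blast
  have aV: "a \<in> V0" using a(1) Ii(1) by blast
  have "V0 \<subseteq> I N"
  proof fix v assume v: "v \<in> V0" have u: "a \<in> Units D" using aV a(2) V_carrier[OF one_closed] unit by blast
   have "inv a \<in> V0" using V_inv[OF one_closed aV a(2)] by simp
   then have "(v \<otimes> inv a) \<otimes> a \<in> I N" using Ii(3)[OF _ a(1)] V_mult[OF one_closed one_closed v] by simp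
   then show "v \<in> I N" using u V_carrier[OF one_closed v] by (simp add: D.m_assoc D.Units_closed)
  qed
  then have "I i = I N" if "i \<ge> N" for i using Imono[OF that] Ii(1)[of i] by blast
  then show ?thesis by blast
 next case False then have "I i = {\<zero>}" for i using Ii(2)[of i] by blast then show ?thesis by simp
 qed
qed

text \<open>In a commutative degree group, conjugation by a homogeneous element does not change
  degrees.\<close>

lemma conj_ES: assumes H: "H \<subseteq> carrier G" and g: "g \<in> carrier G" and u: "u \<in> V g" "u \<noteq> \<zero>" and s: "s \<in> ES H"
 shows "u \<otimes> s \<otimes> inv u \<in> ES H"
proof (rule ES_mult[of "{g \<otimes>\<^bsub>G\<^esub> h | h. h \<in> H}" "{inv\<^bsub>G\<^esub> g}" H])
 have hc: "h \<in> carrier G" if "h \<in> H" for h using H that by blast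
 show "u \<otimes> s \<in> ES {g \<otimes>\<^bsub>G\<^esub> h | h. h \<in> H}"
  by (rule ES_mult[of "{g}" H _ u s]) (use g hc u s in \<open>auto intro: ES_gen\<close>)
 show "inv u \<in> ES {inv\<^bsub>G\<^esub> g}" by (rule ES_gen) (use g V_inv[OF g u] in auto)
 fix l l' assume "l \<in> {g \<otimes>\<^bsub>G\<^esub> h | h. h \<in> H}" "l' \<in> {inv\<^bsub>G\<^esub> g}"
 then obtain h where h: "h \<in> H" "l = g \<otimes>\<^bsub>G\<^esub> h" "l' = inv\<^bsub>G\<^esub> g" by blast
 have "l \<otimes>\<^bsub>G\<^esub> l' = h" unfolding h(2,3) using hc[OF h(1)] g by (simp add: m_assoc m_lcomm[of g h])
 then show "l \<otimes>\<^bsub>G\<^esub> l' \<in> H" using h(1) by simp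
qed (use g H in auto)

text \<open>In additive notation, a nonzero u of degree g normalizes \<open>ES H\<close>, so
  Hilbert's theorem covers the degrees H + \<nat> g, and inverting the powers of u yields H + \<int>
  g. A power of g may lie in H, so u is treated as a generator (\<open>ore_generated\<close>) and
  not as a free variable.\<close>

lemma left_noetherian_ES_step:
 assumes H: "subgroup H G" and g: "g \<in> carrier G" and N: "left_noetherian (D\<lparr>carrier := ES H\<rparr>)"
 shows "left_noetherian (D\<lparr>carrier := ES {h \<otimes>\<^bsub>G\<^esub> g [^]\<^bsub>G\<^esub> (k :: int) | h k. h \<in> H}\<rparr>)"
proof - obtain u where u: "u \<in> V g" "u \<noteq> \<zero>" using V_nonzero[OF g] by blast
 have uc: "u \<in> carrier D" and uu: "u \<in> Units D" using V_carrier[OF g u(1)] u(2) unit by blast+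
 have iu: "inv u \<in> V (inv\<^bsub>G\<^esub> g)" by (rule V_inv[OF g u])
 note Hc = subgroup.subset[OF H] and H1 = subgroup.one_closed[OF H] and Hm = subgroup.m_closed[OF H]
 have hc: "h \<in> carrier G" if "h \<in> H" for h using Hc that by blast
 define P where "P = {h \<otimes>\<^bsub>G\<^esub> g [^]\<^bsub>G\<^esub> (n :: nat) | h n. h \<in> H}"
 define H' where "H' = {h \<otimes>\<^bsub>G\<^esub> g [^]\<^bsub>G\<^esub> (k :: int) | h k. h \<in> H}"
 have PI: "h \<otimes>\<^bsub>G\<^esub> g [^]\<^bsub>G\<^esub> (n :: nat) \<in> P" if "h \<in> H" for h n using that unfolding P_def by blast
 have H'I: "h \<otimes>\<^bsub>G\<^esub> g [^]\<^bsub>G\<^esub> (k :: int) \<in> H'" if "h \<in> H" for h k using that unfolding H'_def by blast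
 have Pc: "P \<subseteq> carrier G" and H'c: "H' \<subseteq> carrier G" using hc g unfolding P_def H'_def by auto
 have PH': "P \<subseteq> H'"
 proof fix l assume "l \<in> P"
  then obtain h n where "h \<in> H" "l = h \<otimes>\<^bsub>G\<^esub> g [^]\<^bsub>G\<^esub> (n :: nat)" unfolding P_def by blast
  then show "l \<in> H'" using H'I[of h "int n"] by (simp add: int_pow_int)
 qed
 have HP: "H \<subseteq> P"
 proof fix h assume "h \<in> H" then show "h \<in> P" using PI[of h 0] hc by simp
 qed
 have Pm: "l \<otimes>\<^bsub>G\<^esub> m \<in> P" if lm: "l \<in> P" "m \<in> P" for l m
 proof -
  obtain h n h' n' where *: "h \<in> H" "l = h \<otimes>\<^bsub>G\<^esub> g [^]\<^bsub>G\<^esub> (n :: nat)" "h' \<in> H" "m = h' \<otimes>\<^bsub>G\<^esub> g [^]\<^bsub>G\<^esub> (n' :: nat)"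
   using lm unfolding P_def by blast
  have "l \<otimes>\<^bsub>G\<^esub> m = (h \<otimes>\<^bsub>G\<^esub> h') \<otimes>\<^bsub>G\<^esub> g [^]\<^bsub>G\<^esub> (n + n')"
   unfolding *(2,4) using hc[OF *(1)] hc[OF *(3)] g by (simp add: nat_pow_mult[symmetric] m_ac)
  then show ?thesis using PI[OF Hm[OF *(1,3)]] by simp
 qed
 have H'm: "l \<otimes>\<^bsub>G\<^esub> m \<in> H'" if lm: "l \<in> H'" "m \<in> H'" for l m
 proof -
  obtain h n h' n' where *: "h \<in> H" "l = h \<otimes>\<^bsub>G\<^esub> g [^]\<^bsub>G\<^esub> (n :: int)" "h' \<in> H" "m = h' \<otimes>\<^bsub>G\<^esub> g [^]\<^bsub>G\<^esub> (n' :: int)"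
   using lm unfolding H'_def by blast
  have "l \<otimes>\<^bsub>G\<^esub> m = (h \<otimes>\<^bsub>G\<^esub> h') \<otimes>\<^bsub>G\<^esub> g [^]\<^bsub>G\<^esub> (n + n')"
   unfolding *(2,4) using hc[OF *(1)] hc[OF *(3)] g by (simp add: int_pow_mult m_ac)
  then show ?thesis using H'I[OF Hm[OF *(1,3)]] by simp
 qed
 have gP: "g \<in> P" using PI[OF H1, of 1] g by simp
 have SH: "subring (ES H) D" using K_subalgebraE(1)[OF ES_subgroup_subalgebra[OF H]] .
 have SP: "subring (ES P) D" using K_subalgebraE(1)[OF ES_subalgebra[OF Pc _ Pm]] HP H1 by blast
 have SH': "subring (ES H') D" using K_subalgebraE(1)[OF ES_subalgebra[OF H'c _ H'm]] HP PH' H1 by blast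
 have iu0: "inv u \<noteq> \<zero>" using D.Units_inv_Units[OF uu] U by blast
 have conj_l: "u \<otimes> s \<otimes> inv u \<in> ES H" if "s \<in> ES H" for s by (rule conj_ES[OF Hc g u that])
 have conj_r: "inv u \<otimes> s \<otimes> u \<in> ES H" if "s \<in> ES H" for s using conj_ES[OF Hc _ iu iu0 that] g uu by simp
 have EHc: "s \<in> carrier D" if "s \<in> ES H" for s using ES_carrier[OF Hc] that by blast
 interpret O: ore_generated D "ES H" "ES P" u
 proof (intro ore_generated.intro ore_generated_axioms.intro) show "ring D" by (rule D.ring_axioms)
  show "subring (ES H) D" "subring (ES P) D" by fact+
  show "ES H \<subseteq> ES P" by (rule ES_mono[OF HP])
  show "u \<in> ES P" by (rule ES_gen[OF Pc gP u(1)])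
  show "\<exists>s'\<in>ES H. \<exists>s''\<in>ES H. u \<otimes> s = s' \<otimes> u \<oplus> s''" if s: "s \<in> ES H" for s
  proof - have "u \<otimes> s = (u \<otimes> s \<otimes> inv u) \<otimes> u \<oplus> \<zero>" using EHc[OF s] uc uu by (simp add: D.m_assoc)
   then show ?thesis using conj_l[OF s] ES_zero by blast
  qed
  show "\<exists>s'\<in>ES H. \<exists>s''\<in>ES H. s \<otimes> u = u \<otimes> s' \<oplus> s''" if s: "s \<in> ES H" for s
  proof - have "s \<otimes> u = u \<otimes> (inv u \<otimes> s \<otimes> u) \<oplus> \<zero>" using EHc[OF s] uc uu by (simp add: D.m_assoc[symmetric])
   then show ?thesis using conj_r[OF s] ES_zero by blast
  qed
  show "ES P \<subseteq> C" if C: "subring C D" "ES H \<subseteq> C" "u \<in> C" for C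
  proof (rule ES_least[OF Pc]) note Cs = subringE[OF C(1)] fix l v assume lv: "l \<in> P" "v \<in> V l"
   obtain h n where h: "h \<in> H" "l = h \<otimes>\<^bsub>G\<^esub> g [^]\<^bsub>G\<^esub> (n :: nat)" using lv(1) unfolding P_def by blast
   have p: "u [^] n \<in> V (g [^]\<^bsub>G\<^esub> n)" by (rule pow_V[OF g u(1)])
   have "u [^] n \<in> Units D" using uu by (rule D.Units_pow_closed)
   then have p0: "u [^] n \<noteq> \<zero>" using U by blast
   have gn: "g [^]\<^bsub>G\<^esub> n \<in> carrier G" using g by simp
   \<comment> \<open>An element v of degree h + ng is its quotient by u^n, which has degree h, times
     u^n.\<close>
   note vm = V_mult_inv[OF hc[OF h(1)] gn lv(2)[unfolded h(2)] p p0]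
   have pC: "u [^] n \<in> C" by (induction n) (use Cs(3,6) C(3) in auto)
   have "v \<otimes> inv (u [^] n) \<in> C" using ES_gen[OF Hc h(1) vm(1)] C(2) by blast
   then show "v \<in> C" by (subst vm(2)) (rule Cs(6)[OF _ pC])
  next show "\<zero> \<in> C" using subringE(2)[OF C(1)] .
   show "x \<oplus> y \<in> C" if "x \<in> C" "y \<in> C" for x y using subringE(7)[OF C(1) that] .
  qed
 qed
 have NP: "left_noetherian (D\<lparr>carrier := ES P\<rparr>)" by (rule O.left_noetherian_ore_generated[OF N])
 have uP: "u [^] n \<in> ES P" for n :: nat using O.pow_S' .
 \<comment> \<open>Multiplying by a high power of u makes all exponents of g nonnegative.\<close>
 have shift: "\<exists>n :: nat. u [^] n \<otimes> z \<in> ES P" if "z \<in> ES H'" for z using H'c that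
 proof (induction z rule: ES_induct) case (gen l v)
  obtain h k where h: "h \<in> H" "l = h \<otimes>\<^bsub>G\<^esub> g [^]\<^bsub>G\<^esub> (k :: int)" using gen(1) unfolding H'_def by blast
  have lc: "l \<in> carrier G" using gen(1) H'c by blast
  define n where "n = nat \<bar>k\<bar>"
  have gn: "g [^]\<^bsub>G\<^esub> n \<in> carrier G" using g by simp
  have "g [^]\<^bsub>G\<^esub> n \<otimes>\<^bsub>G\<^esub> l = h \<otimes>\<^bsub>G\<^esub> (g [^]\<^bsub>G\<^esub> int n \<otimes>\<^bsub>G\<^esub> g [^]\<^bsub>G\<^esub> k)"
   unfolding h(2) using hc[OF h(1)] g by (simp add: int_pow_int m_lcomm)
  also have "g [^]\<^bsub>G\<^esub> int n \<otimes>\<^bsub>G\<^esub> g [^]\<^bsub>G\<^esub> k = g [^]\<^bsub>G\<^esub> (int n + k)" using g by (simp add: int_pow_mult)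
  also have "int n + k = int (nat (int n + k))" by (simp add: n_def)
  finally have "g [^]\<^bsub>G\<^esub> n \<otimes>\<^bsub>G\<^esub> l \<in> P" using PI[OF h(1)] by (simp only: int_pow_int)
  then have "u [^] n \<otimes> v \<in> ES P" using ES_gen[OF Pc _ V_mult[OF gn lc pow_V[OF g u(1)] gen(2)]] by blast
  then show ?case by blast
 next case zero then show ?case using uc ES_zero by simp
 next case (add a b) then obtain n m :: nat where *: "u [^] n \<otimes> a \<in> ES P" "u [^] m \<otimes> b \<in> ES P" by blast
  have "u [^] (n + m) \<otimes> (a \<oplus> b) = u [^] m \<otimes> (u [^] n \<otimes> a) \<oplus> u [^] n \<otimes> (u [^] m \<otimes> b)"
   using uc add(1,2) by (simp add: D.r_distr D.m_assoc[symmetric] D.nat_pow_mult add.commute)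
  then have "u [^] (n + m) \<otimes> (a \<oplus> b) \<in> ES P"
   using subringE(6)[OF SP uP *(1)] subringE(6)[OF SP uP *(2)] ES_add[OF Pc] by simp
  then show ?case by blast
 qed
 have "left_noetherian (D\<lparr>carrier := ES H'\<rparr>)"
 proof (rule left_noetherian_localization[OF D.ring_axioms SP SH' ES_mono[OF PH'] _ NP])
  fix z assume "z \<in> ES H'"
  then obtain n :: nat where n: "u [^] n \<otimes> z \<in> ES P" using shift by blast
  have pu: "u [^] n \<in> Units D" using uu by (rule D.Units_pow_closed)
  then have p0: "u [^] n \<noteq> \<zero>" using U by blast
  have gn: "g [^]\<^bsub>G\<^esub> n \<in> carrier G" using g by simp
  have "inv (u [^] n) \<in> V (inv\<^bsub>G\<^esub> (g [^]\<^bsub>G\<^esub> n))" by (rule V_inv[OF gn pow_V[OF g u(1)] p0])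
  moreover have "inv\<^bsub>G\<^esub> (g [^]\<^bsub>G\<^esub> n) = \<one>\<^bsub>G\<^esub> \<otimes>\<^bsub>G\<^esub> g [^]\<^bsub>G\<^esub> (- int n)" using g by (simp add: int_pow_neg int_pow_int)
  ultimately have "inv (u [^] n) \<in> ES H'" using ES_gen[OF H'c H'I[OF H1]] by simp
  then show "\<exists>w\<in>ES P. \<exists>v\<in>ES H'. w \<otimes> z \<in> ES P \<and> v \<otimes> w = \<one>"
   using n uP pu by (intro bexI[of _ "u [^] n"] bexI[of _ "inv (u [^] n)"]) auto
 qed
 then show ?thesis unfolding H'_def .
qed

lemma left_noetherian_ES:
 assumes "finite Z" "Z \<subseteq> carrier G" shows "left_noetherian (D\<lparr>carrier := ES (generate G Z)\<rparr>)"
 using assms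
proof (induction Z rule: finite_induct) case empty
 then show ?case using left_noetherian_V_one by (simp add: generate_empty ES_trivial)
next case (insert g Z) then show ?case
  using left_noetherian_ES_step[OF generate_is_subgroup[of Z], of g] generate_insert[of Z g] by simp
qed

lemma nc_noetherian_domain_ES:
 assumes Z: "finite Z" "Z \<subseteq> carrier G" shows "nc_noetherian_domain (D\<lparr>carrier := ES (generate G Z)\<rparr>)"
proof - interpret op: graded_division K "opposite D" G V by (rule opposite_graded_division)
 have sub: "subring (ES (generate G Z)) D"
  by (rule K_subalgebraE(1)[OF ES_subgroup_subalgebra[OF generate_is_subgroup[OF Z(2)]]])
 show ?thesis using nc_domain_subring[OF division_algebra_nc_domain[OF D.K_algebra_axioms U] sub]
   left_noetherian_ES[OF Z] op.left_noetherian_ES[OF Z]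
  by (simp add: nc_noetherian_domain_def opposite_ES)
qed

end

context graded_division
begin

lemma ES_shift: assumes F: "F \<subseteq> carrier G" and l: "l \<in> carrier G" and s: "s \<in> ES F" and v: "v \<in> V l"
 shows "s \<otimes> v \<in> ES ((\<lambda>h. h \<otimes>\<^bsub>G\<^esub> l) ` F)"
proof (rule ES_mult[OF F, of "{l}"]) show "v \<in> ES {l}" by (rule ES_gen) (use l v in auto)
qed (use F l s in auto)

lemma V_subset_frac: assumes F: "F \<subseteq> carrier G" "\<one>\<^bsub>G\<^esub> \<in> F" and l: "l \<in> F" shows "V l \<subseteq> frac_in D (ES F)"
proof fix v assume v: "v \<in> V l" have vc: "v \<in> carrier D" using V_carrier[of l v] v l F(1) by blast
 have "v = inv \<one> \<otimes> v" using vc by simp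
 moreover have "\<one> \<in> ES F - {\<zero>}" using ES_gen[OF F V_one] one_not_zero by blast
 moreover have "v \<in> ES F" by (rule ES_gen[OF F(1) l v])
 ultimately show "v \<in> frac_in D (ES F)" unfolding frac_in_def by blast
qed

lemma noetherian_subdomain_ES:
 "subgroup F G ==> nc_noetherian_domain (D\<lparr>carrier := ES F\<rparr>) ==> noetherian_subdomain K D (ES F)"
 using D.K_algebra_axioms U ES_subgroup_subalgebra
 by (simp add: noetherian_subdomain_def noetherian_subdomain_axioms_def)

text \<open>If \<open>v\<close> is homogeneous of degree \<open>l\<close> and \<open>sv\<close> lies in the \<open>F\<close>-part for some \<open>s\<close> in the \<open>F\<close>-part,
 then the cosets \<open>F\<close> and \<open>Fl\<close> meet.\<close>

lemma homogeneous_fraction: assumes F: "subgroup F G" and N: "nc_noetherian_domain (D\<lparr>carrier := ES F\<rparr>)"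
  and l: "l \<in> carrier G" and v: "v \<in> V l" "v \<in> frac_in D (ES F)" "v \<noteq> \<zero>"
 shows "l \<in> F"
proof - interpret B: noetherian_subdomain K D "ES F" by (rule noetherian_subdomain_ES[OF F N])
 note Fc = subgroup.subset[OF F]
 obtain s where s: "s \<in> ES F" "s \<noteq> \<zero>" "s \<otimes> v \<in> ES F" using v(2) unfolding B.mem_Q_left by blast
 have sc: "s \<in> carrier D" using s(1) ES_carrier[OF Fc] by blast
 have nz: "s \<otimes> v \<noteq> \<zero>" using D.division_cancel[OF U sc V_carrier[OF l v(1)]] s(2) v(3) by blast
 have "(\<lambda>h. h \<otimes>\<^bsub>G\<^esub> l) ` F \<subseteq> carrier G" using Fc l by auto
 then have "F \<inter> (\<lambda>h. h \<otimes>\<^bsub>G\<^esub> l) ` F \<noteq> {}"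
  using ES_disjoint[OF Fc _ _ s(3) ES_shift[OF Fc l s(1) v(1)]] nz by blast
 then obtain h h' where h: "h \<in> F" "h' \<in> F" "h' = h \<otimes>\<^bsub>G\<^esub> l" by blast
 have "l = inv\<^bsub>G\<^esub> h \<otimes>\<^bsub>G\<^esub> h'" unfolding h(3) using h(1) Fc l by (simp add: subset_iff m_assoc[symmetric])
 then show "l \<in> F" using subgroup.m_closed[OF F subgroup.m_inv_closed[OF F h(1)] h(2)] by simp
qed

text \<open>An increasing sequence of finite subsets generates finitely generated groups H_i, for
  which the algebras \<open>ES\<close> are already known to be Noetherian. Their quotient division
  algebras stabilize by \<open>acc\<close>, and \<open>homogeneous_fraction\<close> recovers H_i
  from them. So the groups stabilize, and \<open>acc_finite_subset\<close> yields a finite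
  generating set.\<close>

lemma subgroup_finitely_generated:
 assumes acc: "\<And>E :: nat \<Rightarrow> 'd set. (\<And>i. division_subalgebra K D (E i)) ==> (\<And>i. E i \<subseteq> E (Suc i)) ==>
   \<exists>N. \<forall>i\<ge>N. E i = E N"
  and F: "subgroup F G"
 shows "\<exists>Z. finite Z \<and> Z \<subseteq> F \<and> generate G Z = F"
proof - note Fc = subgroup.subset[OF F]
 obtain Z where Z: "finite Z" "Z \<subseteq> F" "\<And>e. e \<in> F ==> generate G (insert e Z) = generate G Z"
 proof (rule acc_finite_subset[of F "generate G"]) fix Z :: "nat \<Rightarrow> 'g set"
  assume Z: "\<And>i. finite (Z i)" "\<And>i. Z i \<subseteq> F" "\<And>i. Z i \<subseteq> Z (Suc i)"
  have Zc: "Z i \<subseteq> carrier G" for i using Z(2)[of i] Fc by blast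
  define H where "H i = generate G (Z i)" for i
  have H: "subgroup (H i) G" for i unfolding H_def by (rule generate_is_subgroup[OF Zc])
  have Hc: "H i \<subseteq> carrier G" for i by (rule subgroup.subset[OF H])
  have N: "nc_noetherian_domain (D\<lparr>carrier := ES (H i)\<rparr>)" for i
   unfolding H_def by (rule nc_noetherian_domain_ES[OF Z(1) Zc])
  have mono: "H i \<subseteq> H j" if "i \<le> j" for i j
   unfolding H_def by (rule mono_generate) (rule lift_Suc_mono_le[of Z, OF Z(3) that])
  have "\<exists>N. \<forall>i\<ge>N. frac_in D (ES (H i)) = frac_in D (ES (H N))"
  proof (rule acc) show "division_subalgebra K D (frac_in D (ES (H i)))" for i
    by (rule noetherian_subdomain.Q_division_subalgebra[OF noetherian_subdomain_ES[OF H N]])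
   show "frac_in D (ES (H i)) \<subseteq> frac_in D (ES (H (Suc i)))" for i
    by (rule frac_in_mono[OF ES_mono[OF mono]]) simp
  qed
  then obtain M where M: "\<And>i. i \<ge> M ==> frac_in D (ES (H i)) = frac_in D (ES (H M))" by blast
  have "H i = H M" if i: "i \<ge> M" for i
  proof show "H M \<subseteq> H i" by (rule mono[OF i]) show "H i \<subseteq> H M" proof fix l assume l: "l \<in> H i"
    have lc: "l \<in> carrier G" using l Hc by blast
    obtain v where v: "v \<in> V l" "v \<noteq> \<zero>" using V_nonzero[OF lc] by blast
    have "v \<in> frac_in D (ES (H i))" using V_subset_frac[OF Hc subgroup.one_closed[OF H] l] v(1) by blast
    then have "v \<in> frac_in D (ES (H M))" using M[OF i] by simp
    then show "l \<in> H M" using homogeneous_fraction[OF H N lc v(1) _ v(2)] by blast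
   qed
  qed
  then show "\<exists>N. \<forall>i\<ge>N. generate G (Z i) = generate G (Z N)" unfolding H_def by blast
 qed blast
 have "generate G Z = F"
 proof show "generate G Z \<subseteq> F" by (rule generate_subgroup_incl[OF Z(2) F]) show "F \<subseteq> generate G Z" proof
   fix e assume "e \<in> F"
   then show "e \<in> generate G Z" using Z(3)[of e] generate.incl[of e "insert e Z" G] by simp
  qed
 qed
 then show ?thesis using Z(1,2) by blast
qed

lemma ES_insert: assumes l: "l \<in> carrier G" and S: "S \<subseteq> carrier G" and x: "x \<in> ES (insert l S)"
 shows "\<exists>v\<in>V l. \<exists>s\<in>ES S. x = v \<oplus> s"
proof - have "insert l S \<subseteq> carrier G" using l S by simp then show ?thesis using x
 proof (induction x rule: ES_induct) case (gen m v)
  then have vc: "v \<in> carrier D" using l S V_carrier by blast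
  show ?case
  proof (cases "m = l") case True then have "v = v \<oplus> \<zero>" "v \<in> V l" using gen vc by simp_all
   then show ?thesis using ES_zero by blast
  next case False then have "v = \<zero> \<oplus> v" "v \<in> ES S" using gen vc ES_gen[OF S] by auto
   then show ?thesis using V_zero[OF l] by blast
  qed
 next case zero have "\<zero> = \<zero> \<oplus> \<zero>" by simp then show ?case using V_zero[OF l] ES_zero by blast
 next case (add a b)
  then obtain v s w t where *: "v \<in> V l" "s \<in> ES S" "a = v \<oplus> s" "w \<in> V l" "t \<in> ES S" "b = w \<oplus> t" by blast
  have "a \<oplus> b = (v \<oplus> w) \<oplus> (s \<oplus> t)"
   unfolding *(3,6) using V_carrier[OF l] *(1,2,4,5) ES_carrier[OF S] by (simp add: D.a_ac subset_iff)
  then show ?case using V_add[OF l *(1,4)] ES_add[OF S *(2,5)] by blast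
 qed
qed

text \<open>Over finitely many degrees the sum is a finite-dimensional left \<open>V0\<close>-space.
  The induction removes one degree at a time, comparing J with its part in the remaining
  degrees.\<close>

lemma ES_dcc: fixes J :: "nat \<Rightarrow> 'd set" assumes "finite S" "S \<subseteq> carrier G" "\<And>i. J i \<subseteq> ES S"
  and "\<And>i x y. x \<in> J i ==> y \<in> J i ==> x \<oplus> y \<in> J i"
  and "\<And>i c x. c \<in> V0 ==> x \<in> J i ==> c \<otimes> x \<in> J i" and "\<And>i. J (Suc i) \<subseteq> J i"
 shows "\<exists>N. \<forall>i\<ge>N. J i = J N"
 using assms
proof (induction S arbitrary: J rule: finite_induct) case empty
 have J: "J i \<subseteq> {\<zero>}" for i using empty.prems(2)[of i] by (auto simp: homogeneous_sums_def)
 have mono: "J i \<subseteq> J j" if "j \<le> i" for i j by (rule lift_Suc_antimono_le[of J, OF empty.prems(5) that])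
 show ?case
 \<comment> \<open>The closure conditions admit empty sets, so an empty member of the chain is
   treated separately.\<close>
 proof (cases "\<exists>N. J N = {}") case True then show ?thesis using mono by blast
 next case False then have "J i = {\<zero>}" for i using J[of i] by blast then show ?thesis by simp
 qed
next case (insert l S) note J = insert.prems(2-5)
 have l: "l \<in> carrier G" and S: "S \<subseteq> carrier G" using insert.prems(1) by auto
 note Sc = subsetD[OF ES_carrier[OF S]]
 have Jc: "x \<in> carrier D" if "x \<in> J i" for i x using that J(1) ES_carrier[OF insert.prems(1)] by blast
 have mono: "J i \<subseteq> J j" if "j \<le> i" for i j by (rule lift_Suc_antimono_le[of J, OF J(4) that])
 have cS: "c \<otimes> s \<in> ES S" if "c \<in> V0" "s \<in> ES S" for c s
  by (rule ES_mult[of "{\<one>\<^bsub>G\<^esub>}" S S c s]) (use S that in \<open>auto simp: ES_trivial\<close>)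
 have "\<exists>N. \<forall>i\<ge>N. J i \<inter> ES S = J N \<inter> ES S"
 proof (rule insert.IH[OF S]) show "x \<oplus> y \<in> J i \<inter> ES S" if "x \<in> J i \<inter> ES S" "y \<in> J i \<inter> ES S" for i x y
   using J(2)[of x i y] ES_add[OF S, of x y] that by simp
  show "c \<otimes> x \<in> J i \<inter> ES S" if "c \<in> V0" "x \<in> J i \<inter> ES S" for i c x
   using J(3)[of c x i] cS[of c x] that by simp
  show "J (Suc i) \<inter> ES S \<subseteq> J i \<inter> ES S" for i using J(4)[of i] by blast
 qed simp
 then obtain N where N: "\<And>i. i \<ge> N ==> J i \<inter> ES S = J N \<inter> ES S" by blast
 show ?case
 proof (cases "\<exists>n. J n \<subseteq> ES S") case True then obtain n where n: "J n \<subseteq> ES S" by blast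
  have "J i = J (max N n)" if i: "i \<ge> max N n" for i
  proof - have "J i \<subseteq> ES S" "J (max N n) \<subseteq> ES S" using mono[of n i] mono[of n "max N n"] n i by auto
   then show ?thesis using N[of i] N[of "max N n"] i by (simp add: Int_absorb2)
  qed
  then show ?thesis by blast
 \<comment> \<open>J i contains some x with nonzero component v in degree l. Subtracting cx with c =
   w v^(-1) removes the component w of y; the remainder lies in the part of J N without degree l,
   which agrees with that of J i.\<close>
 next case False have "J N \<subseteq> J i" if i: "i \<ge> N" for i proof fix y assume y: "y \<in> J N"
   obtain x where x: "x \<in> J i" "x \<notin> ES S" using False by blast
   have xN: "x \<in> J N" using x(1) mono[OF i] by blast
   obtain v s where vs: "v \<in> V l" "s \<in> ES S" "x = v \<oplus> s"
    using ES_insert[OF l S, of x] x(1) J(1)[of i] by blast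
   have v0: "v \<noteq> \<zero>" using vs x(2) Sc[OF vs(2)] by auto
   note vc = V_carrier[OF l vs(1)]
   obtain w t where wt: "w \<in> V l" "t \<in> ES S" "y = w \<oplus> t"
    using ES_insert[OF l S, of y] y J(1)[of N] by blast
   define c where "c = w \<otimes> inv v"
   have wl: "w \<in> V (\<one>\<^bsub>G\<^esub> \<otimes>\<^bsub>G\<^esub> l)" using wt(1) l by simp
   have c: "c \<in> V0" "w = c \<otimes> v" unfolding c_def using V_mult_inv[OF one_closed l wl vs(1) v0] by blast+
   have c': "\<ominus> c \<in> V0" by (rule V_neg[OF one_closed c(1)])
   note cc = V_carrier[OF one_closed c(1)]
   define b where "b = c \<otimes> v"
   have b: "b \<in> carrier D" "c \<otimes> s \<in> carrier D" "t \<in> carrier D"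
    using cc vc Sc[OF vs(2)] Sc[OF wt(2)] by (simp_all add: b_def)
   have "y \<oplus> \<ominus> c \<otimes> x = (b \<oplus> t) \<oplus> (\<ominus> b \<oplus> \<ominus> (c \<otimes> s))" unfolding wt(3) c(2) vs(3) using cc vc Sc[OF vs(2)]
    by (simp add: b_def D.r_distr D.l_minus D.minus_add)
   also have "\<dots> = (b \<oplus> \<ominus> b) \<oplus> (t \<oplus> \<ominus> (c \<otimes> s))" using b by (simp add: D.a_ac del: D.r_neg)
   finally have "y \<oplus> \<ominus> c \<otimes> x = t \<oplus> \<ominus> c \<otimes> s" using b cc Sc[OF vs(2)] by (simp add: D.r_neg D.l_minus)
   then have "y \<oplus> \<ominus> c \<otimes> x \<in> J N \<inter> ES S"
    using ES_add[OF S wt(2) cS[OF c' vs(2)]] J(2)[OF y J(3)[OF c' xN]] by simp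
   then have "y \<oplus> \<ominus> c \<otimes> x \<in> J i" using N[OF i] by blast
   then have "(y \<oplus> \<ominus> c \<otimes> x) \<oplus> c \<otimes> x \<in> J i" by (rule J(2)[OF _ J(3)[OF c(1) x(1)]])
   moreover have "(y \<oplus> \<ominus> c \<otimes> x) \<oplus> c \<otimes> x = y"
    using cc Jc[OF y] Jc[OF x(1)] by (simp add: D.a_assoc D.l_minus D.l_neg)
   ultimately show "y \<in> J i" by simp
  qed
  then have "J i = J N" if "i \<ge> N" for i using mono[OF that] that by blast
  then show ?thesis by blast
 qed
qed

text \<open>The left \<open>V0\<close>-modules \<open>ES F a\<^sup>n\<close> form a decreasing chain.\<close>

lemma ES_finite_inverse: assumes F: "subgroup F G" "finite F" and a: "a \<in> ES F" "a \<noteq> \<zero>" shows "inv a \<in> ES F"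
proof - note Fc = subgroup.subset[OF F(1)] and S = K_subalgebraE(1)[OF ES_subgroup_subalgebra[OF F(1)]]
 note Ss = subringE[OF S]
 have Ec: "x \<in> carrier D" if "x \<in> ES F" for x using that Ss(1) by blast
 have ac: "a \<in> carrier D" and au: "a \<in> Units D" using Ec[OF a(1)] a(2) unit by blast+
 define J where "J n = {x \<otimes> a [^] n | x. x \<in> ES F}" for n :: nat
 have JI: "x \<otimes> a [^] n \<in> J n" if "x \<in> ES F" for x n using that by (auto simp: J_def)
 have pow: "a [^] n \<in> ES F" for n :: nat
 proof (induction n) case (Suc n) then show ?case using Ss(6)[OF Suc.IH a(1)] by simp
 qed (simp add: Ss(3))
 have "\<exists>N. \<forall>i\<ge>N. J i = J N"
 proof (rule ES_dcc[OF F(2) Fc]) show "J i \<subseteq> ES F" for i using Ss(6)[OF _ pow] by (auto simp: J_def)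
  show "x \<oplus> y \<in> J i" if xy: "x \<in> J i" "y \<in> J i" for i x y
  proof - obtain x' y' where *: "x' \<in> ES F" "y' \<in> ES F" "x = x' \<otimes> a [^] i" "y = y' \<otimes> a [^] i"
    using xy unfolding J_def by blast
   show ?thesis using JI[OF Ss(7)[OF *(1,2)], of i] Ec *(1,2) ac unfolding *(3,4) by (simp add: D.l_distr)
  qed
  show "c \<otimes> x \<in> J i" if c: "c \<in> V0" and x: "x \<in> J i" for i c x
  proof - obtain x' where x': "x' \<in> ES F" "x = x' \<otimes> a [^] i" using x unfolding J_def by blast
   have cF: "c \<in> ES F" by (rule ES_gen[OF Fc subgroup.one_closed[OF F(1)] c])
   show ?thesis using JI[OF Ss(6)[OF cF x'(1)], of i] Ec x'(1) cF ac unfolding x'(2) by (simp add: D.m_assoc)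
  qed
  show "J (Suc i) \<subseteq> J i" for i
  proof fix x assume "x \<in> J (Suc i)"
   then obtain x' where x': "x' \<in> ES F" "x = x' \<otimes> a [^] Suc i" unfolding J_def by blast
   have "x = (x' \<otimes> a) \<otimes> a [^] i" unfolding x'(2) D.nat_pow_Suc2[OF ac] using Ec[OF x'(1)] ac by (simp add: D.m_assoc)
   then show "x \<in> J i" using JI[OF Ss(6)[OF x'(1) a(1)]] by simp
  qed
 qed
 \<comment> \<open>Now a^N = xa^(N+1) for some x in \<open>ES F\<close>, and cancelling a^N shows
   that x is the inverse of a.\<close>
 then obtain N where "J (Suc N) = J N" by (metis le_SucI order_refl)
 moreover have "a [^] N \<in> J N" using JI[OF Ss(3), of N] ac by simp
 ultimately obtain x where x: "x \<in> ES F" "a [^] N = x \<otimes> a [^] Suc N" unfolding J_def by blast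
 have pu: "a [^] N \<in> Units D" by (rule D.Units_pow_closed[OF au])
 have xc: "x \<in> carrier D" by (rule Ec[OF x(1)])
 have "x \<otimes> a = (x \<otimes> a [^] Suc N) \<otimes> inv (a [^] N)"
  unfolding D.nat_pow_Suc2[OF ac] using xc ac pu by (simp add: D.m_assoc)
 also have "\<dots> = \<one>" unfolding x(2)[symmetric] using pu by simp
 finally have xa: "x \<otimes> a = \<one>" .
 have "inv a = (x \<otimes> a) \<otimes> inv a" unfolding xa using au by simp
 also have "\<dots> = x" using xc ac au by (simp add: D.m_assoc)
 finally show ?thesis using x(1) by simp
qed

lemma ES_finite_division: assumes F: "subgroup F G" "finite F" shows "division_subalgebra K D (ES F)"
proof (rule division_subalgebraI[OF D.K_algebra_axioms ES_subgroup_subalgebra[OF F(1)] one_not_zero])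
 fix a assume a: "a \<in> ES F" "a \<noteq> \<zero>"
 have "a \<in> Units D" using a ES_carrier[OF subgroup.subset[OF F(1)]] unit by blast
 then show "\<exists>e'\<in>ES F. e' \<otimes> a = \<one> \<and> a \<otimes> e' = \<one>"
  using ES_finite_inverse[OF F a] by (intro bexI[of _ "inv a"]) simp_all
qed

text \<open>Each new degree contributes one line V0 u, which is independent of the previous ones
  because its degree is new.\<close>

lemma dimension_ES: assumes "finite S" "S \<subseteq> carrier G" shows "ring.dimension D (card S) (V0) (ES S)"
 using assms
proof (induction S rule: finite_induct) case empty have "ES {} = {\<zero>}" by (auto simp: homogeneous_sums_def)
 then show ?case by simp
next case (insert l S) have l: "l \<in> carrier G" and S: "S \<subseteq> carrier G" using insert.prems by auto
 obtain u where u: "u \<in> V l" "u \<noteq> \<zero>" using V_nonzero[OF l] by blast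
 have "u \<notin> ES S" using ES_homogeneous[OF S l u(1) _ u(2)] insert.hyps(2) by blast
 then have "D.dimension (Suc (card S)) (V0) (D.line_extension (V0) u (ES S))"
  using D.Suc_dim[OF V_carrier[OF l u(1)]] insert.IH[OF S] by blast
 moreover have "D.line_extension (V0) u (ES S) = ES (insert l S)"
 proof (intro equalityI subsetI) fix x assume "x \<in> D.line_extension (V0) u (ES S)"
  then obtain c s where x: "c \<in> V0" "s \<in> ES S" "x = c \<otimes> u \<oplus> s" unfolding D.line_extension_mem_iff by blast
  have "c \<otimes> u \<in> V l" using V_mult[OF one_closed l x(1) u(1)] l by simp
  then have "c \<otimes> u \<in> ES (insert l S)" using ES_gen[OF insert.prems, of l] by simp
  moreover have "s \<in> ES (insert l S)" using x(2) ES_mono[of S "insert l S"] by blast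
  ultimately show "x \<in> ES (insert l S)" unfolding x(3) by (rule ES_add[OF insert.prems])
 next fix x assume "x \<in> ES (insert l S)"
  then obtain v s where x: "v \<in> V l" "s \<in> ES S" "x = v \<oplus> s" using ES_insert[OF l S] by blast
  have "v \<in> V (\<one>\<^bsub>G\<^esub> \<otimes>\<^bsub>G\<^esub> l)" using x(1) l by simp
  note v = V_mult_inv[OF one_closed l this u]
  show "x \<in> D.line_extension (V0) u (ES S)" unfolding D.line_extension_mem_iff x(3) using v x(2) by metis
 qed
 ultimately show ?case using insert.hyps by simp
qed

lemma ES_m_inv: assumes H: "subgroup H G" and u: "u \<in> ES H" "inv u \<in> ES H" "u \<in> Units D"
 shows "u \<in> Units (D\<lparr>carrier := ES H\<rparr>)" "inv\<^bsub>D\<lparr>carrier := ES H\<rparr>\<^esub> u = inv u"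
proof - interpret S: ring "D\<lparr>carrier := ES H\<rparr>"
  by (rule D.subring_is_ring[OF K_subalgebraE(1)[OF ES_subgroup_subalgebra[OF H]]])
 show "u \<in> Units (D\<lparr>carrier := ES H\<rparr>)" unfolding Units_def using u by (auto intro!: bexI[of _ "inv u"])
 show "inv\<^bsub>D\<lparr>carrier := ES H\<rparr>\<^esub> u = inv u" using u by (intro S.inv_char) simp_all
qed

lemma int_pow_V: assumes g: "g \<in> carrier G" and u: "u \<in> V g" "u \<noteq> \<zero>"
 shows "u [^] (k :: int) \<in> V (g [^]\<^bsub>G\<^esub> k)" "u [^] k \<noteq> \<zero>"
proof - have uu: "u \<in> Units D" using V_carrier[OF g u(1)] u(2) unit by blast
 have n: "u [^] (n :: nat) \<in> Units D" for n by (rule D.Units_pow_closed[OF uu])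
 have n0: "u [^] (n :: nat) \<noteq> \<zero>" for n using n[of n] U by blast
 have "inv (u [^] (m :: nat)) \<in> Units D" for m by (rule D.Units_inv_Units[OF n])
 then have "u [^] k \<in> Units D" using n by (subst int_pow_def2) (simp only: simp_thms split: if_split)
 then show "u [^] k \<noteq> \<zero>" using U by blast
 show "u [^] k \<in> V (g [^]\<^bsub>G\<^esub> k)" using pow_V[OF g u(1)] V_inv[OF nat_pow_closed[OF g] pow_V[OF g u(1)] n0]
  unfolding int_pow_def2[of D u k] int_pow_def2[of G g k] by (cases "k < 0") (simp_all only: if_True if_False simp_thms)
qed

text \<open>The automorphism is conjugation by u. The term c_k u^k has its degrees in the coset H +
  kg, and by \<open>indep\<close> these cosets are pairwise disjoint; this gives independence of the
  powers of u over \<open>ES H\<close>.\<close>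

lemma skew_laurent_extension_ES:
 assumes H: "subgroup H G" and g: "g \<in> carrier G" and indep: "\<And>k :: int. g [^]\<^bsub>G\<^esub> k \<in> H ==> k = 0"
  and u: "u \<in> V g" "u \<noteq> \<zero>"
 shows "skew_laurent_extension K (D\<lparr>carrier := ES {h \<otimes>\<^bsub>G\<^esub> g [^]\<^bsub>G\<^esub> (k :: int) | h k. h \<in> H}\<rparr>) (ES H) u
  (\<lambda>a. u \<otimes> a \<otimes> inv u)"
proof - define H' where "H' = {h \<otimes>\<^bsub>G\<^esub> g [^]\<^bsub>G\<^esub> (k :: int) | h k. h \<in> H}"
 define S where "S = D\<lparr>carrier := ES H'\<rparr>"
 define \<tau> where "\<tau> = (\<lambda>a. u \<otimes> a \<otimes> inv u)"
 note Hc = subgroup.subset[OF H]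
 have hc: "h \<in> carrier G" if "h \<in> H" for h using Hc that by blast
 have "generate G H = H"
  by (rule equalityI[OF generate_subgroup_incl[OF order_refl H]]) (auto intro: generate.incl)
 then have "H' = generate G (insert g H)" using generate_insert[OF Hc g] by (simp add: H'_def)
 then have H': "subgroup H' G" using generate_is_subgroup[of "insert g H"] Hc g by simp
 note H'c = subgroup.subset[OF H']
 have HH': "H \<subseteq> H'"
 proof fix h assume h: "h \<in> H" have "h = h \<otimes>\<^bsub>G\<^esub> g [^]\<^bsub>G\<^esub> (0 :: int)" using hc[OF h] by simp
  then show "h \<in> H'" unfolding H'_def using h by blast
 qed
 have gH': "g \<in> H'"
 proof - have "g = \<one>\<^bsub>G\<^esub> \<otimes>\<^bsub>G\<^esub> g [^]\<^bsub>G\<^esub> (1 :: int)" using g by simp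
  then show ?thesis unfolding H'_def using subgroup.one_closed[OF H] by blast
 qed
 have S_simps [simp]: "carrier S = ES H'" "x \<oplus>\<^bsub>S\<^esub> y = x \<oplus> y" "x \<otimes>\<^bsub>S\<^esub> y = x \<otimes> y"
  "\<zero>\<^bsub>S\<^esub> = \<zero>" "\<one>\<^bsub>S\<^esub> = \<one>" "k \<odot>\<^bsub>S\<^esub> x = k \<odot> x"
  "S\<lparr>carrier := C\<rparr> = D\<lparr>carrier := C\<rparr>" for x y k C by (simp_all add: S_def)
 note EH = ES_subgroup_subalgebra[OF H] and EH' = ES_subgroup_subalgebra[OF H']
 note SH = K_subalgebraE(1)[OF EH] and SH' = K_subalgebraE(1)[OF EH']
 have S_alg: "K_algebra K S" unfolding S_def by (rule K_algebra_subalgebra[OF D.K_algebra_axioms EH'])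
 interpret S: K_algebra K S by (rule S_alg)
 have uc: "u \<in> carrier D" and uu: "u \<in> Units D" using V_carrier[OF g u(1)] u(2) unit by blast+
 have iu: "inv u \<in> V (inv\<^bsub>G\<^esub> g)" by (rule V_inv[OF g u])
 have iu0: "inv u \<noteq> \<zero>" using D.Units_inv_Units[OF uu] U by blast
 have iuc: "inv u \<in> carrier D" using uu by simp
 have uS: "u \<in> ES H'" by (rule ES_gen[OF H'c gH' u(1)])
 have iuS: "inv u \<in> ES H'" by (rule ES_gen[OF H'c subgroup.m_inv_closed[OF H' gH'] iu])
 have S_Units: "u \<in> Units S" and S_inv: "inv\<^bsub>S\<^esub> u = inv u"
  unfolding S_def by (rule ES_m_inv[OF H' uS iuS uu])+
 have S_nat_pow: "x [^]\<^bsub>S\<^esub> n = x [^] n" for x and n :: nat by (simp add: S_def)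
 have S_pow: "u [^]\<^bsub>S\<^esub> (k :: int) = u [^] k" for k unfolding int_pow_def2[of S u k] int_pow_def2[of D u k]
  by (simp only: S.inv_nat_pow[OF S_Units] D.inv_nat_pow[OF uu] S_inv, simp only: S_nat_pow)
 have EHc: "s \<in> carrier D" if "s \<in> ES H" for s using ES_carrier[OF Hc] that by blast
 have \<tau>H: "\<tau> a \<in> ES H" if "a \<in> ES H" for a unfolding \<tau>_def by (rule conj_ES[OF Hc g u that])
 have \<tau>'H: "inv u \<otimes> a \<otimes> u \<in> ES H" if "a \<in> ES H" for a using conj_ES[OF Hc _ iu iu0 that] g uu by simp
 have \<tau>_u: "u \<otimes> a = \<tau> a \<otimes> u" if "a \<in> carrier D" for a
  unfolding \<tau>_def using that uc iuc uu by (simp add: D.m_assoc)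
 have \<tau>\<tau>': "\<tau> (inv u \<otimes> a \<otimes> u) = a" if "a \<in> carrier D" for a
 proof - have "\<tau> (inv u \<otimes> a \<otimes> u) = (u \<otimes> inv u) \<otimes> a \<otimes> (u \<otimes> inv u)"
   unfolding \<tau>_def using that uc iuc by (simp add: D.m_assoc del: D.Units_r_inv)
  then show ?thesis using that uu by simp
 qed
 have \<tau>'\<tau>: "inv u \<otimes> \<tau> a \<otimes> u = a" if "a \<in> carrier D" for a
 proof - have "inv u \<otimes> \<tau> a \<otimes> u = (inv u \<otimes> u) \<otimes> a \<otimes> (inv u \<otimes> u)"
   unfolding \<tau>_def using that uc iuc by (simp add: D.m_assoc del: D.Units_l_inv)
  then show ?thesis using that uu by simp
 qed
 have inj: "inj_on \<tau> (ES H)"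
 proof (rule inj_onI) fix a b assume ab: "a \<in> ES H" "b \<in> ES H" "\<tau> a = \<tau> b"
  show "a = b" using \<tau>'\<tau>[OF EHc[OF ab(1)]] \<tau>'\<tau>[OF EHc[OF ab(2)]] unfolding ab(3) by (rule subst)
 qed
 have surj: "\<tau> ` ES H = ES H"
 proof show "\<tau> ` ES H \<subseteq> ES H" using \<tau>H by blast show "ES H \<subseteq> \<tau> ` ES H" proof fix a assume a: "a \<in> ES H"
   have "\<tau> (inv u \<otimes> a \<otimes> u) \<in> \<tau> ` ES H" by (rule imageI[OF \<tau>'H[OF a]])
   then show "a \<in> \<tau> ` ES H" unfolding \<tau>\<tau>'[OF EHc[OF a]] .
  qed
 qed
 have \<tau>_mult: "\<tau> (a \<otimes> b) = \<tau> a \<otimes> \<tau> b" if "a \<in> carrier D" "b \<in> carrier D" for a b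
 proof - have "\<tau> a \<otimes> \<tau> b = u \<otimes> a \<otimes> (inv u \<otimes> u) \<otimes> b \<otimes> inv u"
   unfolding \<tau>_def using that uc iuc by (simp add: D.m_assoc del: D.Units_l_inv)
  then show ?thesis unfolding \<tau>_def using that uc iuc uu by (simp add: D.m_assoc)
 qed
 have "skew_laurent_extension K S (ES H) u \<tau>" unfolding skew_laurent_extension_def
 proof (intro conjI ballI allI impI) show "K_algebra K S" by (rule S_alg)
  show "u \<in> Units S" by (rule S_Units)
  show "K_subalgebra K S (ES H)" unfolding K_subalgebra_def
  proof (intro conjI ballI) show "subring (ES H) S"
    unfolding S_def using D.subring_is_ring[OF SH] ES_mono[OF HH'] D.subring_is_ring[OF SH']
    by (intro ring.ring_incl_imp_subring) simp_all
   show "k \<odot>\<^bsub>S\<^esub> b \<in> ES H" if "k \<in> carrier K" "b \<in> ES H" for k b using K_subalgebraE(5)[OF EH that] by simp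
  qed
  show "\<tau> \<in> ring_iso (S\<lparr>carrier := ES H\<rparr>) (S\<lparr>carrier := ES H\<rparr>)"
  proof (rule ring_iso_memI) show "bij_betw \<tau> (carrier (S\<lparr>carrier := ES H\<rparr>)) (carrier (S\<lparr>carrier := ES H\<rparr>))"
    using inj surj by (simp add: bij_betw_def)
   show "\<tau> \<one>\<^bsub>S\<lparr>carrier := ES H\<rparr>\<^esub> = \<one>\<^bsub>S\<lparr>carrier := ES H\<rparr>\<^esub>" using uc uu by (simp add: \<tau>_def)
   fix a b assume ab: "a \<in> carrier (S\<lparr>carrier := ES H\<rparr>)" "b \<in> carrier (S\<lparr>carrier := ES H\<rparr>)"
   then have c: "a \<in> carrier D" "b \<in> carrier D" using EHc by simp_all
   show "\<tau> a \<in> carrier (S\<lparr>carrier := ES H\<rparr>)" using \<tau>H ab(1) by simp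
   show "\<tau> (a \<otimes>\<^bsub>S\<lparr>carrier := ES H\<rparr>\<^esub> b) = \<tau> a \<otimes>\<^bsub>S\<lparr>carrier := ES H\<rparr>\<^esub> \<tau> b" using \<tau>_mult[OF c] by simp
   show "\<tau> (a \<oplus>\<^bsub>S\<lparr>carrier := ES H\<rparr>\<^esub> b) = \<tau> a \<oplus>\<^bsub>S\<lparr>carrier := ES H\<rparr>\<^esub> \<tau> b"
    unfolding \<tau>_def using c uc iuc by (simp add: D.l_distr D.r_distr)
  qed
  fix a assume a: "a \<in> ES H"
  show "u \<otimes>\<^bsub>S\<^esub> a = \<tau> a \<otimes>\<^bsub>S\<^esub> u" using \<tau>_u[OF EHc[OF a]] by simp
  have "inv_into (ES H) \<tau> a = inv u \<otimes> a \<otimes> u" by (rule inv_into_f_eq[OF inj \<tau>'H[OF a] \<tau>\<tau>'[OF EHc[OF a]]])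
  then show "inv\<^bsub>S\<^esub> u \<otimes>\<^bsub>S\<^esub> a = inv_into (ES H) \<tau> a \<otimes>\<^bsub>S\<^esub> inv\<^bsub>S\<^esub> u"
   using EHc[OF a] uc iuc uu by (simp add: S_inv D.m_assoc)
 next fix C assume "subring C S \<and> insert u (insert (inv\<^bsub>S\<^esub> u) (ES H)) \<subseteq> C"
  then have C: "subring C S" "u \<in> C" "inv u \<in> C" "ES H \<subseteq> C" by (simp_all add: S_inv)
  note Cs = subringE[OF C(1), simplified]
  have nC: "x [^] n \<in> C" if "x \<in> C" for x and n :: nat
   by (induction n) (simp_all add: Cs(3) Cs(6)[OF _ that])
  have kC: "u [^] (k :: int) \<in> C" for k using nC[OF C(2)] nC[OF C(3)]
   by (subst int_pow_def2) (simp only: D.inv_nat_pow[OF uu] simp_thms split: if_split)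
  show "C = carrier S"
  proof show "C \<subseteq> carrier S" using Cs(1) by simp have "ES H' \<subseteq> C" proof (rule ES_least[OF H'c])
    fix l v assume lv: "l \<in> H'" "v \<in> V l"
    obtain h k where h: "h \<in> H" "l = h \<otimes>\<^bsub>G\<^esub> g [^]\<^bsub>G\<^esub> (k :: int)" using lv(1) unfolding H'_def by blast
    have gk: "g [^]\<^bsub>G\<^esub> k \<in> carrier G" using g by simp
    note vm = V_mult_inv[OF hc[OF h(1)] gk lv(2)[unfolded h(2)] int_pow_V[OF g u]]
    have "v \<otimes> inv (u [^] k) \<in> C" using ES_gen[OF Hc h(1) vm(1)] C(4) by blast
    then show "v \<in> C" by (subst vm(2)) (rule Cs(6)[OF _ kC])
   next show "\<zero> \<in> C" using Cs(2) . show "x \<oplus> y \<in> C" if "x \<in> C" "y \<in> C" for x y using Cs(7)[OF that] .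
   qed
   then show "carrier S \<subseteq> C" by simp
  qed
 next fix I :: "int set" and c i
  assume "finite I \<and> (\<forall>i\<in>I. c i \<in> ES H) \<and> (\<Oplus>\<^bsub>S\<^esub>i\<in>I. c i \<otimes>\<^bsub>S\<^esub> u [^]\<^bsub>S\<^esub> i) = \<zero>\<^bsub>S\<^esub>" and i: "i \<in> I"
  then have I: "finite I" "\<And>i. i \<in> I ==> c i \<in> ES H" "finsum S (\<lambda>i. c i \<otimes> u [^] i) I = \<zero>"
   by (simp_all add: S_pow)
  define F where "F k = (\<lambda>h. h \<otimes>\<^bsub>G\<^esub> g [^]\<^bsub>G\<^esub> k) ` H" for k :: int
  have Fc: "F k \<subseteq> H'" for k by (auto simp: F_def H'_def)
  have gk: "g [^]\<^bsub>G\<^esub> k \<in> carrier G" for k :: int using g by simp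
  have mem: "c k \<otimes> u [^] k \<in> ES (F k)" if "k \<in> I" for k
   unfolding F_def by (rule ES_shift[OF Hc gk I(2)[OF that] int_pow_V(1)[OF g u]])
  have disj: "F k \<inter> F k' = {}" if "k \<noteq> k'" for k k'
  proof (rule ccontr) assume "F k \<inter> F k' \<noteq> {}"
   then obtain h h' where h: "h \<in> H" "h' \<in> H" "h \<otimes>\<^bsub>G\<^esub> g [^]\<^bsub>G\<^esub> k = h' \<otimes>\<^bsub>G\<^esub> g [^]\<^bsub>G\<^esub> k'" by (auto simp: F_def)
   have "g [^]\<^bsub>G\<^esub> (k - k') = g [^]\<^bsub>G\<^esub> k \<otimes>\<^bsub>G\<^esub> inv\<^bsub>G\<^esub> (g [^]\<^bsub>G\<^esub> k')" using g by (simp add: int_pow_diff)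
   also have "g [^]\<^bsub>G\<^esub> k = inv\<^bsub>G\<^esub> h \<otimes>\<^bsub>G\<^esub> (h \<otimes>\<^bsub>G\<^esub> g [^]\<^bsub>G\<^esub> k)" using hc[OF h(1)] gk by (simp add: m_assoc[symmetric])
   also have "inv\<^bsub>G\<^esub> h \<otimes>\<^bsub>G\<^esub> (h \<otimes>\<^bsub>G\<^esub> g [^]\<^bsub>G\<^esub> k) \<otimes>\<^bsub>G\<^esub> inv\<^bsub>G\<^esub> (g [^]\<^bsub>G\<^esub> k') = inv\<^bsub>G\<^esub> h \<otimes>\<^bsub>G\<^esub> h'"
    unfolding h(3) using hc[OF h(1)] hc[OF h(2)] gk by (simp add: m_assoc)
   finally have "g [^]\<^bsub>G\<^esub> (k - k') \<in> H" using subgroup.m_closed[OF H subgroup.m_inv_closed[OF H h(1)] h(2)] by simp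
   then show False using indep that by force
  qed
  have "c k \<otimes> u [^] k \<in> ES H'" if "k \<in> I" for k using mem[OF that] ES_mono[OF Fc] by blast
  from D.finsum_subring[OF SH' this] have "finsum D (\<lambda>i. c i \<otimes> u [^] i) I = \<zero>"
   using I(3) unfolding S_def by (rule subst)
  then have "c i \<otimes> u [^] i = \<zero>"
   by (rule ES_family_independent[of I F, rotated -2]) (use I(1) Fc H'c disj mem i in auto)
  moreover have "u [^] i \<in> carrier D" using V_carrier[OF gk int_pow_V(1)[OF g u]] .
  ultimately show "c i = \<zero>\<^bsub>S\<^esub>" using D.division_cancel[OF U EHc[OF I(2)[OF i]]] int_pow_V(2)[OF g u] by auto
 qed
 then show ?thesis unfolding S_def H'_def \<tau>_def .
qed

text \<open>The basis elements of the degree group modulo torsion are adjoined one at a time, each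
  represented by a nonzero homogeneous element.\<close>

lemma iterated_skew_laurent_extension_ES:
 assumes "basis_mod_torsion G g r" and y: "\<And>i. i < r ==> y i \<in> V (g i)" "\<And>i. i < r ==> y i \<noteq> \<zero>"
 shows "iterated_skew_laurent_extension K (D\<lparr>carrier := ES (torsion_subgroup G)\<rparr>) r (\<lambda>a. a) y
  (\<lambda>i a. y i \<otimes> a \<otimes> inv (y i)) (D\<lparr>carrier := ES (carrier G)\<rparr>)"
proof - interpret b: basis_mod_torsion G g r by fact
 have gi: "g i \<in> carrier G" if "i < r" for i using b.gc that by auto
 \<comment> \<open>\<open>H i\<close> is the subgroup generated by the torsion subgroup and g 0,
   ..., g (i-1).\<close>
 define H where "H = rec_nat b.tors (\<lambda>i H. {h \<otimes>\<^bsub>G\<^esub> g i [^]\<^bsub>G\<^esub> (k :: int) | h k. h \<in> H})"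
 have H0: "H 0 = b.tors" and HS: "H (Suc i) = {h \<otimes>\<^bsub>G\<^esub> g i [^]\<^bsub>G\<^esub> (k :: int) | h k. h \<in> H i}" for i
  by (simp_all add: H_def)
 have H: "subgroup (H i) G" if "i \<le> r" for i using that
 proof (induction i) case 0 then show ?case using torsion_subgroup_subgroup by (simp add: H0)
 next case (Suc i) then have Hi: "subgroup (H i) G" and g: "g i \<in> carrier G" using gi by simp_all
  note Hc = subgroup.subset[OF Hi]
  have "generate G (H i) = H i"
   by (rule equalityI[OF generate_subgroup_incl[OF order_refl Hi]]) (auto intro: generate.incl)
  then have "H (Suc i) = generate G (insert (g i) (H i))" using generate_insert[OF Hc g] by (simp add: HS)
  then show ?case using generate_is_subgroup[of "insert (g i) (H i)"] Hc g by simp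
 qed
 have H_comb: "H i = {t \<otimes>\<^bsub>G\<^esub> int_comb g n {..<i} | t n. t \<in> b.tors}" if "i \<le> r" for i using that
 proof (induction i) case 0 have t: "t \<otimes>\<^bsub>G\<^esub> int_comb g n {} = t" if "t \<in> b.tors" for t n
   using b.tors_carrier[OF that] by (simp add: int_comb_def)
  show ?case
  proof (intro equalityI subsetI) fix h assume "h \<in> H 0"
   then have "h = h \<otimes>\<^bsub>G\<^esub> int_comb g (\<lambda>_. 0) {..<0}" "h \<in> b.tors" using t[of h] by (simp_all add: H0)
   then show "h \<in> {t \<otimes>\<^bsub>G\<^esub> int_comb g n {..<0} | t n. t \<in> b.tors}" by blast
  qed (auto simp: H0 t)
 next case (Suc i)
  have g': "g \<in> {..<i} \<rightarrow> carrier G" "g \<in> insert i {..<i} \<rightarrow> carrier G" using gi Suc.prems by auto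
  have step: "int_comb g n {..<Suc i} = g i [^]\<^bsub>G\<^esub> n i \<otimes>\<^bsub>G\<^esub> int_comb g n {..<i}" for n
   using int_comb_insert[of "{..<i}" i g n] g'(2) by (simp add: lessThan_Suc)
  have gic: "g i \<in> carrier G" using gi Suc.prems by simp
  show ?case
  proof (intro equalityI subsetI) fix h assume "h \<in> H (Suc i)"
   then obtain h' k where h: "h' \<in> H i" "h = h' \<otimes>\<^bsub>G\<^esub> g i [^]\<^bsub>G\<^esub> (k :: int)" unfolding HS by blast
   then obtain t n where t: "t \<in> b.tors" "h' = t \<otimes>\<^bsub>G\<^esub> int_comb g n {..<i}" using Suc by auto
   have "int_comb g (n(i := k)) {..<i} = int_comb g n {..<i}" by (rule int_comb_cong[OF g'(1)]) simp
   then have "h = t \<otimes>\<^bsub>G\<^esub> int_comb g (n(i := k)) {..<Suc i}"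
    unfolding h(2) t(2) step using b.tors_carrier[OF t(1)] gic g'(1) by (simp add: m_ac)
   then show "h \<in> {t \<otimes>\<^bsub>G\<^esub> int_comb g n {..<Suc i} | t n. t \<in> b.tors}" using t(1) by blast
  next fix h assume "h \<in> {t \<otimes>\<^bsub>G\<^esub> int_comb g n {..<Suc i} | t n. t \<in> b.tors}"
   then obtain t n where t: "t \<in> b.tors" "h = t \<otimes>\<^bsub>G\<^esub> int_comb g n {..<Suc i}" by blast
   have "h = (t \<otimes>\<^bsub>G\<^esub> int_comb g n {..<i}) \<otimes>\<^bsub>G\<^esub> g i [^]\<^bsub>G\<^esub> n i"
    unfolding t(2) step using b.tors_carrier[OF t(1)] gic g'(1) by (simp add: m_ac)
   then show "h \<in> H (Suc i)" unfolding HS using Suc t(1) by auto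
  qed
 qed
 have Hr: "H r = carrier G"
 proof show "H r \<subseteq> carrier G" by (rule subgroup.subset[OF H]) simp show "carrier G \<subseteq> H r" proof
   fix h assume "h \<in> carrier G"
   then obtain t n where "t \<in> b.tors" "h = t \<otimes>\<^bsub>G\<^esub> b.comb n" by (rule b.decomposition)
   then show "h \<in> H r" using H_comb[of r] by auto
  qed
 qed
 \<comment> \<open>If a multiple of g i lies in \<open>H i\<close>, subtracting the combination of
   the earlier generators leaves torsion, so all coefficients vanish, in particular k. The function
   \<open>m\<close> collects these coefficients and is zero beyond i.\<close>
 have indep: "k = 0" if i: "i < r" and k: "g i [^]\<^bsub>G\<^esub> (k :: int) \<in> H i" for i k
 proof -
  obtain t n where t: "t \<in> b.tors" "g i [^]\<^bsub>G\<^esub> k = t \<otimes>\<^bsub>G\<^esub> int_comb g n {..<i}" using k H_comb[of i] i by auto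
  define m where "m j = (if j = i then k else if j < i then - n j else 0)" for j
  have g': "g \<in> {..<i} \<rightarrow> carrier G" "g \<in> insert i {..<i} \<rightarrow> carrier G" using gi i by auto
  have "b.comb m = int_comb g m (insert i {..<i})" unfolding int_comb_def
   by (rule finprod_mono_neutral_cong_right) (use i gi in \<open>auto simp: m_def\<close>)
  also have "\<dots> = g i [^]\<^bsub>G\<^esub> m i \<otimes>\<^bsub>G\<^esub> int_comb g m {..<i}" by (rule int_comb_insert) (use g' in auto)
  also have "int_comb g m {..<i} = int_comb g (\<lambda>j. - n j) {..<i}"
   by (rule int_comb_cong[OF g'(1)]) (auto simp: m_def)
  also have "\<dots> = inv\<^bsub>G\<^esub> (int_comb g n {..<i})" by (rule int_comb_uminus[OF g'(1)])
  also have "g i [^]\<^bsub>G\<^esub> m i \<otimes>\<^bsub>G\<^esub> inv\<^bsub>G\<^esub> (int_comb g n {..<i}) = t"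
   using b.tors_carrier[OF t(1)] g'(1) by (simp add: m_def t(2) m_assoc)
  finally have "\<forall>i<r. m i = 0" using b.independent t(1) by simp
  then show "k = 0" using i by (auto simp: m_def)
 qed
 define L where "L = D\<lparr>carrier := ES (carrier G)\<rparr>"
 have sub: "K_subalgebra K D (ES (H i))" if "i \<le> r" for i by (rule ES_subgroup_subalgebra[OF H[OF that]])
 have L_alg: "K_algebra K L"
  unfolding L_def by (rule K_algebra_subalgebra[OF D.K_algebra_axioms]) (use sub[of r] Hr in simp)
 interpret L: K_algebra K L by (rule L_alg)
 have HL: "ES (H i) \<subseteq> ES (carrier G)" if "i \<le> r" for i by (rule ES_mono[OF subgroup.subset[OF H[OF that]]])
 have subL: "K_subalgebra K L (ES (H i))" if "i \<le> r" for i unfolding K_subalgebra_def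
 proof (intro conjI ballI) show "subring (ES (H i)) L"
   using D.subring_is_ring[OF K_subalgebraE(1)[OF sub[OF that]]] HL[OF that]
   by (intro L.ring_incl_imp_subring) (simp_all add: L_def)
  show "k \<odot>\<^bsub>L\<^esub> b \<in> ES (H i)" if "k \<in> carrier K" "b \<in> ES (H i)" for k b
   using K_subalgebraE(5)[OF sub[OF \<open>i \<le> r\<close>] that] by (simp add: L_def)
 qed
 have "iterated_skew_laurent_extension K (D\<lparr>carrier := ES b.tors\<rparr>) r (\<lambda>a. a) y
  (\<lambda>i a. y i \<otimes> a \<otimes> inv (y i)) L"
  unfolding iterated_skew_laurent_extension_def
 proof (intro conjI exI[of _ "\<lambda>i. ES (H i)"] allI impI) show "K_algebra K (D\<lparr>carrier := ES b.tors\<rparr>)"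
   using K_algebra_subalgebra[OF D.K_algebra_axioms sub[of 0]] by (simp add: H0)
  show "K_algebra K L" by (rule L_alg)
  have "ES b.tors \<subseteq> ES (carrier G)" using HL[of 0] by (simp add: H0)
  then show "(\<lambda>a. a) \<in> algebra_hom K (D\<lparr>carrier := ES b.tors\<rparr>) L"
   by (auto simp: algebra_hom_def ring_hom_def L_def)
  show "ES (H 0) = (\<lambda>a. a) ` carrier (D\<lparr>carrier := ES b.tors\<rparr>)" by (simp add: H0)
  show "ES (H r) = carrier L" by (simp add: Hr L_def)
  show "K_subalgebra K L (ES (H i))" if "i \<le> r" for i by (rule subL[OF that])
  show "skew_laurent_extension K (L\<lparr>carrier := ES (H (Suc i))\<rparr>) (ES (H i)) (y i)
    (\<lambda>a. y i \<otimes> a \<otimes> inv (y i))" if i: "i < r" for i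
  proof - have "subgroup (H i) G" using H i by simp
   from skew_laurent_extension_ES[OF this gi[OF i] indep[OF i] y(1)[OF i] y(2)[OF i]]
   show ?thesis by (simp add: HS L_def)
  qed
 qed simp
 then show ?thesis unfolding L_def .
qed

end

section \<open>Joint eigenspaces of commuting derivations or automorphisms\<close>

section \<open>Joint eigenvectors\<close>

lemma subgroup_comm_group: assumes "comm_group G" "subgroup H G" shows "comm_group (G\<lparr>carrier := H\<rparr>)"
proof - interpret G: comm_group G by fact
 interpret H: group "G\<lparr>carrier := H\<rparr>" by (rule G.subgroup_imp_group[OF assms(2)])
 show ?thesis by (rule H.group_comm_groupI) (use subgroup.mem_carrier[OF assms(2)] in \<open>simp add: G.m_comm\<close>)
qed

text \<open>Derivations and automorphisms enter only through the multiplicativity of eigenspaces and the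
 two possible formulas for \<open>d\<close> of a fraction.\<close>

locale joint_eigenvectors = D: K_algebra K D + comm_group G
 for K :: "'k ring" and D :: "('k, 'd) module" (structure) and G :: "(nat \<Rightarrow> 'k) monoid" +
 fixes t :: nat and d :: "nat \<Rightarrow> 'd \<Rightarrow> 'd"
 assumes U: "Units D = carrier D - {\<zero>}" and d_closed: "i < t ==> u \<in> carrier D ==> d i u \<in> carrier D"
  and d_add: "i < t ==> u \<in> carrier D ==> v \<in> carrier D ==> d i (u \<oplus> v) = d i u \<oplus> d i v"
  and d_smult: "i < t ==> k \<in> carrier K ==> u \<in> carrier D ==> d i (k \<odot> u) = k \<odot> d i u"
  and tuple_closed: "l \<in> carrier G ==> i < t ==> l i \<in> carrier K"
  and tuple_ext: "l \<in> carrier G ==> m \<in> carrier G ==> (\<And>i. i < t ==> l i = m i) ==> l = m"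
  and V_one: "\<one> \<in> eigenspace D t d (carrier D) \<one>\<^bsub>G\<^esub>"
  and V_mult: "l \<in> carrier G ==> m \<in> carrier G ==> u \<in> eigenspace D t d (carrier D) l ==>
   v \<in> eigenspace D t d (carrier D) m ==> u \<otimes> v \<in> eigenspace D t d (carrier D) (l \<otimes>\<^bsub>G\<^esub> m)"
  and V_inv: "l \<in> carrier G ==> u \<in> eigenspace D t d (carrier D) l ==> u \<noteq> \<zero> ==>
   inv u \<in> eigenspace D t d (carrier D) (inv\<^bsub>G\<^esub> l)"
  and d_fraction: "i < t ==> s \<in> carrier D ==> s \<noteq> \<zero> ==> b \<in> carrier D ==>
   (d i s \<noteq> \<zero> \<and> d i (inv s \<otimes> b) = inv (d i s) \<otimes> d i b) \<or>
   d i (inv s \<otimes> b) = inv s \<otimes> (d i b \<oplus> \<ominus> (d i s \<otimes> (inv s \<otimes> b)))"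
begin

abbreviation "V \<equiv> eigenspace D t d (carrier D)"
abbreviation "Ev \<equiv> eigenvalues G D t d (carrier D)"
abbreviation "EvG \<equiv> G\<lparr>carrier := Ev\<rparr>"

lemma V_carrier: "u \<in> V l ==> u \<in> carrier D" by (simp add: eigenspace_def)

lemma d_eigen: "u \<in> V l ==> i < t ==> d i u = l i \<odot> u" by (simp add: eigenspace_def)

lemma d_zero: assumes "i < t" shows "d i \<zero> = \<zero>"
proof - have "d i \<zero> \<oplus> d i \<zero> = d i \<zero>" using d_add[OF assms D.zero_closed D.zero_closed] by simp
 then show ?thesis using d_closed[OF assms D.zero_closed] by simp
qed

lemma V_zero: "l \<in> carrier G ==> \<zero> \<in> V l" using tuple_closed by (simp add: eigenspace_def d_zero D.smult_r_null)

lemma V_add: "l \<in> carrier G ==> u \<in> V l ==> v \<in> V l ==> u \<oplus> v \<in> V l"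
 using tuple_closed by (simp add: eigenspace_def d_add D.smult_r_distr)

lemma V_smult: assumes "l \<in> carrier G" "k \<in> carrier K" "u \<in> V l" shows "k \<odot> u \<in> V l"
proof - have u: "u \<in> carrier D" by (rule V_carrier[OF assms(3)])
 have "d i (k \<odot> u) = l i \<odot> (k \<odot> u)" if i: "i < t" for i
  using d_smult[OF i assms(2) u] d_eigen[OF assms(3) i] tuple_closed[OF assms(1) i] assms(2) u
  by (simp add: D.smult_assoc1[symmetric] D.R.m_comm)
 then show ?thesis using u assms(2) by (simp add: eigenspace_def)
qed

lemma smult_eq_zero: assumes "c \<in> carrier K" "c \<noteq> \<zero>\<^bsub>K\<^esub>" "u \<in> carrier D" "c \<odot> u = \<zero>" shows "u = \<zero>"
proof - have c: "c \<in> Units K" using field.field_Units[OF D.K_field] assms(1,2) by simp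
 have "u = (inv\<^bsub>K\<^esub> c \<otimes>\<^bsub>K\<^esub> c) \<odot> u" using c assms(3) by simp
 also have "\<dots> = inv\<^bsub>K\<^esub> c \<odot> (c \<odot> u)" by (rule D.smult_assoc1) (use c assms in simp_all)
 also have "\<dots> = \<zero>" unfolding assms(4) using c by (simp add: D.smult_r_null)
 finally show ?thesis .
qed

text \<open>Applying \<open>d\<^sub>i - m\<^sub>i\<close> to a relation removes the term with eigenvalue \<open>m\<close>.\<close>

lemma V_independent: assumes "finite S" "S \<subseteq> carrier G" "\<And>l. l \<in> S ==> f l \<in> V l" "(\<Oplus>l\<in>S. f l) = \<zero>" "l \<in> S"
 shows "f l = \<zero>"
 using assms
proof (induction S arbitrary: f l rule: finite_induct) case (insert m S)
 have fc: "f k \<in> carrier D" if "k \<in> insert m S" for k by (rule V_carrier[OF insert.prems(2)[OF that]])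
 have m: "m \<in> carrier G" and S: "S \<subseteq> carrier G" using insert.prems(1) by auto
 have zero: "f k = \<zero>" if k: "k \<in> S" for k
 proof - have "k \<noteq> m" using k insert.hyps(2) by blast
  then obtain i where i: "i < t" "k i \<noteq> m i" using tuple_ext[of k m] k S m by blast
  have mi: "m i \<in> carrier K" by (rule tuple_closed[OF m i(1)])
  have tc: "j i \<in> carrier K" if "j \<in> insert m S" for j
   using tuple_closed[OF _ i(1), of j] that insert.prems(1) by blast
  define q where "q z = d i z \<oplus> \<ominus> (m i \<odot> z)" for z
  have q_closed: "q z \<in> carrier D" if "z \<in> carrier D" for z
   using that d_closed[OF i(1) that] mi by (simp add: q_def)
  have q_add: "q (z \<oplus> w) = q z \<oplus> q w" if "z \<in> carrier D" "w \<in> carrier D" for z w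
   unfolding q_def using that d_closed[OF i(1)] mi
   by (simp add: d_add[OF i(1)] D.smult_r_distr D.minus_add D.a_ac)
  have q_zero: "q \<zero> = \<zero>" unfolding q_def using mi by (simp add: d_zero[OF i(1)] D.smult_r_null)
  have q_f: "q (f j) = (j i \<oplus>\<^bsub>K\<^esub> \<ominus>\<^bsub>K\<^esub> m i) \<odot> f j" if j: "j \<in> insert m S" for j
   using d_eigen[OF insert.prems(2)[OF j] i(1)] fc[OF j] tc[OF j] mi
   by (simp add: q_def D.smult_l_distr D.smult_l_minus)
  have q_sum: "q (\<Oplus>j\<in>S'. f j) = (\<Oplus>j\<in>S'. q (f j))" if "finite S'" "S' \<subseteq> insert m S" for S' using that
  proof (induction S' rule: finite_induct) case empty then show ?case using q_zero by simp
  next case (insert j S') have c: "f \<in> S' \<rightarrow> carrier D" "f j \<in> carrier D" using insert.prems fc by auto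
   then have c': "(\<lambda>j. q (f j)) \<in> S' \<rightarrow> carrier D" "q (f j) \<in> carrier D" using q_closed by auto
   have "q (\<Oplus>j\<in>insert j S'. f j) = q (f j) \<oplus> q (\<Oplus>j\<in>S'. f j)"
    using D.finsum_insert[of S' j f, OF insert.hyps c] q_add[OF c(2) D.finsum_closed[OF c(1)]] by simp
   then show ?case using D.finsum_insert[of S' j "\<lambda>j. q (f j)", OF insert.hyps c'] insert.IH insert.prems by simp
  qed
  have "(\<Oplus>j\<in>insert m S. q (f j)) = \<zero>"
   using q_sum[OF _ order_refl] insert.hyps(1) insert.prems(3) q_zero by simp
  moreover have "(\<Oplus>j\<in>insert m S. q (f j)) = q (f m) \<oplus> (\<Oplus>j\<in>S. q (f j))"
   by (rule D.finsum_insert[OF insert.hyps]) (use fc q_closed in auto)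
  moreover have "q (f m) = \<zero>" using q_f[of m] fc[of m] mi by (simp add: D.R.r_neg D.smult_l_null)
  moreover have "(\<Oplus>j\<in>S. q (f j)) \<in> carrier D" using fc q_closed by (intro D.finsum_closed) auto
  ultimately have sum: "(\<Oplus>j\<in>S. q (f j)) = \<zero>" by simp
  have "q (f k) = \<zero>"
  proof (rule insert.IH[OF S _ sum k]) fix j assume j: "j \<in> S"
   have "j i \<oplus>\<^bsub>K\<^esub> \<ominus>\<^bsub>K\<^esub> m i \<in> carrier K" using tc[of j] j mi by simp
   then show "q (f j) \<in> V j" using q_f[of j] V_smult[of j _ "f j"] insert.prems(2)[of j] j S by auto
  qed
  then have "(k i \<oplus>\<^bsub>K\<^esub> \<ominus>\<^bsub>K\<^esub> m i) \<odot> f k = \<zero>" using q_f[of k] k by simp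
  moreover have "k i \<oplus>\<^bsub>K\<^esub> \<ominus>\<^bsub>K\<^esub> m i \<noteq> \<zero>\<^bsub>K\<^esub>"
   using D.R.a_eq_if_minus_zero[of "k i" "m i"] i(2) tc[of k] k mi by blast
  ultimately show ?thesis using smult_eq_zero[of "k i \<oplus>\<^bsub>K\<^esub> \<ominus>\<^bsub>K\<^esub> m i" "f k"] tc[of k] k mi fc[of k] by simp
 qed
 have "(\<Oplus>j\<in>insert m S. f j) = f m \<oplus> (\<Oplus>j\<in>S. f j)" by (rule D.finsum_insert[OF insert.hyps]) (use fc in auto)
 moreover have "(\<Oplus>j\<in>S. f j) = (\<Oplus>j\<in>S. \<zero>)" by (rule D.finsum_cong') (use zero in auto)
 ultimately have "f m = \<zero>" using insert.prems(3) fc[of m] by simp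
 then show ?case using zero insert.prems(4) by blast
qed simp

lemma Ev_iff: "l \<in> Ev \<longleftrightarrow> l \<in> carrier G \<and> (\<exists>u\<in>V l. u \<noteq> \<zero>)" by (simp add: eigenvalues_def)

lemma Ev_subgroup: "subgroup Ev G"
proof (rule subgroupI) show "Ev \<subseteq> carrier G" by (auto simp: Ev_iff)
 have "\<one> \<noteq> \<zero>" using D.Units_one_closed U by blast
 then have "\<one>\<^bsub>G\<^esub> \<in> Ev" unfolding Ev_iff using V_one by blast
 then show "Ev \<noteq> {}" by blast
 show "inv\<^bsub>G\<^esub> l \<in> Ev" if l: "l \<in> Ev" for l
 proof - obtain u where u: "l \<in> carrier G" "u \<in> V l" "u \<noteq> \<zero>" using l unfolding Ev_iff by blast
  have "u \<in> Units D" using V_carrier[OF u(2)] u(3) U by blast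
  then have "inv u \<noteq> \<zero>" using D.Units_inv_Units U by blast
  then show ?thesis unfolding Ev_iff using V_inv[OF u] u(1) by blast
 qed
 show "l \<otimes>\<^bsub>G\<^esub> m \<in> Ev" if lm: "l \<in> Ev" "m \<in> Ev" for l m
 proof - obtain u where u: "l \<in> carrier G" "u \<in> V l" "u \<noteq> \<zero>" using lm(1) unfolding Ev_iff by blast
  obtain v where v: "m \<in> carrier G" "v \<in> V m" "v \<noteq> \<zero>" using lm(2) unfolding Ev_iff by blast
  have "u \<otimes> v \<noteq> \<zero>" using D.division_cancel[OF U V_carrier[OF u(2)] V_carrier[OF v(2)]] u(3) v(3) by blast
  then show ?thesis unfolding Ev_iff using V_mult[OF u(1) v(1) u(2) v(2)] u(1) v(1) by blast
 qed
qed

lemma graded_division_Ev: "graded_division K D EvG V"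
proof (intro graded_division.intro graded_division_axioms.intro)
 have c: "l \<in> carrier G" if "l \<in> carrier EvG" for l using that subgroup.subset[OF Ev_subgroup] by auto
 show "K_algebra K D" by (rule D.K_algebra_axioms)
 show "comm_group EvG" by (rule subgroup_comm_group[OF comm_group_axioms Ev_subgroup])
 show "Units D = carrier D - {\<zero>}" by (rule U)
 show "u \<in> carrier D" if "u \<in> V l" for l u by (rule V_carrier[OF that])
 show "\<zero> \<in> V l" if "l \<in> carrier EvG" for l by (rule V_zero[OF c[OF that]])
 show "u \<oplus> v \<in> V l" if "l \<in> carrier EvG" "u \<in> V l" "v \<in> V l" for l u v by (rule V_add[OF c[OF that(1)] that(2,3)])
 show "k \<odot> u \<in> V l" if "l \<in> carrier EvG" "k \<in> carrier K" "u \<in> V l" for l k u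
  by (rule V_smult[OF c[OF that(1)] that(2,3)])
 show "\<one> \<in> V \<one>\<^bsub>EvG\<^esub>" using V_one by simp
 show "u \<otimes> v \<in> V (l \<otimes>\<^bsub>EvG\<^esub> m)" if "l \<in> carrier EvG" "m \<in> carrier EvG" "u \<in> V l" "v \<in> V m" for l m u v
  using V_mult[OF c[OF that(1)] c[OF that(2)] that(3,4)] by simp
 show "inv u \<in> V (inv\<^bsub>EvG\<^esub> l)" if "l \<in> carrier EvG" "u \<in> V l" "u \<noteq> \<zero>" for l u
  using V_inv[OF c[OF that(1)] that(2,3)] m_inv_consistent[OF Ev_subgroup, of l] that(1) by simp
 show "\<exists>u\<in>V l. u \<noteq> \<zero>" if "l \<in> carrier EvG" for l using that by (simp add: Ev_iff)
 show "f l = \<zero>" if "finite S" "S \<subseteq> carrier EvG" "\<And>l. l \<in> S ==> f l \<in> V l" "(\<Oplus>l\<in>S. f l) = \<zero>" "l \<in> S" for S f l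
  by (rule V_independent[of S]) (use that c in auto)
qed

lemma eigen_sum_homogeneous_sums: "eigen_sum D t d F = homogeneous_sums D V F"
 by (simp add: eigen_sum_def homogeneous_sums_def)

lemma d_eigen_sum: assumes F: "F \<subseteq> Ev" and i: "i < t" and z: "z \<in> eigen_sum D t d F"
 shows "d i z \<in> eigen_sum D t d F"
proof - interpret g: graded_division K D EvG V by (rule graded_division_Ev)
 have Fc: "F \<subseteq> carrier EvG" using F by simp
 have "z \<in> g.ES F" using z by (simp add: eigen_sum_homogeneous_sums)
 with Fc have "d i z \<in> g.ES F"
 proof (induction z rule: g.ES_induct) case (gen l v)
  then have l: "l \<in> carrier G" using F unfolding eigenvalues_def by blast
  show ?case unfolding d_eigen[OF gen(2) i]
   by (rule g.ES_gen[OF Fc gen(1) V_smult[OF l tuple_closed[OF l i] gen(2)]])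
 qed (use d_zero[OF i] d_add[OF i] g.ES_zero g.ES_add[OF Fc] in simp_all)
 then show ?thesis by (simp add: eigen_sum_homogeneous_sums)
qed

text \<open>Both alternatives of \<open>d_fraction\<close> compute the image of a fraction by ring
  operations and inverses from s, b and their images, all of which lie in the division subalgebra
  Q.\<close>

lemma d_frac_in: assumes B: "B \<subseteq> carrier D" "B \<subseteq> Q" and Q: "division_subalgebra K D Q" and i: "i < t"
  and dB: "\<And>b. b \<in> B ==> d i b \<in> B" and q: "q \<in> frac_in D B"
 shows "d i q \<in> Q"
proof - note Qs = division_subalgebraE[OF Q] note Qr = subringE[OF Qs(2)]
 have invQ: "inv s \<in> Q" if s: "s \<in> Q" "s \<noteq> \<zero>" for s
 proof - obtain e where e: "e \<in> Q" "e \<otimes> s = \<one>" "s \<otimes> e = \<one>" using Qs(4)[OF s] by blast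
  have "e \<in> carrier D" "s \<in> carrier D" using e(1) s(1) Qr(1) by blast+
  then have "inv s = e" using e(2,3) by (intro D.inv_char)
  then show ?thesis using e(1) by simp
 qed
 obtain s b where s: "s \<in> B" "s \<noteq> \<zero>" "b \<in> B" "q = inv s \<otimes> b" using q unfolding frac_in_def by blast
 have mem: "s \<in> Q" "b \<in> Q" "d i s \<in> Q" "d i b \<in> Q" using s dB B(2) by blast+
 have is_mem: "inv s \<in> Q" by (rule invQ[OF mem(1) s(2)])
 have c: "s \<in> carrier D" "b \<in> carrier D" using s(1,3) B(1) by blast+
 consider "d i s \<noteq> \<zero>" "d i q = inv (d i s) \<otimes> d i b"
  | "d i q = inv s \<otimes> (d i b \<oplus> \<ominus> (d i s \<otimes> (inv s \<otimes> b)))"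
  using d_fraction[OF i c(1) s(2) c(2)] unfolding s(4) by blast
 then show ?thesis
 proof cases case 1 show ?thesis unfolding 1(2) by (rule Qr(6)[OF invQ[OF mem(3) 1(1)] mem(4)])
 next case 2
  show ?thesis unfolding 2 by (rule Qr(6)[OF is_mem Qr(7)[OF mem(4) Qr(5)[OF Qr(6)[OF mem(3) Qr(6)[OF is_mem mem(2)]]]]])
 qed
qed

text \<open>The chain condition makes every subgroup of the eigenvalue group finitely generated.
  Hence the eigenspace sum over any subgroup is Noetherian, the torsion subgroup is finite and a
  basis modulo torsion exists; everything else is read off from the grading.\<close>

theorem eigenvalues_and_eigen_algebra:
 assumes acc: "\<And>E :: nat \<Rightarrow> 'd set. (\<And>i. division_subalgebra K D (E i)) ==> (\<And>i. E i \<subseteq> E (Suc i)) ==>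
   \<exists>N. \<forall>i\<ge>N. E i = E N"
 shows "let Ev = eigenvalues G D t d (carrier D);
       EvG = G\<lparr>carrier := Ev\<rparr>;
       T = torsion_subgroup EvG;
       D0 = eigenspace D t d (carrier D) \<one>\<^bsub>G\<^esub>;
       DT = eigen_sum D t d T
     in subgroup Ev G \<and> comm_group EvG \<and> finitely_generated_group EvG \<and> subgroup T EvG \<and> finite T \<and>
      (\<exists>r. has_rank EvG r \<and>
        EvG \<cong> (EvG\<lparr>carrier := T\<rparr>) \<times>\<times> product_group {..<r} (\<lambda>_. integer_group) \<and>
        (\<exists>(L :: ('k, 'd) module) \<kappa> y \<tau>.
         iterated_skew_laurent_extension K (D\<lparr>carrier := DT\<rparr>) r \<kappa> y \<tau> L \<and>
         algebra_iso K (D\<lparr>carrier := eigen_sum D t d Ev\<rparr>) L \<noteq> {})) \<and>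
      eigenspaces_independent D t d Ev \<and>
      nc_noetherian_domain (D\<lparr>carrier := eigen_sum D t d Ev\<rparr>) \<and>
      division_subalgebra K D D0 \<and>
      division_subalgebra K D DT \<and>
      ring.dimension D (card T) D0 DT \<and>
      ring.dimension (opposite D) (card T) D0 DT \<and>
      (\<forall>F. subgroup F EvG \<longrightarrow>
        (let B = eigen_sum D t d F; Q = frac_in D B in
         K_subalgebra K D B \<and>
         nc_noetherian_domain (D\<lparr>carrier := B\<rparr>) \<and>
         division_subalgebra K D Q \<and>
         quotient_division_algebra K (D\<lparr>carrier := B\<rparr>) (\<lambda>b. b) (D\<lparr>carrier := Q\<rparr>) \<and>
         (\<forall>i<t. d i ` Q \<subseteq> Q) \<and>
         eigenvalues G D t d Q = F \<and>
         (\<forall>l\<in>F. \<forall>v\<in>eigenspace D t d Q l. v \<noteq> \<zero> \<longrightarrow>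
           (\<exists>m\<in>F. \<exists>u\<in>eigenspace D t d (carrier D) m. \<exists>w\<in>eigenspace D t d (carrier D) (l \<otimes>\<^bsub>G\<^esub> m).
            u \<noteq> \<zero> \<and> v = inv u \<otimes> w))))"
proof - interpret g: graded_division K D EvG V by (rule graded_division_Ev) let ?T = "torsion_subgroup EvG"
 note ES = eigen_sum_homogeneous_sums
 have fg: "\<exists>Z. finite Z \<and> Z \<subseteq> F \<and> generate EvG Z = F" if "subgroup F EvG" for F
 proof (rule g.subgroup_finitely_generated[OF _ that]) fix E :: "nat \<Rightarrow> 'd set"
  assume "\<And>i. division_subalgebra K D (E i)" "\<And>i. E i \<subseteq> E (Suc i)"
  then show "\<exists>N. \<forall>i\<ge>N. E i = E N" by (rule acc)
 qed
 have noeth: "nc_noetherian_domain (D\<lparr>carrier := eigen_sum D t d F\<rparr>)" if F: "subgroup F EvG" for F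
 proof - obtain Z where Z: "finite Z" "Z \<subseteq> F" "generate EvG Z = F" using fg[OF F] by blast
  have "Z \<subseteq> carrier EvG" using Z(2) subgroup.subset[OF F] by blast
  then show ?thesis using g.nc_noetherian_domain_ES[OF Z(1)] unfolding ES Z(3) by blast
 qed
 have top: "subgroup (carrier EvG) EvG" by (rule g.subgroup_self)
 have T: "subgroup ?T EvG" by (rule g.torsion_subgroup_subgroup)
 have Tfin: "finite ?T"
 proof - obtain Z where Z: "finite Z" "Z \<subseteq> ?T" "generate EvG Z = ?T" using fg[OF T] by blast
  show ?thesis using g.finite_generate_torsion[OF Z(1,2)] unfolding Z(3) .
 qed
 obtain Z where Z: "finite Z" "Z \<subseteq> carrier EvG" "generate EvG Z = carrier EvG" using fg[OF top] by blast
 obtain r :: nat and h where h: "g.spans_mod_torsion h {..<r}"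
   "\<And>n. g.int_comb h n {..<r} \<in> ?T ==> \<forall>i<r. n i = 0"
 proof (rule g.finitely_generated_basis[OF Z]) fix r :: nat and h
  assume "g.spans_mod_torsion h {..<r}" "\<And>n. g.int_comb h n {..<r} \<in> ?T ==> \<forall>i<r. n i = 0"
  then show thesis by (rule that)
 qed
 have basis: "basis_mod_torsion EvG h r"
  using h g.comm_group_axioms by (simp add: basis_mod_torsion_def basis_mod_torsion_axioms_def)
 have "\<exists>y. \<forall>i<r. y i \<in> V (h i) \<and> y i \<noteq> \<zero>"
 proof - have "\<exists>u. u \<in> V (h i) \<and> u \<noteq> \<zero>" if "i < r" for i proof -
   have "h i \<in> carrier EvG" using basis_mod_torsion.gc[OF basis] that by (simp add: Pi_iff)
   then show ?thesis using g.V_nonzero by blast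
  qed
  then show ?thesis by metis
 qed
 then obtain y where y: "\<And>i. i < r ==> y i \<in> V (h i)" "\<And>i. i < r ==> y i \<noteq> \<zero>" by blast
 \<comment> \<open>The eigen-algebra itself is the iterated Laurent extension, so the required
   isomorphism is the identity.\<close>
 let ?L = "D\<lparr>carrier := eigen_sum D t d Ev\<rparr>"
 have laurent: "iterated_skew_laurent_extension K (D\<lparr>carrier := eigen_sum D t d ?T\<rparr>) r (\<lambda>a. a) y
   (\<lambda>i a. y i \<otimes> a \<otimes> inv (y i)) ?L"
  using g.iterated_skew_laurent_extension_ES[OF basis y] by (simp add: ES)
 have "(\<lambda>a. a) \<in> algebra_iso K ?L ?L"
  by (auto simp: algebra_iso_def algebra_hom_def ring_hom_def bij_betw_def)
 then have iso: "algebra_iso K ?L ?L \<noteq> {}" by blast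
 have rank: "\<exists>r. has_rank EvG r \<and>
   EvG \<cong> (EvG\<lparr>carrier := ?T\<rparr>) \<times>\<times> product_group {..<r} (\<lambda>_. integer_group) \<and>
   (\<exists>(L :: ('k, 'd) module) \<kappa> y \<tau>.
    iterated_skew_laurent_extension K (D\<lparr>carrier := eigen_sum D t d ?T\<rparr>) r \<kappa> y \<tau> L \<and>
    algebra_iso K ?L L \<noteq> {})"
  using basis_mod_torsion.rank[OF basis] basis_mod_torsion.structure_iso[OF basis] laurent iso by blast
 have fgg: "finitely_generated_group EvG"
  unfolding finitely_generated_group_def using g.group_axioms Z by blast
 have indep: "eigenspaces_independent D t d Ev" unfolding eigenspaces_independent_def
 proof (intro allI impI ballI) fix S u l
  assume "finite S \<and> S \<subseteq> Ev \<and> (\<forall>l\<in>S. u l \<in> V l) \<and> (\<Oplus>l\<in>S. u l) = \<zero>" "l \<in> S"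
  then show "u l = \<zero>" using g.V_independent[of S u l] by simp
 qed
 have D0: "division_subalgebra K D (V \<one>\<^bsub>G\<^esub>)" using g.V_one_division by simp
 have DT: "division_subalgebra K D (eigen_sum D t d ?T)" unfolding ES by (rule g.ES_finite_division[OF T Tfin])
 have dim: "ring.dimension D (card ?T) (V \<one>\<^bsub>G\<^esub>) (eigen_sum D t d ?T)"
  using g.dimension_ES[OF Tfin subgroup.subset[OF T]] by (simp add: ES)
 have op_dim: "ring.dimension (opposite D) (card ?T) (V \<one>\<^bsub>G\<^esub>) (eigen_sum D t d ?T)"
  using graded_division.dimension_ES[OF g.opposite_graded_division Tfin subgroup.subset[OF T]]
  by (simp add: ES g.opposite_ES)
 have sub: "K_subalgebra K D (eigen_sum D t d F)" if "subgroup F EvG" for F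
  unfolding ES by (rule g.ES_subgroup_subalgebra[OF that])
 let ?Q = "\<lambda>F. frac_in D (eigen_sum D t d F)"
 have FE: "F \<subseteq> carrier EvG" and F1: "\<one>\<^bsub>G\<^esub> \<in> F" and sd: "noetherian_subdomain K D (eigen_sum D t d F)"
  if F: "subgroup F EvG" for F
  using subgroup.subset[OF F] subgroup.one_closed[OF F] g.noetherian_subdomain_ES[OF F] noeth[OF F]
  unfolding ES by simp_all
 note Qd = noetherian_subdomain.Q_division_subalgebra[OF sd] and Qq = noetherian_subdomain.Q_quotient[OF sd]
 have Qc: "q \<in> carrier D" if "subgroup F EvG" "q \<in> ?Q F" for F q
  using that(2) noetherian_subdomain.mem_Q_left[OF sd[OF that(1)]] by blast
 have Qinv: "d i ` ?Q F \<subseteq> ?Q F" if F: "subgroup F EvG" and i: "i < t" for F i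
 proof (rule image_subsetI) fix q assume q: "q \<in> ?Q F"
  have "d i b \<in> eigen_sum D t d F" if "b \<in> eigen_sum D t d F" for b using d_eigen_sum[OF _ i that] FE[OF F] by simp
  then show "d i q \<in> ?Q F" using d_frac_in[OF _ noetherian_subdomain.B_subset_Q[OF sd[OF F]] Qd[OF F] i _ q]
    noetherian_subdomain.B_carrier[OF sd[OF F]] by blast
 qed
 have Qev: "eigenvalues G D t d (?Q F) = F" if F: "subgroup F EvG" for F
 proof (intro equalityI subsetI) fix l assume "l \<in> eigenvalues G D t d (?Q F)"
  then obtain u where u: "l \<in> carrier G" "u \<in> ?Q F" "u \<noteq> \<zero>" "\<forall>i<t. d i u = l i \<odot> u"
   by (auto simp: eigenvalues_def eigenspace_def)
  have uV: "u \<in> V l" using u(4) Qc[OF F u(2)] by (simp add: eigenspace_def)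
  then have "l \<in> carrier EvG" using u(1,3) by (auto simp: Ev_iff)
  then show "l \<in> F" using g.homogeneous_fraction[OF F noeth[OF F, unfolded ES] _ uV u(2)[unfolded ES] u(3)] by blast
 next fix l assume l: "l \<in> F" have lE: "l \<in> carrier EvG" using l FE[OF F] by blast
  then obtain u where u: "u \<in> V l" "u \<noteq> \<zero>" using g.V_nonzero by blast
  have "u \<in> ?Q F" using g.V_subset_frac[OF FE[OF F] _ l] F1[OF F] u(1) unfolding ES by auto
  then have "u \<in> eigenspace D t d (?Q F) l" using u(1) by (simp add: eigenspace_def)
  moreover have "l \<in> carrier G" using lE by (simp add: Ev_iff)
  ultimately show "l \<in> eigenvalues G D t d (?Q F)" using u(2) unfolding eigenvalues_def by blast
 qed
 \<comment> \<open>An eigenvector in the quotient division algebra is already homogeneous in D, so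
   the denominator u = 1 of neutral degree and the numerator w = v suffice.\<close>
 have Qvec: "\<exists>m\<in>F. \<exists>u\<in>V m. \<exists>w\<in>V (l \<otimes>\<^bsub>G\<^esub> m). u \<noteq> \<zero> \<and> v = inv u \<otimes> w"
  if F: "subgroup F EvG" and "l \<in> F" "v \<in> eigenspace D t d (?Q F) l" for F l v
 proof (intro bexI conjI) have l: "l \<in> carrier G" using that(2) FE[OF F] by (auto simp: Ev_iff)
  have v: "v \<in> V l" using that(3) Qc[OF F] by (simp add: eigenspace_def)
  show "v = inv \<one> \<otimes> v" using V_carrier[OF v] by simp
  show "v \<in> V (l \<otimes>\<^bsub>G\<^esub> \<one>\<^bsub>G\<^esub>)" using v l by simp
 qed (rule g.one_not_zero V_one F1[OF F])+
 have noeth_Ev: "nc_noetherian_domain ?L" using noeth[OF top] by simp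
 show ?thesis unfolding Let_def
  by (intro conjI allI impI ballI; (fact Ev_subgroup g.comm_group_axioms fgg T Tfin rank indep noeth_Ev D0 DT dim op_dim
    | erule sub noeth Qd Qq Qev | rule Qinv Qvec; assumption))
qed

end

text \<open>Differentiate the product of s^(-1) and s, which is 1.\<close>

lemma skew_derivation_inverse: fixes K :: "'k ring" and D :: "('k, 'd) module" (structure)
 assumes D: "K_algebra K D" and dv: "skew_derivation K D (\<lambda>u. u) \<delta>" and s: "s \<in> Units D"
 shows "\<delta> (inv s) = \<ominus> (inv s \<otimes> \<delta> s \<otimes> inv s)"
proof - interpret D: K_algebra K D by fact
 have \<delta>: "\<delta> a \<in> carrier D" if "a \<in> carrier D" for a using dv that by (auto simp: skew_derivation_def)
 have mult: "\<delta> (a \<otimes> b) = \<delta> a \<otimes> b \<oplus> a \<otimes> \<delta> b" if "a \<in> carrier D" "b \<in> carrier D" for a b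
  using dv that by (simp add: skew_derivation_def)
 have c: "s \<in> carrier D" "inv s \<in> carrier D" using s by (auto dest: D.Units_closed)
 have one: "\<delta> \<one> = \<zero>" using mult[OF D.one_closed D.one_closed] \<delta>[OF D.one_closed] by simp
 define a where "a = \<delta> (inv s)"
 have ac: "a \<in> carrier D" "\<delta> s \<in> carrier D" using \<delta> c by (simp_all add: a_def)
 have 0: "a \<otimes> s \<oplus> inv s \<otimes> \<delta> s = \<zero>" using mult[OF c(2,1)] s one by (simp add: a_def)
 have a_s: "\<ominus> (inv s \<otimes> \<delta> s) = a \<otimes> s" by (rule D.minus_equality[OF 0]) (use ac c in simp_all)
 have "a = (a \<otimes> s) \<otimes> inv s" using ac(1) c s by (simp add: D.m_assoc)
 also have "\<dots> = \<ominus> (inv s \<otimes> \<delta> s \<otimes> inv s)" unfolding a_s[symmetric] using ac(2) c by (simp add: D.l_minus)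
 finally show ?thesis unfolding a_def .
qed

text \<open>By the Leibniz rule eigenvalues of products add, and the quotient rule is the second
  alternative of \<open>d_fraction\<close>.\<close>

lemma joint_eigenvectors_derivations: fixes K :: "'k ring" and D :: "('k, 'd) module" (structure)
 assumes D: "K_algebra K D" and U: "Units D = carrier D - {\<zero>}" and cd: "commuting_derivations K D t d"
 shows "joint_eigenvectors K D (additive_tuples K t) t d"
proof - interpret D: K_algebra K D by fact let ?G = "additive_tuples K t"
 have dv: "skew_derivation K D (\<lambda>u. u) (d i)" if "i < t" for i using cd that by (simp add: commuting_derivations_def)
 have d_closed: "d i u \<in> carrier D" if "i < t" "u \<in> carrier D" for i u
  using dv[OF that(1)] that(2) by (auto simp: skew_derivation_def)
 have d_add: "d i (u \<oplus> v) = d i u \<oplus> d i v" if "i < t" "u \<in> carrier D" "v \<in> carrier D" for i u v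
  using dv[OF that(1)] that(2,3) by (simp add: skew_derivation_def)
 have d_smult: "d i (k \<odot> u) = k \<odot> d i u" if "i < t" "k \<in> carrier K" "u \<in> carrier D" for i k u
  using dv[OF that(1)] that(2,3) by (simp add: skew_derivation_def)
 have d_mult: "d i (u \<otimes> v) = d i u \<otimes> v \<oplus> u \<otimes> d i v" if "i < t" "u \<in> carrier D" "v \<in> carrier D" for i u v
  using dv[OF that(1)] that(2,3) by (simp add: skew_derivation_def)
 have d_inv: "d i (inv s) = \<ominus> (inv s \<otimes> d i s \<otimes> inv s)" if "i < t" "s \<in> Units D" for i s
  by (rule skew_derivation_inverse[OF D dv[OF that(1)] that(2)])
 have d_one: "d i \<one> = \<zero>" if "i < t" for i
  using d_mult[OF that D.one_closed D.one_closed] d_closed[OF that D.one_closed] by simp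
 have gK: "group (add_monoid K)" by (rule D.R.add.is_group)
 have gG: "group ?G" unfolding additive_tuples_def by (rule product_group) (rule gK)
 interpret G: group ?G by (rule gG)
 have Gc: "carrier ?G = ({..<t} \<rightarrow>\<^sub>E carrier K)" by (simp add: additive_tuples_def)
 have G_one: "\<one>\<^bsub>?G\<^esub> i = \<zero>\<^bsub>K\<^esub>" if "i < t" for i using that by (simp add: additive_tuples_def)
 have G_mult: "(l \<otimes>\<^bsub>?G\<^esub> m) i = l i \<oplus>\<^bsub>K\<^esub> m i" if "i < t" for l m i using that by (simp add: additive_tuples_def)
 have lK: "l i \<in> carrier K" if "l \<in> carrier ?G" "i < t" for l i using that by (auto simp: Gc PiE_iff)
 have G_inv: "(inv\<^bsub>?G\<^esub> l) i = \<ominus>\<^bsub>K\<^esub> l i" if l: "l \<in> carrier ?G" and i: "i < t" for l i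
 proof - have "(inv\<^bsub>?G\<^esub> l) i \<oplus>\<^bsub>K\<^esub> l i = (inv\<^bsub>?G\<^esub> l \<otimes>\<^bsub>?G\<^esub> l) i" by (simp only: G_mult[OF i])
  also have "\<dots> = \<zero>\<^bsub>K\<^esub>" using l G_one[OF i] by simp
  finally show ?thesis using D.R.minus_equality lK[OF _ i] l by simp
 qed
 show ?thesis
 proof (intro joint_eigenvectors.intro joint_eigenvectors_axioms.intro) show "K_algebra K D" by fact
  show "comm_group ?G"
  proof (rule G.group_comm_groupI) fix l m assume "l \<in> carrier ?G" "m \<in> carrier ?G"
   then show "l \<otimes>\<^bsub>?G\<^esub> m = m \<otimes>\<^bsub>?G\<^esub> l" by (auto simp: additive_tuples_def PiE_iff D.R.a_comm)
  qed
  show "l = m" if "l \<in> carrier ?G" "m \<in> carrier ?G" "\<And>i. i < t ==> l i = m i" for l m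
   using that unfolding Gc by (intro PiE_ext[of l "{..<t}" "\<lambda>_. carrier K"]) auto
  show "\<one> \<in> eigenspace D t d (carrier D) \<one>\<^bsub>?G\<^esub>" by (simp add: eigenspace_def d_one G_one D.smult_l_null)
  show "u \<otimes> v \<in> eigenspace D t d (carrier D) (l \<otimes>\<^bsub>?G\<^esub> m)"
   if "l \<in> carrier ?G" "m \<in> carrier ?G" "u \<in> eigenspace D t d (carrier D) l" "v \<in> eigenspace D t d (carrier D) m"
   for l m u v
  proof -
   have uv: "u \<in> carrier D" "v \<in> carrier D" "\<And>i. i < t ==> d i u = l i \<odot> u" "\<And>i. i < t ==> d i v = m i \<odot> v"
    using that(3,4) by (simp_all add: eigenspace_def)
   have "d i (u \<otimes> v) = (l \<otimes>\<^bsub>?G\<^esub> m) i \<odot> (u \<otimes> v)" if i: "i < t" for i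
    using uv(1,2) lK[OF \<open>l \<in> carrier ?G\<close> i] lK[OF \<open>m \<in> carrier ?G\<close> i]
    by (simp add: d_mult[OF i] uv(3,4)[OF i] G_mult[OF i] D.smult_mult_left D.smult_mult_right D.smult_l_distr)
   then show ?thesis using uv(1,2) by (simp add: eigenspace_def)
  qed
  show "inv u \<in> eigenspace D t d (carrier D) (inv\<^bsub>?G\<^esub> l)"
   if "l \<in> carrier ?G" "u \<in> eigenspace D t d (carrier D) l" "u \<noteq> \<zero>" for l u
  proof -
   have u: "u \<in> carrier D" "\<And>i. i < t ==> d i u = l i \<odot> u" using that(2) by (simp_all add: eigenspace_def)
   have uu: "u \<in> Units D" using u(1) that(3) U by blast
   have "d i (inv u) = (inv\<^bsub>?G\<^esub> l) i \<odot> inv u" if i: "i < t" for i using u(1) uu lK[OF \<open>l \<in> carrier ?G\<close> i]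
    by (simp add: d_inv[OF i uu] u(2)[OF i] G_inv[OF \<open>l \<in> carrier ?G\<close> i] D.smult_mult_left D.smult_mult_right
      D.smult_l_minus)
   then show ?thesis using uu by (simp add: eigenspace_def)
  qed
  show "(d i s \<noteq> \<zero> \<and> d i (inv s \<otimes> b) = inv (d i s) \<otimes> d i b) \<or>
   d i (inv s \<otimes> b) = inv s \<otimes> (d i b \<oplus> \<ominus> (d i s \<otimes> (inv s \<otimes> b)))"
   if i: "i < t" and s: "s \<in> carrier D" "s \<noteq> \<zero>" and b: "b \<in> carrier D" for i s b
  proof - have su: "s \<in> Units D" using s U by blast
   have c: "inv s \<in> carrier D" "d i s \<in> carrier D" "d i b \<in> carrier D" using su s(1) b d_closed[OF i] by simp_all
   have "d i (inv s \<otimes> b) = inv s \<otimes> (d i b \<oplus> \<ominus> (d i s \<otimes> (inv s \<otimes> b)))"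
    unfolding d_mult[OF i c(1) b] d_inv[OF i su] using c b
    by (simp add: D.r_distr D.l_minus D.r_minus D.m_assoc D.a_comm)
   then show ?thesis by blast
  qed
 qed (fact d_closed d_add d_smult U lK)+
qed

text \<open>Eigenvalues of products multiply. An automorphism commutes with inversion, which is the
  first alternative of \<open>d_fraction\<close>.\<close>

lemma joint_eigenvectors_automorphisms: fixes K :: "'k ring" and D :: "('k, 'd) module" (structure)
 assumes D: "K_algebra K D" and U: "Units D = carrier D - {\<zero>}" and ca: "commuting_automorphisms K D t d"
 shows "joint_eigenvectors K D (multiplicative_tuples K t) t d"
proof - interpret D: K_algebra K D by fact let ?G = "multiplicative_tuples K t"
 have dh: "d i \<in> ring_hom D D" "d i \<in> carrier D \<rightarrow> carrier D"
  "\<And>k u. k \<in> carrier K ==> u \<in> carrier D ==> d i (k \<odot> u) = k \<odot> d i u" if "i < t" for i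
  using ca that by (auto simp: commuting_automorphisms_def algebra_iso_def algebra_hom_def ring_hom_def)
 have d_closed: "d i u \<in> carrier D" if "i < t" "u \<in> carrier D" for i u
  using dh(2)[OF that(1)] that(2) by blast
 have d_add: "d i (u \<oplus> v) = d i u \<oplus> d i v" if "i < t" "u \<in> carrier D" "v \<in> carrier D" for i u v
  by (rule ring_hom_add[OF dh(1)[OF that(1)] that(2,3)])
 have d_mult: "d i (u \<otimes> v) = d i u \<otimes> d i v" if "i < t" "u \<in> carrier D" "v \<in> carrier D" for i u v
  by (rule ring_hom_mult[OF dh(1)[OF that(1)] that(2,3)])
 have d_one: "d i \<one> = \<one>" if "i < t" for i by (rule ring_hom_one[OF dh(1)[OF that]])
 have d_smult: "d i (k \<odot> u) = k \<odot> d i u" if "i < t" "k \<in> carrier K" "u \<in> carrier D" for i k u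
  by (rule dh(3)[OF that])
 have d_inv: "d i s \<in> Units D" "d i (inv s) = inv (d i s)" if i: "i < t" and s: "s \<in> Units D" for i s
 proof - have c: "s \<in> carrier D" "inv s \<in> carrier D" using s by (auto dest: D.Units_closed)
  have 1: "d i s \<otimes> d i (inv s) = \<one>" "d i (inv s) \<otimes> d i s = \<one>"
   using d_mult[OF i c] d_mult[OF i c(2,1)] s d_one[OF i] by simp_all
  show "d i s \<in> Units D" unfolding Units_def using 1 d_closed[OF i c(1)] d_closed[OF i c(2)] by blast
  show "d i (inv s) = inv (d i s)" using D.inv_char[OF d_closed[OF i c(1)] d_closed[OF i c(2)] 1] by simp
 qed
 have comm: "comm_group (units_of K)" by (rule D.R.units_comm_group)
 interpret KU: comm_group "units_of K" by (rule comm)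
 have gG: "group ?G" unfolding multiplicative_tuples_def by (rule product_group) (rule KU.is_group)
 interpret G: group ?G by (rule gG)
 have Gc: "carrier ?G = ({..<t} \<rightarrow>\<^sub>E Units K)" by (simp add: multiplicative_tuples_def units_of_carrier)
 have G_one: "\<one>\<^bsub>?G\<^esub> i = \<one>\<^bsub>K\<^esub>" if "i < t" for i using that by (simp add: multiplicative_tuples_def units_of_one)
 have G_mult: "(l \<otimes>\<^bsub>?G\<^esub> m) i = l i \<otimes>\<^bsub>K\<^esub> m i" if "i < t" for l m i
  using that by (simp add: multiplicative_tuples_def units_of_mult)
 have lU: "l i \<in> Units K" if "l \<in> carrier ?G" "i < t" for l i using that by (auto simp: Gc PiE_iff)
 have lK: "l i \<in> carrier K" if "l \<in> carrier ?G" "i < t" for l i by (rule D.R.Units_closed[OF lU[OF that]])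
 have G_inv: "(inv\<^bsub>?G\<^esub> l) i \<otimes>\<^bsub>K\<^esub> l i = \<one>\<^bsub>K\<^esub>" if l: "l \<in> carrier ?G" and i: "i < t" for l i
 proof - have "(inv\<^bsub>?G\<^esub> l) i \<otimes>\<^bsub>K\<^esub> l i = (inv\<^bsub>?G\<^esub> l \<otimes>\<^bsub>?G\<^esub> l) i" by (simp only: G_mult[OF i])
  also have "\<dots> = \<one>\<^bsub>K\<^esub>" using l G_one[OF i] by simp
  finally show ?thesis .
 qed
 show ?thesis
 proof (intro joint_eigenvectors.intro joint_eigenvectors_axioms.intro) show "K_algebra K D" by fact
  show "comm_group ?G"
  proof (rule G.group_comm_groupI) fix l m assume lm: "l \<in> carrier ?G" "m \<in> carrier ?G"
   have "l i \<otimes>\<^bsub>units_of K\<^esub> m i = m i \<otimes>\<^bsub>units_of K\<^esub> l i" if "i < t" for i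
    using lU[OF lm(1) that] lU[OF lm(2) that] by (intro KU.m_comm) (simp_all add: units_of_carrier)
   then show "l \<otimes>\<^bsub>?G\<^esub> m = m \<otimes>\<^bsub>?G\<^esub> l" by (auto simp: multiplicative_tuples_def)
  qed
  show "l = m" if "l \<in> carrier ?G" "m \<in> carrier ?G" "\<And>i. i < t ==> l i = m i" for l m
   using that unfolding Gc by (intro PiE_ext[of l "{..<t}" "\<lambda>_. Units K"]) auto
  show "\<one> \<in> eigenspace D t d (carrier D) \<one>\<^bsub>?G\<^esub>" by (simp add: eigenspace_def d_one G_one)
  show "u \<otimes> v \<in> eigenspace D t d (carrier D) (l \<otimes>\<^bsub>?G\<^esub> m)"
   if "l \<in> carrier ?G" "m \<in> carrier ?G" "u \<in> eigenspace D t d (carrier D) l" "v \<in> eigenspace D t d (carrier D) m"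
   for l m u v
  proof -
   have uv: "u \<in> carrier D" "v \<in> carrier D" "\<And>i. i < t ==> d i u = l i \<odot> u" "\<And>i. i < t ==> d i v = m i \<odot> v"
    using that(3,4) by (simp_all add: eigenspace_def)
   have "d i (u \<otimes> v) = (l \<otimes>\<^bsub>?G\<^esub> m) i \<odot> (u \<otimes> v)" if i: "i < t" for i
    using uv(1,2) lK[OF \<open>l \<in> carrier ?G\<close> i] lK[OF \<open>m \<in> carrier ?G\<close> i]
    by (simp add: d_mult[OF i] uv(3,4)[OF i] G_mult[OF i] D.smult_mult_left D.smult_mult_right
      D.smult_assoc1[symmetric] D.R.m_comm)
   then show ?thesis using uv(1,2) by (simp add: eigenspace_def)
  qed
  show "inv u \<in> eigenspace D t d (carrier D) (inv\<^bsub>?G\<^esub> l)"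
   if l: "l \<in> carrier ?G" and "u \<in> eigenspace D t d (carrier D) l" "u \<noteq> \<zero>" for l u
  proof -
   have u: "u \<in> carrier D" "\<And>i. i < t ==> d i u = l i \<odot> u" using that(2) by (simp_all add: eigenspace_def)
   have uu: "u \<in> Units D" using u(1) that(3) U by blast
   have iu: "inv u \<in> carrier D" using uu by simp
   have "d i (inv u) = (inv\<^bsub>?G\<^esub> l) i \<odot> inv u" if i: "i < t" for i
   proof - let ?k = "(inv\<^bsub>?G\<^esub> l) i"
    have k: "?k \<in> carrier K" "l i \<in> carrier K" using lK[OF _ i] l by simp_all
    have "(?k \<odot> inv u) \<otimes> (l i \<odot> u) = (?k \<otimes>\<^bsub>K\<^esub> l i) \<odot> (inv u \<otimes> u)"
     using k iu u(1) by (simp add: D.smult_mult_left D.smult_mult_right D.smult_assoc1[symmetric] D.R.m_comm del: D.Units_l_inv)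
    then have 1: "(?k \<odot> inv u) \<otimes> d i u = \<one>" using G_inv[OF l i] uu by (simp add: u(2)[OF i])
    have "?k \<odot> inv u = (?k \<odot> inv u) \<otimes> (d i u \<otimes> inv (d i u))" using d_inv(1)[OF i uu] k iu by simp
    also have "\<dots> = inv (d i u)"
     using 1 d_inv(1)[OF i uu] d_closed[OF i u(1)] k iu by (simp add: D.m_assoc[symmetric] del: D.Units_r_inv)
    finally show ?thesis using d_inv(2)[OF i uu] by simp
   qed
   then show ?thesis using uu by (simp add: eigenspace_def)
  qed
  show "(d i s \<noteq> \<zero> \<and> d i (inv s \<otimes> b) = inv (d i s) \<otimes> d i b) \<or>
   d i (inv s \<otimes> b) = inv s \<otimes> (d i b \<oplus> \<ominus> (d i s \<otimes> (inv s \<otimes> b)))"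
   if i: "i < t" and s: "s \<in> carrier D" "s \<noteq> \<zero>" and b: "b \<in> carrier D" for i s b
  proof - have su: "s \<in> Units D" using s U by blast have "d i s \<noteq> \<zero>" using d_inv(1)[OF i su] U by blast
   moreover have "d i (inv s \<otimes> b) = inv (d i s) \<otimes> d i b"
    using d_mult[OF i _ b, of "inv s"] d_inv(2)[OF i su] su by simp
   ultimately show ?thesis by blast
  qed
 qed (fact d_closed d_add d_smult U lK)+
qed

section \<open>Quotient division algebras of iterated Ore extensions\<close>

section \<open>The main theorem\<close>

text \<open>For A itself, Hilbert's theorem is applied along the tower, starting from the copy of
  \<Gamma>. For D, the tower is transported into D by \<open>j\<close>; the composite of \<iota> and
  \<open>j\<close> supplies the copy of \<Gamma>^e at the bottom, and the fraction conditions supply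
  the denominators for the final localization.\<close>

lemma iterated_ore_extension_noetherian:
 assumes G: "K_algebra K \<Gamma>" and N: "nc_noetherian_domain (enveloping_algebra K \<Gamma>)"
  and ore: "iterated_ore_extension K \<Gamma> n \<iota> x \<sigma> \<delta> A"
 shows "nc_noetherian_domain A"
  and "quotient_division_algebra K A j D ==> nc_noetherian_domain (enveloping_algebra K D)"
proof - have A: "K_algebra K A" and \<iota>: "\<iota> \<in> algebra_hom K \<Gamma> A" "inj_on \<iota> (carrier \<Gamma>)"
  using ore by (simp_all add: iterated_ore_extension_def)
 interpret A: K_algebra K A by fact
 obtain C where C0: "C 0 = \<iota> ` carrier \<Gamma>" and Cn: "C n = carrier A"
  and C: "\<And>i. i \<le> n ==> K_subalgebra K A (C i)"
  and O: "\<And>i. i < n ==> ore_extension K (A\<lparr>carrier := C (Suc i)\<rparr>) (C i) (x i) (\<sigma> i) (\<delta> i)"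
  using ore unfolding iterated_ore_extension_def by blast
 have step: "ore_free A (C i) (C (Suc i)) (x i)" if "i < n" for i
  by (rule ore_extension_imp_ore_free[OF A C O]) (use that in simp_all)
 have "nc_noetherian_domain (A\<lparr>carrier := C i\<rparr>)" if "i \<le> n" for i using that
 proof (induction i) case 0 have "\<iota> \<in> ring_hom \<Gamma> A" using \<iota>(1) by (simp add: algebra_hom_def) then show ?case
   unfolding C0 using nc_noetherian_domain_image[OF A.ring_axioms _ \<iota>(2) nc_noetherian_domain_of_enveloping[OF G N]]
   by blast
 next case (Suc i) then show ?case using ore_free.nc_noetherian_domain_ore_free[OF step[of i]] by simp
 qed
 from this[of n] show "nc_noetherian_domain A" by (simp add: Cn)
 assume Q: "quotient_division_algebra K A j D"
 have D: "K_algebra K D" and U: "Units D = carrier D - {\<zero>\<^bsub>D\<^esub>}" and j: "j \<in> algebra_hom K A D" "inj_on j (carrier A)"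
  using Q by (simp_all add: quotient_division_algebra_def division_algebra_def)
 interpret D: K_algebra K D by fact
 have nt: "\<one>\<^bsub>D\<^esub> \<noteq> \<zero>\<^bsub>D\<^esub>" using D.Units_one_closed U by blast
 interpret E: enveloping K D by (intro enveloping.intro enveloping_axioms.intro D nt)
 have jh: "j \<in> ring_hom A D" using j(1) by (simp add: algebra_hom_def)
 interpret j: ring_hom_ring A D j by (rule ring_hom_ringI2[OF A.ring_axioms D.ring_axioms jh])
 have jn: "j s \<noteq> \<zero>\<^bsub>D\<^esub>" if "s \<in> carrier A - {\<zero>\<^bsub>A\<^esub>}" for s
  using inj_onD[OF j(2), of s "\<zero>\<^bsub>A\<^esub>"] that j.hom_zero by auto
 have ju: "j s \<in> Units D" if "s \<in> carrier A - {\<zero>\<^bsub>A\<^esub>}" for s using jn[OF that] U that j.hom_closed by blast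
 have "nc_noetherian_domain E.De"
 proof (rule E.nc_noetherian_domain_De[of n "\<lambda>i. j ` C i" "\<lambda>i. j (x i)"])
  show "Units D = carrier D - {\<zero>\<^bsub>D\<^esub>}" by (rule U)
  show "K_subalgebra K D (j ` C i)" if "i \<le> n" for i by (rule algebra_hom_image_subalgebra[OF A D j(1) C[OF that]])
  show "ore_free D (j ` C i) (j ` C (Suc i)) (j (x i))" if "i < n" for i
   by (rule ore_free_image[OF D.ring_axioms jh j(2) step[OF that]])
  have \<iota>h: "\<iota> \<in> ring_hom \<Gamma> A" using \<iota>(1) by (simp add: algebra_hom_def)
  have f: "j \<circ> \<iota> \<in> algebra_hom K \<Gamma> D"
   using ring_hom_trans[OF \<iota>h jh] ring_hom_closed[OF \<iota>h] \<iota>(1) j(1) by (simp add: algebra_hom_def)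
  have \<iota>A: "\<iota> ` carrier \<Gamma> \<subseteq> carrier A" using ring_hom_closed[OF \<iota>h] by blast
  have inj: "inj_on (j \<circ> \<iota>) (carrier \<Gamma>)" by (rule comp_inj_on[OF \<iota>(2) inj_on_subset[OF j(2) \<iota>A]])
  show "nc_noetherian_domain (E.De\<lparr>carrier := E.sub_tensor (j ` C 0) (j ` C 0)\<rparr>)"
   using E.sub_tensor_image[OF G f inj N] by (simp add: C0 image_comp)
  fix q assume q: "q \<in> carrier D"
  show "\<exists>s\<in>j ` C n - {\<zero>\<^bsub>D\<^esub>}. s \<otimes>\<^bsub>D\<^esub> q \<in> j ` C n"
  proof - obtain s a where s: "s \<in> carrier A - {\<zero>\<^bsub>A\<^esub>}" "a \<in> carrier A" "q = inv\<^bsub>D\<^esub> (j s) \<otimes>\<^bsub>D\<^esub> j a"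
    using Q q unfolding quotient_division_algebra_def by blast
   have c: "j s \<in> carrier D" "inv\<^bsub>D\<^esub> (j s) \<in> carrier D" "j a \<in> carrier D" using s(1,2) ju[OF s(1)] by simp_all
   have "j s \<otimes>\<^bsub>D\<^esub> q = j a" unfolding s(3) using c ju[OF s(1)] by (simp add: D.m_assoc[symmetric])
   moreover have "j s \<in> j ` C n - {\<zero>\<^bsub>D\<^esub>}" "j a \<in> j ` C n" using s(1,2) jn[OF s(1)] by (auto simp: Cn)
   ultimately show ?thesis by (intro bexI[of _ "j s"]) simp_all
  qed
  show "\<exists>s\<in>j ` C n - {\<zero>\<^bsub>D\<^esub>}. q \<otimes>\<^bsub>D\<^esub> s \<in> j ` C n"
  proof - obtain s a where s: "s \<in> carrier A - {\<zero>\<^bsub>A\<^esub>}" "a \<in> carrier A" "q = j a \<otimes>\<^bsub>D\<^esub> inv\<^bsub>D\<^esub> (j s)"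
    using Q q unfolding quotient_division_algebra_def by blast
   have c: "j s \<in> carrier D" "inv\<^bsub>D\<^esub> (j s) \<in> carrier D" "j a \<in> carrier D" using s(1,2) ju[OF s(1)] by simp_all
   have "q \<otimes>\<^bsub>D\<^esub> j s = j a" unfolding s(3) using c ju[OF s(1)] by (simp add: D.m_assoc)
   moreover have "j s \<in> j ` C n - {\<zero>\<^bsub>D\<^esub>}" "j a \<in> j ` C n" using s(1,2) jn[OF s(1)] by (auto simp: Cn)
   ultimately show ?thesis by (intro bexI[of _ "j s"]) simp_all
  qed
 qed
 then show "nc_noetherian_domain (enveloping_algebra K D)" by (simp add: enveloping_algebra_def)
qed

theorem lemma3p1: fixes K :: "'k ring" and \<Gamma> :: "('k, 'g) module" and A :: "('k, 'a) module"
  and n :: nat and \<iota> :: "'g \<Rightarrow> 'a" and x :: "nat \<Rightarrow> 'a" and \<sigma> \<delta> :: "nat \<Rightarrow> 'a \<Rightarrow> 'a"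
 assumes "field K" and "K_algebra K \<Gamma>" and "nc_noetherian_domain (enveloping_algebra K \<Gamma>)"
  and "iterated_ore_extension K \<Gamma> n \<iota> x \<sigma> \<delta> A"
 shows "nc_noetherian_domain \<Gamma> \<and> nc_noetherian_domain A \<and>
  (\<forall>(D :: ('k, 'd) module) j. quotient_division_algebra K A j D \<longrightarrow>
   nc_noetherian_domain (enveloping_algebra K D) \<and>
   (\<forall>E :: nat \<Rightarrow> 'd set. (\<forall>i. division_subalgebra K D (E i) \<and> E i \<subseteq> E (Suc i)) \<longrightarrow>
     (\<exists>N. \<forall>i\<ge>N. E i = E N)) \<and>
   (\<forall>E. division_subalgebra K D E \<longrightarrow> finitely_generated_division_algebra K (D\<lparr>carrier := E\<rparr>)) \<and>
   (\<forall>t d G.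
     (commuting_derivations K D t d \<and> G = additive_tuples K t) \<or>
     (commuting_automorphisms K D t d \<and> G = multiplicative_tuples K t) \<longrightarrow>
     (let Ev = eigenvalues G D t d (carrier D);
       EvG = G\<lparr>carrier := Ev\<rparr>;
       T = torsion_subgroup EvG;
       D0 = eigenspace D t d (carrier D) \<one>\<^bsub>G\<^esub>;
       DT = eigen_sum D t d T
     in subgroup Ev G \<and> comm_group EvG \<and> finitely_generated_group EvG \<and> subgroup T EvG \<and> finite T \<and>
      (\<exists>r. has_rank EvG r \<and>
        EvG \<cong> (EvG\<lparr>carrier := T\<rparr>) \<times>\<times> product_group {..<r} (\<lambda>_. integer_group) \<and>
        (\<exists>(L :: ('k, 'd) module) \<kappa> y \<tau>.
         iterated_skew_laurent_extension K (D\<lparr>carrier := DT\<rparr>) r \<kappa> y \<tau> L \<and>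
         algebra_iso K (D\<lparr>carrier := eigen_sum D t d Ev\<rparr>) L \<noteq> {})) \<and>
      eigenspaces_independent D t d Ev \<and>
      nc_noetherian_domain (D\<lparr>carrier := eigen_sum D t d Ev\<rparr>) \<and>
      division_subalgebra K D D0 \<and>
      division_subalgebra K D DT \<and>
      ring.dimension D (card T) D0 DT \<and>
      ring.dimension (opposite D) (card T) D0 DT \<and>
      (\<forall>F. subgroup F EvG \<longrightarrow>
        (let B = eigen_sum D t d F; Q = frac_in D B in
         K_subalgebra K D B \<and>
         nc_noetherian_domain (D\<lparr>carrier := B\<rparr>) \<and>
         division_subalgebra K D Q \<and>
         quotient_division_algebra K (D\<lparr>carrier := B\<rparr>) (\<lambda>b. b) (D\<lparr>carrier := Q\<rparr>) \<and>
         (\<forall>i<t. d i ` Q \<subseteq> Q) \<and>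
         eigenvalues G D t d Q = F \<and>
         (\<forall>l\<in>F. \<forall>v\<in>eigenspace D t d Q l. v \<noteq> \<zero>\<^bsub>D\<^esub> \<longrightarrow>
           (\<exists>m\<in>F. \<exists>u\<in>eigenspace D t d (carrier D) m. \<exists>w\<in>eigenspace D t d (carrier D) (l \<otimes>\<^bsub>G\<^esub> m).
            u \<noteq> \<zero>\<^bsub>D\<^esub> \<and> v = inv\<^bsub>D\<^esub> u \<otimes>\<^bsub>D\<^esub> w)))))))"
proof - note G = assms(2) and N = assms(3) and ore = assms(4)
 have env: "nc_noetherian_domain (enveloping_algebra K D)" "enveloping K D"
   "Units D = carrier D - {\<zero>\<^bsub>D\<^esub>}" "left_noetherian (tensor_algebra K D (opposite D))"
  if Q: "quotient_division_algebra K A j D" for D :: "('k, 'd) module" and j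
 proof - show e: "nc_noetherian_domain (enveloping_algebra K D)"
   by (rule iterated_ore_extension_noetherian(2)[OF G N ore Q])
  have D: "K_algebra K D" and U: "Units D = carrier D - {\<zero>\<^bsub>D\<^esub>}"
   using Q by (simp_all add: quotient_division_algebra_def division_algebra_def)
  then show "enveloping K D" "Units D = carrier D - {\<zero>\<^bsub>D\<^esub>}"
   using enveloping_nontrivial[OF D] e by (simp_all add: nc_noetherian_domain_def)
  show "left_noetherian (tensor_algebra K D (opposite D))"
   using e by (simp add: nc_noetherian_domain_def enveloping_algebra_def)
 qed
 have acc: "\<exists>N. \<forall>i\<ge>N. E i = E N"
  if "quotient_division_algebra K A j D" "\<And>i. division_subalgebra K D (E i)" "\<And>i. E i \<subseteq> E (Suc i)"
  for D :: "('k, 'd) module" and j and E :: "nat \<Rightarrow> 'd set"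
  by (rule enveloping.acc_division_subalgebras[OF env(2,4)[OF that(1)]]) (fact that)+
 have J: "joint_eigenvectors K D G t d" if Q: "quotient_division_algebra K A j D"
   and dG: "(commuting_derivations K D t d \<and> G = additive_tuples K t) \<or>
    (commuting_automorphisms K D t d \<and> G = multiplicative_tuples K t)"
  for D :: "('k, 'd) module" and j t d G
 proof - have D: "K_algebra K D" using Q by (simp add: quotient_division_algebra_def division_algebra_def)
  show ?thesis
   using dG joint_eigenvectors_derivations[OF D env(3)[OF Q]] joint_eigenvectors_automorphisms[OF D env(3)[OF Q]]
   by blast
 qed
 show ?thesis
 proof (intro conjI allI impI)
  show "nc_noetherian_domain \<Gamma>" by (rule nc_noetherian_domain_of_enveloping[OF G N])
  show "nc_noetherian_domain A" by (rule iterated_ore_extension_noetherian(1)[OF G N ore])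
  fix D :: "('k, 'd) module" and j
  assume Q: "quotient_division_algebra K A j D"
  show "nc_noetherian_domain (enveloping_algebra K D)" by (rule env(1)[OF Q])
  show "\<exists>N. \<forall>i\<ge>N. E i = E N"
   if "\<forall>i. division_subalgebra K D (E i) \<and> E i \<subseteq> E (Suc i)" for E :: "nat \<Rightarrow> 'd set"
   by (rule acc[OF Q]) (use that in blast)+
  show "finitely_generated_division_algebra K (D\<lparr>carrier := E\<rparr>)" if "division_subalgebra K D E" for E
   by (rule enveloping.division_subalgebra_finitely_generated[OF env(2,4)[OF Q] that])
 qed (rule joint_eigenvectors.eigenvalues_and_eigen_algebra, erule (1) J, rule acc, assumption+)
qed

end
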